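(* Let $R$ be a commutative noetherian ring. (1) For each $M\in\mathrm{D}^{\mathrm{n}}_{+}(R)$, one has $\mathrm{supp}_R M=\bigcup_{i\in\mathbb{Z}}\mathrm{supp}_R \mathrm{H}_i(M)$. (2) If $R$ is semi-local complete, then for each $M\in\mathrm{D}^{\mathrm{a}}_{-}(R)$, one has $\mathrm{cosupp}_R M=\bigcup_{i\in\mathbb{Z}}\mathrm{cosupp}_R \mathrm{H}_i(M)$.
   Context: $R$ is a commutative noetherian ring; $\simeq$ denotes isomorphism in the derived category $\mathrm{D}(R)$; modules are complexes concentrated in degree $0$. $E(-)$ denotes injective envelopes, and $k(\mathfrak p)=R_\mathfrak p/\mathfrak pR_\mathfrak p$. Put $D_R(-)=\mathrm{Hom}_R(-,\bigoplus_{\mathfrak{m}\in\mathrm{Max}R}E(R/\mathfrak{m}))$ and, for an $R$-complex $M$ and $\mathfrak{p}\in\mathrm{Spec}R$, ${}^{\mathfrak{p}}M=\mathrm{Hom}_{R_\mathfrak{p}}(D_R(M)_\mathfrak{p},E_{R_\mathfrak{p}}(k(\mathfrak{p})))$. The small support is $\mathrm{supp}_R M=\{\mathfrak{p}\in\mathrm{Spec}R\mid k(\mathfrak{p})\otimes^{\mathrm{L}}_R M\not\simeq 0\}$ and the small cosupport is $\mathrm{cosupp}_R M=\{\mathfrak{p}\in\mathrm{Spec}R\mid \mathrm{RHom}_R(R/\mathfrak{p},{}^{\mathfrak{p}}M)\not\simeq 0\}$. $\mathrm{D}^{\mathrm{n}}_{+}(R)$: complexes with all $\mathrm{H}_i(M)$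 noetherian $R$-modules and $\mathrm{H}_n(M)=0$ for $n\ll 0$. $\mathrm{D}^{\mathrm{a}}_{-}(R)$: complexes with all $\mathrm{H}_i(M)$ artinian $R$-modules and $\mathrm{H}_n(M)=0$ for $n\gg 0$. Semi-local complete means that $R$ has finitely many maximal ideals and is complete in the adic topology of its Jacobson radical. *)

theory Defs
  imports
    "HOL-Algebra.Module" "HOL-Algebra.Ideal_Product" "HOL-Algebra.Ring_Divisibility"
    "HOL-Algebra.Free_Abelian_Groups"
begin

section \<open>Modules\<close>

text \<open>
  Modules are records of the library type \<^typ>\<open>('a, 'm) module\<close>; the ring-multiplication fields
  \<open>mult\<close> and \<open>one\<close> of that record play no role for modules and are filled arbitrarily.
\<close>

definition mk_mod ::
    "'m set \<Rightarrow> 'm \<Rightarrow> ('m \<Rightarrow> 'm \<Rightarrow> 'm) \<Rightarrow> ('a \<Rightarrow> 'm \<Rightarrow> 'm) \<Rightarrow> ('a, 'm) module" where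
  "mk_mod C z a s =
     \<lparr>carrier = C, monoid.mult = (\<lambda>_ _. z), one = z, ring.zero = z, add = a, smult = s\<rparr>"

definition mod_hom ::
    "'a ring \<Rightarrow> ('a, 'm) module \<Rightarrow> ('a, 'n) module \<Rightarrow> ('m \<Rightarrow> 'n) \<Rightarrow> bool" where
  "mod_hom R M N f \<longleftrightarrow>
     f \<in> carrier M \<rightarrow> carrier N \<and>
     (\<forall>x\<in>carrier M. \<forall>y\<in>carrier M. f (x \<oplus>\<^bsub>M\<^esub> y) = f x \<oplus>\<^bsub>N\<^esub> f y) \<and>
     (\<forall>r\<in>carrier R. \<forall>x\<in>carrier M. f (r \<odot>\<^bsub>M\<^esub> x) = r \<odot>\<^bsub>N\<^esub> f x)"

definition ring_mod :: "'a ring \<Rightarrow> ('a, 'a) module" where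
  "ring_mod R = mk_mod (carrier R) \<zero>\<^bsub>R\<^esub> (add R) (monoid.mult R)"

definition zero_mod :: "('a, 'm) module" where
  "zero_mod = mk_mod {undefined} undefined (\<lambda>_ _. undefined) (\<lambda>_ _. undefined)"

definition sub_mod :: "('a, 'm) module \<Rightarrow> 'm set \<Rightarrow> ('a, 'm) module" where
  "sub_mod M A = M\<lparr>carrier := A\<rparr>"

text \<open>
  In the quotient constructions below, an operation on classes is written as a union over all
  representatives; all members of the union are the same class.
\<close>

definition quot_mod :: "('a, 'm) module \<Rightarrow> 'm set \<Rightarrow> ('a, 'm set) module" where
  "quot_mod M B =
     mk_mod (a_rcosets\<^bsub>M\<^esub> B) B (set_add M) (\<lambda>r X. \<Union>x\<in>X. B +>\<^bsub>M\<^esub> (r \<odot>\<^bsub>M\<^esub> x))"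

definition restrict_scalars :: "('a \<Rightarrow> 'b) \<Rightarrow> ('b, 'm) module \<Rightarrow> ('a, 'm) module" where
  "restrict_scalars \<phi> M =
     mk_mod (carrier M) \<zero>\<^bsub>M\<^esub> (add M) (\<lambda>r x. \<phi> r \<odot>\<^bsub>M\<^esub> x)"

definition prod_mod :: "'i set \<Rightarrow> ('i \<Rightarrow> ('a, 'm) module) \<Rightarrow> ('a, 'i \<Rightarrow> 'm) module" where
  "prod_mod I N = mk_mod
     (\<Pi>\<^sub>E i\<in>I. carrier (N i))
     (\<lambda>i\<in>I. \<zero>\<^bsub>N i\<^esub>)
     (\<lambda>f g. \<lambda>i\<in>I. f i \<oplus>\<^bsub>N i\<^esub> g i)
     (\<lambda>r f. \<lambda>i\<in>I. r \<odot>\<^bsub>N i\<^esub> f i)"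

definition sum_mod :: "'i set \<Rightarrow> ('i \<Rightarrow> ('a, 'm) module) \<Rightarrow> ('a, 'i \<Rightarrow> 'm) module" where
  "sum_mod I N = sub_mod (prod_mod I N)
     {f \<in> (\<Pi>\<^sub>E i\<in>I. carrier (N i)). finite {i \<in> I. f i \<noteq> \<zero>\<^bsub>N i\<^esub>}}"

definition hom_mod ::
    "'a ring \<Rightarrow> ('a, 'm) module \<Rightarrow> ('a, 'n) module \<Rightarrow> ('a, 'm \<Rightarrow> 'n) module" where
  "hom_mod R M N = mk_mod
     {h \<in> extensional (carrier M). mod_hom R M N h}
     (\<lambda>x\<in>carrier M. \<zero>\<^bsub>N\<^esub>)
     (\<lambda>g h. \<lambda>x\<in>carrier M. g x \<oplus>\<^bsub>N\<^esub> h x)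
     (\<lambda>r h. \<lambda>x\<in>carrier M. r \<odot>\<^bsub>N\<^esub> h x)"

text \<open>
  The tensor product is the free abelian group on the set of pairs modulo the subgroup generated
  by the usual relations; \<open>tensor_pre\<close> is the group of formal sums with \<open>R\<close> acting on the left
  factor, an action that becomes additive in the scalar only in the quotient.
\<close>

definition tensor_rels ::
    "'a ring \<Rightarrow> ('a, 'm) module \<Rightarrow> ('a, 'n) module \<Rightarrow> (('m \<times> 'n) \<Rightarrow>\<^sub>0 int) set" where
  "tensor_rels R M N =
     {frag_of (x \<oplus>\<^bsub>M\<^esub> x', y) - frag_of (x, y) - frag_of (x', y) |x x' y.
        x \<in> carrier M \<and> x' \<in> carrier M \<and> y \<in> carrier N} \<union>
     {frag_of (x, y \<oplus>\<^bsub>N\<^esub> y') - frag_of (x, y) - frag_of (x, y') |x y y'.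
        x \<in> carrier M \<and> y \<in> carrier N \<and> y' \<in> carrier N} \<union>
     {frag_of (r \<odot>\<^bsub>M\<^esub> x, y) - frag_of (x, r \<odot>\<^bsub>N\<^esub> y) |r x y.
        r \<in> carrier R \<and> x \<in> carrier M \<and> y \<in> carrier N}"

definition tensor_null ::
    "'a ring \<Rightarrow> ('a, 'm) module \<Rightarrow> ('a, 'n) module \<Rightarrow> (('m \<times> 'n) \<Rightarrow>\<^sub>0 int) set" where
  "tensor_null R M N =
     generate (free_Abelian_group (carrier M \<times> carrier N)) (tensor_rels R M N)"

definition tensor_pre ::
    "('a, 'm) module \<Rightarrow> ('a, 'n) module \<Rightarrow> ('a, ('m \<times> 'n) \<Rightarrow>\<^sub>0 int) module" where
  "tensor_pre M N = mk_mod
     (carrier (free_Abelian_group (carrier M \<times> carrier N))) 0 (+)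
     (\<lambda>r. frag_extend (\<lambda>(x, y). frag_of (r \<odot>\<^bsub>M\<^esub> x, y)))"

definition tensor_mod ::
    "'a ring \<Rightarrow> ('a, 'm) module \<Rightarrow> ('a, 'n) module \<Rightarrow> ('a, (('m \<times> 'n) \<Rightarrow>\<^sub>0 int) set) module" where
  "tensor_mod R M N = quot_mod (tensor_pre M N) (tensor_null R M N)"

text \<open>The map \<open>f \<otimes> g\<close> into \<open>M' \<otimes> N'\<close>.\<close>

definition tensor_map ::
    "'a ring \<Rightarrow> ('a, 'm2) module \<Rightarrow> ('a, 'n2) module \<Rightarrow> ('m \<Rightarrow> 'm2) \<Rightarrow> ('n \<Rightarrow> 'n2) \<Rightarrow>
     (('m \<times> 'n) \<Rightarrow>\<^sub>0 int) set \<Rightarrow> (('m2 \<times> 'n2) \<Rightarrow>\<^sub>0 int) set" where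
  "tensor_map R M' N' f g X =
     (\<Union>c\<in>X. tensor_null R M' N' +>\<^bsub>tensor_pre M' N'\<^esub>
        frag_extend (\<lambda>(x, y). frag_of (f x, g y)) c)"

definition free_mod :: "'a ring \<Rightarrow> ('a, 'm) module \<Rightarrow> bool" where
  "free_mod R F \<longleftrightarrow>
     (\<exists>B\<subseteq>carrier F. \<forall>x\<in>carrier F. \<exists>!c. c \<in> (\<Pi>\<^sub>E b\<in>B. carrier R) \<and>
        finite {b \<in> B. c b \<noteq> \<zero>\<^bsub>R\<^esub>} \<and>
        x = finsum F (\<lambda>b. c b \<odot>\<^bsub>F\<^esub> b) {b \<in> B. c b \<noteq> \<zero>\<^bsub>R\<^esub>})"

definition noetherian_mod :: "'a ring \<Rightarrow> ('a, 'm) module \<Rightarrow> bool" where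
  "noetherian_mod R M \<longleftrightarrow> module R M \<and>
     (\<forall>C::nat \<Rightarrow> 'm set. (\<forall>n. submodule (C n) R M \<and> C n \<subseteq> C (Suc n)) \<longrightarrow>
        (\<exists>N. \<forall>n\<ge>N. C n = C N))"

definition artinian_mod :: "'a ring \<Rightarrow> ('a, 'm) module \<Rightarrow> bool" where
  "artinian_mod R M \<longleftrightarrow> module R M \<and>
     (\<forall>C::nat \<Rightarrow> 'm set. (\<forall>n. submodule (C n) R M \<and> C (Suc n) \<subseteq> C n) \<longrightarrow>
        (\<exists>N. \<forall>n\<ge>N. C n = C N))"

text \<open>
  A definition cannot quantify over all carrier types, so the extension property is demanded
  for modules \<open>A\<close>, \<open>B\<close> carried by the type of \<open>R\<close>. These include \<open>R\<close> and its ideals, so by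
  Baer's criterion the extension property then holds for modules over arbitrary types
  (\<open>injective_mod_extend\<close> below).
\<close>

definition injective_mod :: "'a ring \<Rightarrow> ('a, 'm) module \<Rightarrow> bool" where
  "injective_mod R E \<longleftrightarrow> module R E \<and>
     (\<forall>(A :: ('a, 'a) module) (B :: ('a, 'a) module) j f.
        module R A \<and> module R B \<and> mod_hom R A B j \<and> inj_on j (carrier A) \<and> mod_hom R A E f \<longrightarrow>
        (\<exists>g. mod_hom R B E g \<and> (\<forall>x\<in>carrier A. g (j x) = f x)))"

text \<open>\<open>G\<close> is the graph of a homomorphism from a submodule of \<open>B\<close> to \<open>E\<close>.\<close>

definition partial_hom ::
    "'a ring \<Rightarrow> ('a, 'm) module \<Rightarrow> ('a, 'n) module \<Rightarrow> ('m \<times> 'n) set \<Rightarrow> bool" where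
  "partial_hom R B E G \<longleftrightarrow> G \<subseteq> carrier B \<times> carrier E \<and> (\<zero>\<^bsub>B\<^esub>, \<zero>\<^bsub>E\<^esub>) \<in> G \<and>
     (\<forall>x y x' y'. (x, y) \<in> G \<longrightarrow> (x', y') \<in> G \<longrightarrow> (x \<oplus>\<^bsub>B\<^esub> x', y \<oplus>\<^bsub>E\<^esub> y') \<in> G) \<and>
     (\<forall>r x y. r \<in> carrier R \<longrightarrow> (x, y) \<in> G \<longrightarrow> (r \<odot>\<^bsub>B\<^esub> x, r \<odot>\<^bsub>E\<^esub> y) \<in> G) \<and>
     (\<forall>y. (\<zero>\<^bsub>B\<^esub>, y) \<in> G \<longrightarrow> y = \<zero>\<^bsub>E\<^esub>)"

lemma partial_homD:
  assumes "partial_hom R B E G"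
  shows "(x, y) \<in> G \<Longrightarrow> x \<in> carrier B" "(x, y) \<in> G \<Longrightarrow> y \<in> carrier E"
    "(x, y) \<in> G \<Longrightarrow> (x', y') \<in> G \<Longrightarrow> (x \<oplus>\<^bsub>B\<^esub> x', y \<oplus>\<^bsub>E\<^esub> y') \<in> G"
    "r \<in> carrier R \<Longrightarrow> (x, y) \<in> G \<Longrightarrow> (r \<odot>\<^bsub>B\<^esub> x, r \<odot>\<^bsub>E\<^esub> y) \<in> G"
    "(\<zero>\<^bsub>B\<^esub>, y) \<in> G \<Longrightarrow> y = \<zero>\<^bsub>E\<^esub>" "(\<zero>\<^bsub>B\<^esub>, \<zero>\<^bsub>E\<^esub>) \<in> G"
  using assms unfolding partial_hom_def by blast+

lemma partial_hom_unique:
  assumes B: "module R B" and E: "module R E" and G: "partial_hom R B E G"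
    and xy: "(x, y) \<in> G" and xy': "(x, y') \<in> G"
  shows "y = y'"
proof -
  interpret B: module R B by (rule B)
  interpret E: module R E by (rule E)
  note D = partial_homD[OF G]
  have "((\<ominus>\<^bsub>R\<^esub> \<one>\<^bsub>R\<^esub>) \<odot>\<^bsub>B\<^esub> x, (\<ominus>\<^bsub>R\<^esub> \<one>\<^bsub>R\<^esub>) \<odot>\<^bsub>E\<^esub> y') \<in> G"
    using D(4)[OF _ xy'] by simp
  hence "(\<ominus>\<^bsub>B\<^esub> x, \<ominus>\<^bsub>E\<^esub> y') \<in> G"
    using D(1)[OF xy] D(2)[OF xy'] by (simp add: B.smult_l_minus E.smult_l_minus)
  from D(3)[OF xy this] have "y \<oplus>\<^bsub>E\<^esub> (\<ominus>\<^bsub>E\<^esub> y') = \<zero>\<^bsub>E\<^esub>"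
    using D(1)[OF xy] by (intro D(5)) (simp add: B.M.r_neg)
  thus ?thesis using D(2)[OF xy] D(2)[OF xy']
    by (metis E.M.a_inv_closed E.M.minus_equality E.M.minus_minus)
qed

lemma partial_hom_total_imp_mod_hom:
  assumes B: "module R B" and E: "module R E" and G: "partial_hom R B E G"
    and tot: "Domain G = carrier B"
  shows "\<exists>g. mod_hom R B E g \<and> (\<forall>x y. (x, y) \<in> G \<longrightarrow> g x = y)"
proof -
  define g where "g x = (THE y. (x, y) \<in> G)" for x
  have g: "g x = y" if "(x, y) \<in> G" for x y
    unfolding g_def using that partial_hom_unique[OF B E G] by blast
  have gG: "(x, g x) \<in> G" if "x \<in> carrier B" for x
    using that tot g by (metis DomainE)
  have "mod_hom R B E g" unfolding mod_hom_def
    using gG g partial_homD[OF G] by (auto, blast+)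
  with g show ?thesis by blast
qed

lemma module_ring_mod: "cring R \<Longrightarrow> module R (ring_mod R)"
proof -
  assume "cring R"
  then interpret cring R .
  show ?thesis
    by (rule moduleI) (auto simp: ring_mod_def mk_mod_def is_cring l_distr r_distr m_assoc
        intro!: abelian_groupI a_assoc a_comm l_neg intro: exI[of _ "\<ominus>\<^bsub>R\<^esub> _"])
qed

lemma partial_hom_extend_one:
  assumes inj: "injective_mod R E" and B: "module R B" and G: "partial_hom R B E G"
    and b: "b \<in> carrier B"
  obtains G' where "partial_hom R B E G'" "G \<subseteq> G'" "b \<in> Domain G'"
proof -
  have E: "module R E" using inj by (simp add: injective_mod_def)
  interpret B: module R B by (rule B)
  interpret E: module R E by (rule E)
  note D = partial_homD[OF G]
  note uniq = partial_hom_unique[OF B E G]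
  define J where "J = {r \<in> carrier R. r \<odot>\<^bsub>B\<^esub> b \<in> Domain G}"
  define h where "h r = (THE y. (r \<odot>\<^bsub>B\<^esub> b, y) \<in> G)" for r
  have h: "h r = y" if "(r \<odot>\<^bsub>B\<^esub> b, y) \<in> G" for r y
    unfolding h_def using that uniq by blast
  have hG: "(r \<odot>\<^bsub>B\<^esub> b, h r) \<in> G" if "r \<in> J" for r
    using that h unfolding J_def by (metis (mono_tags, lifting) DomainE mem_Collect_eq)
  let ?R = "ring_mod R" and ?J = "sub_mod (ring_mod R) J"
  have mR: "module R ?R" by (rule module_ring_mod) (rule B.R.is_cring)
  interpret RR: module R "ring_mod R" by (rule mR)
  have sums: "(r \<oplus>\<^bsub>R\<^esub> s) \<in> J" "h (r \<oplus>\<^bsub>R\<^esub> s) = h r \<oplus>\<^bsub>E\<^esub> h s" if "r \<in> J" "s \<in> J" for r s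
  proof -
    have "((r \<oplus>\<^bsub>R\<^esub> s) \<odot>\<^bsub>B\<^esub> b, h r \<oplus>\<^bsub>E\<^esub> h s) \<in> G"
      using D(3)[OF hG[OF that(1)] hG[OF that(2)]] that b by (simp add: J_def B.smult_l_distr)
    thus "(r \<oplus>\<^bsub>R\<^esub> s) \<in> J" "h (r \<oplus>\<^bsub>R\<^esub> s) = h r \<oplus>\<^bsub>E\<^esub> h s"
      using h that by (auto simp: J_def)
  qed
  have smul: "(r \<otimes>\<^bsub>R\<^esub> s) \<in> J" "h (r \<otimes>\<^bsub>R\<^esub> s) = r \<odot>\<^bsub>E\<^esub> h s"
    if "r \<in> carrier R" "s \<in> J" for r s
  proof -
    have "((r \<otimes>\<^bsub>R\<^esub> s) \<odot>\<^bsub>B\<^esub> b, r \<odot>\<^bsub>E\<^esub> h s) \<in> G"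
      using D(4)[OF that(1) hG[OF that(2)]] that b by (simp add: J_def B.smult_assoc1)
    thus "(r \<otimes>\<^bsub>R\<^esub> s) \<in> J" "h (r \<otimes>\<^bsub>R\<^esub> s) = r \<odot>\<^bsub>E\<^esub> h s"
      using h that by (auto simp: J_def)
  qed
  have J0: "\<zero>\<^bsub>R\<^esub> \<in> J" using b D(6) by (auto simp: J_def)
  have Jsub: "J \<subseteq> carrier R" by (auto simp: J_def)
  have negJ: "\<ominus>\<^bsub>R\<^esub> r \<in> J" if "r \<in> J" for r
    using smul(1)[of "\<ominus>\<^bsub>R\<^esub> \<one>\<^bsub>R\<^esub>" r] that Jsub by (auto simp: B.R.l_minus)
  have "submodule J R ?R"
  proof (rule RR.submoduleI)
    fix a assume "a \<in> J"
    moreover have "\<ominus>\<^bsub>?R\<^esub> a = \<ominus>\<^bsub>R\<^esub> a"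
      using \<open>a \<in> J\<close> Jsub
      by (intro RR.M.minus_equality) (auto simp: ring_mod_def mk_mod_def B.R.l_neg)
    ultimately show "\<ominus>\<^bsub>?R\<^esub> a \<in> J" using negJ by simp
  qed (use J0 Jsub sums smul in \<open>auto simp: ring_mod_def mk_mod_def\<close>)
  hence mJ: "module R ?J"
    using submodule.submodule_is_module[OF _ mR] by (simp add: sub_mod_def)
  have "mod_hom R ?J ?R id" "inj_on id (carrier ?J)" "mod_hom R ?J E h"
    using Jsub sums(2) smul(2) D(2)[OF hG]
    by (auto simp: mod_hom_def sub_mod_def ring_mod_def mk_mod_def)
  then obtain k where k: "mod_hom R ?R E k" "\<And>x. x \<in> J \<Longrightarrow> k x = h x"
    using inj mJ mR unfolding injective_mod_def
    by (metis (no_types, lifting) id_apply sub_mod_def partial_object.select_convs(1)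
        partial_object.surjective partial_object.update_convs(1))
  define e where "e = k \<one>\<^bsub>R\<^esub>"
  have e: "e \<in> carrier E"
    using k(1) by (auto simp: e_def mod_hom_def ring_mod_def mk_mod_def)
  have he: "h r = r \<odot>\<^bsub>E\<^esub> e" if "r \<in> J" for r
  proof -
    have "h r = k (r \<otimes>\<^bsub>R\<^esub> \<one>\<^bsub>R\<^esub>)" using k(2) that Jsub by auto
    also have "\<dots> = r \<odot>\<^bsub>E\<^esub> e"
      using k(1) subsetD[OF Jsub that] B.R.one_closed
      by (simp add: e_def mod_hom_def ring_mod_def mk_mod_def del: B.R.r_one)
    finally show ?thesis .
  qed
  define G' where "G' = {(x \<oplus>\<^bsub>B\<^esub> r \<odot>\<^bsub>B\<^esub> b, y \<oplus>\<^bsub>E\<^esub> r \<odot>\<^bsub>E\<^esub> e) |x y r. (x, y) \<in> G \<and> r \<in> carrier R}"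
  have G'I: "(x \<oplus>\<^bsub>B\<^esub> r \<odot>\<^bsub>B\<^esub> b, y \<oplus>\<^bsub>E\<^esub> r \<odot>\<^bsub>E\<^esub> e) \<in> G'" if "(x, y) \<in> G" "r \<in> carrier R" for x y r
    using that unfolding G'_def by blast
  have sub: "G \<subseteq> G'"
  proof
    fix z assume z: "z \<in> G"
    obtain x y where [simp]: "z = (x, y)" by (cases z)
    show "z \<in> G'"
      using G'I[of x y "\<zero>\<^bsub>R\<^esub>"] z D(1,2)[of x y] b e by simp
  qed
  have "partial_hom R B E G'" unfolding partial_hom_def
  proof (intro conjI allI impI)
    show "G' \<subseteq> carrier B \<times> carrier E" using D(1,2) b e by (auto simp: G'_def)
    show "(\<zero>\<^bsub>B\<^esub>, \<zero>\<^bsub>E\<^esub>) \<in> G'" using sub D(6) by blast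
  next
    fix x y x' y' assume "(x, y) \<in> G'" "(x', y') \<in> G'"
    then obtain u v r u' v' r' where *: "(u, v) \<in> G" "r \<in> carrier R" "(u', v') \<in> G" "r' \<in> carrier R"
      and [simp]: "x = u \<oplus>\<^bsub>B\<^esub> r \<odot>\<^bsub>B\<^esub> b" "y = v \<oplus>\<^bsub>E\<^esub> r \<odot>\<^bsub>E\<^esub> e"
        "x' = u' \<oplus>\<^bsub>B\<^esub> r' \<odot>\<^bsub>B\<^esub> b" "y' = v' \<oplus>\<^bsub>E\<^esub> r' \<odot>\<^bsub>E\<^esub> e"
      unfolding G'_def by blast
    note c = D(1,2)[OF *(1)] D(1,2)[OF *(3)]
    have "x \<oplus>\<^bsub>B\<^esub> x' = (u \<oplus>\<^bsub>B\<^esub> u') \<oplus>\<^bsub>B\<^esub> (r \<oplus>\<^bsub>R\<^esub> r') \<odot>\<^bsub>B\<^esub> b"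
      using c * b by (simp add: B.smult_l_distr B.M.a_ac)
    moreover have "y \<oplus>\<^bsub>E\<^esub> y' = (v \<oplus>\<^bsub>E\<^esub> v') \<oplus>\<^bsub>E\<^esub> (r \<oplus>\<^bsub>R\<^esub> r') \<odot>\<^bsub>E\<^esub> e"
      using c * e by (simp add: E.smult_l_distr E.M.a_ac)
    ultimately show "(x \<oplus>\<^bsub>B\<^esub> x', y \<oplus>\<^bsub>E\<^esub> y') \<in> G'"
      using G'I[OF D(3)[OF *(1,3)], of "r \<oplus>\<^bsub>R\<^esub> r'"] * by simp
  next
    fix s x y assume s: "s \<in> carrier R" and "(x, y) \<in> G'"
    then obtain u v r where *: "(u, v) \<in> G" "r \<in> carrier R"
      and [simp]: "x = u \<oplus>\<^bsub>B\<^esub> r \<odot>\<^bsub>B\<^esub> b" "y = v \<oplus>\<^bsub>E\<^esub> r \<odot>\<^bsub>E\<^esub> e"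
      unfolding G'_def by blast
    show "(s \<odot>\<^bsub>B\<^esub> x, s \<odot>\<^bsub>E\<^esub> y) \<in> G'"
      using G'I[OF D(4)[OF s *(1)], of "s \<otimes>\<^bsub>R\<^esub> r"] * s D(1,2)[OF *(1)] b e
      by (simp add: B.smult_r_distr E.smult_r_distr B.smult_assoc1 E.smult_assoc1)
  next
    fix y assume "(\<zero>\<^bsub>B\<^esub>, y) \<in> G'"
    then obtain u v r where *: "(u, v) \<in> G" "r \<in> carrier R"
      and z: "\<zero>\<^bsub>B\<^esub> = u \<oplus>\<^bsub>B\<^esub> r \<odot>\<^bsub>B\<^esub> b" and y: "y = v \<oplus>\<^bsub>E\<^esub> r \<odot>\<^bsub>E\<^esub> e"
      unfolding G'_def by blast
    note c = D(1,2)[OF *(1)]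
    have "u = \<ominus>\<^bsub>B\<^esub> (r \<odot>\<^bsub>B\<^esub> b)"
      using z c * b by (metis B.M.minus_equality B.smult_closed)
    hence "\<ominus>\<^bsub>B\<^esub> u = r \<odot>\<^bsub>B\<^esub> b" using * b by simp
    moreover have "(\<ominus>\<^bsub>B\<^esub> u, \<ominus>\<^bsub>E\<^esub> v) \<in> G"
      using D(4)[OF _ *(1), of "\<ominus>\<^bsub>R\<^esub> \<one>\<^bsub>R\<^esub>"] c by (simp add: B.smult_l_minus E.smult_l_minus)
    ultimately have rG: "(r \<odot>\<^bsub>B\<^esub> b, \<ominus>\<^bsub>E\<^esub> v) \<in> G" by simp
    hence "r \<in> J" using * by (auto simp: J_def)
    hence "r \<odot>\<^bsub>E\<^esub> e = \<ominus>\<^bsub>E\<^esub> v" using he h[OF rG] by simp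
    thus "y = \<zero>\<^bsub>E\<^esub>" using y c by (simp add: E.M.r_neg)
  qed
  moreover have "b \<in> Domain G'"
    using G'I[OF D(6), of "\<one>\<^bsub>R\<^esub>"] b e by auto
  ultimately show ?thesis using sub by (intro that)
qed

lemma injective_mod_extend:
  fixes A :: "('a, 'm) module" and B :: "('a, 'n) module"
  assumes inj: "injective_mod R E" and A: "module R A" and B: "module R B"
    and j: "mod_hom R A B j" "inj_on j (carrier A)" and f: "mod_hom R A E f"
  shows "\<exists>g. mod_hom R B E g \<and> (\<forall>x\<in>carrier A. g (j x) = f x)"
proof -
  have E: "module R E" using inj by (simp add: injective_mod_def)
  interpret A: module R A by (rule A)
  interpret B: module R B by (rule B)
  interpret E: module R E by (rule E)
  define G0 where "G0 = {(j x, f x) |x. x \<in> carrier A}"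
  have j0: "j \<zero>\<^bsub>A\<^esub> = \<zero>\<^bsub>B\<^esub>" and f0: "f \<zero>\<^bsub>A\<^esub> = \<zero>\<^bsub>E\<^esub>"
  proof -
    have c: "j \<zero>\<^bsub>A\<^esub> \<in> carrier B" "f \<zero>\<^bsub>A\<^esub> \<in> carrier E"
      using j f by (auto simp: mod_hom_def)
    have "j (\<zero>\<^bsub>A\<^esub> \<oplus>\<^bsub>A\<^esub> \<zero>\<^bsub>A\<^esub>) = j \<zero>\<^bsub>A\<^esub> \<oplus>\<^bsub>B\<^esub> j \<zero>\<^bsub>A\<^esub>" "f (\<zero>\<^bsub>A\<^esub> \<oplus>\<^bsub>A\<^esub> \<zero>\<^bsub>A\<^esub>) = f \<zero>\<^bsub>A\<^esub> \<oplus>\<^bsub>E\<^esub> f \<zero>\<^bsub>A\<^esub>"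
      using j(1) f A.M.zero_closed unfolding mod_hom_def by blast+
    with c show "j \<zero>\<^bsub>A\<^esub> = \<zero>\<^bsub>B\<^esub>" "f \<zero>\<^bsub>A\<^esub> = \<zero>\<^bsub>E\<^esub>"
      by (simp_all add: B.M.add.r_cancel_one' E.M.add.r_cancel_one')
  qed
  have G0: "partial_hom R B E G0" unfolding partial_hom_def
  proof (intro conjI allI impI)
    show "G0 \<subseteq> carrier B \<times> carrier E" using j f by (auto simp: G0_def mod_hom_def)
    show "(\<zero>\<^bsub>B\<^esub>, \<zero>\<^bsub>E\<^esub>) \<in> G0" using j0 f0 unfolding G0_def by force
  next
    fix x y x' y' assume "(x, y) \<in> G0" "(x', y') \<in> G0"
    then obtain u v where "u \<in> carrier A" "v \<in> carrier A" "x = j u" "y = f u" "x' = j v" "y' = f v"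
      unfolding G0_def by blast
    thus "(x \<oplus>\<^bsub>B\<^esub> x', y \<oplus>\<^bsub>E\<^esub> y') \<in> G0"
      using j f unfolding G0_def mod_hom_def by (auto intro!: exI[of _ "u \<oplus>\<^bsub>A\<^esub> v"])
  next
    fix r x y assume "r \<in> carrier R" "(x, y) \<in> G0"
    then obtain u where "u \<in> carrier A" "x = j u" "y = f u" unfolding G0_def by blast
    thus "(r \<odot>\<^bsub>B\<^esub> x, r \<odot>\<^bsub>E\<^esub> y) \<in> G0"
      using j f \<open>r \<in> carrier R\<close> unfolding G0_def mod_hom_def by (auto intro!: exI[of _ "r \<odot>\<^bsub>A\<^esub> u"])
  next
    fix y assume "(\<zero>\<^bsub>B\<^esub>, y) \<in> G0"
    then obtain u where "u \<in> carrier A" "j u = j \<zero>\<^bsub>A\<^esub>" "y = f u" unfolding G0_def using j0 by auto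
    thus "y = \<zero>\<^bsub>E\<^esub>" using j(2) f0 by (metis A.M.zero_closed inj_onD)
  qed
  let ?S = "{G. partial_hom R B E G \<and> G0 \<subseteq> G}"
  have "\<exists>G\<in>?S. \<forall>X\<in>?S. G \<subseteq> X \<longrightarrow> X = G"
  proof (rule subset_Zorn_nonempty)
    show "?S \<noteq> {}" using G0 by blast
  next
    fix C assume ne: "C \<noteq> {}" and "subset.chain ?S C"
    hence CS: "\<And>G. G \<in> C \<Longrightarrow> partial_hom R B E G \<and> G0 \<subseteq> G"
      and lin: "\<And>G H. G \<in> C \<Longrightarrow> H \<in> C \<Longrightarrow> G \<subseteq> H \<or> H \<subseteq> G"
      unfolding subset_chain_def by blast+
    have "partial_hom R B E (\<Union>C)" unfolding partial_hom_def
    proof (intro conjI allI impI)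
      show "\<Union>C \<subseteq> carrier B \<times> carrier E"
      proof (rule Union_least)
        fix G assume "G \<in> C"
        thus "G \<subseteq> carrier B \<times> carrier E" using CS[of G] by (simp add: partial_hom_def)
      qed
      obtain G where "G \<in> C" using ne by blast
      thus "(\<zero>\<^bsub>B\<^esub>, \<zero>\<^bsub>E\<^esub>) \<in> \<Union>C" using CS[of G] by (auto dest: partial_homD(6))
    next
      fix x y x' y' assume "(x, y) \<in> \<Union>C" "(x', y') \<in> \<Union>C"
      then obtain G H where GH: "G \<in> C" "H \<in> C" "(x, y) \<in> G" "(x', y') \<in> H" by blast
      then obtain K where K: "K \<in> C" "(x, y) \<in> K" "(x', y') \<in> K" using lin[OF GH(1,2)] by blast
      have "(x \<oplus>\<^bsub>B\<^esub> x', y \<oplus>\<^bsub>E\<^esub> y') \<in> K" using partial_homD(3) CS[OF K(1)] K(2,3) by metis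
      thus "(x \<oplus>\<^bsub>B\<^esub> x', y \<oplus>\<^bsub>E\<^esub> y') \<in> \<Union>C" using K(1) by (rule UnionI[rotated])
    next
      fix r x y assume r: "r \<in> carrier R" "(x, y) \<in> \<Union>C"
      then obtain G where G: "G \<in> C" "(x, y) \<in> G" by blast
      have "(r \<odot>\<^bsub>B\<^esub> x, r \<odot>\<^bsub>E\<^esub> y) \<in> G" using partial_homD(4) CS[OF G(1)] G(2) r(1) by metis
      thus "(r \<odot>\<^bsub>B\<^esub> x, r \<odot>\<^bsub>E\<^esub> y) \<in> \<Union>C" using G(1) by (rule UnionI[rotated])
    next
      fix y assume "(\<zero>\<^bsub>B\<^esub>, y) \<in> \<Union>C"
      then obtain G where G: "G \<in> C" "(\<zero>\<^bsub>B\<^esub>, y) \<in> G" by blast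
      thus "y = \<zero>\<^bsub>E\<^esub>" using partial_homD(5) CS[OF G(1)] by metis
    qed
    moreover have "G0 \<subseteq> \<Union>C"
    proof -
      obtain G where "G \<in> C" using ne by blast
      thus ?thesis using CS[of G] by (meson Union_upper subset_trans)
    qed
    ultimately show "\<Union>C \<in> ?S" by simp
  qed
  then obtain G where "G \<in> ?S" and "\<forall>X\<in>?S. G \<subseteq> X \<longrightarrow> X = G" by (rule bexE)
  moreover from this(1) have G: "partial_hom R B E G" "G0 \<subseteq> G" by simp_all
  ultimately have max: "H = G" if "partial_hom R B E H" "G \<subseteq> H" for H
    using that by simp
  have "Domain G = carrier B"
  proof
    show "Domain G \<subseteq> carrier B" using partial_homD(1)[OF G(1)] by blast
    show "carrier B \<subseteq> Domain G"
    proof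
      fix b assume "b \<in> carrier B"
      from partial_hom_extend_one[OF inj B G(1) this] obtain H
        where H: "partial_hom R B E H" "G \<subseteq> H" "b \<in> Domain H" .
      with max[OF H(1,2)] show "b \<in> Domain G" by simp
    qed
  qed
  from partial_hom_total_imp_mod_hom[OF B E G(1) this]
  obtain g where "mod_hom R B E g" and "\<forall>x y. (x, y) \<in> G \<longrightarrow> g x = y" by (elim exE conjE)
  moreover have "(j x, f x) \<in> G" if "x \<in> carrier A" for x
    using that by (intro subsetD[OF G(2)]) (auto simp: G0_def)
  ultimately show ?thesis by (intro exI[of _ g]) simp
qed

definition injective_envelope ::
    "'a ring \<Rightarrow> ('a, 'n) module \<Rightarrow> ('a, 'm) module \<Rightarrow> bool" where
  "injective_envelope R N E \<longleftrightarrow> injective_mod R E \<and>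
     (\<exists>\<iota>. mod_hom R N E \<iota> \<and> inj_on \<iota> (carrier N) \<and>
        (\<forall>U. submodule U R E \<and> U \<noteq> {\<zero>\<^bsub>E\<^esub>} \<longrightarrow> U \<inter> \<iota> ` carrier N \<noteq> {\<zero>\<^bsub>E\<^esub>}))"


section \<open>Spectrum and localization\<close>

definition Spec :: "'a ring \<Rightarrow> 'a set set" where
  "Spec R = {p. primeideal p R}"

definition Max_Spec :: "'a ring \<Rightarrow> 'a set set" where
  "Max_Spec R = {m. maximalideal m R}"

text \<open>The fraction \<open>x / s\<close> in the localization of \<open>M\<close> at \<open>p\<close>, as a class of pairs.\<close>

definition frac :: "'a ring \<Rightarrow> 'a set \<Rightarrow> ('a, 'm) module \<Rightarrow> 'm \<Rightarrow> 'a \<Rightarrow> ('m \<times> 'a) set" where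
  "frac R p M x s = {(y, t). y \<in> carrier M \<and> t \<in> carrier R - p \<and>
     (\<exists>u\<in>carrier R - p. u \<odot>\<^bsub>M\<^esub> (t \<odot>\<^bsub>M\<^esub> x) = u \<odot>\<^bsub>M\<^esub> (s \<odot>\<^bsub>M\<^esub> y))}"

definition loc_mod ::
    "'a ring \<Rightarrow> 'a set \<Rightarrow> ('a, 'm) module \<Rightarrow> (('a \<times> 'a) set, ('m \<times> 'a) set) module" where
  "loc_mod R p M = mk_mod
     {frac R p M x s |x s. x \<in> carrier M \<and> s \<in> carrier R - p}
     (frac R p M \<zero>\<^bsub>M\<^esub> \<one>\<^bsub>R\<^esub>)
     (\<lambda>X Y. \<Union>(x, s)\<in>X. \<Union>(y, t)\<in>Y.
        frac R p M (t \<odot>\<^bsub>M\<^esub> x \<oplus>\<^bsub>M\<^esub> s \<odot>\<^bsub>M\<^esub> y) (s \<otimes>\<^bsub>R\<^esub> t))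
     (\<lambda>A X. \<Union>(a, s)\<in>A. \<Union>(x, t)\<in>X. frac R p M (a \<odot>\<^bsub>M\<^esub> x) (s \<otimes>\<^bsub>R\<^esub> t))"

definition loc_ring :: "'a ring \<Rightarrow> 'a set \<Rightarrow> ('a \<times> 'a) set ring" where
  "loc_ring R p =
     (let L = loc_mod R p (ring_mod R) in
      \<lparr>carrier = carrier L, monoid.mult = smult L, one = frac R p (ring_mod R) \<one>\<^bsub>R\<^esub> \<one>\<^bsub>R\<^esub>,
       ring.zero = ring.zero L, add = add L\<rparr>)"

definition loc_map :: "'a ring \<Rightarrow> 'a set \<Rightarrow> 'a \<Rightarrow> ('a \<times> 'a) set" where
  "loc_map R p a = frac R p (ring_mod R) a \<one>\<^bsub>R\<^esub>"

text \<open>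
  The residue field \<open>k(p)\<close>, first as a module over the localization at \<open>p\<close>, then as a module
  over \<open>R\<close>.
\<close>

definition residue_loc ::
    "'a ring \<Rightarrow> 'a set \<Rightarrow> (('a \<times> 'a) set, ('a \<times> 'a) set set) module" where
  "residue_loc R p =
     quot_mod (ring_mod (loc_ring R p)) (genideal (loc_ring R p) (loc_map R p ` p))"

definition residue_mod :: "'a ring \<Rightarrow> 'a set \<Rightarrow> ('a, ('a \<times> 'a) set set) module" where
  "residue_mod R p = restrict_scalars (loc_map R p) (residue_loc R p)"

primrec ideal_power :: "'a ring \<Rightarrow> 'a set \<Rightarrow> nat \<Rightarrow> 'a set" where
  "ideal_power R I 0 = carrier R"
| "ideal_power R I (Suc n) = ideal_prod R (ideal_power R I n) I"

text \<open>Uniqueness of limits makes completeness include separatedness.\<close>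

definition adically_complete :: "'a ring \<Rightarrow> 'a set \<Rightarrow> bool" where
  "adically_complete R I \<longleftrightarrow>
     (\<forall>x :: nat \<Rightarrow> 'a. range x \<subseteq> carrier R \<and>
        (\<forall>n. \<exists>N. \<forall>i\<ge>N. \<forall>j\<ge>N. x i \<ominus>\<^bsub>R\<^esub> x j \<in> ideal_power R I n) \<longrightarrow>
        (\<exists>!l. l \<in> carrier R \<and> (\<forall>n. \<exists>N. \<forall>i\<ge>N. x i \<ominus>\<^bsub>R\<^esub> l \<in> ideal_power R I n)))"

definition semilocal_complete :: "'a ring \<Rightarrow> bool" where
  "semilocal_complete R \<longleftrightarrow>
     finite (Max_Spec R) \<and> adically_complete R (carrier R \<inter> \<Inter>(Max_Spec R))"


section \<open>Complexes and the derived category\<close>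

text \<open>Homological grading: \<open>dif X n\<close> maps \<open>obj X n\<close> to \<open>obj X (n - 1)\<close>.\<close>

record ('a, 'm) cpx =
  obj :: "int \<Rightarrow> ('a, 'm) module"
  dif :: "int \<Rightarrow> 'm \<Rightarrow> 'm"

definition is_cpx :: "'a ring \<Rightarrow> ('a, 'm) cpx \<Rightarrow> bool" where
  "is_cpx R X \<longleftrightarrow>
     (\<forall>n. module R (obj X n) \<and> mod_hom R (obj X n) (obj X (n - 1)) (dif X n) \<and>
        (\<forall>x\<in>carrier (obj X n). dif X (n - 1) (dif X n x) = \<zero>\<^bsub>obj X (n - 2)\<^esub>))"

definition cycles :: "('a, 'm) cpx \<Rightarrow> int \<Rightarrow> 'm set" where
  "cycles X n = {x \<in> carrier (obj X n). dif X n x = \<zero>\<^bsub>obj X (n - 1)\<^esub>}"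

definition boundaries :: "('a, 'm) cpx \<Rightarrow> int \<Rightarrow> 'm set" where
  "boundaries X n = dif X (n + 1) ` carrier (obj X (n + 1))"

definition homology :: "int \<Rightarrow> ('a, 'm) cpx \<Rightarrow> ('a, 'm set) module" where
  "homology n X = quot_mod (sub_mod (obj X n) (cycles X n)) (boundaries X n)"

definition chain_map ::
    "'a ring \<Rightarrow> ('a, 'm) cpx \<Rightarrow> ('a, 'n) cpx \<Rightarrow> (int \<Rightarrow> 'm \<Rightarrow> 'n) \<Rightarrow> bool" where
  "chain_map R X Y f \<longleftrightarrow>
     (\<forall>n. mod_hom R (obj X n) (obj Y n) (f n) \<and>
        (\<forall>x\<in>carrier (obj X n). f (n - 1) (dif X n x) = dif Y n (f n x)))"

definition homology_map ::
    "('a, 'n) cpx \<Rightarrow> (int \<Rightarrow> 'm \<Rightarrow> 'n) \<Rightarrow> int \<Rightarrow> 'm set \<Rightarrow> 'n set" where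
  "homology_map Y f n Z = (\<Union>z\<in>Z. boundaries Y n +>\<^bsub>obj Y n\<^esub> f n z)"

definition quasi_iso ::
    "'a ring \<Rightarrow> ('a, 'm) cpx \<Rightarrow> ('a, 'n) cpx \<Rightarrow> (int \<Rightarrow> 'm \<Rightarrow> 'n) \<Rightarrow> bool" where
  "quasi_iso R X Y f \<longleftrightarrow> is_cpx R X \<and> is_cpx R Y \<and> chain_map R X Y f \<and>
     (\<forall>n. bij_betw (homology_map Y f n) (carrier (homology n X)) (carrier (homology n Y)))"

text \<open>
  Two complexes are isomorphic in the derived category iff they are connected by a zigzag of
  quasi-isomorphisms. The intermediate complexes are taken over the same carrier type, which is
  no restriction for the comparison with the zero complex, the only use made of this relation.
\<close>

definition derived_iso :: "'a ring \<Rightarrow> ('a, 'm) cpx \<Rightarrow> ('a, 'm) cpx \<Rightarrow> bool" where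
  "derived_iso R = equivclp (\<lambda>X Y. \<exists>f. quasi_iso R X Y f)"

definition zero_cpx :: "('a, 'm) cpx" where
  "zero_cpx = \<lparr>obj = (\<lambda>_. zero_mod), dif = (\<lambda>_ _. undefined)\<rparr>"

definition mod_cpx :: "('a, 'm) module \<Rightarrow> ('a, 'm) cpx" where
  "mod_cpx N = \<lparr>obj = (\<lambda>n. if n = 0 then N else zero_mod),
     dif = (\<lambda>n _. if n = 1 then \<zero>\<^bsub>N\<^esub> else undefined)\<rparr>"

definition loc_cpx ::
    "'a ring \<Rightarrow> 'a set \<Rightarrow> ('a, 'm) cpx \<Rightarrow> (('a \<times> 'a) set, ('m \<times> 'a) set) cpx" where
  "loc_cpx R p X = \<lparr>obj = (\<lambda>n. loc_mod R p (obj X n)),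
     dif = (\<lambda>n C. \<Union>(x, s)\<in>C. frac R p (obj X (n - 1)) (dif X n x) s)\<rparr>"

definition restrict_cpx :: "('a \<Rightarrow> 'b) \<Rightarrow> ('b, 'm) cpx \<Rightarrow> ('a, 'm) cpx" where
  "restrict_cpx \<phi> X = \<lparr>obj = (\<lambda>n. restrict_scalars \<phi> (obj X n)), dif = dif X\<rparr>"

definition signed :: "int \<Rightarrow> ('a, 'm) module \<Rightarrow> 'm \<Rightarrow> 'm" where
  "signed n N y = (if even n then y else \<ominus>\<^bsub>N\<^esub> y)"

text \<open>
  In degree \<open>n\<close>, component \<open>i\<close> of the tensor product complex is the tensor product of \<open>obj X i\<close>
  and \<open>obj Y (n - i)\<close>; the differential sends \<open>x \<otimes> y\<close> to \<open>dx \<otimes> y + (-1)\<^sup>i x \<otimes> dy\<close>.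
\<close>

definition tensor_cpx ::
    "'a ring \<Rightarrow> ('a, 'm) cpx \<Rightarrow> ('a, 'n) cpx \<Rightarrow> ('a, int \<Rightarrow> (('m \<times> 'n) \<Rightarrow>\<^sub>0 int) set) cpx" where
  "tensor_cpx R X Y = \<lparr>
     obj = (\<lambda>n. sum_mod UNIV (\<lambda>i. tensor_mod R (obj X i) (obj Y (n - i)))),
     dif = (\<lambda>n w i.
       let T = tensor_mod R (obj X i) (obj Y (n - 1 - i)) in
       tensor_map R (obj X i) (obj Y (n - 1 - i)) (dif X (i + 1)) id (w (i + 1)) \<oplus>\<^bsub>T\<^esub>
       signed i T (tensor_map R (obj X i) (obj Y (n - 1 - i)) id (dif Y (n - i)) (w i)))\<rparr>"

text \<open>
  In degree \<open>n\<close>, component \<open>i\<close> of the Hom complex consists of the homomorphisms from \<open>obj X i\<close>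
  to \<open>obj Y (i + n)\<close>; the differential sends \<open>h\<close> to \<open>d h - (-1)\<^sup>n h d\<close>.
\<close>

definition hom_cpx ::
    "'a ring \<Rightarrow> ('a, 'm) cpx \<Rightarrow> ('a, 'n) cpx \<Rightarrow> ('a, int \<Rightarrow> 'm \<Rightarrow> 'n) cpx" where
  "hom_cpx R X Y = \<lparr>
     obj = (\<lambda>n. prod_mod UNIV (\<lambda>i. hom_mod R (obj X i) (obj Y (i + n)))),
     dif = (\<lambda>n h i. \<lambda>x\<in>carrier (obj X i).
       dif Y (i + n) (h i x) \<ominus>\<^bsub>obj Y (i + n - 1)\<^esub>
       signed n (obj Y (i + n - 1)) (h (i - 1) (dif X i x)))\<rparr>"

text \<open>
  Derived functors are computed by a free resolution of a module in the first argument. The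
  elements of the chosen resolution are functions on the infinite index type
  \<open>(nat + 'a + 'n) list\<close>. The finitely supported functions from this type to \<open>R\<close> are no more
  numerous than the type itself, and neither are the elements of \<open>N\<close>; so \<open>N\<close>, and every submodule
  of a free module on a subset of the type, is a quotient of such a free module. Hence every module
  has a free resolution of this kind. Up to isomorphism in the derived category, nothing depends
  on the choice.
\<close>

definition free_resolution ::
    "'a ring \<Rightarrow> ('a, 'n) module \<Rightarrow> ('a, 'm) cpx \<Rightarrow> bool" where
  "free_resolution R N F \<longleftrightarrow> is_cpx R F \<and>
     (\<forall>n. free_mod R (obj F n)) \<and> (\<forall>n<0. carrier (obj F n) = {\<zero>\<^bsub>obj F n\<^esub>}) \<and>
     (\<exists>\<epsilon>. quasi_iso R F (mod_cpx N) \<epsilon>)"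

type_synonym ('a, 'n) free_elt = "(nat + 'a + 'n) list \<Rightarrow> 'a"

definition resolution ::
    "'a ring \<Rightarrow> ('a, 'n) module \<Rightarrow> ('a, ('a, 'n) free_elt) cpx" where
  "resolution R N = (SOME F. free_resolution R N F)"

definition Ltensor ::
    "'a ring \<Rightarrow> ('a, 'n) module \<Rightarrow> ('a, 'm) cpx \<Rightarrow>
     ('a, int \<Rightarrow> ((('a, 'n) free_elt \<times> 'm) \<Rightarrow>\<^sub>0 int) set) cpx" where
  "Ltensor R N X = tensor_cpx R (resolution R N) X"

definition RHom ::
    "'a ring \<Rightarrow> ('a, 'n) module \<Rightarrow> ('a, 'm) cpx \<Rightarrow>
     ('a, int \<Rightarrow> ('a, 'n) free_elt \<Rightarrow> 'm) cpx" where
  "RHom R N X = hom_cpx R (resolution R N) X"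

definition Dn_plus :: "'a ring \<Rightarrow> ('a, 'm) cpx set" where
  "Dn_plus R = {X. is_cpx R X \<and> (\<forall>i. noetherian_mod R (homology i X)) \<and>
     (\<exists>b. \<forall>n<b. carrier (homology n X) = {\<zero>\<^bsub>homology n X\<^esub>})}"

definition Da_minus :: "'a ring \<Rightarrow> ('a, 'm) cpx set" where
  "Da_minus R = {X. is_cpx R X \<and> (\<forall>i. artinian_mod R (homology i X)) \<and>
     (\<exists>b. \<forall>n>b. carrier (homology n X) = {\<zero>\<^bsub>homology n X\<^esub>})}"


section \<open>Small support and small cosupport\<close>

definition supp :: "'a ring \<Rightarrow> ('a, 'm) cpx \<Rightarrow> 'a set set" where
  "supp R M = {p \<in> Spec R. \<not> derived_iso R (Ltensor R (residue_mod R p) M) zero_cpx}"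

text \<open>
  Injective envelopes are unique only up to isomorphism. The choices are made explicit: \<open>E m\<close> is
  an injective envelope of \<open>R / m\<close> for each maximal ideal \<open>m\<close>, and \<open>EL p\<close> is an injective
  envelope of \<open>k(p)\<close> over the localization at \<open>p\<close>, for each prime ideal \<open>p\<close>.
\<close>

definition envelope_choice ::
    "'a ring \<Rightarrow> ('a set \<Rightarrow> ('a, 'e) module) \<Rightarrow>
     ('a set \<Rightarrow> (('a \<times> 'a) set, 'f) module) \<Rightarrow> bool" where
  "envelope_choice R E EL \<longleftrightarrow>
     (\<forall>m\<in>Max_Spec R. injective_envelope R (quot_mod (ring_mod R) m) (E m)) \<and>
     (\<forall>p\<in>Spec R. injective_envelope (loc_ring R p) (residue_loc R p) (EL p))"

definition dual_cpx ::
    "'a ring \<Rightarrow> ('a set \<Rightarrow> ('a, 'e) module) \<Rightarrow> ('a, 'm) cpx \<Rightarrow>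
     ('a, int \<Rightarrow> 'm \<Rightarrow> 'a set \<Rightarrow> 'e) cpx" where
  "dual_cpx R E M = hom_cpx R M (mod_cpx (sum_mod (Max_Spec R) E))"

text \<open>The complex \<open>\<^sup>pM\<close>, over the localization at \<open>p\<close>.\<close>

definition coloc_cpx ::
    "'a ring \<Rightarrow> ('a set \<Rightarrow> ('a, 'e) module) \<Rightarrow>
     ('a set \<Rightarrow> (('a \<times> 'a) set, 'f) module) \<Rightarrow> 'a set \<Rightarrow> ('a, 'm) cpx \<Rightarrow>
     (('a \<times> 'a) set, int \<Rightarrow> ((int \<Rightarrow> 'm \<Rightarrow> 'a set \<Rightarrow> 'e) \<times> 'a) set \<Rightarrow> 'f) cpx" where
  "coloc_cpx R E EL p M =
     hom_cpx (loc_ring R p) (loc_cpx R p (dual_cpx R E M)) (mod_cpx (EL p))"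

definition cosupp ::
    "'a ring \<Rightarrow> ('a set \<Rightarrow> ('a, 'e) module) \<Rightarrow>
     ('a set \<Rightarrow> (('a \<times> 'a) set, 'f) module) \<Rightarrow> ('a, 'm) cpx \<Rightarrow> 'a set set" where
  "cosupp R E EL M = {p \<in> Spec R.
     \<not> derived_iso R
         (RHom R (quot_mod (ring_mod R) p) (restrict_cpx (loc_map R p) (coloc_cpx R E EL p M)))
         zero_cpx}"

end

theory Submission
  imports Defs
begin

text \<open>
  Notation: \<open>|M|\<close> is the carrier of \<open>M\<close>, and a subscript names the module or ring of an operation;
  \<open>a .\<^sub>M x\<close> is the action of a scalar.
\<close>

unbundle no cardinal_syntax
notation carrier ("|_|")

syntax
  "_index" :: "logic \<Rightarrow> index" ("\<^sub>_" [1000] 1000)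
  "_zero_sub" :: "logic \<Rightarrow> logic" ("0\<^sub>_" [1000] 1000)
  "_one_sub" :: "logic \<Rightarrow> logic" ("1\<^sub>_" [1000] 1000)
  "_add_sub" :: "logic \<Rightarrow> logic \<Rightarrow> logic \<Rightarrow> logic" ("_ +\<^sub>_ _" [65, 1000, 66] 65)
  "_minus_sub" :: "logic \<Rightarrow> logic \<Rightarrow> logic \<Rightarrow> logic" ("_ -\<^sub>_ _" [65, 1000, 66] 65)
  "_neg_sub" :: "logic \<Rightarrow> logic \<Rightarrow> logic" ("-\<^sub>_ _" [1000, 81] 80)
  "_smult_sub" :: "logic \<Rightarrow> logic \<Rightarrow> logic \<Rightarrow> logic" ("_ .\<^sub>_ _" [70, 1000, 71] 70)
translations
  "_zero_sub M" => "CONST ring.zero M"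
  "_one_sub M" => "CONST monoid.one M"
  "_add_sub x M y" => "CONST ring.add M x y"
  "_minus_sub x M y" => "CONST a_minus M x y"
  "_neg_sub M x" => "CONST a_inv M x"
  "_smult_sub a M x" => "CONST module.smult M a x"

section \<open>Modules, quotients and linear combinations\<close>

lemma (in abelian_group) ab_cancel:
 assumes "a : |G|" "b : |G|"
 shows "a \<oplus> (b \<oplus> \<ominus> a) = b" "\<ominus> a \<oplus> (b \<oplus> a) = b" "a \<oplus> \<ominus> a = \<zero>" "\<ominus> a \<oplus> a = \<zero>"
  "a \<oplus> (\<ominus> a \<oplus> b) = b" "\<ominus> a \<oplus> (a \<oplus> b) = b"
  "c : |G| ==> a \<oplus> (b \<oplus> (\<ominus> a \<oplus> c)) = b \<oplus> c"
  "c : |G| ==> \<ominus> a \<oplus> (b \<oplus> (a \<oplus> c)) = b \<oplus> c"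
  "c : |G| ==> a \<oplus> (b \<oplus> (c \<oplus> \<ominus> a)) = b \<oplus> c"
  "c : |G| ==> \<ominus> a \<oplus> (b \<oplus> (c \<oplus> a)) = b \<oplus> c"
proof -
 show 1: "a \<oplus> \<ominus> a = \<zero>" "\<ominus> a \<oplus> a = \<zero>" using assms by (simp_all add: r_neg l_neg)
 have 2: "a \<oplus> (\<ominus> a \<oplus> b) = b" "\<ominus> a \<oplus> (a \<oplus> b) = b" if "b : |G|" for b
  using assms 1 that by (simp_all add: a_assoc[symmetric])
 show "a \<oplus> (\<ominus> a \<oplus> b) = b" "\<ominus> a \<oplus> (a \<oplus> b) = b" using 2 assms by auto
 have 3: "a \<oplus> (b \<oplus> \<ominus> a) = b" "\<ominus> a \<oplus> (b \<oplus> a) = b" if "b : |G|" for b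
  using assms that a_lcomm[of a b "\<ominus> a"] a_lcomm[of "\<ominus> a" b a] by (simp_all add: 1)
 show "a \<oplus> (b \<oplus> \<ominus> a) = b" "\<ominus> a \<oplus> (b \<oplus> a) = b" using 3 assms by auto
 assume c: "c : |G|"
 show "a \<oplus> (b \<oplus> (\<ominus> a \<oplus> c)) = b \<oplus> c" "\<ominus> a \<oplus> (b \<oplus> (a \<oplus> c)) = b \<oplus> c"
  using assms c a_lcomm[of a b "\<ominus> a \<oplus> c"] a_lcomm[of "\<ominus> a" b "a \<oplus> c"] by (simp_all add: 2)
 show "a \<oplus> (b \<oplus> (c \<oplus> \<ominus> a)) = b \<oplus> c" "\<ominus> a \<oplus> (b \<oplus> (c \<oplus> a)) = b \<oplus> c"
  using assms c a_lcomm[of a b "c \<oplus> \<ominus> a"] a_lcomm[of "\<ominus> a" b "c \<oplus> a"] by (simp_all add: 3)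
qed

lemma mk_mod_simps [simp]:
 "|mk_mod C z a s| = C" "ring.zero (mk_mod C z a s) = z" "add (mk_mod C z a s) = a"
 "smult (mk_mod C z a s) = s"
 by (simp_all add: mk_mod_def)

lemma sub_mod_simps [simp]:
 "|sub_mod M A| = A" "ring.zero (sub_mod M A) = ring.zero M" "add (sub_mod M A) = add M"
 "smult (sub_mod M A) = smult M"
 by (simp_all add: sub_mod_def)

lemma modI:
 fixes R :: "'a ring" and M :: "('a, 'm) module"
 assumes "cring R"
  and "!!x y. x : |M| ==> y : |M| ==> x +\<^sub>M y : |M|"
  and "0\<^sub>M : |M|"
  and "!!x y z. x : |M| ==> y : |M| ==> z : |M| ==>
   (x +\<^sub>M y) +\<^sub>M z = x +\<^sub>M (y +\<^sub>M z)"
  and "!!x y. x : |M| ==> y : |M| ==> x +\<^sub>M y = y +\<^sub>M x"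
  and "!!x. x : |M| ==> 0\<^sub>M +\<^sub>M x = x"
  and "!!x. x : |M| ==> \<exists>y\<in>|M|. y +\<^sub>M x = 0\<^sub>M"
  and "!!a x. a : |R| ==> x : |M| ==> a .\<^sub>M x : |M|"
  and "!!a b x. a : |R| ==> b : |R| ==> x : |M| ==>
   (a +\<^sub>R b) .\<^sub>M x = a .\<^sub>M x +\<^sub>M b .\<^sub>M x"
  and "!!a x y. a : |R| ==> x : |M| ==> y : |M| ==>
   a .\<^sub>M (x +\<^sub>M y) = a .\<^sub>M x +\<^sub>M a .\<^sub>M y"
  and "!!a b x. a : |R| ==> b : |R| ==> x : |M| ==>
   (a \<otimes>\<^sub>R b) .\<^sub>M x = a .\<^sub>M (b .\<^sub>M x)"
  and "!!x. x : |M| ==> 1\<^sub>R .\<^sub>M x = x"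
 shows "module R M"
 by (intro moduleI abelian_groupI) (use assms in auto)

lemma ring_mod_simps [simp]:
 "|ring_mod R| = |R|" "ring.zero (ring_mod R) = ring.zero R" "add (ring_mod R) = add R"
 "smult (ring_mod R) = monoid.mult R"
 by (simp_all add: ring_mod_def)

lemma mod_homD:
 assumes "mod_hom R M N f"
 shows "x : |M| ==> f x : |N|"
  "x : |M| ==> y : |M| ==> f (x +\<^sub>M y) = f x +\<^sub>N f y"
  "r : |R| ==> x : |M| ==> f (r .\<^sub>M x) = r .\<^sub>N f x"
 using assms by (auto simp: mod_hom_def)

lemma mod_homI:
 assumes "!!x. x : |M| ==> f x : |N|"
  "!!x y. x : |M| ==> y : |M| ==> f (x +\<^sub>M y) = f x +\<^sub>N f y"
  "!!r x. r : |R| ==> x : |M| ==> f (r .\<^sub>M x) = r .\<^sub>N f x"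
 shows "mod_hom R M N f"
 using assms by (auto simp: mod_hom_def)

lemma mod_hom_zero:
 assumes "module R M" "module R N" "mod_hom R M N f"
 shows "f 0\<^sub>M = 0\<^sub>N"
proof -
 interpret M: module R M by fact
 interpret N: module R N by fact
 have "f (0\<^sub>R .\<^sub>M 0\<^sub>M) = 0\<^sub>R .\<^sub>N f 0\<^sub>M" by (rule mod_homD(3)[OF assms(3)]) auto
 then show ?thesis using mod_homD(1)[OF assms(3)] by simp
qed

lemma (in module) uminus_smult: "x : |M| ==> -\<^sub>M x = (-\<^sub>R 1\<^sub>R) .\<^sub>M x"
 by (simp add: smult_l_minus)

lemma mod_hom_neg:
 assumes "module R M" "module R N" "mod_hom R M N f" "x : |M|"
 shows "f (-\<^sub>M x) = -\<^sub>N f x"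
proof -
 interpret M: module R M by fact
 interpret N: module R N by fact
 show ?thesis using assms(4) mod_homD[OF assms(3)] by (simp add: M.uminus_smult N.uminus_smult)
qed

lemma mod_hom_minus:
 assumes "module R M" "module R N" "mod_hom R M N f" "x : |M|" "y : |M|"
 shows "f (x -\<^sub>M y) = f x -\<^sub>N f y"
proof -
 interpret M: module R M by fact
 show ?thesis using assms mod_homD[OF assms(3)] by (simp add: a_minus_def mod_hom_neg)
qed

lemma mod_hom_comp:
 "mod_hom R M N f ==> mod_hom R N P g ==> mod_hom R M P (%x. g (f x))"
 by (auto simp: mod_hom_def Pi_def)

lemma submoduleD:
 assumes "module R M" "submodule U R M"
 shows "U \<subseteq> |M|" "0\<^sub>M : U" "x : U ==> y : U ==> x +\<^sub>M y : U"
  "r : |R| ==> x : U ==> r .\<^sub>M x : U" "x : U ==> -\<^sub>M x : U"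
  "x : U ==> y : U ==> x -\<^sub>M y : U"
proof -
 interpret module R M by fact
 show "U \<subseteq> |M|" "x : U ==> y : U ==> x +\<^sub>M y : U"
  "r : |R| ==> x : U ==> r .\<^sub>M x : U" "x : U ==> -\<^sub>M x : U"
  "x : U ==> y : U ==> x -\<^sub>M y : U"
  using submoduleE[OF assms(2)] by (auto simp: a_minus_def)
 show "0\<^sub>M : U"
  using subgroup.one_closed[OF submodule.axioms(1)[OF assms(2)]] by simp
qed

lemma submodI:
 assumes "module R M" "U \<subseteq> |M|" "0\<^sub>M : U"
  "!!x y. x : U ==> y : U ==> x +\<^sub>M y : U"
  "!!r x. r : |R| ==> x : U ==> r .\<^sub>M x : U"
 shows "submodule U R M"
proof -
 interpret module R M by fact
 show ?thesis
 proof (rule submoduleI)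
  fix a assume "a : U"
  then show "-\<^sub>M a : U" using assms(5)[of "-\<^sub>R 1\<^sub>R" a] assms(2) uminus_smult by auto
 qed (use assms in auto)
qed

lemma module_sub_mod: "module R M ==> submodule U R M ==> module R (sub_mod M U)"
 using submodule.submodule_is_module by (simp add: sub_mod_def)

lemma submodule_sub_mod:
 assumes "module R M" "submodule V R M" "submodule U R M" "U \<subseteq> V"
 shows "submodule U R (sub_mod M V)"
 by (rule submodI) (use assms submoduleD[OF assms(1,3)] in "auto intro: module_sub_mod")

lemma submodule_kernel:
 assumes M: "module R M" and N: "module R N" and f: "mod_hom R M N f"
 shows "submodule {x : |M|. f x = 0\<^sub>N} R M"
proof -
 interpret M: module R M by fact
 interpret N: module R N by fact
 show ?thesis
  by (rule submodI[OF M]) (use mod_homD[OF f] mod_hom_zero[OF M N f] in auto)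
qed

lemma submodule_image:
 assumes M: "module R M" and N: "module R N" and f: "mod_hom R M N f" and U: "submodule U R M"
 shows "submodule (f ` U) R N"
proof -
 note u = submoduleD[OF M U]
 note h = mod_homD[OF f]
 show ?thesis
 proof (rule submodI[OF N])
  show "f ` U \<subseteq> |N|" using u(1) h(1) by auto
  show "0\<^sub>N : f ` U" using u(2) mod_hom_zero[OF M N f] by (metis imageI)
 next
  fix x y assume "x : f ` U" "y : f ` U"
  then obtain a b where "a : U" "b : U" "x = f a" "y = f b" by auto
  then show "x +\<^sub>N y : f ` U" using u h(2)[of a b] by (metis imageI subsetD)
 next
  fix r x assume "r : |R|" "x : f ` U"
  then show "r .\<^sub>N x : f ` U" using u h(3) by (smt (verit) image_iff subsetD)
 qed
qed

lemma submodule_preimage: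
 assumes M: "module R M" and N: "module R N" and f: "mod_hom R M N f" and V: "submodule V R N"
 shows "submodule {x : |M|. f x : V} R M"
proof -
 interpret M: module R M by fact
 show ?thesis
  by (rule submodI[OF M])
    (use mod_homD[OF f] mod_hom_zero[OF M N f] submoduleD[OF N V] in auto)
qed

lemma additive_subgroup_submodule: "submodule U R M ==> additive_subgroup U M"
 by (simp add: additive_subgroup_def submodule_def)

text \<open>
 Both homology and tensor products are quotients \<^const>\<open>quot_mod\<close>. In the second case the
 numerator is only an abelian group with an action that becomes a module structure in the quotient;
 the locale covers both cases.
\<close>

locale module_mod = R: cring R + M: abelian_group M + B: additive_subgroup B M
 for R :: "'a ring" and M :: "('a, 'm) module" and B +
 assumes act_closed: "r : |R| ==> x : |M| ==> r .\<^sub>M x : |M|"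
  and act_cong: "r : |R| ==> x : |M| ==> y : |M| ==> x -\<^sub>M y : B ==>
   (r .\<^sub>M x) -\<^sub>M (r .\<^sub>M y) : B"
  and act_l: "r : |R| ==> s : |R| ==> x : |M| ==>
   ((r +\<^sub>R s) .\<^sub>M x) -\<^sub>M (r .\<^sub>M x +\<^sub>M s .\<^sub>M x) : B"
  and act_r: "r : |R| ==> x : |M| ==> y : |M| ==>
   (r .\<^sub>M (x +\<^sub>M y)) -\<^sub>M (r .\<^sub>M x +\<^sub>M r .\<^sub>M y) : B"
  and act_assoc: "r : |R| ==> s : |R| ==> x : |M| ==>
   ((r \<otimes>\<^sub>R s) .\<^sub>M x) -\<^sub>M (r .\<^sub>M (s .\<^sub>M x)) : B"
  and act_one: "x : |M| ==> (1\<^sub>R .\<^sub>M x) -\<^sub>M x : B"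
begin

abbreviation cls where "cls x \<equiv> B +>\<^sub>M x"
abbreviation Q where "Q \<equiv> quot_mod M B"

lemma absub: "abelian_subgroup B M"
 by (rule abelian_subgroupI3) (rule B.additive_subgroup_axioms, rule M.abelian_group_axioms)

lemma cls_eq_iff:
 assumes x: "x : |M|" and y: "y : |M|"
 shows "cls x = cls y \<longleftrightarrow> x -\<^sub>M y : B"
proof
 assume "cls x = cls y"
 then have "cls (x +\<^sub>M -\<^sub>M y) = B" using x y B.a_subset by (rule M.a_coset_add_inv2)
 moreover have "x +\<^sub>M -\<^sub>M y : |M|" using x y by simp
 ultimately show "x -\<^sub>M y : B"
  unfolding a_minus_def using B.a_subgroup by (rule M.a_coset_join1)
next
 assume "x -\<^sub>M y : B"
 then have "x +\<^sub>M -\<^sub>M y : B" by (simp add: a_minus_def)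
 moreover have "x +\<^sub>M -\<^sub>M y : |M|" using x y by simp
 ultimately have "cls (x +\<^sub>M -\<^sub>M y) = B" using M.a_coset_join2 B.a_subgroup by blast
 then show "cls x = cls y" using x y B.a_subset by (rule M.a_coset_add_inv1)
qed

lemma cls_self: "x : |M| ==> x : cls x"
 using M.a_rcosI[OF B.zero_closed B.a_subset, of x] by simp

lemma mem_cls: "x : |M| ==> y : cls x \<longleftrightarrow> y : |M| \<and> cls y = cls x"
 using M.a_repr_independence[OF _ _ B.a_subgroup, of y x] M.a_r_coset_subset_G[OF B.a_subset, of x]
  cls_self[of y] by auto

lemma Q_carrier: "|Q| = cls ` |M|"
 by (auto simp: quot_mod_def A_RCOSETS_def')

lemma Q_cases: "X : |Q| ==> (!!x. x : |M| ==> X = cls x ==> P) ==> P"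
 by (auto simp: Q_carrier)

lemma Q_zero: "0\<^sub>Q = cls 0\<^sub>M" "0\<^sub>Q = B"
 using M.a_coset_add_zero[OF B.a_subset] by (simp_all add: quot_mod_def)

lemma Q_add: "x : |M| ==> y : |M| ==> cls x +\<^sub>Q cls y = cls (x +\<^sub>M y)"
 by (simp add: quot_mod_def abelian_subgroup.a_rcos_sum[OF absub])

lemma Q_smult: assumes "r : |R|" "x : |M|" shows "r .\<^sub>Q cls x = cls (r .\<^sub>M x)"
proof -
 have "cls (r .\<^sub>M y) = cls (r .\<^sub>M x)" if "y : cls x" for y
 proof -
  have y: "y : |M|" "cls y = cls x" using that mem_cls[OF assms(2)] by auto
  then show ?thesis using assms act_cong[of r y x] act_closed by (simp add: cls_eq_iff)
 qed
 then have "(\<Union>y\<in>cls x. cls (r .\<^sub>M y)) = cls (r .\<^sub>M x)"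
  using cls_self[OF assms(2)] by (intro SUP_eq_const) blast+
 then show ?thesis by (simp add: quot_mod_def)
qed

lemma Q_module: "module R Q"
proof (rule modI, goal_cases)
 case 1 show ?case by (rule R.is_cring)
next
 case (2 x y) then show ?case by (elim Q_cases) (simp add: Q_add Q_carrier)
next
 case 3 show ?case by (simp add: Q_zero(1) Q_carrier)
next
 case (4 x y z) then show ?case by (elim Q_cases) (simp add: Q_add M.a_assoc)
next
 case (5 x y) then show ?case by (elim Q_cases) (simp add: Q_add M.a_comm)
next
 case (6 x) then show ?case by (elim Q_cases) (simp add: Q_add Q_zero(1))
next
 case (7 x)
 then obtain a where a: "a : |M|" "x = cls a" by (rule Q_cases)
 show ?case
  by (rule bexI[of _ "cls (-\<^sub>M a)"]) (use a in "simp_all add: Q_carrier Q_add Q_zero(1) M.l_neg")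
next
 case (8 r x) then show ?case by (elim Q_cases) (simp add: Q_smult Q_carrier act_closed)
next
 case (9 r s x)
 then obtain a where a: "a : |M|" "x = cls a" by (elim Q_cases)
 have "cls ((r +\<^sub>R s) .\<^sub>M a) = cls (r .\<^sub>M a +\<^sub>M s .\<^sub>M a)"
  using 9 a by (subst cls_eq_iff) (simp_all add: act_closed act_l)
 then show ?case using 9 a by (simp add: Q_smult Q_add act_closed)
next
 case (10 r x y)
 then obtain a b where a: "a : |M|" "x = cls a" "b : |M|" "y = cls b" by (elim Q_cases)
 have "cls (r .\<^sub>M (a +\<^sub>M b)) = cls (r .\<^sub>M a +\<^sub>M r .\<^sub>M b)"
  using 10 a by (subst cls_eq_iff) (simp_all add: act_closed act_r)
 then show ?case using 10 a by (simp add: Q_smult Q_add act_closed)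
next
 case (11 r s x)
 then obtain a where a: "a : |M|" "x = cls a" by (elim Q_cases)
 have "cls ((r \<otimes>\<^sub>R s) .\<^sub>M a) = cls (r .\<^sub>M (s .\<^sub>M a))"
  using 11 a by (subst cls_eq_iff) (simp_all add: act_closed act_assoc)
 then show ?case using 11 a by (simp add: Q_smult act_closed)
next
 case (12 x)
 then obtain a where a: "a : |M|" "x = cls a" by (elim Q_cases)
 have "cls (1\<^sub>R .\<^sub>M a) = cls a"
  using a by (subst cls_eq_iff) (simp_all add: act_closed act_one)
 then show ?case using a by (simp add: Q_smult)
qed

lemma cls_zero_iff: "x : |M| ==> cls x = 0\<^sub>Q \<longleftrightarrow> x : B"
 using cls_eq_iff[of x "0\<^sub>M"] M.minus_equality[of "0\<^sub>M" "0\<^sub>M"]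
 by (simp add: Q_zero(1) a_minus_def)

end

lemma module_modI:
 assumes "module R M" "submodule B R M"
 shows "module_mod R M B"
proof -
 interpret module R M by fact
 note b = submoduleD[OF assms]
 interpret B: additive_subgroup B M using assms(2) by (rule additive_subgroup_submodule)
 have z: "x -\<^sub>M x : B" if "x : |M|" for x
  using that b(2) by (simp add: a_minus_def M.r_neg)
 show ?thesis
 proof unfold_locales
  fix r x y assume "r : |R|" "x : |M|" "y : |M|" "x -\<^sub>M y : B"
  then show "r .\<^sub>M x -\<^sub>M r .\<^sub>M y : B"
   using b(4)[of r "x -\<^sub>M y"] by (simp add: a_minus_def smult_r_distr smult_r_minus)
 qed (use z in "auto simp: smult_l_distr smult_r_distr smult_assoc1")
qed

subsection \<open>Linear combinations\<close>

inductive_set lincomb :: "('a, 'm, 'd) module_scheme => 'a set => 'm set => 'm set" for M I S where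
 zero: "0\<^sub>M : lincomb M I S"
| step: "a : I ==> x : S ==> y : lincomb M I S ==> a .\<^sub>M x +\<^sub>M y : lincomb M I S"

lemma lincomb_mono:
 assumes "I \<subseteq> J" "S \<subseteq> T" shows "lincomb M I S \<subseteq> lincomb M J T"
proof
 fix x assume "x : lincomb M I S"
 then show "x : lincomb M J T" by induct (use assms in "auto intro: lincomb.intros")
qed

lemma lincomb_in_submodule:
 assumes "module R M" "submodule U R M" "!!a x. a : I ==> x : S ==> a .\<^sub>M x : U"
 shows "lincomb M I S \<subseteq> U"
proof
 fix x assume "x : lincomb M I S"
 then show "x : U" by induct (use assms submoduleD[OF assms(1,2)] in auto)
qed

context module
begin

lemma lincomb_closed:
 assumes "I \<subseteq> |R|" "S \<subseteq> |M|" shows "lincomb M I S \<subseteq> |M|"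
 by (rule lincomb_in_submodule[OF module_axioms carrier_is_submodule]) (use assms in auto)

lemma lincomb_single:
 assumes "I \<subseteq> |R|" "S \<subseteq> |M|" "a : I" "x : S" shows "a .\<^sub>M x : lincomb M I S"
 using lincomb.step[OF assms(3,4) lincomb.zero, of M] assms by (auto simp: subset_iff)

lemma lincomb_add:
 assumes "I \<subseteq> |R|" "S \<subseteq> |M|" "x : lincomb M I S" "y : lincomb M I S"
 shows "x +\<^sub>M y : lincomb M I S"
 using assms(3)
proof induct
 case zero
 then show ?case using assms lincomb_closed[OF assms(1,2)] by auto
next
 case (step a u v)
 have "a .\<^sub>M u +\<^sub>M v +\<^sub>M y = a .\<^sub>M u +\<^sub>M (v +\<^sub>M y)"
  using step assms lincomb_closed[OF assms(1,2)] by (intro M.a_assoc) auto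
 then show ?case using step by (auto intro: lincomb.step)
qed

lemma lincomb_smult:
 assumes I: "ideal I R" and S: "S \<subseteq> |M|" and r: "r : |R|" and x: "x : lincomb M I S"
 shows "r .\<^sub>M x : lincomb M I S"
 using x
proof induct
 case zero
 then show ?case using r by (simp add: lincomb.zero)
next
 case (step a u v)
 have Ic: "I \<subseteq> |R|" using I by (rule ideal.Icarr[THEN subsetI])
 have "r .\<^sub>M (a .\<^sub>M u +\<^sub>M v) = (r \<otimes>\<^sub>R a) .\<^sub>M u +\<^sub>M r .\<^sub>M v"
  using step r S Ic lincomb_closed[OF Ic S]
  by (subst smult_r_distr) (auto simp: smult_assoc1 subset_iff)
 then show ?case using step r ideal.I_l_closed[OF I] by (auto intro: lincomb.step)
qed

lemma lincomb_submodule: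
 assumes I: "ideal I R" and S: "S \<subseteq> |M|"
 shows "submodule (lincomb M I S) R M"
proof -
 have Ic: "I \<subseteq> |R|" using I by (rule ideal.Icarr[THEN subsetI])
 show ?thesis
  by (rule submodI[OF module_axioms])
    (use lincomb_closed[OF Ic S] lincomb_add[OF Ic S] lincomb_smult[OF I S] lincomb.zero in auto)
qed

lemma lincomb_incl: "S \<subseteq> |M| ==> x : S ==> x : lincomb M |R| S"
 using lincomb_single[of "|R|" S "1\<^sub>R" x] by auto

lemma lincomb_lincomb:
 assumes I: "ideal I R" and S: "S \<subseteq> |M|"
 shows "lincomb M I (lincomb M |R| S) \<subseteq> lincomb M I S"
proof (rule lincomb_in_submodule[OF module_axioms lincomb_submodule[OF I S]])
 fix a x assume a: "a : I" and "x : lincomb M |R| S"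
 have Ic: "I \<subseteq> |R|" using I by (rule ideal.Icarr[THEN subsetI])
 note sub = submoduleD[OF module_axioms lincomb_submodule[OF I S]]
 from \<open>x \<in> _\<close> show "a .\<^sub>M x : lincomb M I S"
 proof induct
  case zero
  then show ?case using a Ic sub(2) by auto
 next
  case (step b u v)
  have "a .\<^sub>M (b .\<^sub>M u +\<^sub>M v) = (a \<otimes>\<^sub>R b) .\<^sub>M u +\<^sub>M a .\<^sub>M v"
   using step a S Ic lincomb_closed[OF subset_refl S]
   by (subst smult_r_distr) (auto simp: smult_assoc1 subset_iff)
  then show ?case using step a ideal.I_r_closed[OF I] by (auto intro: lincomb.step)
 qed
qed

lemma lincomb_insert:
 assumes I: "ideal I R" and x: "x : |M|" and S: "S \<subseteq> |M|"
  and z: "z : lincomb M I (insert x S)"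
 obtains a y where "a : I" "y : lincomb M I S" "z = a .\<^sub>M x +\<^sub>M y"
proof -
 have Ic: "I \<subseteq> |R|" using I by (rule ideal.Icarr[THEN subsetI])
 have "\<exists>a\<in>I. \<exists>y\<in>lincomb M I S. z = a .\<^sub>M x +\<^sub>M y"
  using z
 proof induct
  case zero
  have "0\<^sub>R : I" using I by (simp add: additive_subgroup.zero_closed ideal.axioms(1))
  then show ?case using x lincomb.zero by (intro bexI) auto
 next
  case (step b u v)
  then obtain a y where ay: "a : I" "y : lincomb M I S" "v = a .\<^sub>M x +\<^sub>M y" by auto
  have y: "y : |M|" using ay lincomb_closed[OF Ic S] by auto
  show ?case
  proof (cases "u = x")
   case True
   have "b .\<^sub>M u +\<^sub>M v = (b +\<^sub>R a) .\<^sub>M x +\<^sub>M y"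
    using True ay step Ic x y by (auto simp: smult_l_distr M.a_assoc subset_iff)
   moreover have "b +\<^sub>R a : I"
    using I step ay by (simp add: additive_subgroup.a_closed ideal.axioms(1))
   ultimately show ?thesis using ay by blast
  next
   case False
   then have u: "u : S" using step by auto
   have "b .\<^sub>M u +\<^sub>M v = a .\<^sub>M x +\<^sub>M (b .\<^sub>M u +\<^sub>M y)"
    using ay step Ic x y u S by (auto simp: M.a_lcomm subset_iff)
   then show ?thesis using ay u step by (blast intro: lincomb.step)
  qed
 qed
 then show ?thesis using that by blast
qed

end

section \<open>Prime ideals and a local form of Nakayama's lemma\<close>

lemma prime_compl:
 assumes "primeideal p R"
 shows "1\<^sub>R : |R| - p"
  "s : |R| - p ==> t : |R| - p ==> s \<otimes>\<^sub>R t : |R| - p"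
  "s : |R| - p ==> a : p ==> s +\<^sub>R a : |R| - p"
  "s : |R| - p ==> a : p ==> s -\<^sub>R a : |R| - p"
  "p \<subseteq> |R|" "ideal p R"
proof -
 interpret primeideal p R by fact
 show "1\<^sub>R : |R| - p" using one_imp_carrier I_notcarr by auto
 show "s : |R| - p ==> t : |R| - p ==> s \<otimes>\<^sub>R t : |R| - p"
  using I_prime by auto
 show plus: "s +\<^sub>R a : |R| - p" if "s : |R| - p" "a : p" for s a
 proof -
  have "s : p" if "s +\<^sub>R a : p"
  proof -
   have "(s +\<^sub>R a) +\<^sub>R -\<^sub>R a : p" using that \<open>a \<in> p\<close> by auto
   then show ?thesis using \<open>a \<in> p\<close> \<open>s \<in> _\<close> Icarr by (simp add: a_assoc r_neg)
  qed
  then show ?thesis using that Icarr by auto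
 qed
 show "s : |R| - p ==> a : p ==> s -\<^sub>R a : |R| - p"
  unfolding a_minus_def by (rule plus) auto
 show "p \<subseteq> |R|" using Icarr by auto
 show "ideal p R" by (rule is_ideal)
qed

lemma submodule_cyclic_plus:
 assumes M: "module R M" and K: "submodule K R M" and I: "ideal I R" and x: "x : |M|"
 shows "submodule {a .\<^sub>M x +\<^sub>M k |a k. a : I \<and> k : K} R M"
proof -
 interpret module R M by fact
 interpret I: ideal I R by fact
 note K' = submoduleD[OF M K]
 note Ic = I.Icarr
 have Kc: "k : |M|" if "k : K" for k using K' that by auto
 have mem: "a .\<^sub>M x +\<^sub>M k : {a .\<^sub>M x +\<^sub>M k |a k. a : I \<and> k : K}"
  if "a : I" "k : K" for a k using that by auto
 show ?thesis
 proof (rule submodI[OF M])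
  show "{a .\<^sub>M x +\<^sub>M k |a k. a : I \<and> k : K} \<subseteq> |M|" using Ic Kc x by auto
  show "0\<^sub>M : {a .\<^sub>M x +\<^sub>M k |a k. a : I \<and> k : K}"
   using x K'(2) I.zero_closed by (intro CollectI exI[of _ "0\<^sub>R"] exI[of _ "0\<^sub>M"]) simp
 next
  fix u v assume "u : {a .\<^sub>M x +\<^sub>M k |a k. a : I \<and> k : K}"
   "v : {a .\<^sub>M x +\<^sub>M k |a k. a : I \<and> k : K}"
  then obtain a k b l where *: "a : I" "k : K" "b : I" "l : K"
   "u = a .\<^sub>M x +\<^sub>M k" "v = b .\<^sub>M x +\<^sub>M l" by auto
  then have "u +\<^sub>M v = (a +\<^sub>R b) .\<^sub>M x +\<^sub>M (k +\<^sub>M l)"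
   using x Kc Ic by (simp add: smult_l_distr M.a_ac)
  then show "u +\<^sub>M v : {a .\<^sub>M x +\<^sub>M k |a k. a : I \<and> k : K}"
   by (simp only:) (rule mem, use * I.a_closed K'(3) in simp_all)
 next
  fix r u assume r: "r : |R|" and "u : {a .\<^sub>M x +\<^sub>M k |a k. a : I \<and> k : K}"
  then obtain a k where *: "a : I" "k : K" "u = a .\<^sub>M x +\<^sub>M k" by auto
  then have "r .\<^sub>M u = (r \<otimes>\<^sub>R a) .\<^sub>M x +\<^sub>M (r .\<^sub>M k)"
   using x Kc Ic r by (simp add: smult_r_distr smult_assoc1)
  then show "r .\<^sub>M u : {a .\<^sub>M x +\<^sub>M k |a k. a : I \<and> k : K}"
   by (simp only:) (rule mem, use * r I.I_l_closed K'(4) in simp_all)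
 qed
qed

lemma common_multiplier:
 assumes M: "module R M" and K: "submodule K R M" and p: "primeideal p R" and "finite S"
  and "S \<subseteq> |M|" and "!!x. x : S ==> \<exists>s\<in>|R| - p. s .\<^sub>M x : K"
 shows "\<exists>s\<in>|R| - p. \<forall>x\<in>S. s .\<^sub>M x : K"
 using assms(4-)
proof (induct S)
 case empty
 then show ?case using prime_compl(1)[OF p] by auto
next
 case (insert x S)
 interpret module R M by fact
 from insert obtain s where s: "s : |R| - p" "!!y. y : S ==> s .\<^sub>M y : K" by auto
 obtain t where t: "t : |R| - p" "t .\<^sub>M x : K" using insert.prems(2)[of x] by auto
 have "(s \<otimes>\<^sub>R t) .\<^sub>M y : K" if y: "y : insert x S" for y
 proof -
  have yc: "y : |M|" using y insert by auto
  have "(s \<otimes>\<^sub>R t) .\<^sub>M y = s .\<^sub>M (t .\<^sub>M y)"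
   using s(1) t(1) yc by (simp add: smult_assoc1)
  moreover have "(s \<otimes>\<^sub>R t) .\<^sub>M y = t .\<^sub>M (s .\<^sub>M y)"
   using s(1) t(1) yc smult_assoc1[of t s y] R.m_comm[of s t] by simp
  moreover have "y = x \<or> s .\<^sub>M y : K" using s(2) y by blast
  ultimately show ?thesis using s(1) t submoduleD(4)[OF M K] by (metis DiffD1)
 qed
 then show ?case using prime_compl(2)[OF p s(1) t(1)] by auto
qed

text \<open>
 The induction removes one element \<open>x\<close> of \<open>S\<close> by adding it to \<open>K\<close>: modulo the enlarged \<open>K\<close> the
 other elements are torsion, so that modulo the old \<open>K\<close> a multiple of \<open>x\<close> by an element outside
 \<open>p\<close> lies in "p x". The usual proof with a determinant would need matrices over \<open>R\<close>.
\<close>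

lemma nakayama_at_prime:
 fixes R :: "'a ring" and M :: "('a, 'm) module"
 assumes M: "module R M" and p: "primeideal p R" and K: "submodule K R M"
  and S: "finite S" "S \<subseteq> |M|"
  and hyp: "!!x. x : S ==> \<exists>t\<in>|R| - p. \<exists>y\<in>lincomb M p S. \<exists>k\<in>K. t .\<^sub>M x = y +\<^sub>M k"
 shows "\<forall>x\<in>S. \<exists>s\<in>|R| - p. s .\<^sub>M x : K"
 using S K hyp
proof (induct S arbitrary: K)
 case empty
 then show ?case by simp
next
 case (insert x T)
 interpret module R M by fact
 note pc = prime_compl[OF p]
 note K = submoduleD[OF M insert.prems(2)]
 have Kc: "k : |M|" if "k : K" for k using K that by auto
 have x: "x : |M|" and T: "T \<subseteq> |M|" using insert by auto
 have lT: "y : |M|" if "y : lincomb M p T" for y using lincomb_closed[OF pc(5) T] that by auto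
 define K1 where "K1 = {a .\<^sub>M x +\<^sub>M k |a k. a : |R| \<and> k : K}"
 define K2 where "K2 = {a .\<^sub>M x +\<^sub>M k |a k. a : p \<and> k : K}"
 have K1: "submodule K1 R M" unfolding K1_def
  by (rule submodule_cyclic_plus[OF M insert.prems(2) R.oneideal x])
 have K2: "submodule K2 R M" unfolding K2_def
  by (rule submodule_cyclic_plus[OF M insert.prems(2) pc(6) x])
 have eq: "\<exists>t\<in>|R| - p. \<exists>a\<in>p. \<exists>y\<in>lincomb M p T. \<exists>k\<in>K. t .\<^sub>M z = y +\<^sub>M (a .\<^sub>M x +\<^sub>M k)"
  if z: "z : insert x T" for z
 proof -
  from insert.prems(3)[OF z] obtain t y k where *: "t : |R| - p"
   "y : lincomb M p (insert x T)" "k : K" "t .\<^sub>M z = y +\<^sub>M k" by auto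
  from lincomb_insert[OF pc(6) x T *(2)] obtain a u where
   u: "a : p" "u : lincomb M p T" "y = a .\<^sub>M x +\<^sub>M u" .
  have "t .\<^sub>M z = u +\<^sub>M (a .\<^sub>M x +\<^sub>M k)"
   using * u lT[OF u(2)] Kc x pc(5) by (auto simp: M.a_ac subset_iff)
  then show ?thesis using * u by blast
 qed
 have tors1: "\<forall>y\<in>T. \<exists>s\<in>|R| - p. s .\<^sub>M y : K1"
 proof (rule insert.hyps(3)[OF T K1])
  fix z assume "z : T"
  then obtain t a y k where "t : |R| - p" "a : p" "y : lincomb M p T" "k : K"
   "t .\<^sub>M z = y +\<^sub>M (a .\<^sub>M x +\<^sub>M k)" using eq[of z] by blast
  then show "\<exists>t\<in>|R| - p. \<exists>y\<in>lincomb M p T. \<exists>k\<in>K1. t .\<^sub>M z = y +\<^sub>M k"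
   using pc(5) unfolding K1_def by blast
 qed
 obtain s where s: "s : |R| - p" "!!y. y : T ==> s .\<^sub>M y : K1"
  using common_multiplier[OF M K1 p insert.hyps(1) T] tors1 by blast
 have sK2: "lincomb M p T \<subseteq> {y : |M|. s .\<^sub>M y : K2}"
 proof (rule lincomb_in_submodule[OF M])
  have "mod_hom R M M (%y. s .\<^sub>M y)"
   by (rule mod_homI) (use s in "auto simp: smult_r_distr smult_assoc1[symmetric] R.m_comm")
  then show "submodule {y : |M|. s .\<^sub>M y : K2} R M"
   by (rule submodule_preimage[OF M M _ K2])
 next
  fix a y assume a: "a : p" and y: "y : T"
  from s(2)[OF y] obtain r k where rk: "r : |R|" "k : K" "s .\<^sub>M y = r .\<^sub>M x +\<^sub>M k"
   by (auto simp: K1_def)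
  have ac: "a : |R|" and yc: "y : |M|" using a pc(5) y T by auto
  have "s .\<^sub>M (a .\<^sub>M y) = a .\<^sub>M (s .\<^sub>M y)"
   using s(1) ac yc by (simp add: smult_assoc1[symmetric] R.m_comm)
  also have "\<dots> = (a \<otimes>\<^sub>R r) .\<^sub>M x +\<^sub>M a .\<^sub>M k"
   using ac rk x Kc by (simp add: smult_r_distr smult_assoc1)
  also have "\<dots> : K2" unfolding K2_def using a ac rk K(4) ideal.I_r_closed[OF pc(6)] by blast
  finally show "a .\<^sub>M y : {y : |M|. s .\<^sub>M y : K2}" using ac yc by simp
 qed
 obtain t a y k where t: "t : |R| - p" "a : p" "y : lincomb M p T" "k : K"
  "t .\<^sub>M x = y +\<^sub>M (a .\<^sub>M x +\<^sub>M k)" using eq[of x] by blast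
 obtain b l where b: "b : p" "l : K" "s .\<^sub>M y = b .\<^sub>M x +\<^sub>M l"
  using sK2 t(3) by (auto simp: K2_def)
 have car: "s : |R|" "t : |R|" "a : |R|" "b : |R|" "k : |M|" "l : |M|"
  "y : |M|"
  using s t b pc(5) Kc lT by auto
 define u where "u = (s \<otimes>\<^sub>R t -\<^sub>R s \<otimes>\<^sub>R a) -\<^sub>R b"
 have u: "u : |R| - p" unfolding u_def
  by (intro pc(4) pc(2) s t b ideal.I_l_closed[OF pc(6)] car)
 have "(s \<otimes>\<^sub>R t) .\<^sub>M x = s .\<^sub>M (t .\<^sub>M x)" using car x by (simp add: smult_assoc1)
 also have "\<dots> = (b .\<^sub>M x +\<^sub>M l) +\<^sub>M ((s \<otimes>\<^sub>R a) .\<^sub>M x +\<^sub>M s .\<^sub>M k)"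
  using car x by (simp add: t(5) b(3)[symmetric] smult_r_distr smult_assoc1)
 finally have "u .\<^sub>M x = l +\<^sub>M s .\<^sub>M k"
  unfolding u_def a_minus_def using car x
  by (simp add: smult_l_distr smult_l_minus M.a_ac M.ab_cancel)
 then have ux: "u .\<^sub>M x : K" using K b t car by auto
 show ?case
 proof
  fix z assume z: "z : insert x T"
  show "\<exists>s\<in>|R| - p. s .\<^sub>M z : K"
  proof (cases "z = x")
   case True
   then show ?thesis using ux u by auto
  next
   case False
   then obtain r k where rk: "r : |R|" "k : K" "s .\<^sub>M z = r .\<^sub>M x +\<^sub>M k"
    using s(2)[of z] z by (auto simp: K1_def)
   have zc: "z : |M|" using z x T by auto
   have "(u \<otimes>\<^sub>R s) .\<^sub>M z = u .\<^sub>M (r .\<^sub>M x) +\<^sub>M u .\<^sub>M k"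
    using u car rk x Kc zc by (simp add: smult_r_distr smult_assoc1)
   also have "u .\<^sub>M (r .\<^sub>M x) = r .\<^sub>M (u .\<^sub>M x)"
    using u rk x by (simp add: smult_assoc1[symmetric] R.m_comm)
   finally have "(u \<otimes>\<^sub>R s) .\<^sub>M z : K" using ux K u rk by auto
   then show ?thesis using pc(2)[OF u s(1)] by blast
  qed
 qed
qed

lemma noetherian_modD:
 assumes "noetherian_mod R A" "!!n. submodule (C n) R A" "!!n. C n \<subseteq> C (Suc n)"
 shows "\<exists>N. \<forall>n\<ge>N. C n = C N"
 using assms(1)[unfolded noetherian_mod_def, THEN conjunct2, THEN spec[of _ C]] assms(2,3) by simp

text \<open>A noetherian module is finitely generated: otherwise adding generators one at a time gives
 a strictly increasing sequence of submodules.\<close>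

lemma noetherian_mod_fg:
 assumes "noetherian_mod R A"
 shows "\<exists>S. finite S \<and> S \<subseteq> |A| \<and> |A| = lincomb A |R| S"
proof (rule ccontr)
 assume neg: "\<not> ?thesis"
 have A: "module R A" using assms by (simp add: noetherian_mod_def)
 interpret module R A by fact
 have "\<exists>x. x : |A| \<and> x \<notin> lincomb A |R| S" if "finite S" "S \<subseteq> |A|" for S
  using neg that lincomb_closed[OF subset_refl that(2)] by blast
 then have "\<exists>g. \<forall>S. finite S \<longrightarrow> S \<subseteq> |A| \<longrightarrow> g S : |A| \<and> g S \<notin> lincomb A |R| S"
  by (intro choice) blast
 then obtain g where g: "!!S. finite S ==> S \<subseteq> |A| ==> g S : |A|"
  "!!S. finite S ==> S \<subseteq> |A| ==> g S \<notin> lincomb A |R| S" by blast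
 define T where "T n = ((%S. insert (g S) S) ^^ n) {}" for n
 have TS: "T (Suc n) = insert (g (T n)) (T n)" for n by (simp add: T_def)
 have T: "finite (T n) \<and> T n \<subseteq> |A|" for n
  by (induct n) (use g in "auto simp: TS T_def")
 have "submodule (lincomb A |R| (T n)) R A" for n
  by (rule lincomb_submodule[OF R.oneideal]) (simp add: T)
 moreover have "lincomb A |R| (T n) \<subseteq> lincomb A |R| (T (Suc n))" for n
  by (rule lincomb_mono) (auto simp: TS)
 ultimately obtain N where N: "\<forall>n\<ge>N. lincomb A |R| (T n) = lincomb A |R| (T N)"
  using noetherian_modD[OF assms, of "%n. lincomb A |R| (T n)"] by blast
 have "lincomb A |R| (T (Suc N)) = lincomb A |R| (T N)"
  by (rule N[rule_format]) simp
 moreover have "g (T N) : lincomb A |R| (T (Suc N))"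
  using T[of "Suc N"] by (intro lincomb_incl) (auto simp: TS)
 ultimately show False using g(2)[of "T N"] T[of N] by auto
qed

section \<open>Exactness and homology\<close>

definition exact_at :: "('a, 'm) cpx => int => bool" where
 "exact_at X n \<longleftrightarrow> cycles X n \<subseteq> boundaries X n"

definition torsion_at :: "'a ring => 'a set => ('a, 'm) cpx => int => bool" where
 "torsion_at R p X n \<longleftrightarrow>
   (\<forall>z\<in>cycles X n. \<exists>s\<in>|R| - p. s .\<^sub>(obj X n) z : boundaries X n)"

definition fg_at :: "'a ring => ('a, 'm) cpx => int => bool" where
 "fg_at R X n \<longleftrightarrow> (\<exists>S. finite S \<and> S \<subseteq> cycles X n \<and>
   (\<forall>z\<in>cycles X n. \<exists>y\<in>lincomb (obj X n) |R| S. \<exists>b\<in>boundaries X n. z = y +\<^sub>(obj X n) b))"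

text \<open>A module \<open>A\<close> together with a map from the cycles that identifies it with the homology. This
 spares the transport of properties along isomorphisms.\<close>

definition homology_via ::
  "'a ring => ('a, 'm) cpx => int => ('a, 'n) module => ('m => 'n) => bool" where
 "homology_via R X n A pj \<longleftrightarrow> module R A \<and> mod_hom R (sub_mod (obj X n) (cycles X n)) A pj \<and>
   pj ` cycles X n = |A| \<and> (\<forall>z\<in>cycles X n. pj z = 0\<^sub>A \<longleftrightarrow> z : boundaries X n)"

lemma is_cpxD:
 assumes "is_cpx R X"
 shows "module R (obj X n)" "mod_hom R (obj X n) (obj X (n - 1)) (dif X n)"
  "x : |obj X n| ==> dif X (n - 1) (dif X n x) = 0\<^sub>(obj X (n - 2))"
  "mod_hom R (obj X (n + 1)) (obj X n) (dif X (n + 1))"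
  "x : |obj X (n + 1)| ==> dif X n (dif X (n + 1) x) = 0\<^sub>(obj X (n - 1))"
proof -
 show "module R (obj X n)" "mod_hom R (obj X n) (obj X (n - 1)) (dif X n)"
  "x : |obj X n| ==> dif X (n - 1) (dif X n x) = 0\<^sub>(obj X (n - 2))"
  using assms by (auto simp: is_cpx_def)
 have "mod_hom R (obj X (n + 1)) (obj X (n + 1 - 1)) (dif X (n + 1))"
  using assms unfolding is_cpx_def by blast
 then show "mod_hom R (obj X (n + 1)) (obj X n) (dif X (n + 1))" by simp
 have "x : |obj X (n + 1)| ==> dif X (n + 1 - 1) (dif X (n + 1) x) = 0\<^sub>(obj X (n + 1 - 2))"
  using assms unfolding is_cpx_def by blast
 then show "x : |obj X (n + 1)| ==> dif X n (dif X (n + 1) x) = 0\<^sub>(obj X (n - 1))" by simp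
qed

lemma cycles_boundaries:
 assumes "is_cpx R X"
 shows "submodule (cycles X n) R (obj X n)" "submodule (boundaries X n) R (obj X n)"
  "boundaries X n \<subseteq> cycles X n" "cycles X n \<subseteq> |obj X n|"
proof -
 note X = is_cpxD[OF assms]
 show "submodule (cycles X n) R (obj X n)" unfolding cycles_def
  by (rule submodule_kernel[OF X(1) X(1) X(2)])
 interpret N: module R "obj X (n + 1)" by (rule X)
 show "submodule (boundaries X n) R (obj X n)" unfolding boundaries_def
  by (rule submodule_image[OF X(1) X(1) X(4) N.carrier_is_submodule])
 show "boundaries X n \<subseteq> cycles X n"
  using mod_homD(1)[OF X(4)] X(5) by (auto simp: boundaries_def cycles_def)
 show "cycles X n \<subseteq> |obj X n|" by (auto simp: cycles_def)
qed

lemma module_cycles: "is_cpx R X ==> module R (sub_mod (obj X n) (cycles X n))"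
 by (rule module_sub_mod) (auto simp: is_cpxD cycles_boundaries)

lemma module_mod_homology:
 assumes "is_cpx R X" shows "module_mod R (sub_mod (obj X n) (cycles X n)) (boundaries X n)"
 by (rule module_modI[OF module_cycles[OF assms] submodule_sub_mod[OF is_cpxD(1)[OF assms]
    cycles_boundaries(1-3)[OF assms]]])

lemma coset_sub_mod [simp]: "B +>\<^sub>(sub_mod M A) x = B +>\<^sub>M x"
 by (simp add: a_r_coset_def')

lemma homology_via_homology:
 assumes "is_cpx R X"
 shows "homology_via R X n (homology n X) (%z. boundaries X n +>\<^sub>(obj X n) z)"
proof -
 interpret module_mod R "sub_mod (obj X n) (cycles X n)" "boundaries X n"
  by (rule module_mod_homology[OF assms])
 have "homology n X = Q" by (simp add: homology_def)
 then show ?thesis unfolding homology_via_def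
  using Q_module Q_carrier Q_add Q_smult cls_zero_iff by (auto intro!: mod_homI)
qed

lemma homology_viaD:
 assumes "homology_via R X n A pj"
 shows "module R A" "mod_hom R (sub_mod (obj X n) (cycles X n)) A pj"
  "z : cycles X n ==> pj z : |A|"
  "a : |A| ==> \<exists>z\<in>cycles X n. pj z = a"
  "z : cycles X n ==> pj z = 0\<^sub>A \<longleftrightarrow> z : boundaries X n"
proof -
 have im: "pj ` cycles X n = |A|" using assms by (simp add: homology_via_def)
 show "\<exists>z\<in>cycles X n. pj z = a" if "a : |A|"
  using that unfolding im[symmetric] by auto
 show "z : cycles X n ==> pj z : |A|" unfolding im[symmetric] by auto
qed (use assms in "auto simp: homology_via_def")

lemma torsion_at_homology:
 assumes X: "is_cpx R X" and h: "homology_via R X n A pj"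
 shows "torsion_at R p X n \<longleftrightarrow> (\<forall>a\<in>|A|. \<exists>s\<in>|R| - p. s .\<^sub>A a = 0\<^sub>A)"
proof -
 note h' = homology_viaD[OF h]
 note c = submoduleD[OF is_cpxD(1)[OF X] cycles_boundaries(1)[OF X]]
 have key: "s .\<^sub>A pj z = 0\<^sub>A \<longleftrightarrow> s .\<^sub>(obj X n) z : boundaries X n"
  if "z : cycles X n" "s : |R| - p" for s z
  using h'(5)[of "s .\<^sub>(obj X n) z"] mod_homD(3)[OF h'(2), of s z] c(4)[of s z n] that by auto
 show ?thesis unfolding torsion_at_def
 proof safe
  fix a assume H: "\<forall>z\<in>cycles X n. \<exists>s\<in>|R| - p. s .\<^sub>(obj X n) z : boundaries X n"
   and "a : |A|"
  then obtain z where "z : cycles X n" "pj z = a" using h'(4) by auto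
  then show "\<exists>s\<in>|R| - p. s .\<^sub>A a = 0\<^sub>A" using H key by blast
 next
  fix z assume H: "\<forall>a\<in>|A|. \<exists>s\<in>|R| - p. s .\<^sub>A a = 0\<^sub>A" and z: "z : cycles X n"
  then show "\<exists>s\<in>|R| - p. s .\<^sub>(obj X n) z : boundaries X n" using key h'(3)[OF z] by blast
 qed
qed

lemma fg_at_homology:
 assumes X: "is_cpx R X" and h: "homology_via R X n A pj"
  and S: "finite S" "S \<subseteq> |A|" "|A| = lincomb A |R| S"
 shows "fg_at R X n"
proof -
 note h' = homology_viaD[OF h]
 let ?M = "obj X n" and ?Z = "sub_mod (obj X n) (cycles X n)"
 have Z: "module R ?Z" by (rule module_cycles[OF X])
 interpret M: module R ?M by (rule is_cpxD[OF X])
 interpret A: module R A by (rule h')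
 interpret Z: module R ?Z by (rule Z)
 note c = submoduleD[OF is_cpxD(1)[OF X] cycles_boundaries(1)[OF X]]
 obtain r where r: "!!a. a : |A| ==> r a : cycles X n \<and> pj (r a) = a" using h'(4) by metis
 let ?S = "r ` S"
 have Ss: "?S \<subseteq> cycles X n" using r S(2) by auto
 have lift: "\<exists>y\<in>lincomb ?M |R| ?S. y : cycles X n \<and> pj y = a" if "a : lincomb A |R| S" for a
  using that
 proof induct
  case zero
  then show ?case using c(2) mod_hom_zero[OF Z h'(1,2)] lincomb.zero[of ?M] by auto
 next
  case (step q x a)
  then obtain y where y: "y : lincomb ?M |R| ?S" "y : cycles X n" "pj y = a" by auto
  have rx: "r x : cycles X n" "pj (r x) = x" "r x : ?S" using r step S(2) by auto
  have "pj (q .\<^sub>?M r x +\<^sub>?M y) = q .\<^sub>A x +\<^sub>A a"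
   using mod_homD(2)[OF h'(2), of "q .\<^sub>?M r x" y] mod_homD(3)[OF h'(2), of q "r x"]
    step y rx c(4)[of q "r x" n] by auto
  then show ?case
   using step y rx c(3)[of "q .\<^sub>?M r x" n y] c(4)[of q "r x" n]
   by (intro bexI[of _ "q .\<^sub>?M r x +\<^sub>?M y"]) (auto intro: lincomb.step)
 qed
 show ?thesis unfolding fg_at_def
 proof (intro exI conjI ballI)
  show "finite ?S" "?S \<subseteq> cycles X n" using S(1) Ss by auto
  fix z assume z: "z : cycles X n"
  then obtain y where y: "y : lincomb ?M |R| ?S" "y : cycles X n" "pj y = pj z"
   using lift[of "pj z"] h'(3) S(3) by auto
  have yz: "z : |?M|" "y : |?M|" using y z c by auto
  have "-\<^sub>?M y : cycles X n" using y c by auto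
  moreover have "pj (-\<^sub>?M y) = -\<^sub>A pj y"
   using mod_homD(3)[OF h'(2), of "-\<^sub>R 1\<^sub>R" y] y yz h'(3)[OF y(2)]
   by (simp add: M.uminus_smult A.uminus_smult)
  ultimately have "pj (z +\<^sub>?M -\<^sub>?M y) = 0\<^sub>A"
   using mod_homD(2)[OF h'(2), of z "-\<^sub>?M y"] y z h'(3)[OF z] by (simp add: A.M.r_neg)
  then have "z +\<^sub>?M -\<^sub>?M y : boundaries X n" using h'(5) z y c by auto
  moreover have "z = y +\<^sub>?M (z +\<^sub>?M -\<^sub>?M y)"
   using yz M.a_lcomm[of y z "-\<^sub>?M y"] by (simp add: M.r_neg)
  ultimately show "\<exists>y\<in>lincomb ?M |R| ?S. \<exists>b\<in>boundaries X n. z = y +\<^sub>?M b"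
   using y(1) by blast
 qed
qed

lemma exact_at_iff_homology:
 assumes X: "is_cpx R X"
 shows "exact_at X n \<longleftrightarrow> |homology n X| = {0\<^sub>(homology n X)}"
proof -
 note h = homology_viaD[OF homology_via_homology[OF X, of n]]
 interpret H: module R "homology n X" by (rule h(1))
 show ?thesis
 proof
  assume "exact_at X n"
  then have "a = 0\<^sub>(homology n X)" if "a : |homology n X|" for a
   using that h(4)[of a] h(5) by (auto simp: exact_at_def)
  then show "|homology n X| = {0\<^sub>(homology n X)}" by auto
 next
  assume "|homology n X| = {0\<^sub>(homology n X)}"
  then show "exact_at X n" using h(3,5) by (auto simp: exact_at_def)
 qed
qed

lemma exact_at_imp:
 assumes X: "is_cpx R X" and e: "exact_at X n" and p: "primeideal p R"
 shows "torsion_at R p X n" "fg_at R X n"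
proof -
 interpret M: module R "obj X n" by (rule is_cpxD[OF X])
 note c = cycles_boundaries[OF X, of n]
 show "torsion_at R p X n"
  unfolding torsion_at_def
 proof
  fix z assume "z : cycles X n"
  then show "\<exists>s\<in>|R| - p. s .\<^sub>(obj X n) z : boundaries X n"
   using prime_compl(1)[OF p] e c(4) by (intro bexI[of _ "1\<^sub>R"]) (auto simp: exact_at_def subset_iff)
 qed
 show "fg_at R X n"
  unfolding fg_at_def
 proof (intro exI[of _ "{}"] conjI ballI)
  fix z assume z: "z : cycles X n"
  show "\<exists>y\<in>lincomb (obj X n) |R| {}. \<exists>b\<in>boundaries X n. z = y +\<^sub>(obj X n) b"
   using e c(4) z by (intro bexI[of _ "0\<^sub>(obj X n)"] bexI[of _ z]) (auto simp: exact_at_def lincomb.zero)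
 qed auto
qed

section \<open>Acyclicity and the derived category\<close>

lemma sub_mod_neg:
 assumes M: "module R M" and U: "submodule U R M" and x: "x : U"
 shows "-\<^sub>(sub_mod M U) x = -\<^sub>M x"
proof -
 interpret M: module R M by fact
 interpret U: module R "sub_mod M U" by (rule module_sub_mod[OF M U])
 note u = submoduleD[OF M U]
 show ?thesis by (rule U.M.minus_equality) (use x u in "auto simp: M.M.l_neg")
qed

lemma coset_boundaries_eq:
 assumes X: "is_cpx R X" and z: "z : cycles X n" "w : cycles X n"
 shows "boundaries X n +>\<^sub>(obj X n) z = boundaries X n +>\<^sub>(obj X n) w \<longleftrightarrow>
  z -\<^sub>(obj X n) w : boundaries X n"
proof -
 interpret module_mod R "sub_mod (obj X n) (cycles X n)" "boundaries X n"
  by (rule module_mod_homology[OF X])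
 show ?thesis using cls_eq_iff[of z w] z sub_mod_neg[OF is_cpxD(1)[OF X] cycles_boundaries(1)[OF X] z(2)]
  by (simp add: a_minus_def)
qed

lemma carrier_homology:
 assumes X: "is_cpx R X"
 shows "|homology n X| = (%z. boundaries X n +>\<^sub>(obj X n) z) ` cycles X n"
proof -
 interpret module_mod R "sub_mod (obj X n) (cycles X n)" "boundaries X n"
  by (rule module_mod_homology[OF X])
 show ?thesis using Q_carrier by (simp add: homology_def)
qed

lemma chain_mapD:
 assumes "chain_map R X Y f"
 shows "mod_hom R (obj X n) (obj Y n) (f n)"
  "x : |obj X n| ==> f (n - 1) (dif X n x) = dif Y n (f n x)"
 using assms by (auto simp: chain_map_def)

lemma chain_map_cycles:
 assumes X: "is_cpx R X" and Y: "is_cpx R Y" and f: "chain_map R X Y f"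
 shows "z : cycles X n ==> f n z : cycles Y n" "b : boundaries X n ==> f n b : boundaries Y n"
proof -
 note f' = chain_mapD[OF f]
 show "f n z : cycles Y n" if "z : cycles X n"
  using that f'(2)[of z n] mod_homD(1)[OF f'(1), of z n]
   mod_hom_zero[OF is_cpxD(1)[OF X] is_cpxD(1)[OF Y] f'(1)]
  by (auto simp: cycles_def)
 show "f n b : boundaries Y n" if b: "b : boundaries X n"
 proof -
  from b obtain c where c: "c : |obj X (n + 1)|" "b = dif X (n + 1) c"
   by (auto simp: boundaries_def)
  have "f n b = dif Y (n + 1) (f (n + 1) c)" using f'(2)[OF c(1)] c(2) by simp
  then show ?thesis using mod_homD(1)[OF f'(1) c(1)] by (auto simp: boundaries_def)
 qed
qed

lemma homology_map_coset:
 assumes X: "is_cpx R X" and Y: "is_cpx R Y" and f: "chain_map R X Y f" and z: "z : cycles X n"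
 shows "homology_map Y f n (boundaries X n +>\<^sub>(obj X n) z) = boundaries Y n +>\<^sub>(obj Y n) f n z"
 unfolding homology_map_def
proof (rule SUP_eq_const)
 interpret MX: module_mod R "sub_mod (obj X n) (cycles X n)" "boundaries X n"
  by (rule module_mod_homology[OF X])
 show "boundaries X n +>\<^sub>(obj X n) z \<noteq> {}" using MX.cls_self[of z] z by auto
 fix w assume "w : boundaries X n +>\<^sub>(obj X n) z"
 then have w: "w : cycles X n" "w -\<^sub>(obj X n) z : boundaries X n"
  using MX.mem_cls[of z w] coset_boundaries_eq[OF X _ z, of w] z by auto
 have c: "w : |obj X n|" "z : |obj X n|" using w z cycles_boundaries(4)[OF X] by auto
 have "f n w -\<^sub>(obj Y n) f n z : boundaries Y n"
  using chain_map_cycles(2)[OF X Y f w(2)]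
   mod_hom_minus[OF is_cpxD(1)[OF X] is_cpxD(1)[OF Y] chain_mapD(1)[OF f] c] by simp
 then show "boundaries Y n +>\<^sub>(obj Y n) f n w = boundaries Y n +>\<^sub>(obj Y n) f n z"
  using coset_boundaries_eq[OF Y] chain_map_cycles(1)[OF X Y f] w z by auto
qed

lemma quasi_iso_iff:
 assumes X: "is_cpx R X" and Y: "is_cpx R Y" and f: "chain_map R X Y f"
 shows "quasi_iso R X Y f \<longleftrightarrow> (\<forall>n. (\<forall>z\<in>cycles X n. f n z : boundaries Y n \<longrightarrow> z : boundaries X n) \<and>
  (\<forall>w\<in>cycles Y n. \<exists>z\<in>cycles X n. w -\<^sub>(obj Y n) f n z : boundaries Y n))"
  (is "_ \<longleftrightarrow> (\<forall>n. ?I n \<and> ?S n)")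
proof -
 have inj: "inj_on (homology_map Y f n) |homology n X| \<longleftrightarrow> ?I n" for n
 proof -
  interpret MX: module R "obj X n" by (rule is_cpxD[OF X])
  interpret MY: module R "obj Y n" by (rule is_cpxD[OF Y])
  let ?b = "%z. boundaries X n +>\<^sub>(obj X n) z"
  note cX = submoduleD[OF MX.module_axioms cycles_boundaries(1)[OF X]]
  note bX = submoduleD[OF MX.module_axioms cycles_boundaries(2)[OF X]]
  have min: "f n z -\<^sub>(obj Y n) f n w = f n (z -\<^sub>(obj X n) w)"
   if "z : cycles X n" "w : cycles X n" for z w
   using mod_hom_minus[OF MX.module_axioms MY.module_axioms chain_mapD(1)[OF f]
     subsetD[OF cX(1) that(1)] subsetD[OF cX(1) that(2)]] by (rule sym)
  have "inj_on (homology_map Y f n) |homology n X| \<longleftrightarrow>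
   (\<forall>z\<in>cycles X n. \<forall>w\<in>cycles X n. f n (z -\<^sub>(obj X n) w) : boundaries Y n \<longrightarrow>
     z -\<^sub>(obj X n) w : boundaries X n)"
   using homology_map_coset[OF X Y f] coset_boundaries_eq[OF X] coset_boundaries_eq[OF Y]
    chain_map_cycles(1)[OF X Y f] min
   by (simp add: carrier_homology[OF X] inj_on_def)
  also have "\<dots> \<longleftrightarrow> ?I n"
  proof safe
   fix z assume H: "\<forall>z\<in>cycles X n. \<forall>w\<in>cycles X n. f n (z -\<^sub>(obj X n) w) : boundaries Y n \<longrightarrow>
     z -\<^sub>(obj X n) w : boundaries X n" and z: "z : cycles X n" "f n z : boundaries Y n"
   have "z -\<^sub>(obj X n) 0\<^sub>(obj X n) = z"
    using z(1) cX(1) MX.M.minus_equality[of "0\<^sub>(obj X n)" "0\<^sub>(obj X n)"] by (auto simp: a_minus_def)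
   then show "z : boundaries X n" using H[rule_format, OF z(1) cX(2)] z(2) by simp
  qed (use cX(6) in auto)
  finally show ?thesis .
 qed
 have surj: "homology_map Y f n ` |homology n X| = |homology n Y| \<longleftrightarrow> ?S n" for n
 proof -
  have sub: "homology_map Y f n ` |homology n X| \<subseteq> |homology n Y|"
   using homology_map_coset[OF X Y f] chain_map_cycles(1)[OF X Y f]
   by (auto simp: carrier_homology[OF X] carrier_homology[OF Y])
  have "|homology n Y| \<subseteq> homology_map Y f n ` |homology n X| \<longleftrightarrow>
   (\<forall>w\<in>cycles Y n. \<exists>z\<in>cycles X n. boundaries Y n +>\<^sub>(obj Y n) w = boundaries Y n +>\<^sub>(obj Y n) f n z)"
   using homology_map_coset[OF X Y f]
   by (simp add: carrier_homology[OF X] carrier_homology[OF Y] image_subset_iff image_iff)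
  also have "\<dots> \<longleftrightarrow> ?S n"
   using coset_boundaries_eq[OF Y] chain_map_cycles(1)[OF X Y f] by (simp cong: bex_cong)
  finally show ?thesis using sub by auto
 qed
 show ?thesis using X Y f inj surj by (auto simp: quasi_iso_def bij_betw_def)
qed

definition acyclic :: "('a, 'm) cpx => bool" where
 "acyclic X \<longleftrightarrow> (\<forall>n. exact_at X n)"

lemma zero_mod_simps [simp]:
 "|zero_mod| = {undefined}" "0\<^sub>(zero_mod) = undefined" "x +\<^sub>(zero_mod) y = undefined"
 "r .\<^sub>(zero_mod) x = undefined"
 by (simp_all add: zero_mod_def)

lemma module_zero_mod:
 fixes R :: "'a ring" assumes "cring R" shows "module R zero_mod"
 by (rule modI) (use assms in auto)

lemma zero_cpx_simps [simp]: "obj zero_cpx n = zero_mod" "dif zero_cpx n x = undefined"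
 by (simp_all add: zero_cpx_def)

lemma is_cpx_zero_cpx: "cring R ==> is_cpx R zero_cpx"
 by (auto simp: is_cpx_def module_zero_mod mod_hom_def)

lemma acyclic_zero_cpx: "acyclic zero_cpx"
 by (auto simp: acyclic_def exact_at_def cycles_def boundaries_def)

lemma quasi_iso_acyclic:
 assumes q: "quasi_iso R X Y f" shows "acyclic X \<longleftrightarrow> acyclic Y"
proof -
 have X: "is_cpx R X" and Y: "is_cpx R Y" and f: "chain_map R X Y f"
  using q by (auto simp: quasi_iso_def)
 note qi = q[unfolded quasi_iso_iff[OF X Y f], rule_format]
 show ?thesis
 proof
  assume a: "acyclic X"
  show "acyclic Y" unfolding acyclic_def exact_at_def
  proof safe
   fix n w assume w: "w : cycles Y n"
   interpret MY: module R "obj Y n" by (rule is_cpxD[OF Y])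
   note bY = submoduleD[OF MY.module_axioms cycles_boundaries(2)[OF Y]]
   obtain z where z: "z : cycles X n" "w -\<^sub>(obj Y n) f n z : boundaries Y n" using qi w by blast
   then have fz: "f n z : boundaries Y n"
    using a chain_map_cycles(2)[OF X Y f] by (auto simp: acyclic_def exact_at_def)
   have "(w -\<^sub>(obj Y n) f n z) +\<^sub>(obj Y n) f n z = w"
    using w cycles_boundaries(4)[OF Y] fz bY(1)
    by (auto simp: a_minus_def MY.M.a_assoc MY.M.l_neg subset_iff)
   then show "w : boundaries Y n" using bY(3)[OF z(2) fz] by simp
  qed
 next
  assume "acyclic Y"
  then show "acyclic X"
   using qi chain_map_cycles(1)[OF X Y f] by (fastforce simp: acyclic_def exact_at_def)
 qed
qed

lemma derived_iso_zero_iff: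
 fixes R :: "'a ring" and X :: "('a, 'b) cpx"
 assumes R: "cring R" and X: "is_cpx R X"
 shows "derived_iso R X zero_cpx \<longleftrightarrow> acyclic X"
proof
 assume "derived_iso R X zero_cpx"
 then have "acyclic X \<longleftrightarrow> acyclic (zero_cpx :: ('a, 'b) cpx)" unfolding derived_iso_def
  by (induct rule: equivclp_induct) (use quasi_iso_acyclic in blast)+
 then show "acyclic X" by (simp add: acyclic_zero_cpx)
next
 assume a: "acyclic X"
 let ?f = "%(n::int) (x::'b). undefined :: 'b"
 have f: "chain_map R X zero_cpx ?f" by (auto simp: chain_map_def mod_hom_def)
 note Y = is_cpx_zero_cpx[OF R]
 have "quasi_iso R X zero_cpx ?f"
  unfolding quasi_iso_iff[OF X Y f]
 proof (intro allI conjI ballI impI)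
  fix n z assume "z : cycles X n"
  then show "z : boundaries X n" using a by (auto simp: acyclic_def exact_at_def)
 next
  fix n w assume w: "w : cycles (zero_cpx :: ('a, 'b) cpx) n"
  interpret Z: module R "zero_mod :: ('a, 'b) module" by (rule module_zero_mod[OF R])
  have "w -\<^sub>((zero_mod :: ('a, 'b) module)) undefined : |zero_mod :: ('a, 'b) module|"
   by (rule Z.M.minus_closed) (use w in "auto simp: cycles_def")
  then show "\<exists>z\<in>cycles X n. w -\<^sub>(obj (zero_cpx :: ('a, 'b) cpx) n) undefined : boundaries (zero_cpx :: ('a, 'b) cpx) n"
   using submoduleD(2)[OF is_cpxD(1)[OF X] cycles_boundaries(1)[OF X]]
   by (auto simp: boundaries_def)
 qed
 then show "derived_iso R X zero_cpx" unfolding derived_iso_def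
  by (intro r_into_equivclp) auto
qed

subsection \<open>A module as a complex\<close>

lemma mod_cpx_simps [simp]:
 "obj (mod_cpx N) 0 = N" "n \<noteq> 0 ==> obj (mod_cpx N) n = zero_mod"
 "dif (mod_cpx N) 1 x = 0\<^sub>N" "n \<noteq> 1 ==> dif (mod_cpx N) n x = undefined"
 by (simp_all add: mod_cpx_def)

lemma mod_cpx_dif_zero: "dif (mod_cpx N) n x = 0\<^sub>(obj (mod_cpx N) (n - 1))"
 by (cases "n = 1") auto

lemma is_cpx_mod_cpx: assumes "module R N" shows "is_cpx R (mod_cpx N)"
proof -
 interpret N: module R N by fact
 have m: "module R (obj (mod_cpx N) n)" for n
  using assms module_zero_mod[OF N.R.is_cring] by (cases "n = 0") auto
 have z: "mod_hom R (obj (mod_cpx N) n) (obj (mod_cpx N) (n - 1)) (dif (mod_cpx N) n)" for n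
 proof -
  interpret T: module R "obj (mod_cpx N) (n - 1)" by (rule m)
  show ?thesis by (rule mod_homI) (auto simp: mod_cpx_dif_zero)
 qed
 show ?thesis unfolding is_cpx_def
  using m z mod_cpx_dif_zero[of N] by (auto simp: algebra_simps)
qed

lemma mod_cpx_cycles:
 fixes R :: "'a ring" and N :: "('a, 'b) module"
 assumes "module R N"
 shows "cycles (mod_cpx N) n = |obj (mod_cpx N) n|"
  "boundaries (mod_cpx N) 0 = {0\<^sub>N}" "n \<noteq> 0 ==> exact_at (mod_cpx N) n"
proof -
 interpret N: module R N by fact
 show c: "cycles (mod_cpx N) n = |obj (mod_cpx N) n|" for n
  by (auto simp: cycles_def mod_cpx_dif_zero)
 show "boundaries (mod_cpx N) 0 = {0\<^sub>N}" by (auto simp: boundaries_def)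
 show "exact_at (mod_cpx N) n" if "n \<noteq> 0"
  using that submoduleD(2)[OF is_cpxD(1)[OF is_cpx_mod_cpx[OF assms]]
    cycles_boundaries(2)[OF is_cpx_mod_cpx[OF assms]], of n]
  by (auto simp: exact_at_def c)
qed

lemma homology_via_mod_cpx: "module R N ==> homology_via R (mod_cpx N) 0 N id"
 by (auto simp: homology_via_def mod_cpx_cycles mod_hom_def)

section \<open>Free modules and lifting\<close>

lemma mod_hom_finsum:
 assumes M: "module R M" and N: "module R N" and f: "mod_hom R M N f" and A: "finite A"
  and h: "h : A \<rightarrow> |M|"
 shows "f (finsum M h A) = finsum N (%i. f (h i)) A"
proof -
 interpret M: module R M by fact
 interpret N: module R N by fact
 show ?thesis using A h
 proof (induct A)
  case empty
  then show ?case by (simp add: mod_hom_zero[OF M N f])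
 next
  case (insert a A)
  then have "f (finsum M h (insert a A)) = f (h a) +\<^sub>N f (finsum M h A)"
   by (simp add: mod_homD[OF f] Pi_def)
  then show ?case using insert mod_homD(1)[OF f] by (simp add: Pi_def)
 qed
qed

lemma (in module) finsum_support:
 assumes T: "finite T" "{b : B. c b \<noteq> 0\<^sub>R} \<subseteq> T" "T \<subseteq> B" and c: "c : B \<rightarrow> |R|"
  and u: "u : B \<rightarrow> |M|"
 shows "finsum M (%b. c b .\<^sub>M u b) {b : B. c b \<noteq> 0\<^sub>R} = finsum M (%b. c b .\<^sub>M u b) T"
proof -
 have z: "c i .\<^sub>M u i = 0\<^sub>M" if "i : T - {b : B. c b \<noteq> 0\<^sub>R}" for i
 proof -
  have "c i = 0\<^sub>R" "u i : |M|" using that T(3) u by auto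
  then show ?thesis by simp
 qed
 have "(%b. c b .\<^sub>M u b) : T \<rightarrow> |M|"
 proof
  fix b assume "b : T"
  then have "c b : |R|" "u b : |M|" using T(3) c u by auto
  then show "c b .\<^sub>M u b : |M|" by simp
 qed
 then show ?thesis
  using M.add.finprod_mono_neutral_cong_left[OF T(1,2), of "%b. c b .\<^sub>M u b" "%b. c b .\<^sub>M u b"] z
  by auto
qed

text \<open>A basis of a free module together with its coordinate functions.\<close>

definition basis_coord ::
  "'a ring => ('a, 'm) module => 'm set => ('m => 'm => 'a) => bool" where
 "basis_coord R F B c \<longleftrightarrow> B \<subseteq> |F| \<and> (\<forall>b\<in>B. mod_hom R F (ring_mod R) (c b)) \<and>
   (\<forall>x\<in>|F|. finite {b : B. c b x \<noteq> 0\<^sub>R} \<and>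
    x = finsum F (%b. c b x .\<^sub>F b) {b : B. c b x \<noteq> 0\<^sub>R})"

lemma free_mod_basis_coord:
 assumes F: "module R F" and free: "free_mod R F"
 shows "\<exists>B c. basis_coord R F B c"
proof -
 interpret F: module R F by fact
 from free obtain B where B: "B \<subseteq> |F|" and
  un: "!!x. x : |F| ==> \<exists>!c. c : (\<Pi>\<^sub>E b\<in>B. |R| ) \<and> finite {b : B. c b \<noteq> 0\<^sub>R} \<and>
    x = finsum F (%b. c b .\<^sub>F b) {b : B. c b \<noteq> 0\<^sub>R}"
  unfolding free_mod_def by auto
 define P where "P x c \<longleftrightarrow> c : (\<Pi>\<^sub>E b\<in>B. |R| ) \<and> finite {b : B. c b \<noteq> 0\<^sub>R} \<and>
    x = finsum F (%b. c b .\<^sub>F b) {b : B. c b \<noteq> 0\<^sub>R}" for x c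
 define d where "d x = (THE c. P x c)" for x
 have d: "P x (d x)" if "x : |F|" for x
  unfolding d_def by (rule theI'[of "P x"]) (use un[OF that] in "simp add: P_def")
 have dI: "d x = c" if "x : |F|" "P x c" for x c
  unfolding d_def using un[OF that(1)] that(2) by (intro the1_equality) (simp_all add: P_def)
 have PT: "P x c" if "c : (\<Pi>\<^sub>E b\<in>B. |R| )" "finite T" "T \<subseteq> B" "{b : B. c b \<noteq> 0\<^sub>R} \<subseteq> T"
  "x = finsum F (%b. c b .\<^sub>F b) T" for x c T
 proof -
  have "c : B \<rightarrow> |R|" "(%b. b) : B \<rightarrow> |F|" using that(1) B by (auto simp: PiE_def)
  then show ?thesis
   unfolding P_def using that F.finsum_support[OF that(2,4,3), of "%b. b"] finite_subset[OF that(4,2)]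
   by simp
 qed
 have car: "d x b : |R|" if "x : |F|" "b : B" for x b
  using d[OF that(1)] that(2) by (auto simp: P_def)
 have sum: "x = finsum F (%b. d x b .\<^sub>F b) T"
  if "x : |F|" "finite T" "T \<subseteq> B" "{b : B. d x b \<noteq> 0\<^sub>R} \<subseteq> T" for x T
  using F.finsum_support[of T B "d x" "%b. b"] that B d[OF that(1)] car[OF that(1)]
  by (auto simp: P_def Pi_def)
 have "mod_hom R F (ring_mod R) (%x. d x b)" if b: "b : B" for b
 proof (rule mod_homI)
  fix x y assume xy: "x : |F|" "y : |F|"
  define T where "T = {b : B. d x b \<noteq> 0\<^sub>R} \<union> {b : B. d y b \<noteq> 0\<^sub>R}"
  have T: "finite T" "T \<subseteq> B" "{b : B. d x b \<noteq> 0\<^sub>R} \<subseteq> T" "{b : B. d y b \<noteq> 0\<^sub>R} \<subseteq> T"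
   using d xy by (auto simp: P_def T_def)
  have supp: "{b : B. (\<lambda>b\<in>B. d x b +\<^sub>R d y b) b \<noteq> 0\<^sub>R} \<subseteq> T"
   unfolding T_def using car xy by auto
  have Tc: "z : |F|" "d x z : |R|" "d y z : |R|" if "z : T" for z
   using that subsetD[OF T(2) that] B car xy by auto
  have "x +\<^sub>F y = finsum F (%b. d x b .\<^sub>F b) T +\<^sub>F finsum F (%b. d y b .\<^sub>F b) T"
   by (intro arg_cong2[where f = "add F"] sum xy T)
  also have "\<dots> = finsum F (%b. d x b .\<^sub>F b +\<^sub>F d y b .\<^sub>F b) T"
   by (rule F.M.finsum_addf[symmetric]; rule Pi_I) (use Tc in simp_all)
  also have "\<dots> = finsum F (%b. (\<lambda>b\<in>B. d x b +\<^sub>R d y b) b .\<^sub>F b) T"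
  proof (rule F.M.finsum_cong')
   show "(%b. (\<lambda>b\<in>B. d x b +\<^sub>R d y b) b .\<^sub>F b) : T \<rightarrow> |F|"
    by (rule Pi_I) (use Tc subsetD[OF T(2)] in simp)
   show "d x i .\<^sub>F i +\<^sub>F d y i .\<^sub>F i = (\<lambda>b\<in>B. d x b +\<^sub>R d y b) i .\<^sub>F i" if "i : T" for i
    using Tc[OF that] subsetD[OF T(2) that] by (simp add: F.smult_l_distr)
  qed simp
  finally have eq: "x +\<^sub>F y = finsum F (%b. (\<lambda>b\<in>B. d x b +\<^sub>R d y b) b .\<^sub>F b) T" .
  have "d (x +\<^sub>F y) = (\<lambda>b\<in>B. d x b +\<^sub>R d y b)"
   by (rule dI[OF F.M.a_closed[OF xy] PT[OF _ T(1,2) supp eq]]) (use xy car in auto)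
  then show "d (x +\<^sub>F y) b = d x b +\<^sub>(ring_mod R) d y b" using b by simp
 next
  fix r x assume r: "r : |R|" and x: "x : |F|"
  define T where "T = {b : B. d x b \<noteq> 0\<^sub>R}"
  have T: "finite T" "T \<subseteq> B" using d x by (auto simp: P_def T_def)
  have supp: "{b : B. (\<lambda>b\<in>B. r \<otimes>\<^sub>R d x b) b \<noteq> 0\<^sub>R} \<subseteq> T"
   unfolding T_def using r by auto
  have Tc: "z : |F|" "d x z : |R|" if "z : T" for z
   using that subsetD[OF T(2) that] B car x by auto
  have "r .\<^sub>F x = r .\<^sub>F finsum F (%b. d x b .\<^sub>F b) T"
   by (intro arg_cong2[where f = "smult F"] sum x T refl) (simp add: T_def)
  also have "\<dots> = finsum F (%b. r .\<^sub>F (d x b .\<^sub>F b)) T"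
   by (rule F.finsum_smult_ldistr) (use T Tc r in auto)
  also have "\<dots> = finsum F (%b. (\<lambda>b\<in>B. r \<otimes>\<^sub>R d x b) b .\<^sub>F b) T"
  proof (rule F.M.finsum_cong')
   show "(%b. (\<lambda>b\<in>B. r \<otimes>\<^sub>R d x b) b .\<^sub>F b) : T \<rightarrow> |F|"
    by (rule Pi_I) (use Tc r subsetD[OF T(2)] in simp)
   show "r .\<^sub>F (d x i .\<^sub>F i) = (\<lambda>b\<in>B. r \<otimes>\<^sub>R d x b) i .\<^sub>F i" if "i : T" for i
    using Tc[OF that] subsetD[OF T(2) that] r by (simp add: F.smult_assoc1)
  qed simp
  finally have eq: "r .\<^sub>F x = finsum F (%b. (\<lambda>b\<in>B. r \<otimes>\<^sub>R d x b) b .\<^sub>F b) T" .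
  have "d (r .\<^sub>F x) = (\<lambda>b\<in>B. r \<otimes>\<^sub>R d x b)"
   by (rule dI[OF F.smult_closed[OF r x] PT[OF _ T supp eq]]) (use x r car in auto)
  then show "d (r .\<^sub>F x) b = r .\<^sub>(ring_mod R) d x b" using b by simp
 qed (use b car in auto)
 then have "basis_coord R F B (%b x. d x b)"
  unfolding basis_coord_def using B d unfolding P_def by blast
 then show ?thesis by blast
qed

lemma basis_coordD:
 assumes "basis_coord R F B c"
 shows "B \<subseteq> |F|" "b : B ==> mod_hom R F (ring_mod R) (c b)"
  "x : |F| ==> finite {b : B. c b x \<noteq> 0\<^sub>R}"
  "x : |F| ==> x = finsum F (%b. c b x .\<^sub>F b) {b : B. c b x \<noteq> 0\<^sub>R}"
  "b : B ==> x : |F| ==> c b x : |R|"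
proof -
 show 2: "mod_hom R F (ring_mod R) (c b)" if "b : B" for b
  using assms that unfolding basis_coord_def by auto
 show "b : B ==> x : |F| ==> c b x : |R|" using mod_homD(1)[OF 2] by auto
qed (use assms in "auto simp: basis_coord_def")

lemma basis_extend_hom:
 assumes F: "module R F" and Q: "module R Q" and b: "basis_coord R F B c"
  and u: "u : B \<rightarrow> |Q|"
 shows "mod_hom R F Q (%x. finsum Q (%b. c b x .\<^sub>Q u b) {b : B. c b x \<noteq> 0\<^sub>R})"
proof -
 interpret F: module R F by fact
 interpret Q: module R Q by fact
 note d = basis_coordD[OF b]
 have uB: "u b : |Q|" if "b : B" for b using u that by auto
 have sum: "finsum Q (%b. c b x .\<^sub>Q u b) {b : B. c b x \<noteq> 0\<^sub>R} = finsum Q (%b. c b x .\<^sub>Q u b) T"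
  if "x : |F|" "finite T" "T \<subseteq> B" "{b : B. c b x \<noteq> 0\<^sub>R} \<subseteq> T" for x T
  using Q.finsum_support[of T B "%b. c b x" u] that d u by auto
 show ?thesis
 proof (rule mod_homI)
  fix x y assume xy: "x : |F|" "y : |F|"
  define T where "T = {b : B. c b x \<noteq> 0\<^sub>R} \<union> {b : B. c b y \<noteq> 0\<^sub>R}"
  have T: "finite T" "T \<subseteq> B" "{b : B. c b x \<noteq> 0\<^sub>R} \<subseteq> T" "{b : B. c b y \<noteq> 0\<^sub>R} \<subseteq> T"
   using d(3) xy by (auto simp: T_def)
  have Tc: "u z : |Q|" "c z x : |R|" "c z y : |R|" "z : B" if "z : T" for z
   using subsetD[OF T(2) that] uB d(5) xy by auto
  have cadd: "c b (x +\<^sub>F y) = c b x +\<^sub>R c b y" if "b : B" for b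
   using mod_homD(2)[OF d(2)[OF that] xy] by simp
  have "finsum Q (%b. c b (x +\<^sub>F y) .\<^sub>Q u b) {b : B. c b (x +\<^sub>F y) \<noteq> 0\<^sub>R} =
   finsum Q (%b. c b (x +\<^sub>F y) .\<^sub>Q u b) T"
   by (rule sum) (use T(1,2) xy cadd d(5) in "auto simp: T_def")
  also have "\<dots> = finsum Q (%b. c b x .\<^sub>Q u b +\<^sub>Q c b y .\<^sub>Q u b) T"
   by (rule Q.M.finsum_cong')
     (use Tc cadd in "auto simp: Q.smult_l_distr")
  also have "\<dots> = finsum Q (%b. c b x .\<^sub>Q u b) T +\<^sub>Q finsum Q (%b. c b y .\<^sub>Q u b) T"
   by (rule Q.M.finsum_addf) (use Tc in auto)
  also have "\<dots> = finsum Q (%b. c b x .\<^sub>Q u b) {b : B. c b x \<noteq> 0\<^sub>R} +\<^sub>Q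
    finsum Q (%b. c b y .\<^sub>Q u b) {b : B. c b y \<noteq> 0\<^sub>R}"
   by (intro arg_cong2[where f = "add Q"] sum[symmetric] xy T)
  finally show "finsum Q (%b. c b (x +\<^sub>F y) .\<^sub>Q u b) {b : B. c b (x +\<^sub>F y) \<noteq> 0\<^sub>R} =
   finsum Q (%b. c b x .\<^sub>Q u b) {b : B. c b x \<noteq> 0\<^sub>R} +\<^sub>Q
    finsum Q (%b. c b y .\<^sub>Q u b) {b : B. c b y \<noteq> 0\<^sub>R}" .
 next
  fix r x assume r: "r : |R|" and x: "x : |F|"
  define T where "T = {b : B. c b x \<noteq> 0\<^sub>R}"
  have T: "finite T" "T \<subseteq> B" using d(3) x by (auto simp: T_def)
  have Tc: "u z : |Q|" "c z x : |R|" "z : B" if "z : T" for z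
   using subsetD[OF T(2) that] uB d(5) x by auto
  have cm: "c b (r .\<^sub>F x) = r \<otimes>\<^sub>R c b x" if "b : B" for b
   using mod_homD(3)[OF d(2)[OF that] r x] by simp
  have "finsum Q (%b. c b (r .\<^sub>F x) .\<^sub>Q u b) {b : B. c b (r .\<^sub>F x) \<noteq> 0\<^sub>R} =
   finsum Q (%b. c b (r .\<^sub>F x) .\<^sub>Q u b) T"
   by (rule sum) (use T x r cm in "auto simp: T_def")
  also have "\<dots> = finsum Q (%b. r .\<^sub>Q (c b x .\<^sub>Q u b)) T"
   by (rule Q.M.finsum_cong')
     (use Tc r cm in "auto simp: Q.smult_assoc1")
  also have "\<dots> = r .\<^sub>Q finsum Q (%b. c b x .\<^sub>Q u b) T"
   by (rule Q.finsum_smult_ldistr[symmetric]) (use T Tc r in auto)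
  finally show "finsum Q (%b. c b (r .\<^sub>F x) .\<^sub>Q u b) {b : B. c b (r .\<^sub>F x) \<noteq> 0\<^sub>R} =
   r .\<^sub>Q finsum Q (%b. c b x .\<^sub>Q u b) {b : B. c b x \<noteq> 0\<^sub>R}"
   unfolding T_def .
 qed (use uB d in "auto intro!: Q.M.finsum_closed")
qed

lemma free_mod_lift:
 assumes F: "module R F" and free: "free_mod R F" and P: "module R P" and Q: "module R Q"
  and f: "mod_hom R F Q f" and g: "mod_hom R P Q g" and sub: "f ` |F| \<subseteq> g ` |P|"
 shows "\<exists>h. mod_hom R F P h \<and> (\<forall>x\<in>|F|. g (h x) = f x)"
proof -
 interpret F: module R F by fact
 interpret Q: module R Q by fact
 interpret P: module R P by fact
 obtain B c where b: "basis_coord R F B c" using free_mod_basis_coord[OF F free] by blast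
 note d = basis_coordD[OF b]
 have "\<forall>b\<in>B. \<exists>y. y : |P| \<and> g y = f b"
 proof
  fix b assume "b : B"
  then have "f b : g ` |P|" using sub d(1) by blast
  then show "\<exists>y. y : |P| \<and> g y = f b" by auto
 qed
 then obtain u where u: "!!b. b : B ==> u b : |P|" "!!b. b : B ==> g (u b) = f b" by metis
 let ?h = "%x. finsum P (%b. c b x .\<^sub>P u b) {b : B. c b x \<noteq> 0\<^sub>R}"
 have "g (?h x) = f x" if x: "x : |F|" for x
 proof -
  define T where "T = {b : B. c b x \<noteq> 0\<^sub>R}"
  have T: "finite T" "T \<subseteq> B" using d(3) x by (auto simp: T_def)
  have Tc: "u z : |P|" "c z x : |R|" "z : |F|" "g (u z) = f z" if "z : T" for z
   using subsetD[OF T(2) that] u d(1) d(5)[OF _ x] by auto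
  have "g (?h x) = g (finsum P (%b. c b x .\<^sub>P u b) T)" by (simp add: T_def)
  also have "\<dots> = finsum Q (%b. g (c b x .\<^sub>P u b)) T"
   by (rule mod_hom_finsum[OF P Q g T(1)]) (use Tc in auto)
  also have "\<dots> = finsum Q (%b. f (c b x .\<^sub>F b)) T"
   by (rule Q.M.finsum_cong')
     (use Tc mod_homD(1,3)[OF g] mod_homD(1,3)[OF f] in auto)
  also have "\<dots> = f (finsum F (%b. c b x .\<^sub>F b) T)"
   by (rule mod_hom_finsum[OF F Q f T(1), symmetric]) (use Tc in auto)
  also have "\<dots> = f x" using d(4)[OF x] by (simp add: T_def)
  finally show ?thesis .
 qed
 moreover have "mod_hom R F P ?h" by (rule basis_extend_hom[OF F P b]) (use u in auto)
 ultimately show ?thesis by blast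
qed

section \<open>Complexes of homomorphisms\<close>

lemma modD:
 assumes "module R M"
 shows "x : |M| ==> y : |M| ==> x +\<^sub>M y : |M|" "0\<^sub>M : |M|"
  "x : |M| ==> y : |M| ==> z : |M| ==> (x +\<^sub>M y) +\<^sub>M z = x +\<^sub>M (y +\<^sub>M z)"
  "x : |M| ==> y : |M| ==> x +\<^sub>M y = y +\<^sub>M x"
  "x : |M| ==> 0\<^sub>M +\<^sub>M x = x" "x : |M| ==> -\<^sub>M x : |M|"
  "x : |M| ==> -\<^sub>M x +\<^sub>M x = 0\<^sub>M"
  "r : |R| ==> x : |M| ==> r .\<^sub>M x : |M|"
  "r : |R| ==> s : |R| ==> x : |M| ==> (r +\<^sub>R s) .\<^sub>M x = r .\<^sub>M x +\<^sub>M s .\<^sub>M x"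
  "r : |R| ==> x : |M| ==> y : |M| ==> r .\<^sub>M (x +\<^sub>M y) = r .\<^sub>M x +\<^sub>M r .\<^sub>M y"
  "r : |R| ==> s : |R| ==> x : |M| ==> (r \<otimes>\<^sub>R s) .\<^sub>M x = r .\<^sub>M (s .\<^sub>M x)"
  "x : |M| ==> 1\<^sub>R .\<^sub>M x = x"
  "cring R" "x : |M| ==> x +\<^sub>M 0\<^sub>M = x" "x : |M| ==> x +\<^sub>M -\<^sub>M x = 0\<^sub>M"
  "r : |R| ==> r .\<^sub>M 0\<^sub>M = 0\<^sub>M" "x : |M| ==> 0\<^sub>R .\<^sub>M x = 0\<^sub>M"
  "x : |M| ==> y : |M| ==> x -\<^sub>M y : |M|"
proof -
 interpret M: module R M by fact
 show "cring R" by (rule M.R.is_cring)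
qed (use module.smult_l_distr[OF assms] module.smult_r_distr[OF assms] module.smult_assoc1[OF assms]
   abelian_groupE[OF module.axioms(2)[OF assms]] in
  \<open>auto simp: module.smult_closed[OF assms] module.smult_one[OF assms]
   module.smult_r_null[OF assms] module.smult_l_null[OF assms]
   abelian_group.a_inv_closed[OF module.axioms(2)[OF assms]]
   abelian_group.l_neg[OF module.axioms(2)[OF assms]] abelian_group.r_neg[OF module.axioms(2)[OF assms]]
   abelian_group.minus_closed[OF module.axioms(2)[OF assms]]
   abelian_monoid.r_zero[OF abelian_group.axioms(1)[OF module.axioms(2)[OF assms]]]\<close>)

lemma module_prod_mod:
 fixes R :: "'a ring"
 assumes R: "cring R" and N: "!!i. i : I ==> module R (N i)"
 shows "module R (prod_mod I N)"
proof -
 note m = modD[OF N]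
 note eqI = PiE_ext[where k = I and s = "%i. |N i|"]
 show ?thesis
  unfolding prod_mod_def
 proof (rule modI, goal_cases)
  case 1 show ?case by (rule R)
 next
  case (2 x y) then show ?case using m(1) by (auto simp: PiE_iff)
 next
  case 3 show ?case using m(2) by auto
 next
  case (4 x y z) then show ?case
   by (auto simp: PiE_iff m(3) intro!: restrict_ext)
 next
  case (5 x y) then show ?case
   by (auto simp: PiE_iff m(4) intro!: restrict_ext)
 next
  case (6 x)
  then have "(\<lambda>i\<in>I. 0\<^sub>(N i) +\<^sub>(N i) x i) = x"
   by (intro eqI) (auto simp: m PiE_iff)
  then show ?case by (simp cong: restrict_cong)
 next
  case (7 x)
  then show ?case
   by (intro bexI[of _ "\<lambda>i\<in>I. -\<^sub>(N i) x i"]) (auto simp: PiE_iff m intro!: restrict_ext)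
 next
  case (8 r x) then show ?case using m(8) by (auto simp: PiE_iff)
 next
  case (9 r s x) then show ?case by (auto simp: PiE_iff m(9) intro!: restrict_ext)
 next
  case (10 r x y) then show ?case by (auto simp: PiE_iff m(10) intro!: restrict_ext)
 next
  case (11 r s x) then show ?case by (auto simp: PiE_iff m(11) intro!: restrict_ext)
 next
  case (12 x)
  then have "(\<lambda>i\<in>I. 1\<^sub>R .\<^sub>(N i) x i) = x"
   by (intro eqI) (auto simp: m PiE_iff)
  then show ?case by simp
 qed
qed

lemma mod_hom_restrict [simp]:
 "module R M ==> mod_hom R M N (restrict f |M| ) \<longleftrightarrow> mod_hom R M N f"
 using modD(1,8)[of R M] by (auto simp: mod_hom_def Pi_def)

lemma mod_hom_zero_fun: "module R N ==> mod_hom R M N (%x. 0\<^sub>N)"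
 by (rule mod_homI) (auto simp: modD)

lemma mod_hom_add_fun:
 assumes "module R N" "mod_hom R M N f" "mod_hom R M N g"
 shows "mod_hom R M N (%x. f x +\<^sub>N g x)"
proof -
 interpret N: module R N by fact
 show ?thesis
  by (rule mod_homI)
    (use mod_homD[OF assms(2)] mod_homD[OF assms(3)] in "auto simp: N.M.a_ac N.smult_r_distr")
qed

lemma mod_hom_smult_fun:
 assumes "module R N" "mod_hom R M N f" "r : |R|"
 shows "mod_hom R M N (%x. r .\<^sub>N f x)"
proof -
 interpret N: module R N by fact
 have "r .\<^sub>N (s .\<^sub>N y) = s .\<^sub>N (r .\<^sub>N y)" if "s : |R|" "y : |N|" for s y
  using assms(3) that by (metis N.R.m_comm N.smult_assoc1)
 then show ?thesis
  by (intro mod_homI)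
    (use mod_homD[OF assms(2)] assms(3) in "auto simp: N.smult_r_distr")
qed

lemma module_hom_mod:
 fixes R :: "'a ring"
 assumes M: "module R M" and N: "module R N"
 shows "module R (hom_mod R M N)"
proof -
 note n = modD[OF N]
 have val: "h x : |N|" if "mod_hom R M N h" "x : |M|" for h x
  using mod_homD(1)[OF that] .
 note eqI = extensionalityI[where A = "|M|"]
 show ?thesis
  unfolding hom_mod_def
 proof (rule modI, goal_cases)
  case 1 show ?case by (rule n)
 next
  case (2 x y) then show ?case using M N by (auto intro: mod_hom_add_fun)
 next
  case 3 show ?case using M N by (auto intro: mod_hom_zero_fun)
 next
  case (4 x y z) then show ?case by (auto simp: n(3) val intro!: restrict_ext)
 next
  case (5 x y) then show ?case by (auto simp: n(4) val intro!: restrict_ext)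
 next
  case (6 x)
  then have "(\<lambda>i\<in>|M|. 0\<^sub>N +\<^sub>N x i) = x"
   by (intro eqI) (auto simp: n val)
  then show ?case by (simp cong: restrict_cong)
 next
  case (7 x)
  have neg: "-\<^sub>N x i = (-\<^sub>R 1\<^sub>R) .\<^sub>N x i" if "i : |M|" for i
   using module.uminus_smult[OF N] val that 7 by auto
  interpret R: cring R by (rule n)
  have "mod_hom R M N (%i. (-\<^sub>R 1\<^sub>R) .\<^sub>N x i)"
   using 7 by (intro mod_hom_smult_fun N) auto
  moreover have "(\<lambda>i\<in>|M|. (-\<^sub>R 1\<^sub>R) .\<^sub>N x i +\<^sub>N x i) = (\<lambda>i\<in>|M|. 0\<^sub>N)"
   using 7 by (intro restrict_ext) (auto simp: neg[symmetric] n val)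
  ultimately show ?case using M
   by (intro bexI[of _ "\<lambda>i\<in>|M|. (-\<^sub>R 1\<^sub>R) .\<^sub>N x i"]) (auto cong: restrict_cong)
 next
  case (8 r x) then show ?case using M N by (auto intro: mod_hom_smult_fun)
 next
  case (9 r s x) then show ?case by (auto simp: n(9) val intro!: restrict_ext)
 next
  case (10 r x y) then show ?case by (auto simp: n(10) val intro!: restrict_ext)
 next
  case (11 r s x) then show ?case by (auto simp: n(11) val intro!: restrict_ext)
 next
  case (12 x)
  then have "(\<lambda>i\<in>|M|. 1\<^sub>R .\<^sub>N x i) = x"
   by (intro eqI) (auto simp: n val)
  then show ?case by simp
 qed
qed

definition sg :: "'a ring => int => 'a" where
 "sg R n = (if even n then 1\<^sub>R else -\<^sub>R 1\<^sub>R)"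

lemma sg_simps:
 assumes "cring R"
 shows "sg R n : |R|" "sg R n \<otimes>\<^sub>R sg R n = 1\<^sub>R" "sg R (n + 1) = -\<^sub>R sg R n"
  "sg R (n - 1) = -\<^sub>R sg R n" "sg R 0 = 1\<^sub>R"
proof -
 interpret cring R by fact
 show "sg R n : |R|" "sg R n \<otimes>\<^sub>R sg R n = 1\<^sub>R" "sg R (n + 1) = -\<^sub>R sg R n"
  "sg R (n - 1) = -\<^sub>R sg R n" "sg R 0 = 1\<^sub>R"
  by (auto simp: sg_def l_minus r_minus)
qed

lemma signed_eq:
 assumes "module R N" "y : |N|"
 shows "signed n N y = sg R n .\<^sub>N y"
 using assms module.uminus_smult[OF assms] by (auto simp: signed_def sg_def modD)

lemma hom_cpx_carrier:
 "h : |obj (hom_cpx R X Y) n| \<longleftrightarrow>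
  (\<forall>i. h i : extensional |obj X i| \<and> mod_hom R (obj X i) (obj Y (i + n)) (h i))"
 by (auto simp: hom_cpx_def prod_mod_def hom_mod_def PiE_UNIV_domain)

lemma hom_cpx_ops:
 "0\<^sub>(obj (hom_cpx R X Y) n) i = (\<lambda>x\<in>|obj X i|. 0\<^sub>(obj Y (i + n)))"
 "(g +\<^sub>(obj (hom_cpx R X Y) n) h) i = (\<lambda>x\<in>|obj X i|. g i x +\<^sub>(obj Y (i + n)) h i x)"
 "(r .\<^sub>(obj (hom_cpx R X Y) n) h) i = (\<lambda>x\<in>|obj X i|. r .\<^sub>(obj Y (i + n)) h i x)"
 by (simp_all add: hom_cpx_def prod_mod_def hom_mod_def)

lemma hom_cpx_eqI:
 assumes "g : |obj (hom_cpx R X Y) n|" "h : |obj (hom_cpx R X Y) n|"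
  "!!i x. x : |obj X i| ==> g i x = h i x"
 shows "g = h"
proof
 fix i show "g i = h i"
  by (rule extensionalityI[of _ "|obj X i|"]) (use assms in "auto simp: hom_cpx_carrier")
qed

lemma hom_cpx_dif:
 assumes X: "is_cpx R X" and Y: "is_cpx R Y" and h: "h : |obj (hom_cpx R X Y) n|"
  and x: "x : |obj X i|"
 shows "dif (hom_cpx R X Y) n h i x =
  dif Y (i + n) (h i x) +\<^sub>(obj Y (i + n - 1)) (-\<^sub>R sg R n) .\<^sub>(obj Y (i + n - 1)) h (i - 1) (dif X i x)"
proof -
 interpret Y: module R "obj Y (i + n - 1)" by (rule is_cpxD[OF Y])
 have "mod_hom R (obj X (i - 1)) (obj Y (i - 1 + n)) (h (i - 1))"
  using h unfolding hom_cpx_carrier by blast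
 moreover have "i - 1 + n = i + n - 1" by simp
 ultimately have "mod_hom R (obj X (i - 1)) (obj Y (i + n - 1)) (h (i - 1))" by simp
 then have "h (i - 1) (dif X i x) : |obj Y (i + n - 1)|"
  using mod_homD(1) mod_homD(1)[OF is_cpxD(2)[OF X] x] by metis
 then show ?thesis
  using x signed_eq[OF Y.module_axioms] sg_simps(1)[OF Y.R.is_cring]
  by (simp add: hom_cpx_def a_minus_def Y.smult_l_minus)
qed

lemma is_cpx_hom_cpx:
 fixes R :: "'a ring"
 assumes X: "is_cpx R X" and Y: "is_cpx R Y"
 shows "is_cpx R (hom_cpx R X Y)"
proof -
 let ?H = "hom_cpx R X Y"
 note dX = is_cpxD[OF X] and dY = is_cpxD[OF Y]
 interpret R: cring R by (rule modD(13)[OF dX(1)])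
 note sgs = sg_simps[OF R.is_cring]
 have m: "module R (obj ?H n)" for n
  unfolding hom_cpx_def by (simp add: module_prod_mod module_hom_mod dX(1) dY(1) R.is_cring)
 have D: "dif ?H n h : |obj ?H (n - 1)|" if h: "h : |obj ?H n|" for n h
  unfolding hom_cpx_carrier
 proof
  fix i
  have hh: "mod_hom R (obj X i) (obj Y (i + n)) (h i)" for i using h unfolding hom_cpx_carrier by blast
  have h1: "mod_hom R (obj X (i - 1)) (obj Y (i + n - 1)) (h (i - 1))"
   using hh[of "i - 1"] by (simp add: algebra_simps)
  have "mod_hom R (obj X i) (obj Y (i + n - 1))
   (%x. dif Y (i + n) (h i x) +\<^sub>(obj Y (i + n - 1)) (-\<^sub>R sg R n) .\<^sub>(obj Y (i + n - 1)) h (i - 1) (dif X i x))"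
   by (intro mod_hom_add_fun mod_hom_smult_fun dY(1) mod_hom_comp[OF hh dY(2)] mod_hom_comp[OF dX(2) h1])
     (simp add: sgs)
  then have "mod_hom R (obj X i) (obj Y (i + n - 1)) (dif ?H n h i)"
   unfolding mod_hom_def using hom_cpx_dif[OF X Y h] modD(1,8)[OF dX(1)] by (simp add: Pi_def)
  then show "dif ?H n h i : extensional |obj X i| \<and>
   mod_hom R (obj X i) (obj Y (i + (n - 1))) (dif ?H n h i)"
   by (simp add: add_diff_eq) (simp add: hom_cpx_def)
 qed
 have lin: "mod_hom R (obj ?H n) (obj ?H (n - 1)) (dif ?H n)" for n
 proof (rule mod_homI)
  fix g h assume g: "g : |obj ?H n|" and h: "h : |obj ?H n|"
  have gh: "g +\<^sub>(obj ?H n) h : |obj ?H n|" using modD(1)[OF m] g h by auto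
  show "dif ?H n (g +\<^sub>(obj ?H n) h) = dif ?H n g +\<^sub>(obj ?H (n - 1)) dif ?H n h"
  proof (rule hom_cpx_eqI[where R = R and Y = Y and n = "n - 1"])
   fix i x assume x: "x : |obj X i|"
   interpret Y: module R "obj Y (i + n - 1)" by (rule dY)
   have dx: "dif X i x : |obj X (i - 1)|" using mod_homD(1)[OF dX(2) x] .
   have e: "i - 1 + n = i + n - 1" "i + (n - 1) = i + n - 1" by simp_all
   have vals: "k i x : |obj Y (i + n)|" "k (i - 1) (dif X i x) : |obj Y (i + n - 1)|"
    if "k : |obj ?H n|" for k
    using that mod_homD(1)[OF _ x] mod_homD(1)[OF _ dx] e unfolding hom_cpx_carrier by metis+
   note v = vals[OF g] vals[OF h]
   note dv = mod_homD(1)[OF dY(2) v(1)] mod_homD(1)[OF dY(2) v(3)]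
   show "dif ?H n (g +\<^sub>(obj ?H n) h) i x = (dif ?H n g +\<^sub>(obj ?H (n - 1)) dif ?H n h) i x"
    using x dx v dv sgs(1) mod_homD(2)[OF dY(2) v(1) v(3)]
    by (simp add: hom_cpx_dif[OF X Y gh] hom_cpx_ops hom_cpx_dif[OF X Y g] hom_cpx_dif[OF X Y h]
      e Y.smult_r_distr Y.M.a_ac)
  qed (use D[OF gh] modD(1)[OF m] D g h in auto)
 next
  fix r h assume r: "r : |R|" and h: "h : |obj ?H n|"
  have rh: "r .\<^sub>(obj ?H n) h : |obj ?H n|" using modD(8)[OF m] r h by auto
  show "dif ?H n (r .\<^sub>(obj ?H n) h) = r .\<^sub>(obj ?H (n - 1)) dif ?H n h"
  proof (rule hom_cpx_eqI[where R = R and Y = Y and n = "n - 1"])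
   fix i x assume x: "x : |obj X i|"
   interpret Y: module R "obj Y (i + n - 1)" by (rule dY)
   have dx: "dif X i x : |obj X (i - 1)|" using mod_homD(1)[OF dX(2) x] .
   have e: "i - 1 + n = i + n - 1" "i + (n - 1) = i + n - 1" by simp_all
   have v: "h i x : |obj Y (i + n)|" "h (i - 1) (dif X i x) : |obj Y (i + n - 1)|"
    using h mod_homD(1)[OF _ x] mod_homD(1)[OF _ dx] e unfolding hom_cpx_carrier by metis+
   note dv = mod_homD(1)[OF dY(2) v(1)]
   have sw: "(-\<^sub>R sg R n) .\<^sub>(obj Y (i + n - 1)) (r .\<^sub>(obj Y (i + n - 1)) y) =
    r .\<^sub>(obj Y (i + n - 1)) ((-\<^sub>R sg R n) .\<^sub>(obj Y (i + n - 1)) y)"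
    if "y : |obj Y (i + n - 1)|" for y
    using that r sgs(1) by (simp add: Y.smult_assoc1[symmetric] R.m_comm)
   show "dif ?H n (r .\<^sub>(obj ?H n) h) i x = (r .\<^sub>(obj ?H (n - 1)) dif ?H n h) i x"
    using x dx v dv r sgs(1) mod_homD(3)[OF dY(2) r v(1)]
    by (simp add: hom_cpx_dif[OF X Y rh] hom_cpx_ops hom_cpx_dif[OF X Y h] e Y.smult_r_distr sw)
  qed (use D[OF rh] modD(8)[OF m] D r h in auto)
 qed (rule D)
 have dd: "dif ?H (n - 1) (dif ?H n h) = 0\<^sub>(obj ?H (n - 2))" if h: "h : |obj ?H n|" for n h
 proof (rule hom_cpx_eqI[where R = R and Y = Y and n = "n - 2"])
  have "dif ?H (n - 1) (dif ?H n h) : |obj ?H (n - 1 - 1)|" by (rule D[OF D[OF h]])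
  then show "dif ?H (n - 1) (dif ?H n h) : |obj ?H (n - 2)|" by simp
  show "0\<^sub>(obj ?H (n - 2)) : |obj ?H (n - 2)|" by (rule modD(2)[OF m])
 next
  fix i x assume x: "x : |obj X i|"
  let ?Y1 = "obj Y (i + n - 1)" and ?Y2 = "obj Y (i + n - 2)"
  interpret Y2: module R ?Y2 by (rule dY)
  interpret Y1: module R ?Y1 by (rule dY)
  note hD = D[OF h]
  have dx: "dif X i x : |obj X (i - 1)|" using mod_homD(1)[OF dX(2) x] .
  have e: "i - 1 + n = i + n - 1" "i + (n - 1) = i + n - 1" "i + n - 1 - 1 = i + n - 2"
   "i - 1 - 1 = i - 2" "i + n - 1 - 2 = i + n - 3" "i - 2 + n = i + n - 2" by simp_all
  have dYh: "mod_hom R ?Y1 ?Y2 (dif Y (i + n - 1))" using dY(2)[of "i + n - 1"] e by simp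
  have v: "h i x : |obj Y (i + n)|" "h (i - 1) (dif X i x) : |?Y1|"
   using h mod_homD(1)[OF _ x] mod_homD(1)[OF _ dx] e unfolding hom_cpx_carrier by metis+
  have hz: "h (i - 2) 0\<^sub>(obj X (i - 2)) = 0\<^sub>?Y2"
   using mod_hom_zero[OF dX(1) dY(1), of "i - 2" "i - 2 + n" "h (i - 2)"] h e
   unfolding hom_cpx_carrier by metis
  note dv = mod_homD(1)[OF dY(2) v(1)] mod_homD(1)[OF dYh v(2)]
  have e1: "dif ?H n h (i - 1) (dif X i x) = dif Y (i + n - 1) (h (i - 1) (dif X i x))"
   using hom_cpx_dif[OF X Y h dx] dX(3)[OF x] hz sgs(1) e dv(2)
   by (simp add: Y2.smult_r_null)
  have e2: "dif Y (i + n - 1) (dif ?H n h i x) = (-\<^sub>R sg R n) .\<^sub>?Y2 dif Y (i + n - 1) (h (i - 1) (dif X i x))"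
   using hom_cpx_dif[OF X Y h x] v dv sgs(1) dY(3)[OF v(1)]
    mod_homD(2)[OF dYh dv(1), of "(-\<^sub>R sg R n) .\<^sub>?Y1 h (i - 1) (dif X i x)"]
    mod_homD(3)[OF dYh, of "-\<^sub>R sg R n" "h (i - 1) (dif X i x)"]
   by simp
  have "dif ?H (n - 1) (dif ?H n h) i x =
   dif Y (i + n - 1) (dif ?H n h i x) +\<^sub>?Y2 (-\<^sub>R sg R (n - 1)) .\<^sub>?Y2 dif ?H n h (i - 1) (dif X i x)"
   using hom_cpx_dif[OF X Y hD x] e by simp
  also have "\<dots> = 0\<^sub>?Y2"
   unfolding e1 e2 sgs(4) using dv sgs(1) by (simp add: Y2.smult_l_minus Y2.M.l_neg)
  also have "\<dots> = 0\<^sub>(obj ?H (n - 2)) i x"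
   using x by (simp add: hom_cpx_ops add_diff_eq)
  finally show "dif ?H (n - 1) (dif ?H n h) i x = 0\<^sub>(obj ?H (n - 2)) i x" .
 qed
 show ?thesis unfolding is_cpx_def using m lin dd by blast
qed

section \<open>Homomorphisms out of a bounded below complex of free modules\<close>

text \<open>
 The inductive construction behind both the contraction of maps into acyclic complexes and the
 comparison of resolutions: starting from \<open>k0\<close> in degree \<open>0\<close>, solve
 \<open>d k\<^sub>i\<^sub>+\<^sub>1 = a\<^sub>i + c k\<^sub>i d\<close> one degree at a time. The right-hand side is a cycle by \<open>comp\<close> and the
 previous equation, hence a boundary by exactness, and freeness lifts it.
\<close>

lemma lift_along:
 fixes R :: "'a ring" and a :: "nat => 'm => 'n"
 assumes F: "is_cpx R F" and Y: "is_cpx R Y" and free: "!!n. free_mod R (obj F n)"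
  and c: "c : |R|"
  and a: "!!i. mod_hom R (obj F (int i + 1)) (obj Y (m + int i)) (a i)"
  and k0: "mod_hom R (obj F 0) (obj Y m) k0"
  and start: "!!x. x : |obj F 1| ==> a 0 x +\<^sub>(obj Y m) c .\<^sub>(obj Y m) k0 (dif F 1 x) : boundaries Y m"
  and exact: "!!i. exact_at Y (m + int i + 1)"
  and comp: "!!i x. x : |obj F (int i + 2)| ==>
   dif Y (m + int i + 1) (a (Suc i) x) = (-\<^sub>R c) .\<^sub>(obj Y (m + int i)) a i (dif F (int i + 2) x)"
 shows "\<exists>k. k 0 = k0 \<and> (\<forall>i. mod_hom R (obj F (int i)) (obj Y (m + int i)) (k i)) \<and>
  (\<forall>i. \<forall>x\<in>|obj F (int i + 1)|. dif Y (m + int i + 1) (k (Suc i) x) =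
    a i x +\<^sub>(obj Y (m + int i)) c .\<^sub>(obj Y (m + int i)) k i (dif F (int i + 1) x))"
proof -
 note dF = is_cpxD[OF F] and dY = is_cpxD[OF Y]
 define P where "P i k \<longleftrightarrow> (i = 0 \<longrightarrow> k = k0) \<and> mod_hom R (obj F (int i)) (obj Y (m + int i)) k \<and>
  (\<forall>x\<in>|obj F (int i + 1)|.
    a i x +\<^sub>(obj Y (m + int i)) c .\<^sub>(obj Y (m + int i)) k (dif F (int i + 1) x) : boundaries Y (m + int i))"
  for i k
 define Q where "Q i k k' \<longleftrightarrow> (\<forall>x\<in>|obj F (int i + 1)|. dif Y (m + int i + 1) (k' x) =
  a i x +\<^sub>(obj Y (m + int i)) c .\<^sub>(obj Y (m + int i)) k (dif F (int i + 1) x))" for i and k k' :: "'m => 'n"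
 have "\<exists>k. \<forall>i. P i (k i) \<and> Q i (k i) (k (Suc i))"
 proof (rule dependent_nat_choice)
  show "\<exists>k. P 0 k" using k0 start by (intro exI[of _ k0]) (simp add: P_def)
 next
  fix k i assume "P i k"
  then have k: "mod_hom R (obj F (int i)) (obj Y (m + int i)) k"
   and kb: "!!x. x : |obj F (int i + 1)| ==>
    a i x +\<^sub>(obj Y (m + int i)) c .\<^sub>(obj Y (m + int i)) k (dif F (int i + 1) x) : boundaries Y (m + int i)"
   by (auto simp: P_def)
  let ?b = "%x. a i x +\<^sub>(obj Y (m + int i)) c .\<^sub>(obj Y (m + int i)) k (dif F (int i + 1) x)"
  have b: "mod_hom R (obj F (int i + 1)) (obj Y (m + int i)) ?b"
   by (intro mod_hom_add_fun mod_hom_smult_fun dY(1) a c mod_hom_comp[OF dF(4) k])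
  have sub: "?b ` |obj F (int i + 1)| \<subseteq> dif Y (m + int i + 1) ` |obj Y (m + int i + 1)|"
   using kb unfolding boundaries_def by blast
  obtain k' where k': "mod_hom R (obj F (int i + 1)) (obj Y (m + int i + 1)) k'"
   "!!x. x : |obj F (int i + 1)| ==> dif Y (m + int i + 1) (k' x) = ?b x"
   using free_mod_lift[OF dF(1) free dY(1) dY(1) b dY(4) sub] by blast
  have e: "int (Suc i) = int i + 1" "int i + 1 + 1 = int i + 2" "m + (int i + 1) = m + int i + 1"
   "m + int i + 1 - 1 = m + int i" "int i + 2 - 1 = int i + 1" "int i + 2 - 2 = int i"
   by simp_all
  have "P (Suc i) k'" unfolding P_def
  proof (intro conjI ballI)
   show "mod_hom R (obj F (int (Suc i))) (obj Y (m + int (Suc i))) k'" unfolding e by (rule k')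
   fix x assume "x : |obj F (int (Suc i) + 1)|"
   then have x: "x : |obj F (int i + 2)|" unfolding e .
   let ?Y = "obj Y (m + int i + 1)" and ?Y' = "obj Y (m + int i)"
   interpret Y': module R ?Y' by (rule dY)
   have dx: "dif F (int i + 2) x : |obj F (int i + 1)|"
    using mod_homD(1)[OF dF(2) x] unfolding e .
   have ddx: "dif F (int i + 1) (dif F (int i + 2) x) = 0\<^sub>(obj F (int i))"
    using dF(3)[OF x] unfolding e .
   have aS: "a (Suc i) x : |?Y|" using mod_homD(1)[OF a[of "Suc i"], of x] x unfolding e by simp
   have k'x: "k' (dif F (int i + 2) x) : |?Y|" using mod_homD(1)[OF k'(1) dx] .
   have ai: "a i (dif F (int i + 2) x) : |?Y'|" using mod_homD(1)[OF a dx] .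
   have dYh: "mod_hom R ?Y ?Y' (dif Y (m + int i + 1))" by (rule dY(4))
   have kz: "k 0\<^sub>(obj F (int i)) = 0\<^sub>(?Y')" by (rule mod_hom_zero[OF dF(1) dY(1) k])
   let ?w = "a (Suc i) x +\<^sub>?Y c .\<^sub>?Y k' (dif F (int i + 2) x)"
   have w: "?w : |?Y|" using aS k'x c modD(1,8)[OF dY(1)] by auto
   have "dif Y (m + int i + 1) ?w = dif Y (m + int i + 1) (a (Suc i) x) +\<^sub>(?Y')
     c .\<^sub>(?Y') dif Y (m + int i + 1) (k' (dif F (int i + 2) x))"
    using mod_homD(2)[OF dYh aS] mod_homD(3)[OF dYh c k'x] modD(8)[OF dY(1) c k'x] by simp
   also have "\<dots> = 0\<^sub>(?Y')"
    unfolding comp[OF x] k'(2)[OF dx] ddx kz using ai c by (simp add: Y'.smult_l_minus Y'.M.l_neg)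
   finally have "?w : cycles Y (m + int i + 1)" using w by (simp add: cycles_def)
   then have "?w : boundaries Y (m + int i + 1)" using exact[of i] by (auto simp: exact_at_def)
   then show "a (Suc i) x +\<^sub>(obj Y (m + int (Suc i))) c .\<^sub>(obj Y (m + int (Suc i))) k' (dif F (int (Suc i) + 1) x)
     : boundaries Y (m + int (Suc i))" unfolding e .
  qed simp
  moreover have "Q i k k'" unfolding Q_def using k'(2) by blast
  ultimately show "\<exists>k'. P (Suc i) k' \<and> Q i k k'" by blast
 qed
 then obtain k where k: "!!i. P i (k i)" "!!i. Q i (k i) (k (Suc i))" by blast
 then show ?thesis by (intro exI[of _ k]) (simp add: P_def Q_def)
qed

text \<open>The element of a Hom complex out of \<open>F\<close> whose components are \<open>k\<close> in degrees \<open>\<ge> 0\<close> and zero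
 below.\<close>

definition extend_hom ::
  "('a, 'm) cpx => ('a, 'n) cpx => int => (nat => 'm => 'n) => int => 'm => 'n" where
 "extend_hom F Y m k i =
   (\<lambda>x\<in>|obj F i|. if i < 0 then 0\<^sub>(obj Y (i + m)) else k (nat i) x)"

lemma extend_hom_mem:
 fixes R :: "'a ring"
 assumes F: "is_cpx R F" and Y: "is_cpx R Y"
  and k: "!!i. mod_hom R (obj F (int i)) (obj Y (m + int i)) (k i)"
 shows "extend_hom F Y m k : |obj (hom_cpx R F Y) m|"
 unfolding hom_cpx_carrier
proof (intro allI conjI)
 fix i
 show "extend_hom F Y m k i : extensional |obj F i|" by (simp add: extend_hom_def)
 show "mod_hom R (obj F i) (obj Y (i + m)) (extend_hom F Y m k i)"
 proof (cases "i < 0")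
  case True
  then show ?thesis
   using mod_hom_zero_fun[OF is_cpxD(1)[OF Y, of "i + m"], of "obj F i"]
   by (simp add: extend_hom_def is_cpxD[OF F])
 next
  case False
  then have "mod_hom R (obj F i) (obj Y (i + m)) (k (nat i))"
   using k[of "nat i"] by (simp add: add.commute)
  then show ?thesis using False by (simp add: extend_hom_def is_cpxD[OF F])
 qed
qed

definition bounded_free :: "'a ring => ('a, 'm) cpx => bool" where
 "bounded_free R F \<longleftrightarrow> is_cpx R F \<and> (\<forall>n. free_mod R (obj F n)) \<and>
   (\<forall>n<0. |obj F n| = {0\<^sub>(obj F n)})"

lemma int_nonneg_cases:
 fixes i :: int
 obtains "i < 0" | "i = 0" | j where "i = int j + 1"
proof (cases "i < 0 \<or> i = 0")
 case False
 then have "i = int (nat (i - 1)) + 1" by simp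
 then show ?thesis using that(3) by blast
qed (use that in blast)

lemma hom_cpx_cycle_iff:
 fixes R :: "'a ring"
 assumes F: "is_cpx R F" and Y: "is_cpx R Y" and h: "h : |obj (hom_cpx R F Y) n|"
 shows "h : cycles (hom_cpx R F Y) n \<longleftrightarrow> (\<forall>i. \<forall>x\<in>|obj F i|.
  dif Y (i + n) (h i x) = sg R n .\<^sub>(obj Y (i + n - 1)) h (i - 1) (dif F i x))"
proof -
 let ?H = "hom_cpx R F Y"
 note dH = is_cpxD[OF is_cpx_hom_cpx[OF F Y]]
 have D: "dif ?H n h : |obj ?H (n - 1)|" using mod_homD(1)[OF dH(2) h] .
 have "dif ?H n h i x = 0\<^sub>(obj ?H (n - 1)) i x \<longleftrightarrow>
   dif Y (i + n) (h i x) = sg R n .\<^sub>(obj Y (i + n - 1)) h (i - 1) (dif F i x)"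
  if x: "x : |obj F i|" for i x
 proof -
  interpret Y': module R "obj Y (i + n - 1)" by (rule is_cpxD[OF Y])
  have hh: "mod_hom R (obj F i) (obj Y (i + n)) (h i)" for i using h unfolding hom_cpx_carrier by blast
  have h1: "mod_hom R (obj F (i - 1)) (obj Y (i + n - 1)) (h (i - 1))"
   using hh[of "i - 1"] by (simp add: algebra_simps)
  have v: "dif Y (i + n) (h i x) : |obj Y (i + n - 1)|"
   "h (i - 1) (dif F i x) : |obj Y (i + n - 1)|"
   using mod_homD(1)[OF is_cpxD(2)[OF Y] mod_homD(1)[OF hh x]]
    mod_homD(1)[OF h1 mod_homD(1)[OF is_cpxD(2)[OF F] x]] .
  have s: "sg R n : |R|" by (rule sg_simps[OF Y'.R.is_cring])
  have sv: "sg R n .\<^sub>(obj Y (i + n - 1)) h (i - 1) (dif F i x) : |obj Y (i + n - 1)|" using s v by simp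
  have "a +\<^sub>(obj Y (i + n - 1)) -\<^sub>(obj Y (i + n - 1)) b = 0\<^sub>(obj Y (i + n - 1)) \<longleftrightarrow> a = b"
   if "a : |obj Y (i + n - 1)|" "b : |obj Y (i + n - 1)|" for a b
   using that by (metis Y'.M.add.inv_closed Y'.M.minus_equality Y'.M.minus_minus Y'.M.r_neg)
  then show ?thesis
   using x v sv s by (simp add: hom_cpx_dif[OF F Y h x] hom_cpx_ops add_diff_eq Y'.smult_l_minus)
 qed
 then have "dif ?H n h = 0\<^sub>(obj ?H (n - 1)) \<longleftrightarrow> (\<forall>i. \<forall>x\<in>|obj F i|.
  dif Y (i + n) (h i x) = sg R n .\<^sub>(obj Y (i + n - 1)) h (i - 1) (dif F i x))"
  using hom_cpx_eqI[OF D modD(2)[OF dH(1)]] by metis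
 then show ?thesis using h by (simp add: cycles_def)
qed

lemma hom_cpx_acyclic:
 fixes R :: "'a ring" and F :: "('a, 'm) cpx" and Y :: "('a, 'n) cpx"
 assumes bf: "bounded_free R F" and Y: "is_cpx R Y" and ac: "acyclic Y"
 shows "acyclic (hom_cpx R F Y)"
 unfolding acyclic_def exact_at_def
proof safe
 fix n h assume hc: "h : cycles (hom_cpx R F Y) n"
 have F: "is_cpx R F" and free: "!!n. free_mod R (obj F n)"
  and neg: "!!n. n < 0 ==> |obj F n| = {0\<^sub>(obj F n)}"
  using bf by (auto simp: bounded_free_def)
 let ?H = "hom_cpx R F Y"
 note dF = is_cpxD[OF F] and dY = is_cpxD[OF Y]
 have h: "h : |obj ?H n|" using hc by (simp add: cycles_def)
 have hh: "mod_hom R (obj F i) (obj Y (i + n)) (h i)" for i using h unfolding hom_cpx_carrier by blast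
 have cyc: "dif Y (i + n) (h i x) = sg R n .\<^sub>(obj Y (i + n - 1)) h (i - 1) (dif F i x)"
  if "x : |obj F i|" for i x
  using hc that unfolding hom_cpx_cycle_iff[OF F Y h] by blast
 have exactY: "exact_at Y j" for j using ac by (auto simp: acyclic_def)
 interpret R: cring R by (rule modD(13)[OF dF(1)])
 note sgs = sg_simps[OF R.is_cring]
 have h0: "mod_hom R (obj F 0) (obj Y n) (h 0)" using hh[of 0] by simp
 have F1: "|obj F (-1)| = {0\<^sub>(obj F (-1))}" using neg[of "-1"] by simp
 have d0: "dif F 0 x = 0\<^sub>(obj F (-1))" if "x : |obj F 0|" for x
  using mod_homD(1)[OF dF(2) that] F1 by simp
 have "h 0 ` |obj F 0| \<subseteq> dif Y (n + 1) ` |obj Y (n + 1)|"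
 proof
  fix y assume "y : h 0 ` |obj F 0|"
  then obtain x where x: "x : |obj F 0|" "y = h 0 x" by auto
  have "h (-1) 0\<^sub>(obj F (-1)) = 0\<^sub>(obj Y (n - 1))"
   using mod_hom_zero[OF dF(1) dY(1) hh[of "-1"]] by simp
  then have "dif Y n y = 0\<^sub>(obj Y (n - 1))"
   using cyc[OF x(1)] x d0[OF x(1)] modD(16)[OF dY(1)] sgs(1) by simp
  then have "y : cycles Y n" using mod_homD(1)[OF h0 x(1)] x by (simp add: cycles_def)
  then show "y : dif Y (n + 1) ` |obj Y (n + 1)|"
   using exactY[of n] by (auto simp: exact_at_def boundaries_def)
 qed
 from free_mod_lift[OF dF(1) free dY(1) dY(1) h0 dY(4) this]
 obtain k0 where k0: "mod_hom R (obj F 0) (obj Y (n + 1)) k0"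
  "!!x. x : |obj F 0| ==> dif Y (n + 1) (k0 x) = h 0 x" by blast
 let ?a = "%i. h (int i + 1)" and ?c = "sg R (n + 1)"
 have a: "mod_hom R (obj F (int i + 1)) (obj Y (n + 1 + int i)) (?a i)" for i
  using hh[of "int i + 1"] by (simp add: algebra_simps)
 have c: "?c : |R|" by (rule sgs)
 have sgn: "sg R n = -\<^sub>R ?c" using sgs by simp
 have "a 0 x +\<^sub>(obj Y (n + 1)) ?c .\<^sub>(obj Y (n + 1)) k0 (dif F 1 x) : boundaries Y (n + 1)"
  if x: "x : |obj F 1|" and [simp]: "a = ?a" for x and a :: "nat => 'm => 'n"
 proof -
  interpret Y': module R "obj Y n" by (rule dY)
  have dx: "dif F 1 x : |obj F 0|" using mod_homD(1)[OF dF(2) x] by simp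
  have v: "h 1 x : |obj Y (n + 1)|" "k0 (dif F 1 x) : |obj Y (n + 1)|"
   using mod_homD(1)[OF hh x] mod_homD(1)[OF k0(1) dx] by (simp_all add: add.commute)
  have w: "h 1 x +\<^sub>(obj Y (n + 1)) ?c .\<^sub>(obj Y (n + 1)) k0 (dif F 1 x) : |obj Y (n + 1)|"
   using v c modD(1,8)[OF dY(1)] by auto
  have h0v: "h 0 (dif F 1 x) : |obj Y n|" using mod_homD(1)[OF h0 dx] .
  have dh: "dif Y (n + 1) (h 1 x) = sg R n .\<^sub>(obj Y n) h 0 (dif F 1 x)"
   using cyc[OF x] by (simp add: add.commute)
  have "dif Y (n + 1) (h 1 x +\<^sub>(obj Y (n + 1)) ?c .\<^sub>(obj Y (n + 1)) k0 (dif F 1 x)) =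
   dif Y (n + 1) (h 1 x) +\<^sub>(obj Y n) ?c .\<^sub>(obj Y n) dif Y (n + 1) (k0 (dif F 1 x))"
   using mod_homD(2)[OF dY(4) v(1) modD(8)[OF dY(1) c v(2)]] mod_homD(3)[OF dY(4) c v(2)] by simp
  also have "\<dots> = 0\<^sub>(obj Y n)"
   unfolding dh k0(2)[OF dx] sgn using c h0v by (simp add: Y'.smult_l_minus Y'.M.l_neg)
  finally show ?thesis using w exactY[of "n + 1"] by (auto simp: exact_at_def cycles_def)
 qed
 note start = this[OF _ refl]
 have comp: "dif Y (n + 1 + int i + 1) (?a (Suc i) x) = (-\<^sub>R ?c) .\<^sub>(obj Y (n + 1 + int i)) ?a i (dif F (int i + 2) x)"
  if x: "x : |obj F (int i + 2)|" for i x
 proof -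
  have e: "int i + 2 + n = n + 1 + int i + 1" "n + 1 + int i + 1 - 1 = n + 1 + int i"
   "int i + 2 - 1 = int i + 1" "int (Suc i) + 1 = int i + 2" by simp_all
  show ?thesis using cyc[OF x] sgn unfolding e by simp
 qed
 obtain k where k: "k 0 = k0" "!!i. mod_hom R (obj F (int i)) (obj Y (n + 1 + int i)) (k i)"
  "!!i x. x : |obj F (int i + 1)| ==> dif Y (n + 1 + int i + 1) (k (Suc i) x) =
    ?a i x +\<^sub>(obj Y (n + 1 + int i)) ?c .\<^sub>(obj Y (n + 1 + int i)) k i (dif F (int i + 1) x)"
  using lift_along[of R F Y ?c "n + 1" ?a k0, OF F Y free c a k0(1) start exactY comp] by blast
 let ?K = "extend_hom F Y (n + 1) k"
 have K: "?K : |obj ?H (n + 1)|" by (rule extend_hom_mem[OF F Y k(2)])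
 note dH = is_cpxD[OF is_cpx_hom_cpx[OF F Y]]
 have "dif ?H (n + 1) ?K = h"
 proof (rule hom_cpx_eqI[OF _ h])
  show "dif ?H (n + 1) ?K : |obj ?H n|" using mod_homD(1)[OF dH(4) K] .
  fix i x assume x: "x : |obj F i|"
  interpret Y': module R "obj Y (i + n)" by (rule dY)
  have dx: "dif F i x : |obj F (i - 1)|" using mod_homD(1)[OF dF(2) x] .
  have DK: "dif ?H (n + 1) ?K i x = dif Y (i + n + 1) (?K i x) +\<^sub>(obj Y (i + n))
    (-\<^sub>R ?c) .\<^sub>(obj Y (i + n)) ?K (i - 1) (dif F i x)"
   using hom_cpx_dif[OF F Y K x] by (simp add: add.assoc[symmetric])
  have hx: "h i x : |obj Y (i + n)|" using mod_homD(1)[OF hh x] .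
  show "dif ?H (n + 1) ?K i x = h i x"
  proof (cases i rule: int_nonneg_cases)
   case 1
   have xz: "x = 0\<^sub>(obj F i)" using x neg[OF 1] by simp
   have "mod_hom R (obj F i) (obj Y (i + n)) (dif ?H (n + 1) ?K i)"
    using mod_homD(1)[OF dH(4) K] unfolding hom_cpx_carrier by blast
   then show ?thesis
    using mod_hom_zero[OF dF(1) dY(1)] hh[of i] unfolding xz by metis
  next
   case 2
   have "-\<^sub>R ?c : |R|" using c by simp
   with 2 show ?thesis using x hx dx k0 k(1) modD(14,16)[OF dY(1)] unfolding DK
    by (simp add: extend_hom_def)
  next
   case (3 j)
   have e: "i + n + 1 = n + 1 + int j + 1" "i + n = n + 1 + int j" "nat i = Suc j" "nat (i - 1) = j"
    "i - 1 = int j" using 3 by simp_all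
   have kj: "k j (dif F i x) : |obj Y (i + n)|"
    using mod_homD(1)[OF k(2)[of j]] dx unfolding e by simp
   have "x : |obj F (int j + 1)|" using x 3 by simp
   from k(3)[OF this] have k3: "dif Y (i + n + 1) (k (Suc j) x) =
     h i x +\<^sub>(obj Y (i + n)) ?c .\<^sub>(obj Y (i + n)) k j (dif F i x)"
    unfolding e(2)[symmetric] 3[symmetric] .
   have "?K i x = k (Suc j) x" "?K (i - 1) (dif F i x) = k j (dif F i x)"
    using x dx 3 by (simp_all add: extend_hom_def nat_add_distrib)
   then have "dif ?H (n + 1) ?K i x =
     (h i x +\<^sub>(obj Y (i + n)) ?c .\<^sub>(obj Y (i + n)) k j (dif F i x)) +\<^sub>(obj Y (i + n))
     (-\<^sub>R ?c) .\<^sub>(obj Y (i + n)) k j (dif F i x)"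
    unfolding DK using k3 by simp
   then show ?thesis using hx kj c
    by (simp add: Y'.smult_l_minus Y'.M.a_assoc Y'.M.r_neg)
  qed
 qed
 then show "h : boundaries ?H n" using K by (auto simp: boundaries_def)
qed

text \<open>
 A map \<open>tt\<close> on \<open>F\<^sub>0\<close> that represents \<open>F\<^sub>0 \<rightarrow> R/p\<close> and a cycle \<open>ph\<close> whose class is killed by \<open>p\<close>
 give a chain map \<open>F \<rightarrow> Y\<close> that lifts \<open>R/p \<rightarrow> H\<^sub>c(Y)\<close>. It is not homotopic to zero, because
 a homotopy would make \<open>ph\<close> a boundary.
\<close>

lemma hom_cpx_not_acyclic:
 fixes R :: "'a ring" and F :: "('a, 'm) cpx" and Y :: "('a, 'n) cpx"
 assumes bf: "bounded_free R F" and Y: "is_cpx R Y" and p: "ideal p R"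
  and tt: "mod_hom R (obj F 0) (ring_mod R) tt"
  and ttd: "!!x. x : |obj F 1| ==> tt (dif F 1 x) : p"
  and e: "e : |obj F 0|" "a : p" "tt e = 1\<^sub>R +\<^sub>R a"
  and ph: "ph : cycles Y c" "ph \<notin> boundaries Y c"
  and pph: "!!b. b : p ==> b .\<^sub>(obj Y c) ph : boundaries Y c"
  and exact: "!!i. exact_at Y (c + int i + 1)"
 shows "\<not> acyclic (hom_cpx R F Y)"
proof
 assume ac: "acyclic (hom_cpx R F Y)"
 have F: "is_cpx R F" and free: "!!n. free_mod R (obj F n)"
  and neg: "!!n. n < 0 ==> |obj F n| = {0\<^sub>(obj F n)}"
  using bf by (auto simp: bounded_free_def)
 let ?H = "hom_cpx R F Y"
 note dF = is_cpxD[OF F] and dY = is_cpxD[OF Y]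
 interpret p: ideal p R by (rule p)
 interpret Yc: module R "obj Y c" by (rule dY)
 note sgs = sg_simps[OF Yc.R.is_cring]
 have phc: "ph : |obj Y c|" and dph: "dif Y c ph = 0\<^sub>(obj Y (c - 1))" using ph(1) by (auto simp: cycles_def)
 note bY = submoduleD[OF dY(1) cycles_boundaries(2)[OF Y]]
 let ?k0 = "%x. tt x .\<^sub>(obj Y c) ph"
 have ttc: "tt x : |R|" if "x : |obj F 0|" for x using mod_homD(1)[OF tt that] by simp
 have k0: "mod_hom R (obj F 0) (obj Y c) ?k0"
  by (rule mod_homI) (use phc mod_homD[OF tt] in "auto simp: Yc.smult_l_distr Yc.smult_assoc1")
 let ?a = "%i x. 0\<^sub>(obj Y (c + int i))"
 have start: "?a 0 x +\<^sub>(obj Y c) sg R c .\<^sub>(obj Y c) ?k0 (dif F 1 x) : boundaries Y c"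
  if x: "x : |obj F 1|" for x
  using bY(4)[OF sgs(1) pph[OF ttd[OF x]]] bY(1) by (simp add: subset_iff)
 have comp: "dif Y (c + int i + 1) (?a (Suc i) x) =
   (-\<^sub>R sg R c) .\<^sub>(obj Y (c + int i)) ?a i (dif F (int i + 2) x)" for i x
 proof -
  have s: "-\<^sub>R sg R c : |R|" using sgs(1) by simp
  have e': "c + int (Suc i) = c + int i + 1" by simp
  show ?thesis unfolding e' using mod_hom_zero[OF dY(1) dY(1) dY(4)] modD(16)[OF dY(1) s] by simp
 qed
 obtain k where k: "k 0 = ?k0" "!!i. mod_hom R (obj F (int i)) (obj Y (c + int i)) (k i)"
  "!!i x. x : |obj F (int i + 1)| ==> dif Y (c + int i + 1) (k (Suc i) x) =
    ?a i x +\<^sub>(obj Y (c + int i)) sg R c .\<^sub>(obj Y (c + int i)) k i (dif F (int i + 1) x)"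
  using lift_along[of R F Y "sg R c" c ?a ?k0, OF F Y free sgs(1) mod_hom_zero_fun[OF dY(1)] k0 start exact comp]
  by blast
 let ?K = "extend_hom F Y c k"
 have K: "?K : |obj ?H c|" by (rule extend_hom_mem[OF F Y k(2)])
 have "?K : cycles ?H c"
  unfolding hom_cpx_cycle_iff[OF F Y K]
 proof (intro allI ballI)
  fix i x assume x: "x : |obj F i|"
  have dx: "dif F i x : |obj F (i - 1)|" using mod_homD(1)[OF dF(2) x] .
  interpret Y': module R "obj Y (i + c - 1)" by (rule dY)
  show "dif Y (i + c) (?K i x) = sg R c .\<^sub>(obj Y (i + c - 1)) ?K (i - 1) (dif F i x)"
  proof (cases i rule: int_nonneg_cases)
   case 1
   have e': "i - 1 + c = i + c - 1" by simp
   show ?thesis using x dx 1 mod_hom_zero[OF dY(1) dY(1) dY(2)] sgs(1)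
    by (simp add: extend_hom_def e')
  next
   case 2
   then show ?thesis
    using x dx k(1) sgs(1) ttc[of x] dph mod_homD(3)[OF dY(2) _ phc, of "tt x"] modD(16)[OF dY(1)]
    by (simp add: extend_hom_def)
  next
   case (3 j)
   have e': "i + c = c + int j + 1" "i + c - 1 = c + int j" "nat i = Suc j" "i - 1 = int j" using 3 by simp_all
   have kj: "k j (dif F i x) : |obj Y (c + int j)|"
    using mod_homD(1)[OF k(2)[of j]] dx unfolding e' by simp
   interpret Y'': module R "obj Y (c + int j)" by (rule dY)
   have "?K i x = k (Suc j) x" "?K (i - 1) (dif F i x) = k j (dif F i x)"
    using x dx 3 by (simp_all add: extend_hom_def nat_add_distrib)
   then show ?thesis using k(3)[of x j] x 3 kj sgs(1) unfolding e'(1,2) by simp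
  qed
 qed
 then have "?K : boundaries ?H c" using ac by (auto simp: acyclic_def exact_at_def)
 then obtain L where L: "L : |obj ?H (c + 1)|" "dif ?H (c + 1) L = ?K" by (auto simp: boundaries_def)
 have LL: "mod_hom R (obj F i) (obj Y (i + (c + 1))) (L i)" for i using L unfolding hom_cpx_carrier by blast
 have "dif F 0 e : |obj F (0 - 1)|" using mod_homD(1)[OF dF(2) e(1)] .
 then have de: "dif F 0 e = 0\<^sub>(obj F (-1))" using neg[of "-1"] by simp
 have "L (-1) (dif F 0 e) = 0\<^sub>(obj Y c)"
  unfolding de using mod_hom_zero[OF dF(1) dY(1) LL[of "-1"]] by simp
 moreover have Le: "dif Y (c + 1) (L 0 e) : boundaries Y c"
  using mod_homD(1)[OF LL[of 0] e(1)] by (simp add: boundaries_def)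
 ultimately have "?K 0 e = dif Y (c + 1) (L 0 e)"
  using hom_cpx_dif[OF F Y L(1) e(1)] L(2) bY(1)[of c] sgs(1) Yc.smult_r_null
  by (simp add: subset_iff)
 then have "(1\<^sub>R +\<^sub>R a) .\<^sub>(obj Y c) ph : boundaries Y c"
  using Le e k(1) by (simp add: extend_hom_def)
 moreover have "ph = (1\<^sub>R +\<^sub>R a) .\<^sub>(obj Y c) ph -\<^sub>(obj Y c) a .\<^sub>(obj Y c) ph"
  using phc p.Icarr[OF e(2)] by (simp add: Yc.smult_l_distr a_minus_def Yc.M.a_assoc Yc.M.r_neg)
 ultimately have "ph : boundaries Y c" using bY(6) pph[OF e(2)] by metis
 then show False using ph(2) by simp
qed

section \<open>Free resolutions\<close>

lemma free_resolutionD: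
 fixes R :: "'a ring" and N :: "('a, 'n) module"
 assumes res: "free_resolution R N F" and N: "module R N"
 shows "bounded_free R F" "!!n. n \<noteq> 0 ==> exact_at F n"
  "\<exists>ep. mod_hom R (obj F 0) N ep \<and> ep ` |obj F 0| = |N| \<and>
    (\<forall>x\<in>|obj F 0|. ep x = 0\<^sub>N \<longleftrightarrow> x : boundaries F 0)"
  "cycles F 0 = |obj F 0|"
proof -
 have F: "is_cpx R F" and free: "!!n. free_mod R (obj F n)"
  and neg: "!!n. n < 0 ==> |obj F n| = {0\<^sub>(obj F n)}"
  using res by (auto simp: free_resolution_def)
 obtain ep where q: "quasi_iso R F (mod_cpx N) ep" using res by (auto simp: free_resolution_def)
 note dF = is_cpxD[OF F]
 show "bounded_free R F" using F free neg by (simp add: bounded_free_def)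
 have Nc: "is_cpx R (mod_cpx N)" by (rule is_cpx_mod_cpx[OF N])
 have ch: "chain_map R F (mod_cpx N) ep" using q by (simp add: quasi_iso_def)
 note qi = q[unfolded quasi_iso_iff[OF F Nc ch], rule_format]
 note cN = mod_cpx_cycles[OF N]
 show "exact_at F n" if "n \<noteq> 0" for n
  unfolding exact_at_def
 proof
  fix z assume z: "z : cycles F n"
  have "ep n z : boundaries (mod_cpx N) n"
   using chain_map_cycles(1)[OF F Nc ch z] cN(3)[OF that] by (auto simp: exact_at_def)
  then show "z : boundaries F n" using qi z by blast
 qed
 show c0: "cycles F 0 = |obj F 0|"
  using mod_homD(1)[OF dF(2), of _ 0] neg[of "-1"] by (auto simp: cycles_def)
 have ep: "mod_hom R (obj F 0) N (ep 0)" using chain_mapD(1)[OF ch, of 0] by simp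
 interpret N: module R N by (rule N)
 have "|N| \<subseteq> ep 0 ` |obj F 0|"
 proof
  fix w assume w: "w : |N|"
  then have "w : cycles (mod_cpx N) 0" by (simp add: cN)
  with qi obtain z where z: "z : cycles F 0" "w -\<^sub>(obj (mod_cpx N) 0) ep 0 z : boundaries (mod_cpx N) 0"
   by blast
  have ez: "ep 0 z : |N|" using mod_homD(1)[OF ep] z c0 by simp
  have "w +\<^sub>N -\<^sub>N ep 0 z = 0\<^sub>N" using z(2) by (simp add: cN a_minus_def)
  then have "w = ep 0 z" using w ez by (metis N.M.add.inv_closed N.M.minus_equality N.M.minus_minus)
  then show "w : ep 0 ` |obj F 0|" using z c0 by auto
 qed
 then have "ep 0 ` |obj F 0| = |N|" using mod_homD(1)[OF ep] by auto
 moreover have "ep 0 x = 0\<^sub>N \<longleftrightarrow> x : boundaries F 0" if x: "x : |obj F 0|" for x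
 proof
  assume "ep 0 x = 0\<^sub>N"
  then have "ep 0 x : boundaries (mod_cpx N) 0" by (simp add: cN)
  then show "x : boundaries F 0" using qi x c0 by blast
 next
  assume "x : boundaries F 0"
  then show "ep 0 x = 0\<^sub>N" using chain_map_cycles(2)[OF F Nc ch, of x 0] by (simp add: cN)
 qed
 ultimately show "\<exists>ep. mod_hom R (obj F 0) N ep \<and> ep ` |obj F 0| = |N| \<and>
    (\<forall>x\<in>|obj F 0|. ep x = 0\<^sub>N \<longleftrightarrow> x : boundaries F 0)"
  using ep by blast
qed

subsection \<open>Existence of free resolutions over the index type\<close>

definition fs_mod :: "'a ring => ('a, 'i => 'a) module" where
 "fs_mod R = mk_mod {f. (\<forall>i. f i : |R| ) \<and> finite {i. f i \<noteq> 0\<^sub>R}} (%_. 0\<^sub>R)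
   (%f g i. f i +\<^sub>R g i) (%r f i. r \<otimes>\<^sub>R f i)"

lemma fs_mod_simps [simp]:
 "|fs_mod R| = {f. (\<forall>i. f i : |R| ) \<and> finite {i. f i \<noteq> 0\<^sub>R}}"
 "0\<^sub>(fs_mod R) = (%_. 0\<^sub>R)" "f +\<^sub>(fs_mod R) g = (%i. f i +\<^sub>R g i)"
 "r .\<^sub>(fs_mod R) f = (%i. r \<otimes>\<^sub>R f i)"
 by (simp_all add: fs_mod_def)

lemma module_fs_mod:
 fixes R :: "'a ring"
 assumes "cring R" shows "module R (fs_mod R)"
proof -
 interpret cring R by fact
 show ?thesis
 proof (rule modI, goal_cases)
  case 1 show ?case by fact
 next
  case (2 x y)
  have "{i. x i +\<^sub>R y i \<noteq> 0\<^sub>R} \<subseteq> {i. x i \<noteq> 0\<^sub>R} \<union> {i. y i \<noteq> 0\<^sub>R}" by auto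
  then show ?case using 2 by (auto intro: finite_subset)
 next
  case (7 x) then show ?case by (intro bexI[of _ "%i. -\<^sub>R x i"]) (auto simp: l_neg)
 next
  case (8 r x)
  have "{i. r \<otimes>\<^sub>R x i \<noteq> 0\<^sub>R} \<subseteq> {i. x i \<noteq> 0\<^sub>R}" using 8 by auto
  then show ?case using 8 by (auto intro: finite_subset)
 qed (auto simp: a_ac l_distr r_distr m_assoc)
qed

definition fs_unit :: "'a ring => 'i => 'i => 'a" where
 "fs_unit R i = (%j. if j = i then 1\<^sub>R else 0\<^sub>R)"

definition fs_coord :: "'a ring => ('i => 'a) => ('i => 'a) => 'a" where
 "fs_coord R b x = x (inv_into UNIV (fs_unit R) b)"

lemma fs_unit_simps:
 fixes R :: "'a ring" and i :: 'i
 assumes "cring R" "1\<^sub>R \<noteq> 0\<^sub>R"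
 shows "inj (fs_unit R :: 'i => 'i => 'a)" "fs_unit R i : |fs_mod R|" "fs_coord R (fs_unit R i) x = x i"
proof -
 interpret cring R by fact
 show 1: "inj (fs_unit R :: 'i => 'i => 'a)"
  by (rule injI) (use assms(2) in "auto simp: fs_unit_def fun_eq_iff split: if_splits")
 have "finite {j. fs_unit R i j \<noteq> 0\<^sub>R}"
  by (rule finite_subset[of _ "{i}"]) (auto simp: fs_unit_def)
 then show "fs_unit R i : |fs_mod R|" by (auto simp: fs_unit_def)
 show "fs_coord R (fs_unit R i) x = x i" by (simp add: fs_coord_def 1)
qed

lemma fs_eval:
 fixes R :: "'a ring" and j :: 'i
 assumes R: "cring R" and S: "finite S" and h: "h : S \<rightarrow> |fs_mod R|"
 shows "finsum (fs_mod R) h S j = finsum R (%b. h b j) S"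
proof -
 interpret cring R by fact
 interpret F: module R "fs_mod R :: ('a, 'i => 'a) module" by (rule module_fs_mod[OF R])
 show ?thesis using S h
 proof (induct S)
  case (insert b S)
  then have "h b : |fs_mod R|" "h : S \<rightarrow> |fs_mod R|" by auto
  then show ?case using insert by (subst F.M.finsum_insert) (auto simp: Pi_def)
 qed simp
qed

lemma fs_finsum:
 fixes R :: "'a ring" and j :: 'i
 assumes R: "cring R" and ne: "1\<^sub>R \<noteq> 0\<^sub>R" and c: "c : range (fs_unit R) \<rightarrow> |R|"
  and fin: "finite {b : range (fs_unit R). c b \<noteq> 0\<^sub>R}"
 shows "finsum (fs_mod R) (%b. c b .\<^sub>(fs_mod R) b) {b : range (fs_unit R). c b \<noteq> 0\<^sub>R} j = c (fs_unit R j)"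
proof -
 interpret cring R by fact
 let ?S = "{b : range (fs_unit R). c b \<noteq> 0\<^sub>R}"
 note u = fs_unit_simps[where 'i = 'i, OF R ne]
 interpret F: module R "fs_mod R" by (rule module_fs_mod[OF R])
 have cb: "(%b. c b .\<^sub>(fs_mod R) b) : ?S \<rightarrow> |fs_mod R|"
 proof
  fix b assume "b : ?S"
  then have "c b : |R|" "b : |fs_mod R|" using c u(2) by auto
  then show "c b .\<^sub>(fs_mod R) b : |fs_mod R|" by (rule F.smult_closed)
 qed
 have "finsum (fs_mod R) (%b. c b .\<^sub>(fs_mod R) b) ?S j = finsum R (%b. (c b .\<^sub>(fs_mod R) b) j) ?S"
  by (rule fs_eval[OF R fin cb])
 also have "\<dots> = finsum R (%b. if fs_unit R j = b then c b else 0\<^sub>R) ?S"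
 proof (rule finsum_cong')
  show "(%b. if fs_unit R j = b then c b else 0\<^sub>R) : ?S \<rightarrow> |R|" using c by auto
  fix b assume "b : ?S"
  then obtain i where "b = fs_unit R i" "c b : |R|" using c by auto
  then show "(c b .\<^sub>(fs_mod R) b) j = (if fs_unit R j = b then c b else 0\<^sub>R)"
   using inj_eq[OF u(1), of j i] by (auto simp: fs_unit_def)
 qed simp
 also have "\<dots> = c (fs_unit R j)"
 proof (cases "fs_unit R j : ?S")
  case True
  show ?thesis by (rule add.finprod_singleton[OF True fin]) (use c in auto)
 next
  case False
  then have "finsum R (%b. if fs_unit R j = b then c b else 0\<^sub>R) ?S = finsum R (%b. 0\<^sub>R) ?S"
   by (intro finsum_cong') auto
  then show ?thesis using False by auto
 qed
 finally show ?thesis .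
qed

lemma fs_coord_supp:
 fixes R :: "'a ring" and x :: "'i => 'a"
 assumes "cring R" "1\<^sub>R \<noteq> 0\<^sub>R" "x : |fs_mod R|"
 shows "finite {b : range (fs_unit R). fs_coord R b x \<noteq> 0\<^sub>R}"
proof (rule finite_subset)
 show "{b : range (fs_unit R). fs_coord R b x \<noteq> 0\<^sub>R} \<subseteq> fs_unit R ` {i. x i \<noteq> 0\<^sub>R}"
  using fs_unit_simps(3)[where 'i = 'i, OF assms(1,2)] by auto
qed (use assms(3) in simp)

lemma basis_coord_fs_mod:
 fixes R :: "'a ring"
 assumes R: "cring R" and ne: "1\<^sub>R \<noteq> 0\<^sub>R"
 shows "basis_coord R (fs_mod R :: ('a, 'i => 'a) module) (range (fs_unit R)) (fs_coord R)"
 unfolding basis_coord_def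
proof (intro conjI ballI)
 note u = fs_unit_simps[where 'i = 'i, OF R ne]
 show "range (fs_unit R :: 'i => _) \<subseteq> |fs_mod R|" using u(2) by blast
 show "mod_hom R (fs_mod R) (ring_mod R) (fs_coord R b)" for b
  by (rule mod_homI) (auto simp: fs_coord_def)
 fix x :: "'i => 'a" assume x: "x : |fs_mod R|"
 show fin: "finite {b : range (fs_unit R). fs_coord R b x \<noteq> 0\<^sub>R}" by (rule fs_coord_supp[OF R ne x])
 show "x = finsum (fs_mod R) (%b. fs_coord R b x .\<^sub>(fs_mod R) b) {b : range (fs_unit R). fs_coord R b x \<noteq> 0\<^sub>R}"
 proof
  fix j
  show "x j = finsum (fs_mod R) (%b. fs_coord R b x .\<^sub>(fs_mod R) b) {b : range (fs_unit R). fs_coord R b x \<noteq> 0\<^sub>R} j"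
  proof -
   have "(%b. fs_coord R b x) : range (fs_unit R) \<rightarrow> |R|" using x by (auto simp: fs_coord_def)
   from fs_finsum[OF R ne this fin, of j] show ?thesis unfolding u(3) by (rule sym)
  qed
 qed
qed

lemma free_mod_fs_mod:
 fixes R :: "'a ring"
 assumes R: "cring R" and ne: "1\<^sub>R \<noteq> 0\<^sub>R"
 shows "free_mod R (fs_mod R :: ('a, 'i => 'a) module)"
 unfolding free_mod_def
proof (intro exI[of _ "range (fs_unit R)"] conjI ballI)
 note u = fs_unit_simps[where 'i = 'i, OF R ne]
 note bc = basis_coordD[OF basis_coord_fs_mod[where 'i = 'i, OF R ne]]
 show "range (fs_unit R :: 'i => _) \<subseteq> |fs_mod R|" using u(2) by blast
 fix x :: "'i => 'a" assume x: "x : |fs_mod R|"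
 let ?B = "range (fs_unit R :: 'i => 'i => 'a)"
 let ?c = "\<lambda>b\<in>?B. fs_coord R b x"
 have eq: "{b : ?B. ?c b \<noteq> 0\<^sub>R} = {b : ?B. fs_coord R b x \<noteq> 0\<^sub>R}" by auto
 show "\<exists>!c. c : (\<Pi>\<^sub>E b\<in>?B. |R| ) \<and> finite {b : ?B. c b \<noteq> 0\<^sub>R} \<and>
   x = finsum (fs_mod R) (%b. c b .\<^sub>(fs_mod R) b) {b : ?B. c b \<noteq> 0\<^sub>R}"
 proof (rule ex1I[of _ ?c])
  have c: "?c : (\<Pi>\<^sub>E b\<in>?B. |R| )" using x by (auto simp: fs_coord_def)
  have fin: "finite {b : ?B. ?c b \<noteq> 0\<^sub>R}" unfolding eq by (rule bc(3)[OF x])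
  have "x = finsum (fs_mod R) (%b. ?c b .\<^sub>(fs_mod R) b) {b : ?B. ?c b \<noteq> 0\<^sub>R}"
  proof
   fix j
   have "?c : ?B \<rightarrow> |R|" using c by (simp add: PiE_def)
   from fs_finsum[OF R ne this fin, of j] u(3)[of j x]
   show "x j = finsum (fs_mod R) (%b. ?c b .\<^sub>(fs_mod R) b) {b : ?B. ?c b \<noteq> 0\<^sub>R} j" by simp
  qed
  with c fin show "?c : (\<Pi>\<^sub>E b\<in>?B. |R| ) \<and> finite {b : ?B. ?c b \<noteq> 0\<^sub>R} \<and>
   x = finsum (fs_mod R) (%b. ?c b .\<^sub>(fs_mod R) b) {b : ?B. ?c b \<noteq> 0\<^sub>R}" by blast
 next
  fix c assume c: "c : (\<Pi>\<^sub>E b\<in>?B. |R| ) \<and> finite {b : ?B. c b \<noteq> 0\<^sub>R} \<and>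
   x = finsum (fs_mod R) (%b. c b .\<^sub>(fs_mod R) b) {b : ?B. c b \<noteq> 0\<^sub>R}"
  show "c = ?c"
  proof (rule extensionalityI[of _ ?B])
   fix b assume "b : ?B"
   then obtain j where b: "b = fs_unit R j" by auto
   have "x j = c (fs_unit R j)"
    using c fs_finsum[OF R ne _ conjunct1[OF conjunct2[OF c]], of j] by (auto simp: PiE_def)
   then show "c b = ?c b" using b u(3) by simp
  qed (use c in "auto simp: PiE_def")
 qed
qed

lemma free_mod_zero_mod: "free_mod R zero_mod"
 unfolding free_mod_def by (intro exI[of _ "{}"]) (auto simp: finsum_def finprod_def)

lemma submodule_finsum:
 assumes M: "module R M" and K: "submodule K R M" and S: "finite S" and u: "!!i. i : S ==> u i : K"
 shows "finsum M u S : K"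
 using S u
proof (induct S)
 case empty
 interpret M: module R M by fact
 show ?case using submoduleD(2)[OF M K] by simp
next
 case (insert x S)
 interpret M: module R M by fact
 note k = submoduleD[OF M K]
 show ?case using insert k(1,3) by (subst M.M.finsum_insert) (auto simp: subset_iff)
qed

lemma fs_mod_onto:
 fixes R :: "'a ring" and e :: "'i => 'm"
 assumes R: "cring R" and ne: "1\<^sub>R \<noteq> 0\<^sub>R" and M: "module R M" and K: "submodule K R M"
  and e: "range e = K"
 shows "\<exists>f. mod_hom R (fs_mod R :: ('a, 'i => 'a) module) M f \<and> f ` |fs_mod R| = K"
proof -
 note u = fs_unit_simps[where 'i = 'i, OF R ne] and bc = basis_coord_fs_mod[where 'i = 'i, OF R ne]
 note d = basis_coordD[OF bc]
 note k = submoduleD[OF M K]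
 interpret M: module R M by (rule M)
 let ?B = "range (fs_unit R :: 'i => 'i => 'a)"
 define v where "v b = e (inv_into UNIV (fs_unit R) b)" for b
 have vK: "v b : K" for b using e by (auto simp: v_def)
 define f where "f x = finsum M (%b. fs_coord R b x .\<^sub>M v b) {b : ?B. fs_coord R b x \<noteq> 0\<^sub>R}" for x
 have f: "mod_hom R (fs_mod R) M f" unfolding f_def
  by (rule basis_extend_hom[OF module_fs_mod[OF R] M bc]) (use vK k in auto)
 have "f x : K" if x: "x : |fs_mod R|" for x
  unfolding f_def by (rule submodule_finsum[OF M K d(3)[OF x]]) (use vK k d(5)[OF _ x] in auto)
 moreover have "f (fs_unit R i) = e i" for i
 proof -
  have c: "fs_coord R b (fs_unit R i) = (if b = fs_unit R i then 1\<^sub>R else 0\<^sub>R)" if bB: "b : ?B" for b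
  proof -
   obtain j where b: "b = fs_unit R j" using bB by (rule imageE)
   show ?thesis unfolding b u(3) using inj_eq[OF u(1), of j i] by (simp add: fs_unit_def)
  qed
  have "{b : ?B. fs_coord R b (fs_unit R i) \<noteq> 0\<^sub>R} = {fs_unit R i}"
   using c ne by (auto split: if_splits)
  then have "f (fs_unit R i) = finsum M (%b. fs_coord R b (fs_unit R i) .\<^sub>M v b) {fs_unit R i}" by (simp add: f_def)
  also have "\<dots> = fs_coord R (fs_unit R i) (fs_unit R i) .\<^sub>M v (fs_unit R i)"
   using subsetD[OF k(1) vK, of "fs_unit R i"] c by (subst M.M.finsum_insert) auto
  also have "\<dots> = e i" using vK[of "fs_unit R i"] k c u(1) by (auto simp: v_def)
  finally show ?thesis .
 qed
 ultimately have "f ` |fs_mod R| = K" using u(2) e by (smt (verit) image_iff image_subset_iff subset_antisym subsetI)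
 then show ?thesis using f by blast
qed

text \<open>A finitely supported function is determined by its finite graph, and prefixing an index with a
 value turns a point of the graph into an index.\<close>

lemma fs_mod_lepoll:
 fixes R :: "'a ring"
 shows "|fs_mod R :: ('a, ('a, 'n) free_elt) module| \<lesssim> (UNIV :: (nat + 'a + 'n) list set)"
proof -
 let ?C = "|fs_mod R :: ('a, ('a, 'n) free_elt) module|"
 let ?g = "%f :: ('a, 'n) free_elt. (%i. Inr (Inl (f i)) # i) ` {i. f i \<noteq> 0\<^sub>R}"
 have "inj_on ?g ?C"
 proof (rule inj_onI, rule ext, rule ccontr)
  fix f h i assume eq: "?g f = ?g h" and ne: "f i \<noteq> h i"
  have *: "f i = h i" if "?g f = ?g h" "f i \<noteq> 0\<^sub>R" for f h
  proof -
   have "Inr (Inl (f i)) # i : ?g f" using that(2) by auto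
   then have "Inr (Inl (f i)) # i : ?g h" using that(1) by simp
   then show ?thesis by auto
  qed
  show False using *[OF eq] *[OF eq[symmetric]] ne by metis
 qed
 moreover have "?g ` ?C \<subseteq> Fpow UNIV" by (auto simp: Fpow_def)
 ultimately have "?C \<lesssim> Fpow (UNIV :: (nat + 'a + 'n) list set)" by (auto simp: lepoll_def)
 also have "\<dots> \<approx> (UNIV :: (nat + 'a + 'n) list set)"
  by (rule eqpoll_Fpow) (rule infinite_UNIV_listI)
 finally show ?thesis .
qed

lemma resolution_step:
 fixes R :: "'a ring"
 assumes R: "cring R" and ne: "1\<^sub>R \<noteq> 0\<^sub>R"
  and K: "submodule K R (fs_mod R :: ('a, ('a, 'n) free_elt) module)"
 shows "\<exists>f. mod_hom R (fs_mod R :: ('a, ('a, 'n) free_elt) module) (fs_mod R :: ('a, ('a, 'n) free_elt) module) f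
  \<and> f ` |fs_mod R| = K"
proof -
 note k = submoduleD[OF module_fs_mod[OF R] K]
 have "K \<lesssim> (UNIV :: (nat + 'a + 'n) list set)"
  by (rule lepoll_trans[OF subset_imp_lepoll[OF k(1)] fs_mod_lepoll])
 then obtain g :: "(nat + 'a + 'n) list => ('a, 'n) free_elt" where g: "K \<subseteq> range g"
  by (auto simp: lepoll_iff)
 let ?e = "%i. if g i : K then g i else 0\<^sub>(fs_mod R)"
 have "range ?e = K" using g k(2) by (auto simp: image_iff subset_iff)
 then show ?thesis by (rule fs_mod_onto[OF R ne module_fs_mod[OF R] K])
qed

lemma free_resolution_exists:
 fixes R :: "'a ring" and N :: "('a, 'n) module"
 assumes R: "cring R" and ne: "1\<^sub>R \<noteq> 0\<^sub>R" and N: "module R N"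
 shows "\<exists>F :: ('a, ('a, 'n) free_elt) cpx. free_resolution R N F"
proof -
 let ?L = "fs_mod R :: ('a, ('a, 'n) free_elt) module"
 have L: "module R ?L" by (rule module_fs_mod[OF R])
 interpret N: module R N by (rule N)
 interpret L: module R ?L by (rule L)
 let ?e = "%i :: (nat + 'a + 'n) list. case i of [Inr (Inr x)] => if x : |N| then x else 0\<^sub>N | _ => 0\<^sub>N"
 have "range ?e = |N|"
 proof
  show "range ?e \<subseteq> |N|" by (auto split: list.splits sum.splits)
  show "|N| \<subseteq> range ?e"
  proof
   fix x assume "x : |N|"
   then have "x = ?e [Inr (Inr x)]" by simp
   then show "x : range ?e" by (rule range_eqI)
  qed
 qed
 from fs_mod_onto[OF R ne N N.carrier_is_submodule this]
 obtain ep where ep: "mod_hom R ?L N ep" "ep ` |?L| = |N|" by blast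
 define ker where "ker f = {x : |?L|. f x = 0\<^sub>?L}" for f :: "('a, 'n) free_elt => ('a, 'n) free_elt"
 have "\<exists>d. \<forall>i. ((i = 0 \<longrightarrow> d i ` |?L| = {x : |?L|. ep x = 0\<^sub>N}) \<and> mod_hom R ?L ?L (d i)) \<and>
   d (Suc i) ` |?L| = ker (d i)"
 proof (rule dependent_nat_choice)
  show "\<exists>x. (0 = 0 \<longrightarrow> x ` |?L| = {x : |?L|. ep x = 0\<^sub>N}) \<and> mod_hom R ?L ?L x"
  proof -
   obtain y where "mod_hom R ?L ?L y" "y ` |?L| = {x : |?L|. ep x = 0\<^sub>N}"
    using resolution_step[OF R ne submodule_kernel[OF L N ep(1)]] by (elim exE conjE)
   then show ?thesis by (intro exI[of _ y] conjI impI)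
  qed
 next
  fix d and i :: nat assume "(i = 0 \<longrightarrow> d ` |?L| = {x : |?L|. ep x = 0\<^sub>N}) \<and> mod_hom R ?L ?L d"
  then have d: "mod_hom R ?L ?L d" by blast
  show "\<exists>y. ((Suc i = 0 \<longrightarrow> y ` |?L| = {x : |?L|. ep x = 0\<^sub>N}) \<and> mod_hom R ?L ?L y) \<and>
   y ` |?L| = ker d"
  proof -
   obtain y where "mod_hom R ?L ?L y" "y ` |?L| = ker d"
    using resolution_step[OF R ne submodule_kernel[OF L L d]] unfolding ker_def by (elim exE conjE)
   then show ?thesis by (intro exI[of _ y] conjI impI) (assumption | erule Suc_neq_Zero)+
  qed
 qed
 then obtain d where D: "\<forall>i. ((i = 0 \<longrightarrow> d i ` |?L| = {x : |?L|. ep x = 0\<^sub>N}) \<and>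
   mod_hom R ?L ?L (d i)) \<and> d (Suc i) ` |?L| = ker (d i)" by (rule exE)
 have d0: "d 0 ` |?L| = {x : |?L|. ep x = 0\<^sub>N}"
  by (rule D[THEN spec, THEN conjunct1, THEN conjunct1, THEN mp, OF refl])
 have dh: "mod_hom R ?L ?L (d i)" for i by (rule D[THEN spec, THEN conjunct1, THEN conjunct2])
 have dS: "d (Suc i) ` |?L| = ker (d i)" for i by (rule D[THEN spec, THEN conjunct2])
 define F :: "('a, ('a, 'n) free_elt) cpx" where
  "F = \<lparr>obj = (%n. if n < 0 then zero_mod else ?L),
    dif = (%n x. if n \<le> 0 then undefined else d (nat (n - 1)) x)\<rparr>"
 have objF: "obj F n = (if n < 0 then zero_mod else ?L)" for n by (simp add: F_def)
 have difF: "dif F n = (if n \<le> 0 then (%_. undefined) else d (nat (n - 1)))" for n by (auto simp: F_def)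
 have Fc: "is_cpx R F" unfolding is_cpx_def
 proof (intro allI conjI ballI)
  fix n
  show "module R (obj F n)" by (simp add: objF L module_zero_mod[OF R])
  show "mod_hom R (obj F n) (obj F (n - 1)) (dif F n)"
   using dh by (auto simp: objF difF mod_hom_def)
  fix x assume x: "x : |obj F n|"
  show "dif F (n - 1) (dif F n x) = 0\<^sub>(obj F (n - 2))"
  proof (cases "n \<ge> 2")
   case True
   then have e: "nat (n - 1) = Suc (nat (n - 2))" "nat (n - 1 - 1) = nat (n - 2)" by simp_all
   have "d (Suc (nat (n - 2))) x : ker (d (nat (n - 2)))" using x True dS[of "nat (n - 2)"] by (auto simp: objF)
   then show ?thesis using True e by (simp add: objF difF ker_def)
  next
   case False
   then show ?thesis by (auto simp: objF difF)
  qed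
 qed
 define f where "f n = (if n = 0 then ep else (%_. undefined))" for n :: int
 have ch: "chain_map R F (mod_cpx N) f" unfolding chain_map_def
 proof (intro allI conjI ballI)
  fix n
  show "mod_hom R (obj F n) (obj (mod_cpx N) n) (f n)"
   using ep(1) by (cases "n = 0") (auto simp: f_def objF mod_hom_def)
  fix x assume x: "x : |obj F n|"
  show "f (n - 1) (dif F n x) = dif (mod_cpx N) n (f n x)"
  proof (cases "n = 1")
   case True
   then have "dif F n x : d 0 ` |?L|" using x by (auto simp: objF difF)
   then show ?thesis using True d0 by (simp add: f_def)
  next
   case False
   then show ?thesis by (simp add: f_def)
  qed
 qed
 have Nc: "is_cpx R (mod_cpx N)" by (rule is_cpx_mod_cpx[OF N])
 note cN = mod_cpx_cycles[OF N]
 have b: "boundaries F n = (if n < 0 then {undefined} else d (nat n) ` |?L| )" for n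
  by (auto simp: boundaries_def objF difF)
 have zF: "0\<^sub>(obj F n) : cycles F n" for n
  by (rule submoduleD(2)[OF is_cpxD(1)[OF Fc] cycles_boundaries(1)[OF Fc]])
 have "quasi_iso R F (mod_cpx N) f"
  unfolding quasi_iso_iff[OF Fc Nc ch]
 proof (intro allI conjI ballI impI)
  fix n z assume z: "z : cycles F n" and fz: "f n z : boundaries (mod_cpx N) n"
  consider "n < 0" | "n = 0" | "n > 0" by linarith
  then show "z : boundaries F n"
  proof cases
   case 1 then show ?thesis using z by (auto simp: b cycles_def objF)
  next
   case 2 then show ?thesis using z fz d0 by (auto simp: b cycles_def objF f_def cN)
  next
   case 3
   then have "nat n = Suc (nat (n - 1))" by simp
   then show ?thesis using 3 z dS[of "nat (n - 1)"] by (auto simp: b cycles_def objF difF ker_def)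
  qed
 next
  fix n w assume w: "w : cycles (mod_cpx N) n"
  show "\<exists>z\<in>cycles F n. w -\<^sub>(obj (mod_cpx N) n) f n z : boundaries (mod_cpx N) n"
  proof (cases "n = 0")
   case True
   then have "w : ep ` |?L|" using w ep(2) by (simp only: cN mod_cpx_simps)
   then obtain z where z: "ep z = w" "z : |?L|" by (rule imageE) simp
   have "z : cycles F 0" using z by (simp add: cycles_def objF difF)
   then show ?thesis using True z w by (intro bexI[of _ z]) (auto simp: f_def cN a_minus_def N.M.r_neg)
  next
   case False
   have "w -\<^sub>(obj (mod_cpx N) n) f n 0\<^sub>(obj F n) : cycles (mod_cpx N) n"
    unfolding cN(1) using w mod_homD(1)[OF chain_mapD(1)[OF ch] modD(2)[OF is_cpxD(1)[OF Fc]]]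
    by (intro modD(18)[OF is_cpxD(1)[OF Nc]]) (auto simp: cN(1))
   then show ?thesis using zF cN(3)[OF False] by (auto simp: exact_at_def)
  qed
 qed
 then have "free_resolution R N F" unfolding free_resolution_def
  using Fc free_mod_fs_mod[OF R ne] free_mod_zero_mod by (auto simp: objF)
 then show ?thesis by blast
qed

lemma resolution:
 fixes R :: "'a ring" and N :: "('a, 'n) module"
 assumes "cring R" "1\<^sub>R \<noteq> 0\<^sub>R" "module R N"
 shows "free_resolution R N (resolution R N)"
 unfolding resolution_def by (rule someI_ex[OF free_resolution_exists[OF assms]])

section \<open>Multiplication by an element that acts bijectively on the homology\<close>

definition cone :: "'a ring => 'a => ('a, 'm) cpx => ('a, 'm \<times> 'm) cpx" where
 "cone R s F = \<lparr>
   obj = (%n. mk_mod ( |obj F (n - 1)| \<times> |obj F n| ) (0\<^sub>(obj F (n - 1)), 0\<^sub>(obj F n))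
    (%(x, y) (x', y'). (x +\<^sub>(obj F (n - 1)) x', y +\<^sub>(obj F n) y'))
    (%r (x, y). (r .\<^sub>(obj F (n - 1)) x, r .\<^sub>(obj F n) y))),
   dif = (%n (x, y). ((-\<^sub>R 1\<^sub>R) .\<^sub>(obj F (n - 2)) dif F (n - 1) x,
    s .\<^sub>(obj F (n - 1)) x +\<^sub>(obj F (n - 1)) dif F n y))\<rparr>"

lemma cone_simps:
 "|obj (cone R s F) n| = |obj F (n - 1)| \<times> |obj F n|"
 "0\<^sub>(obj (cone R s F) n) = (0\<^sub>(obj F (n - 1)), 0\<^sub>(obj F n))"
 "(x, y) +\<^sub>(obj (cone R s F) n) (x', y') = (x +\<^sub>(obj F (n - 1)) x', y +\<^sub>(obj F n) y')"
 "r .\<^sub>(obj (cone R s F) n) (x, y) = (r .\<^sub>(obj F (n - 1)) x, r .\<^sub>(obj F n) y)"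
 "dif (cone R s F) n (x, y) = ((-\<^sub>R 1\<^sub>R) .\<^sub>(obj F (n - 2)) dif F (n - 1) x,
   s .\<^sub>(obj F (n - 1)) x +\<^sub>(obj F (n - 1)) dif F n y)"
 by (simp_all add: cone_def)

lemma is_cpx_cone:
 fixes R :: "'a ring"
 assumes F: "is_cpx R F" and s: "s : |R|"
 shows "is_cpx R (cone R s F)"
proof -
 note dF = is_cpxD[OF F]
 note m = modD[OF dF(1)]
 interpret R: cring R by (rule m(13))
 have d1: "mod_hom R (obj F (n - 1)) (obj F (n - 2)) (dif F (n - 1))" for n using dF(2)[of "n - 1"] by simp
 have M: "module R (obj (cone R s F) n)" for n
 proof (rule modI, goal_cases)
  case 1 show ?case by (rule R.is_cring)
 next
  case (4 x y z) then show ?case by (auto simp: cone_simps m(3))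
 next
  case (5 x y) then show ?case by (auto simp: cone_simps m(4))
 next
  case (7 x)
  then show ?case
   by (intro bexI[of _ "(-\<^sub>(obj F (n - 1)) fst x, -\<^sub>(obj F n) snd x)"]) (auto simp: cone_simps m)
 qed (auto simp: cone_simps m)
 have neg: "-\<^sub>R 1\<^sub>R : |R|" by simp
 have lin: "mod_hom R (obj (cone R s F) n) (obj (cone R s F) (n - 1)) (dif (cone R s F) n)" for n
 proof -
  let ?P = "obj (cone R s F) n"
  have e: "n - 1 - 1 = n - 2" by simp
  have f: "mod_hom R ?P (obj F (n - 1)) fst" "mod_hom R ?P (obj F n) snd"
   by (auto simp: mod_hom_def cone_simps)
  have 1: "mod_hom R ?P (obj F (n - 2)) (%u. (-\<^sub>R 1\<^sub>R) .\<^sub>(obj F (n - 2)) dif F (n - 1) (fst u))"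
   by (intro mod_hom_smult_fun dF(1) neg mod_hom_comp[OF f(1) d1])
  have 2: "mod_hom R ?P (obj F (n - 1)) (%u. s .\<^sub>(obj F (n - 1)) fst u +\<^sub>(obj F (n - 1)) dif F n (snd u))"
   by (intro mod_hom_add_fun mod_hom_smult_fun dF(1) s f(1) mod_hom_comp[OF f(2) dF(2)])
  have D: "dif (cone R s F) n = (%u. ((-\<^sub>R 1\<^sub>R) .\<^sub>(obj F (n - 2)) dif F (n - 1) (fst u),
    s .\<^sub>(obj F (n - 1)) fst u +\<^sub>(obj F (n - 1)) dif F n (snd u)))"
   by (auto simp: cone_def)
  show ?thesis unfolding D
   by (rule mod_homI) (use mod_homD[OF 1] mod_homD[OF 2] in "simp_all add: cone_simps e")
 qed
 have "dif (cone R s F) (n - 1) (dif (cone R s F) n u) = 0\<^sub>(obj (cone R s F) (n - 2))"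
  if u: "u : |obj (cone R s F) n|" for n u
 proof -
  obtain x y where u': "u = (x, y)" "x : |obj F (n - 1)|" "y : |obj F n|"
   using u by (auto simp: cone_simps)
  have e: "n - 1 - 1 = n - 2" "n - 1 - 2 = n - 3" "n - 2 - 1 = n - 3" by simp_all
  interpret F2: module R "obj F (n - 2)" by (rule dF)
  interpret F3: module R "obj F (n - 3)" by (rule dF)
  have dx: "dif F (n - 1) x : |obj F (n - 2)|" using mod_homD(1)[OF d1 u'(2)] .
  have ddx: "dif F (n - 2) (dif F (n - 1) x) = 0\<^sub>(obj F (n - 3))" using dF(3)[OF u'(2)] by (simp add: e)
  have d2: "mod_hom R (obj F (n - 2)) (obj F (n - 3)) (dif F (n - 2))" using dF(2)[of "n - 2"] by (simp add: e)
  have dy: "dif F n y : |obj F (n - 1)|" using mod_homD(1)[OF dF(2) u'(3)] .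
  have ddy: "dif F (n - 1) (dif F n y) = 0\<^sub>(obj F (n - 2))" using dF(3)[OF u'(3)] .
  have "dif F (n - 1) (s .\<^sub>(obj F (n - 1)) x +\<^sub>(obj F (n - 1)) dif F n y) = s .\<^sub>(obj F (n - 2)) dif F (n - 1) x"
   using mod_homD(2)[OF d1 m(8)[OF s u'(2)] dy] mod_homD(3)[OF d1 s u'(2)] ddy s dx by simp
  moreover have "s .\<^sub>(obj F (n - 2)) ((-\<^sub>R 1\<^sub>R) .\<^sub>(obj F (n - 2)) dif F (n - 1) x) +\<^sub>(obj F (n - 2))
    s .\<^sub>(obj F (n - 2)) dif F (n - 1) x = 0\<^sub>(obj F (n - 2))"
   using s dx by (simp add: F2.uminus_smult[symmetric] F2.smult_r_minus F2.M.l_neg)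
  ultimately show ?thesis
   using mod_homD(3)[OF d2 neg dx] ddx unfolding u'(1) cone_simps e by simp
 qed
 then show ?thesis unfolding is_cpx_def using M lin by blast
qed

lemma acyclic_cone:
 fixes R :: "'a ring"
 assumes F: "is_cpx R F" and s: "s : |R|"
  and inj: "!!n z. z : cycles F n ==> s .\<^sub>(obj F n) z : boundaries F n ==> z : boundaries F n"
  and surj: "!!n w. w : cycles F n ==> \<exists>z\<in>cycles F n. w -\<^sub>(obj F n) s .\<^sub>(obj F n) z : boundaries F n"
 shows "acyclic (cone R s F)"
 unfolding acyclic_def exact_at_def
proof safe
 fix n x y assume "(x, y) : cycles (cone R s F) n"
 note dF = is_cpxD[OF F]
 note m = modD[OF dF(1)]
 interpret F0: module R "obj F n" by (rule dF)
 interpret F1: module R "obj F (n - 1)" by (rule dF)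
 interpret F2: module R "obj F (n - 2)" by (rule dF)
 have d1: "mod_hom R (obj F (n - 1)) (obj F (n - 2)) (dif F (n - 1))" using dF(2)[of "n - 1"] by simp
 have e: "n - 1 - 1 = n - 2" "n - 1 + 1 = n" by simp_all
 have x: "x : |obj F (n - 1)|" and y: "y : |obj F n|"
  and ndx: "(-\<^sub>R 1\<^sub>R) .\<^sub>(obj F (n - 2)) dif F (n - 1) x = 0\<^sub>(obj F (n - 2))"
  and sx: "s .\<^sub>(obj F (n - 1)) x +\<^sub>(obj F (n - 1)) dif F n y = 0\<^sub>(obj F (n - 1))"
  using \<open>(x, y) \<in> _\<close> by (auto simp: cycles_def cone_simps e)
 have dxc: "dif F (n - 1) x : |obj F (n - 2)|" using mod_homD(1)[OF d1 x] .
 have dx: "dif F (n - 1) x = 0\<^sub>(obj F (n - 2))"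
 proof -
  have "-\<^sub>(obj F (n - 2)) dif F (n - 1) x = 0\<^sub>(obj F (n - 2))"
   using ndx dxc by (simp add: F2.uminus_smult)
  then show ?thesis using F2.M.l_neg[OF dxc] dxc by simp
 qed
 have dyc: "dif F n y : |obj F (n - 1)|" using mod_homD(1)[OF dF(2) y] .
 have "x : cycles F (n - 1)" using x dx by (simp add: cycles_def e)
 moreover have "s .\<^sub>(obj F (n - 1)) x = dif F n (-\<^sub>(obj F n) y)"
  using mod_hom_neg[OF dF(1) dF(1) dF(2) y] sx s x dyc F1.M.minus_equality[OF sx] by simp
 then have "s .\<^sub>(obj F (n - 1)) x : boundaries F (n - 1)" using y by (simp add: boundaries_def e)
 ultimately have "x : boundaries F (n - 1)" by (rule inj)
 then obtain x' where x': "x' : |obj F n|" "x = dif F n x'" by (auto simp: boundaries_def)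
 let ?w = "y +\<^sub>(obj F n) s .\<^sub>(obj F n) x'"
 have "dif F n ?w = dif F n y +\<^sub>(obj F (n - 1)) s .\<^sub>(obj F (n - 1)) x"
  using mod_homD(2)[OF dF(2) y, of "s .\<^sub>(obj F n) x'"] mod_homD(3)[OF dF(2) s x'(1)] x' s by simp
 then have wc: "?w : cycles F n" using sx x' y s x dyc by (simp add: cycles_def F1.M.a_comm)
 from surj[OF this] obtain z v where z: "z : cycles F n" "v : |obj F (n + 1)|"
  and v: "?w -\<^sub>(obj F n) s .\<^sub>(obj F n) z = dif F (n + 1) v" by (auto simp: boundaries_def)
 have zc: "z : |obj F n|" "dif F n z = 0\<^sub>(obj F (n - 1))" using z by (auto simp: cycles_def)
 let ?u = "z +\<^sub>(obj F n) -\<^sub>(obj F n) x'"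
 have "dif F n ?u = -\<^sub>(obj F (n - 1)) x"
  using mod_homD(2)[OF dF(2) zc(1), of "-\<^sub>(obj F n) x'"] mod_hom_neg[OF dF(1) dF(1) dF(2) x'(1)] zc x' x by simp
 then have 1: "(-\<^sub>R 1\<^sub>R) .\<^sub>(obj F (n - 1)) dif F n ?u = x"
  using x by (simp add: F1.uminus_smult[symmetric])
 have 2: "s .\<^sub>(obj F n) ?u +\<^sub>(obj F n) dif F (n + 1) v = y"
  unfolding v[symmetric] a_minus_def using zc x' y s
  by (simp add: F0.smult_r_distr F0.smult_r_minus F0.M.a_ac F0.M.ab_cancel)
 have "n + 1 - 2 = n - 1" by simp
 then have "dif (cone R s F) (n + 1) (?u, v) = (x, y)" unfolding cone_simps using 1 2 by simp
 moreover have "(?u, v) : |obj (cone R s F) (n + 1)|" using zc x' z by (simp add: cone_simps)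
 ultimately show "(x, y) : boundaries (cone R s F) n" unfolding boundaries_def by (metis image_eqI)
qed

text \<open>
 Multiplication by \<open>s\<close> on a bounded below complex of free modules has an inverse \<open>g\<close> up to
 homotopy if it is bijective on homology: the inclusion of \<open>F\<close> into the acyclic cone of \<open>s\<close> is
 homotopic to zero, and \<open>g\<close> and \<open>h\<close> are the two components of a homotopy.
\<close>

lemma homotopy_inverse_of_smult:
 fixes R :: "'a ring" and F :: "('a, 'm) cpx"
 assumes bf: "bounded_free R F" and s: "s : |R|"
  and inj: "!!n z. z : cycles F n ==> s .\<^sub>(obj F n) z : boundaries F n ==> z : boundaries F n"
  and surj: "!!n w. w : cycles F n ==> \<exists>z\<in>cycles F n. w -\<^sub>(obj F n) s .\<^sub>(obj F n) z : boundaries F n"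
 shows "\<exists>g h. (\<forall>i. mod_hom R (obj F i) (obj F i) (g i)) \<and> (\<forall>i. mod_hom R (obj F i) (obj F (i + 1)) (h i)) \<and>
  (\<forall>i. \<forall>x\<in>|obj F i|. dif F i (g i x) = g (i - 1) (dif F i x)) \<and>
  (\<forall>i. \<forall>x\<in>|obj F i|. x = s .\<^sub>(obj F i) g i x +\<^sub>(obj F i)
    (dif F (i + 1) (h i x) +\<^sub>(obj F i) h (i - 1) (dif F i x)))"
proof -
 have F: "is_cpx R F" using bf by (simp add: bounded_free_def)
 let ?C = "cone R s F"
 have C: "is_cpx R ?C" by (rule is_cpx_cone[OF F s])
 have ac: "acyclic (hom_cpx R F ?C)"
  by (rule hom_cpx_acyclic[OF bf C acyclic_cone[OF F s inj surj]])
 note dF = is_cpxD[OF F]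
 note m = modD[OF dF(1)]
 interpret R: cring R by (rule m(13))
 note sgs = sg_simps[OF R.is_cring]
 let ?H = "hom_cpx R F ?C"
 define ph where "ph i = (\<lambda>x\<in>|obj F i|. (0\<^sub>(obj F (i - 1)), x))" for i
 have ph: "ph : |obj ?H 0|"
  unfolding hom_cpx_carrier ph_def
  by (auto simp: mod_hom_def cone_simps m)
 have "ph : cycles ?H 0"
  unfolding hom_cpx_cycle_iff[OF F C ph]
 proof (intro allI ballI)
  fix i x assume x: "x : |obj F i|"
  have dx: "dif F i x : |obj F (i - 1)|" using mod_homD(1)[OF dF(2) x] .
  have e: "i - 1 - 1 = i - 2" by simp
  have d1: "mod_hom R (obj F (i - 1)) (obj F (i - 2)) (dif F (i - 1))" using dF(2)[of "i - 1"] by simp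
  show "dif ?C (i + 0) (ph i x) = sg R 0 .\<^sub>(obj ?C (i + 0 - 1)) ph (i - 1) (dif F i x)"
   using x dx mod_hom_zero[OF dF(1) dF(1) d1] s
   by (simp add: ph_def cone_simps m sgs(5) e)
 qed
 then have "ph : boundaries ?H 0" using ac by (auto simp: acyclic_def exact_at_def)
 then obtain K where K: "K : |obj ?H 1|" "dif ?H 1 K = ph" by (auto simp: boundaries_def)
 have KK: "mod_hom R (obj F i) (obj ?C (i + 1)) (K i)" for i using K(1) unfolding hom_cpx_carrier by blast
 define g where "g i x = fst (K i x)" for i x
 define h where "h i x = snd (K i x)" for i x
 have Kp: "K i x = (g i x, h i x)" for i x by (simp add: g_def h_def)
 have e1: "i + 1 - 1 = i" for i :: int by simp
 have g: "mod_hom R (obj F i) (obj F i) (g i)" for i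
  using KK[of i] unfolding mod_hom_def by (auto simp: Pi_def cone_simps Kp)
 have h: "mod_hom R (obj F i) (obj F (i + 1)) (h i)" for i
  using KK[of i] unfolding mod_hom_def by (auto simp: Pi_def cone_simps Kp)
 have main: "dif F i (g i x) = g (i - 1) (dif F i x)"
  "x = s .\<^sub>(obj F i) g i x +\<^sub>(obj F i) (dif F (i + 1) (h i x) +\<^sub>(obj F i) h (i - 1) (dif F i x))"
  if x: "x : |obj F i|" for i x
 proof -
  interpret F0: module R "obj F i" by (rule dF)
  interpret F1: module R "obj F (i - 1)" by (rule dF)
  have dx: "dif F i x : |obj F (i - 1)|" using mod_homD(1)[OF dF(2) x] .
  have v: "g i x : |obj F i|" "h i x : |obj F (i + 1)|"
   "g (i - 1) (dif F i x) : |obj F (i - 1)|" "h (i - 1) (dif F i x) : |obj F i|"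
   using mod_homD(1)[OF g x] mod_homD(1)[OF h x] mod_homD(1)[OF g dx] mod_homD(1)[OF h dx] by simp_all
  have dv: "dif F i (g i x) : |obj F (i - 1)|" "dif F (i + 1) (h i x) : |obj F i|"
   using mod_homD(1)[OF dF(2) v(1)] mod_homD(1)[OF dF(4) v(2)] .
  have e: "i + 1 - 2 = i - 1" "i + 1 - 1 = i" by simp_all
  have sg1: "-\<^sub>R sg R 1 = 1\<^sub>R" by (simp add: sg_def)
  have "(0\<^sub>(obj F (i - 1)), x) = dif ?H 1 K i x" using K(2) x by (simp add: ph_def)
  also have "\<dots> = dif ?C (i + 1) (K i x) +\<^sub>(obj ?C (i + 1 - 1)) (-\<^sub>R sg R 1) .\<^sub>(obj ?C (i + 1 - 1)) K (i - 1) (dif F i x)"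
   by (rule hom_cpx_dif[OF F C K(1) x])
  finally have eq: "0\<^sub>(obj F (i - 1)) = (-\<^sub>R 1\<^sub>R) .\<^sub>(obj F (i - 1)) dif F i (g i x) +\<^sub>(obj F (i - 1)) g (i - 1) (dif F i x)"
   "x = (s .\<^sub>(obj F i) g i x +\<^sub>(obj F i) dif F (i + 1) (h i x)) +\<^sub>(obj F i) h (i - 1) (dif F i x)"
   using v by (simp_all add: Kp cone_simps e sg1)
  show "x = s .\<^sub>(obj F i) g i x +\<^sub>(obj F i) (dif F (i + 1) (h i x) +\<^sub>(obj F i) h (i - 1) (dif F i x))"
   using eq(2) v dv s by (simp add: F0.M.a_assoc)
  have "-\<^sub>(obj F (i - 1)) dif F i (g i x) +\<^sub>(obj F (i - 1)) g (i - 1) (dif F i x) = 0\<^sub>(obj F (i - 1))"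
   using eq(1) dv by (simp add: F1.uminus_smult)
  then show "dif F i (g i x) = g (i - 1) (dif F i x)"
   using F1.M.ab_cancel(5)[OF dv(1) v(3)] dv(1) by simp
 qed
 show ?thesis using g h main by blast
qed

section \<open>Tensor products\<close>

lemma (in abelian_group) minus_eq_zeroD:
 assumes "x \<ominus> y = \<zero>" "x : |G|" "y : |G|" shows "x = y"
proof -
 have "x = (x \<ominus> y) \<oplus> y" using assms(2,3) by (simp add: a_minus_def a_assoc l_neg)
 then show ?thesis using assms by simp
qed

abbreviation frag_carrier :: "('a, 'm) module => ('a, 'n) module => (('m \<times> 'n) \<Rightarrow>\<^sub>0 int) set" where
 "frag_carrier M N \<equiv> {c. Poly_Mapping.keys c \<subseteq> |M| \<times> |N|}"

lemma tensor_pre_simps: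
 "|tensor_pre M N| = frag_carrier M N" "0\<^sub>(tensor_pre M N) = 0"
 "x +\<^sub>(tensor_pre M N) y = x + y"
 "r .\<^sub>(tensor_pre M N) c = frag_extend (%(x, y). frag_of (r .\<^sub>M x, y)) c"
 by (auto simp: tensor_pre_def)

lemma (in module_mod) Q_neg: "x : |M| ==> -\<^sub>Q cls x = cls (-\<^sub>M x)"
proof -
 assume x: "x : |M|"
 interpret Q: module R Q by (rule Q_module)
 show ?thesis by (rule Q.M.minus_equality) (use x in "simp_all add: Q_add Q_zero(1) Q_carrier M.l_neg")
qed

lemma abelian_group_tensor_pre: "abelian_group (tensor_pre M N)"
proof (rule abelian_groupI)
 fix x assume "x : |tensor_pre M N|"
 then show "\<exists>y\<in>|tensor_pre M N|. y +\<^sub>(tensor_pre M N) x = 0\<^sub>(tensor_pre M N)"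
  by (intro bexI[of _ "- x"]) (auto simp: tensor_pre_simps)
qed (use keys_add in "fastforce simp: tensor_pre_simps algebra_simps")+

lemma tensor_pre_neg: "x : frag_carrier M N ==> -\<^sub>(tensor_pre M N) x = - x"
proof -
 assume x: "x : frag_carrier M N"
 interpret abelian_group "tensor_pre M N" by (rule abelian_group_tensor_pre)
 show ?thesis by (rule minus_equality) (use x in "auto simp: tensor_pre_simps")
qed

lemma tensor_pre_minus: "x : frag_carrier M N ==> y : frag_carrier M N ==> x -\<^sub>(tensor_pre M N) y = x - y"
 by (simp add: a_minus_def tensor_pre_neg tensor_pre_simps)

lemma frag_carrier_closed:
 "0 : frag_carrier M N" "a : frag_carrier M N ==> b : frag_carrier M N ==> a + b : frag_carrier M N"
 "a : frag_carrier M N ==> b : frag_carrier M N ==> a - b : frag_carrier M N"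
 "x : |M| ==> y : |N| ==> frag_of (x, y) : frag_carrier M N"
 using keys_add[of a b] keys_diff[of a b] by auto

lemma tensor_rels_carrier:
 assumes "module R M" "module R N" shows "tensor_rels R M N \<subseteq> frag_carrier M N"
proof -
 interpret M: module R M by fact
 interpret N: module R N by fact
 show ?thesis unfolding tensor_rels_def
  by (intro Un_least subsetI; elim CollectE exE conjE; simp only:; intro frag_carrier_closed) auto
qed

lemma tensor_null_closed:
 assumes "module R M" "module R N"
 shows "tensor_null R M N \<subseteq> frag_carrier M N" "0 : tensor_null R M N"
  "a : tensor_null R M N ==> b : tensor_null R M N ==> a + b : tensor_null R M N"
  "a : tensor_null R M N ==> - a : tensor_null R M N"
  "a : tensor_null R M N ==> b : tensor_null R M N ==> a - b : tensor_null R M N"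
  "a : tensor_rels R M N ==> a : tensor_null R M N"
proof -
 have sg: "subgroup (tensor_null R M N) (free_Abelian_group ( |M| \<times> |N| ))"
  unfolding tensor_null_def
  by (rule group.generate_is_subgroup) (use tensor_rels_carrier[OF assms] in auto)
 show sub: "tensor_null R M N \<subseteq> frag_carrier M N"
  using subgroup.subset[OF sg] by (auto simp: free_Abelian_group_def)
 show "0 : tensor_null R M N" using subgroup.one_closed[OF sg] by simp
 show add: "a : tensor_null R M N ==> b : tensor_null R M N ==> a + b : tensor_null R M N" for a b
  using subgroup.m_closed[OF sg] by simp
 show neg: "a : tensor_null R M N ==> - a : tensor_null R M N" for a
  using subgroup.m_inv_closed[OF sg, of a] sub by auto
 show "a : tensor_null R M N ==> b : tensor_null R M N ==> a - b : tensor_null R M N"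
  using add[OF _ neg, of a b] by simp
 show "a : tensor_rels R M N ==> a : tensor_null R M N"
  unfolding tensor_null_def by (rule generate.incl)
qed

lemma tensor_null_subgroup:
 assumes "module R M" "module R N"
 shows "additive_subgroup (tensor_null R M N) (tensor_pre M N)"
proof (rule additive_subgroupI, rule subgroup.intro)
 note nl = tensor_null_closed[OF assms]
 show "tensor_null R M N \<subseteq> |add_monoid (tensor_pre M N)|" using nl(1) by (simp add: tensor_pre_simps)
 show "1\<^sub>(add_monoid (tensor_pre M N)) : tensor_null R M N" using nl(2) by (simp add: tensor_pre_simps)
 fix x y assume x: "x : tensor_null R M N"
 show "inv\<^bsub>add_monoid (tensor_pre M N)\<^esub> x : tensor_null R M N"
  using nl(4)[OF x] tensor_pre_neg[of x M N] subsetD[OF nl(1) x] unfolding a_inv_def by simp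
 assume "y : tensor_null R M N"
 then show "x \<otimes>\<^sub>(add_monoid (tensor_pre M N)) y : tensor_null R M N"
  using nl(3)[OF x] by (simp add: tensor_pre_simps)
qed

lemma frag_extend_null:
 assumes M: "module R M" and N: "module R N"
  and B0: "0 : B" and Bd: "!!a b. a : B ==> b : B ==> a - b : B"
  and rels: "!!a. a : tensor_rels R M N ==> frag_extend f a : B"
  and c: "c : tensor_null R M N"
 shows "frag_extend f c : B"
proof -
 have Bn: "- a : B" if "a : B" for a using Bd[OF B0 that] by simp
 have Ba: "a + b : B" if "a : B" "b : B" for a b using Bd[OF that(1) Bn[OF that(2)]] by simp
 from c show ?thesis unfolding tensor_null_def
 proof induct
  case one
  then show ?case using B0 by simp
 next
  case (incl h)
  then show ?case by (rule rels)
 next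
  case (inv h)
  then have "h : frag_carrier M N" using tensor_rels_carrier[OF M N] by auto
  then show ?case using rels[OF inv] Bn by (simp add: frag_extend_minus)
 next
  case (eng a b)
  then show ?case using Ba by (simp add: frag_extend_add)
 qed
qed

lemma frag_extend_in:
 assumes B0: "0 : B" and Bd: "!!a b. a : B ==> b : B ==> a - b : B"
  and f: "!!x. x : S ==> f x : B" and c: "Poly_Mapping.keys c \<subseteq> S"
 shows "frag_extend f c : B"
 using c by (induct c rule: frag_induction) (use assms in "auto simp: frag_extend_diff")

lemma frag_extend_rels:
 assumes M: "module R M" and N: "module R N"
  and a: "a : tensor_rels R M N"
  and f1: "!!x x' y. x : |M| ==> x' : |M| ==> y : |N| ==>
   f (x +\<^sub>M x', y) - f (x, y) - f (x', y) : B"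
  and f2: "!!x y y'. x : |M| ==> y : |N| ==> y' : |N| ==>
   f (x, y +\<^sub>N y') - f (x, y) - f (x, y') : B"
  and f3: "!!r x y. r : |R| ==> x : |M| ==> y : |N| ==>
   f (r .\<^sub>M x, y) - f (x, r .\<^sub>N y) : B"
 shows "frag_extend f a : B"
 using a unfolding tensor_rels_def
 by (elim UnE CollectE exE conjE) (simp_all add: frag_extend_diff f1 f2 f3)

lemma rel_null:
 assumes M: "module R M" and N: "module R N"
 shows "x : |M| ==> x' : |M| ==> y : |N| ==>
   frag_of (x +\<^sub>M x', y) - frag_of (x, y) - frag_of (x', y) : tensor_null R M N"
  "x : |M| ==> y : |N| ==> y' : |N| ==>
   frag_of (x, y +\<^sub>N y') - frag_of (x, y) - frag_of (x, y') : tensor_null R M N"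
  "r : |R| ==> x : |M| ==> y : |N| ==>
   frag_of (r .\<^sub>M x, y) - frag_of (x, r .\<^sub>N y) : tensor_null R M N"
 by (rule tensor_null_closed(6)[OF M N]; unfold tensor_rels_def; blast)+

lemma frag_extend_diff_fun: "frag_extend (%x. f x - g x) c = frag_extend f c - frag_extend g c"
proof -
 have "frag_cmul k (f i - g i) = frag_cmul k (f i) - frag_cmul k (g i)" for k i
  by (rule poly_mapping_eqI) (simp add: lookup_minus algebra_simps)
 then show ?thesis by (simp add: frag_extend_def sum_subtractf)
qed

lemma module_mod_tensor:
 fixes R :: "'a ring"
 assumes M: "module R M" and N: "module R N"
 shows "module_mod R (tensor_pre M N) (tensor_null R M N)"
proof -
 interpret M: module R M by fact
 interpret N: module R N by fact
 note nl = tensor_null_closed[OF M N]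
 let ?f = "%r (x, y). frag_of (r .\<^sub>M x, y)"
 have cl: "frag_extend (?f r) c : frag_carrier M N" if "r : |R|" "c : frag_carrier M N" for r c
  by (rule frag_extend_in[where S = "|M| \<times> |N|", OF frag_carrier_closed(1) frag_carrier_closed(3)])
    (use that in "auto")
 have comm: "r .\<^sub>M (s .\<^sub>M x) = s .\<^sub>M (r .\<^sub>M x)"
  if "r : |R|" "s : |R|" "x : |M|" for r s x
  using that by (simp add: M.smult_assoc1[symmetric] M.R.m_comm)
 have null: "frag_extend (?f r) c : tensor_null R M N" if r: "r : |R|" and c: "c : tensor_null R M N" for r c
 proof (rule frag_extend_null[OF M N nl(2,5) _ c], assumption, assumption)
  fix a assume "a : tensor_rels R M N"
  then show "frag_extend (?f r) a : tensor_null R M N"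
  proof (rule frag_extend_rels[OF M N])
   fix s x y assume *: "s : |R|" "x : |M|" "y : |N|"
   then show "?f r (s .\<^sub>M x, y) - ?f r (x, s .\<^sub>N y) : tensor_null R M N"
    using rel_null(3)[OF M N, of s "r .\<^sub>M x" y] r comm[of r s x] by simp
  qed (use r rel_null[OF M N] in "auto simp: M.smult_r_distr")
 qed
 have ind: "frag_extend g c - frag_extend h c : tensor_null R M N"
  if "!!x y. x : |M| ==> y : |N| ==> g (x, y) - h (x, y) : tensor_null R M N"
   "c : frag_carrier M N" for g h c
  using frag_extend_in[OF nl(2,5), of "|M| \<times> |N|" "%x. g x - h x" c] that
  by (auto simp: frag_extend_diff_fun)
 interpret P: abelian_group "tensor_pre M N" by (rule abelian_group_tensor_pre)
 interpret B: additive_subgroup "tensor_null R M N" "tensor_pre M N" by (rule tensor_null_subgroup[OF M N])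
 note fcl = frag_carrier_closed
 show ?thesis
 proof (unfold_locales, goal_cases)
  case (1 r x) then show ?case using cl by (simp add: tensor_pre_simps)
 next
  case (2 r x y)
  then show ?case using null[of r "x - y"] cl
   by (simp add: tensor_pre_simps tensor_pre_minus frag_extend_diff)
 next
  case (3 r s c)
  have "frag_extend (?f (r +\<^sub>R s)) c - frag_extend (%z. ?f r z + ?f s z) c : tensor_null R M N"
  proof (rule ind)
   fix x y assume "x : |M|" "y : |N|"
   then show "?f (r +\<^sub>R s) (x, y) - (?f r (x, y) + ?f s (x, y)) : tensor_null R M N"
    using rel_null(1)[OF M N, of "r .\<^sub>M x" "s .\<^sub>M x" y] 3
    by (simp add: M.smult_l_distr diff_diff_eq)
  qed (use 3 in "simp add: tensor_pre_simps")
  moreover have "frag_extend (%z. ?f r z + ?f s z) c = frag_extend (?f r) c + frag_extend (?f s) c"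
   by (simp add: frag_extend_def frag_cmul_distrib2 sum.distrib)
  moreover have "c : frag_carrier M N" using 3(3) by (simp only: tensor_pre_simps)
  ultimately show ?case
   using cl[of r c] cl[of s c] cl[of "r +\<^sub>R s" c] 3(1,2)
    tensor_pre_minus[OF cl[of "r +\<^sub>R s" c] fcl(2)[OF cl[of r c] cl[of s c]]]
   by (simp add: tensor_pre_simps(3,4))
 next
  case (4 r x y)
  then show ?case using cl[of r x] cl[of r y] cl[of r "x + y"] fcl(2)[of x M N y] nl(2)
   by (simp add: tensor_pre_simps tensor_pre_minus fcl frag_extend_add)
 next
  case (5 r s c)
  have e: "frag_extend (?f r) (frag_extend (?f s) c) = frag_extend (%z. frag_extend (?f r) (?f s z)) c"
   using frag_extend_compose[of "?f r" "%(x, y). (s .\<^sub>M x, y)" c]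
   by (simp add: comp_def case_prod_unfold)
  have "frag_extend (?f (r \<otimes>\<^sub>R s)) c - frag_extend (%z. frag_extend (?f r) (?f s z)) c : tensor_null R M N"
   by (rule ind) (use 5 nl(2) in "auto simp: tensor_pre_simps M.smult_assoc1")
  moreover have c: "c : frag_carrier M N" using 5(3) by (simp only: tensor_pre_simps)
  moreover have "frag_extend (?f (r \<otimes>\<^sub>R s)) c : frag_carrier M N"
   "frag_extend (?f r) (frag_extend (?f s) c) : frag_carrier M N" using c 5(1,2) by (intro cl; simp)+
  ultimately show ?case
   using tensor_pre_minus[of "frag_extend (?f (r \<otimes>\<^sub>R s)) c" M N "frag_extend (?f r) (frag_extend (?f s) c)"]
   by (simp add: tensor_pre_simps(3,4) e)
 next
  case (6 c)
  have c: "c : frag_carrier M N" using 6 by (simp only: tensor_pre_simps)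
  have "frag_extend (?f 1\<^sub>R) c - frag_extend frag_of c : tensor_null R M N"
   by (rule ind[OF _ c]) (use nl(2) in auto)
  then show ?case
   using tensor_pre_minus[OF cl[OF M.R.one_closed c] c] frag_expansion[of c]
   by (simp add: tensor_pre_simps(3,4))
 qed
qed

definition tens :: "'a ring => ('a, 'm) module => ('a, 'n) module => 'm => 'n => (('m \<times> 'n) \<Rightarrow>\<^sub>0 int) set" where
 "tens R M N x y = tensor_null R M N +>\<^sub>(tensor_pre M N) frag_of (x, y)"

lemma module_tensor_mod:
 fixes R :: "'a ring"
 assumes "module R M" "module R N" shows "module R (tensor_mod R M N)"
 unfolding tensor_mod_def by (rule module_mod.Q_module[OF module_mod_tensor[OF assms]])

lemma tens_bilinear:
 fixes R :: "'a ring"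
 assumes M: "module R M" and N: "module R N"
 shows "x : |M| ==> y : |N| ==> tens R M N x y : |tensor_mod R M N|"
  "x : |M| ==> x' : |M| ==> y : |N| ==>
   tens R M N (x +\<^sub>M x') y = tens R M N x y +\<^sub>(tensor_mod R M N) tens R M N x' y"
  "x : |M| ==> y : |N| ==> y' : |N| ==>
   tens R M N x (y +\<^sub>N y') = tens R M N x y +\<^sub>(tensor_mod R M N) tens R M N x y'"
  "r : |R| ==> x : |M| ==> y : |N| ==>
   tens R M N (r .\<^sub>M x) y = r .\<^sub>(tensor_mod R M N) tens R M N x y"
  "r : |R| ==> x : |M| ==> y : |N| ==>
   tens R M N x (r .\<^sub>N y) = r .\<^sub>(tensor_mod R M N) tens R M N x y"
proof -
 interpret module_mod R "tensor_pre M N" "tensor_null R M N" by (rule module_mod_tensor[OF M N])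
 interpret M: module R M by fact
 interpret N: module R N by fact
 have fr: "frag_of (x, y) : |tensor_pre M N|" if "x : |M|" "y : |N|" for x y
  using that by (simp add: tensor_pre_simps)
 note fcl = frag_carrier_closed
 show "x : |M| ==> y : |N| ==> tens R M N x y : |tensor_mod R M N|"
  using fr Q_carrier by (simp add: tens_def tensor_mod_def)
 show "tens R M N (x +\<^sub>M x') y = tens R M N x y +\<^sub>(tensor_mod R M N) tens R M N x' y"
  if "x : |M|" "x' : |M|" "y : |N|"
  unfolding tens_def tensor_mod_def
  using that fr rel_null(1)[OF M N that] fcl(2)[OF fcl(4)[OF that(1,3)] fcl(4)[OF that(2,3)]]
   tensor_pre_minus[OF fcl(4)[OF M.M.a_closed[OF that(1,2)] that(3)]
    fcl(2)[OF fcl(4)[OF that(1,3)] fcl(4)[OF that(2,3)]]]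
  by (simp add: Q_add cls_eq_iff tensor_pre_simps diff_diff_eq)
 show "tens R M N x (y +\<^sub>N y') = tens R M N x y +\<^sub>(tensor_mod R M N) tens R M N x y'"
  if "x : |M|" "y : |N|" "y' : |N|"
  unfolding tens_def tensor_mod_def
  using that fr rel_null(2)[OF M N that] fcl(2)[OF fcl(4)[OF that(1,2)] fcl(4)[OF that(1,3)]]
   tensor_pre_minus[OF fcl(4)[OF that(1) N.M.a_closed[OF that(2,3)]]
    fcl(2)[OF fcl(4)[OF that(1,2)] fcl(4)[OF that(1,3)]]]
  by (simp add: Q_add cls_eq_iff tensor_pre_simps diff_diff_eq)
 show 4: "tens R M N (r .\<^sub>M x) y = r .\<^sub>(tensor_mod R M N) tens R M N x y"
  if "r : |R|" "x : |M|" "y : |N|"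
  unfolding tens_def tensor_mod_def using that fr by (simp add: Q_smult) (simp add: tensor_pre_simps)
 have "tens R M N (r .\<^sub>M x) y = tens R M N x (r .\<^sub>N y)"
  if "r : |R|" "x : |M|" "y : |N|"
  unfolding tens_def using that fr rel_null(3)[OF M N that]
  by (simp add: cls_eq_iff) (simp add: tensor_pre_minus fcl)
 then show "tens R M N x (r .\<^sub>N y) = r .\<^sub>(tensor_mod R M N) tens R M N x y"
  if "r : |R|" "x : |M|" "y : |N|" using 4 that by simp
qed

lemma tensor_spanned:
 fixes R :: "'a ring"
 assumes M: "module R M" and N: "module R N" and U: "submodule U R (tensor_mod R M N)"
  and t: "!!x y. x : |M| ==> y : |N| ==> tens R M N x y : U"
 shows "U = |tensor_mod R M N|"
proof
 interpret module_mod R "tensor_pre M N" "tensor_null R M N" by (rule module_mod_tensor[OF M N])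
 note u = submoduleD[OF module_tensor_mod[OF M N] U]
 interpret T: module R "tensor_mod R M N" by (rule module_tensor_mod[OF M N])
 show "U \<subseteq> |tensor_mod R M N|" by (rule u)
 have "c : frag_carrier M N \<and> cls c : U" if "Poly_Mapping.keys c \<subseteq> |M| \<times> |N|" for c
  using that
 proof (induct c rule: frag_induction)
  case zero
  then show ?case using u(2) Q_zero(1) by (simp add: tensor_mod_def tensor_pre_simps)
 next
  case (one z)
  then show ?case using t[of "fst z" "snd z"] by (auto simp: tens_def)
 next
  case (diff a b)
  have ab: "a : |tensor_pre M N|" "b : |tensor_pre M N|"
   using diff by (auto simp: tensor_pre_simps)
  have "cls a -\<^sub>Q cls b = cls (a -\<^sub>(tensor_pre M N) b)"
   using ab unfolding a_minus_def by (simp add: Q_neg Q_add)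
  also have "a -\<^sub>(tensor_pre M N) b = a - b" using diff by (simp add: tensor_pre_minus)
  finally have "cls (a - b) = cls a -\<^sub>(tensor_mod R M N) cls b" by (simp add: tensor_mod_def)
  then show ?case using diff u(6)[of "cls a" "cls b"] frag_carrier_closed(3)[of a M N b] by simp
 qed
 then show "|tensor_mod R M N| \<subseteq> U" using Q_carrier by (auto simp: tensor_mod_def tensor_pre_simps)
qed

lemma tensor_hom_eq:
 fixes R :: "'a ring"
 assumes M: "module R M" and N: "module R N" and L: "module R L"
  and f: "mod_hom R (tensor_mod R M N) L f" and g: "mod_hom R (tensor_mod R M N) L g"
  and eq: "!!x y. x : |M| ==> y : |N| ==> f (tens R M N x y) = g (tens R M N x y)"
  and u: "u : |tensor_mod R M N|"
 shows "f u = g u"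
proof -
 have T: "module R (tensor_mod R M N)" by (rule module_tensor_mod[OF M N])
 interpret T: module R "tensor_mod R M N" by (rule T)
 have "submodule {u : |tensor_mod R M N|. f u = g u} R (tensor_mod R M N)"
  by (rule submodI[OF T])
    (use mod_homD[OF f] mod_homD[OF g] mod_hom_zero[OF T L f] mod_hom_zero[OF T L g] in auto)
 from tensor_spanned[OF M N this] u eq tens_bilinear(1)[OF M N] show ?thesis by blast
qed

text \<open>The universal property.\<close>

lemma tensor_lift:
 fixes R :: "'a ring"
 assumes M: "module R M" and N: "module R N" and L: "module R L"
  and b1: "!!x y. x : |M| ==> y : |N| ==> \<beta> x y : |L|"
  and b2: "!!x x' y. x : |M| ==> x' : |M| ==> y : |N| ==>
   \<beta> (x +\<^sub>M x') y = \<beta> x y +\<^sub>L \<beta> x' y"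
  and b3: "!!x y y'. x : |M| ==> y : |N| ==> y' : |N| ==>
   \<beta> x (y +\<^sub>N y') = \<beta> x y +\<^sub>L \<beta> x y'"
  and b4: "!!r x y. r : |R| ==> x : |M| ==> y : |N| ==>
   \<beta> (r .\<^sub>M x) y = r .\<^sub>L \<beta> x y"
  and b5: "!!r x y. r : |R| ==> x : |M| ==> y : |N| ==>
   \<beta> x (r .\<^sub>N y) = r .\<^sub>L \<beta> x y"
 shows "\<exists>Th. mod_hom R (tensor_mod R M N) L Th \<and>
  (\<forall>x\<in>|M|. \<forall>y\<in>|N|. Th (tens R M N x y) = \<beta> x y)"
proof -
 interpret module_mod R "tensor_pre M N" "tensor_null R M N" by (rule module_mod_tensor[OF M N])
 interpret M: module R M by fact
 interpret N: module R N by fact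
 interpret L: module R L by fact
 have "(%(x, y). \<beta> x y) ` ( |M| \<times> |N| ) \<subseteq> |add_monoid L|" using b1 by auto
 from comm_group.free_Abelian_group_universal[OF L.M.a_comm_group this] obtain h where
  h: "h : hom (free_Abelian_group ( |M| \<times> |N| )) (add_monoid L)"
  "!!z. z : |M| \<times> |N| ==> h (frag_of z) = (%(x, y). \<beta> x y) z" by blast
 note nl = tensor_null_closed[OF M N]
 have hf: "h (frag_of (x, y)) = \<beta> x y" if "x : |M|" "y : |N|" for x y using h(2)[of "(x, y)"] that by simp
 have hc: "h c : |L|" if "c : frag_carrier M N" for c
  using h(1) that by (auto simp: hom_def Pi_def)
 have ha: "h (a + b) = h a +\<^sub>L h b" if "a : frag_carrier M N" "b : frag_carrier M N" for a b
  using h(1) that by (auto simp: hom_def)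
 have h0: "h 0 = 0\<^sub>L" using ha[of 0 0] hc[of 0] by (simp add: L.M.add.r_cancel_one')
 have hd: "h (a - b) = h a -\<^sub>L h b" if ab: "a : frag_carrier M N" "b : frag_carrier M N" for a b
 proof -
  have d: "a - b : frag_carrier M N" by (rule frag_carrier_closed(3)[OF ab])
  have "h a = h (a - b) +\<^sub>L h b" using ha[OF d ab(2)] by simp
  then show ?thesis using hc[OF d] hc[OF ab(2)] by (simp add: a_minus_def L.M.a_assoc L.M.r_neg)
 qed
 note fcl = frag_carrier_closed
 have z: "x -\<^sub>L x = 0\<^sub>L" if "x : |L|" for x using that by (simp add: a_minus_def L.M.r_neg)
 have zz: "(x +\<^sub>L y) -\<^sub>L x -\<^sub>L y = 0\<^sub>L" if "x : |L|" "y : |L|" for x y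
  using that by (simp add: a_minus_def L.M.a_ac L.M.ab_cancel)
 have h3: "h (frag_of (x, y) - frag_of (x', y') - frag_of (x'', y'')) = \<beta> x y -\<^sub>L \<beta> x' y' -\<^sub>L \<beta> x'' y''"
  if "x : |M|" "x' : |M|" "x'' : |M|" "y : |N|" "y' : |N|" "y'' : |N|"
  for x x' x'' y y' y''
  using hd[OF fcl(3)[OF fcl(4) fcl(4)] fcl(4)] hd[OF fcl(4) fcl(4)] hf that by simp
 have h_rel: "h a = 0\<^sub>L" if "a : tensor_rels R M N" for a
  using that unfolding tensor_rels_def
  by (elim UnE CollectE exE conjE) (simp_all add: h3 hd hf fcl b1 b2 b3 b4 b5 z zz)
 have hn: "h c = 0\<^sub>L" if "c : tensor_null R M N" for c
  using that unfolding tensor_null_def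
 proof induct
  case one
  then show ?case using h0 by simp
 next
  case (incl a)
  then show ?case by (rule h_rel)
 next
  case (inv a)
  then have "a : frag_carrier M N" using tensor_rels_carrier[OF M N] by auto
  then show ?case using h_rel[OF inv] hd[of 0 a] h0 by (simp add: z)
 next
  case (eng a b)
  then have "a : frag_carrier M N" "b : frag_carrier M N"
   using nl(1) unfolding tensor_null_def by auto
  then show ?case using ha[of a b] eng by simp
 qed
 define Th where "Th X = h (SOME c. c : X)" for X
 have Th: "Th (cls c) = h c" if c: "c : frag_carrier M N" for c
 proof -
  have c': "c : |tensor_pre M N|" using c by (simp add: tensor_pre_simps)
  have "(SOME d. d : cls c) : cls c" by (rule someI[of _ c]) (rule cls_self[OF c'])
  then obtain d where d: "d = (SOME d. d : cls c)" "d : |tensor_pre M N|" "cls d = cls c"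
   using mem_cls[OF c'] by blast
  have dc: "d : frag_carrier M N" using d(2) by (simp add: tensor_pre_simps)
  have "d - c : tensor_null R M N" using cls_eq_iff[OF d(2) c'] d(3) tensor_pre_minus[OF dc c] by simp
  then have "h d -\<^sub>L h c = 0\<^sub>L" using hn hd[OF dc c] by simp
  then have "h d = h c" using hc[OF dc] hc[OF c] by (rule L.M.minus_eq_zeroD)
  then show ?thesis using d(1) by (simp add: Th_def)
 qed
 have hs: "h (frag_extend (%(x, y). frag_of (r .\<^sub>M x, y)) c) = r .\<^sub>L h c"
  if r: "r : |R|" and c: "c : frag_carrier M N" for r c
 proof -
  let ?e = "frag_extend (%(x, y). frag_of (r .\<^sub>M x, y))"
  have "c : frag_carrier M N \<and> ?e c : frag_carrier M N \<and> h (?e c) = r .\<^sub>L h c"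
   if "Poly_Mapping.keys c \<subseteq> |M| \<times> |N|" for c
   using that
  proof (induct c rule: frag_induction)
   case zero then show ?case using h0 r by simp
  next
   case (one z) then show ?case using r by (auto simp: hf b4)
  next
   case (diff a b)
   then show ?case using fcl(3)[of a M N b] fcl(3)[of "?e a" M N "?e b"] r hc[of a] hc[of b]
    by (simp add: frag_extend_diff hd a_minus_def L.smult_r_distr L.smult_r_minus)
  qed
  then show ?thesis using c by blast
 qed
 have "mod_hom R (tensor_mod R M N) L Th"
 proof (rule mod_homI)
  fix X assume "X : |tensor_mod R M N|"
  then obtain c where c: "c : |tensor_pre M N|" "X = cls c" using Q_carrier by (auto simp: tensor_mod_def)
  have c': "c : frag_carrier M N" using c by (simp add: tensor_pre_simps)
  show "Th X : |L|" using c hc[OF c'] Th[OF c'] by simp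
  show "Th (r .\<^sub>(tensor_mod R M N) X) = r .\<^sub>L Th X" if r: "r : |R|" for r
   using hs[OF r c'] Th[OF c'] act_closed[OF r c(1)] Q_smult[OF r c(1)] c(2)
    Th[of "r .\<^sub>(tensor_pre M N) c"] by (simp add: tensor_mod_def tensor_pre_simps)
  fix Y assume "Y : |tensor_mod R M N|"
  then obtain d where d: "d : |tensor_pre M N|" "Y = cls d" using Q_carrier by (auto simp: tensor_mod_def)
  have d': "d : frag_carrier M N" using d by (simp add: tensor_pre_simps)
  show "Th (X +\<^sub>(tensor_mod R M N) Y) = Th X +\<^sub>L Th Y"
   using Q_add[OF c(1) d(1)] Th[OF c'] Th[OF d'] Th[OF fcl(2)[OF c' d']] ha[OF c' d'] c(2) d(2)
   by (simp add: tensor_mod_def tensor_pre_simps)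
 qed
 moreover have "Th (tens R M N x y) = \<beta> x y" if "x : |M|" "y : |N|" for x y
  unfolding tens_def using that hf fcl(4) by (subst Th) auto
 ultimately show ?thesis by blast
qed

lemma tensor_map_hom:
 fixes R :: "'a ring"
 assumes M: "module R M" and N: "module R N" and M': "module R M'" and N': "module R N'"
  and f: "mod_hom R M M' f" and g: "mod_hom R N N' g"
 shows "mod_hom R (tensor_mod R M N) (tensor_mod R M' N') (tensor_map R M' N' f g)"
  "x : |M| ==> y : |N| ==> tensor_map R M' N' f g (tens R M N x y) = tens R M' N' (f x) (g y)"
proof -
 interpret A: module_mod R "tensor_pre M N" "tensor_null R M N" by (rule module_mod_tensor[OF M N])
 interpret B: module_mod R "tensor_pre M' N'" "tensor_null R M' N'" by (rule module_mod_tensor[OF M' N'])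
 interpret M: module R M by fact
 interpret N: module R N by fact
 note nl = tensor_null_closed[OF M N] and nl' = tensor_null_closed[OF M' N']
 note hf = mod_homD[OF f] and hg = mod_homD[OF g]
 let ?f = "%(x, y). frag_of (f x, g y)"
 let ?T = "tensor_map R M' N' f g"
 have cl: "frag_extend ?f c : frag_carrier M' N'" if "c : frag_carrier M N" for c
  by (rule frag_extend_in[where S = "|M| \<times> |N|", OF frag_carrier_closed(1) frag_carrier_closed(3)])
    (use that hf hg in auto)
 have null: "frag_extend ?f c : tensor_null R M' N'" if "c : tensor_null R M N" for c
 proof (rule frag_extend_null[OF M N nl'(2,5) _ that], assumption, assumption)
  fix a assume "a : tensor_rels R M N"
  then show "frag_extend ?f a : tensor_null R M' N'"
   by (rule frag_extend_rels[OF M N]) (use rel_null[OF M' N'] hf hg in auto)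
 qed
 have T: "?T (A.cls c) = B.cls (frag_extend ?f c)" if c: "c : frag_carrier M N" for c
  unfolding tensor_map_def
 proof (rule SUP_eq_const)
  have c': "c : |tensor_pre M N|" using c by (simp add: tensor_pre_simps)
  show "A.cls c \<noteq> {}" using A.cls_self[OF c'] by auto
  fix d assume "d : A.cls c"
  then have d: "d : |tensor_pre M N|" "A.cls d = A.cls c" using A.mem_cls[OF c'] by auto
  have dc: "d : frag_carrier M N" using d(1) by (simp add: tensor_pre_simps)
  have "d - c : tensor_null R M N" using A.cls_eq_iff[OF d(1) c'] d(2) tensor_pre_minus[OF dc c] by simp
  from null[OF this] have "frag_extend ?f d - frag_extend ?f c : tensor_null R M' N'" by (simp add: frag_extend_diff)
  then show "B.cls (frag_extend ?f d) = B.cls (frag_extend ?f c)"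
   using B.cls_eq_iff[of "frag_extend ?f d" "frag_extend ?f c"] cl[OF dc] cl[OF c] tensor_pre_minus[OF cl[OF dc] cl[OF c]]
   by (simp add: tensor_pre_simps)
 qed
 have "\<exists>Th. mod_hom R (tensor_mod R M N) (tensor_mod R M' N') Th \<and>
  (\<forall>x\<in>|M|. \<forall>y\<in>|N|. Th (tens R M N x y) = tens R M' N' (f x) (g y))"
  by (rule tensor_lift[OF M N module_tensor_mod[OF M' N']])
    (use hf hg tens_bilinear[OF M' N'] in auto)
 then obtain Th where Th: "mod_hom R (tensor_mod R M N) (tensor_mod R M' N') Th"
  "!!x y. x : |M| ==> y : |N| ==> Th (tens R M N x y) = tens R M' N' (f x) (g y)" by blast
 interpret T: module R "tensor_mod R M N" by (rule module_tensor_mod[OF M N])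
 interpret T': module R "tensor_mod R M' N'" by (rule module_tensor_mod[OF M' N'])
 have "c : frag_carrier M N \<and> Th (A.cls c) = B.cls (frag_extend ?f c)"
  if "Poly_Mapping.keys c \<subseteq> |M| \<times> |N|" for c
  using that
 proof (induct c rule: frag_induction)
  case zero
  then show ?case
   using mod_hom_zero[OF T.module_axioms T'.module_axioms Th(1)] A.Q_zero(1) B.Q_zero(1)
   by (simp add: tensor_mod_def tensor_pre_simps)
 next
  case (one z)
  then show ?case using Th(2)[of "fst z" "snd z"] by (auto simp: tens_def)
 next
  case (diff a b)
  have key: "A.cls (a - b) +\<^sub>(tensor_mod R M N) A.cls b = A.cls a"
   using diff frag_carrier_closed(3)[of a M N b] A.Q_add[of "a - b" b] by (simp add: tensor_mod_def tensor_pre_simps)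
  have ab: "a - b : frag_carrier M N" using diff frag_carrier_closed(3)[of a M N b] by blast
  have mem: "A.cls c : |tensor_mod R M N|" if "c : frag_carrier M N" for c
   using A.Q_carrier that by (simp add: tensor_mod_def tensor_pre_simps)
  have mem': "B.cls c : |tensor_mod R M' N'|" if "c : frag_carrier M' N'" for c
   using B.Q_carrier that by (simp add: tensor_mod_def tensor_pre_simps)
  have "Th (A.cls (a - b)) +\<^sub>(tensor_mod R M' N') Th (A.cls b) = Th (A.cls a)"
   using key mod_homD(2)[OF Th(1) mem[OF ab], of "A.cls b"] mem diff by simp
  moreover have "B.cls (frag_extend ?f (a - b)) +\<^sub>(tensor_mod R M' N') B.cls (frag_extend ?f b) = B.cls (frag_extend ?f a)"
   using B.Q_add[of "frag_extend ?f (a - b)" "frag_extend ?f b"] cl[OF ab] cl[of b] diff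
   by (simp add: tensor_mod_def tensor_pre_simps frag_extend_diff)
  ultimately have "Th (A.cls (a - b)) +\<^sub>(tensor_mod R M' N') B.cls (frag_extend ?f b) =
   B.cls (frag_extend ?f (a - b)) +\<^sub>(tensor_mod R M' N') B.cls (frag_extend ?f b)" using diff by simp
  then have "Th (A.cls (a - b)) = B.cls (frag_extend ?f (a - b))"
   using mod_homD(1)[OF Th(1) mem[OF ab]] mem'[OF cl[OF ab]] mem'[OF cl[of b]] diff by simp
  then show ?case using ab by simp
 qed
 then have eq: "?T X = Th X" if "X : |tensor_mod R M N|" for X
  using that A.Q_carrier T by (auto simp: tensor_mod_def tensor_pre_simps)
 show "mod_hom R (tensor_mod R M N) (tensor_mod R M' N') ?T"
  by (rule mod_homI) (use mod_homD[OF Th(1)] eq in auto)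
 show "x : |M| ==> y : |N| ==> ?T (tens R M N x y) = tens R M' N' (f x) (g y)"
  using eq[OF tens_bilinear(1)[OF M N]] Th(2) by simp
qed

lemma module_sum_mod:
 fixes R :: "'a ring"
 assumes R: "cring R" and N: "!!i. i : I ==> module R (N i)"
 shows "module R (sum_mod I N)"
proof -
 note m = modD[OF N]
 have P: "module R (prod_mod I N)" by (rule module_prod_mod[OF R N])
 let ?A = "{f : (\<Pi>\<^sub>E i\<in>I. |N i| ). finite {i : I. f i \<noteq> 0\<^sub>(N i)}}"
 have "submodule ?A R (prod_mod I N)"
 proof (rule submodI[OF P])
  show "?A \<subseteq> |prod_mod I N|" by (auto simp: prod_mod_def)
  have "{i : I. (\<lambda>i\<in>I. 0\<^sub>(N i)) i \<noteq> 0\<^sub>(N i)} = {}" by auto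
  then have "(\<lambda>i\<in>I. 0\<^sub>(N i)) : ?A" using m(2) by simp
  then show "0\<^sub>(prod_mod I N) : ?A" by (simp add: prod_mod_def)
 next
  fix x y assume x: "x : ?A" and y: "y : ?A"
  have "{i : I. (\<lambda>i\<in>I. x i +\<^sub>(N i) y i) i \<noteq> 0\<^sub>(N i)} \<subseteq> {i : I. x i \<noteq> 0\<^sub>(N i)} \<union> {i : I. y i \<noteq> 0\<^sub>(N i)}"
   using x y m(2,5) by auto
  then have "finite {i : I. (\<lambda>i\<in>I. x i +\<^sub>(N i) y i) i \<noteq> 0\<^sub>(N i)}"
   by (rule finite_subset) (use x y in simp)
  then show "x +\<^sub>(prod_mod I N) y : ?A" using x y m(1) by (simp add: prod_mod_def PiE_iff)
 next
  fix r x assume r: "r : |R|" and x: "x : ?A"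
  have "{i : I. (\<lambda>i\<in>I. r .\<^sub>(N i) x i) i \<noteq> 0\<^sub>(N i)} \<subseteq> {i : I. x i \<noteq> 0\<^sub>(N i)}"
   using r m(16) by auto
  then have "finite {i : I. (\<lambda>i\<in>I. r .\<^sub>(N i) x i) i \<noteq> 0\<^sub>(N i)}"
   by (rule finite_subset) (use x in simp)
  then show "r .\<^sub>(prod_mod I N) x : ?A" using r x m(8) by (simp add: prod_mod_def PiE_iff)
 qed
 then show ?thesis unfolding sum_mod_def by (rule module_sub_mod[OF P])
qed

section \<open>Tensor products of complexes\<close>

definition tX :: "'a ring => ('a, 'm) cpx => ('a, 'n) cpx => int => int =>
  (('m \<times> 'n) \<Rightarrow>\<^sub>0 int) set => (('m \<times> 'n) \<Rightarrow>\<^sub>0 int) set" where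
 "tX R X Y i j = tensor_map R (obj X (i - 1)) (obj Y j) (dif X i) id"

definition tY :: "'a ring => ('a, 'm) cpx => ('a, 'n) cpx => int => int =>
  (('m \<times> 'n) \<Rightarrow>\<^sub>0 int) set => (('m \<times> 'n) \<Rightarrow>\<^sub>0 int) set" where
 "tY R X Y i j = tensor_map R (obj X i) (obj Y (j - 1)) id (dif Y j)"

abbreviation tT :: "'a ring => ('a, 'm) cpx => ('a, 'n) cpx => int => int =>
  ('a, (('m \<times> 'n) \<Rightarrow>\<^sub>0 int) set) module" where
 "tT R X Y i j \<equiv> tensor_mod R (obj X i) (obj Y j)"

lemma mod_hom_id: "mod_hom R N N id"
 by (auto simp: mod_hom_def)

lemma tens_zero:
 fixes R :: "'a ring"
 assumes M: "module R M" and N: "module R N"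
 shows "y : |N| ==> tens R M N 0\<^sub>M y = 0\<^sub>(tensor_mod R M N)"
  "x : |M| ==> tens R M N x 0\<^sub>N = 0\<^sub>(tensor_mod R M N)"
proof -
 interpret M: module R M by fact
 interpret N: module R N by fact
 interpret T: module R "tensor_mod R M N" by (rule module_tensor_mod[OF M N])
 note b = tens_bilinear[OF M N]
 show "tens R M N 0\<^sub>M y = 0\<^sub>(tensor_mod R M N)" if "y : |N|"
  using b(4)[of "0\<^sub>R" "0\<^sub>M" y] b(1)[of "0\<^sub>M" y] that by simp
 show "tens R M N x 0\<^sub>N = 0\<^sub>(tensor_mod R M N)" if "x : |M|"
  using b(5)[of "0\<^sub>R" x "0\<^sub>N"] b(1)[of x "0\<^sub>N"] that by simp
qed

context
 fixes R :: "'a ring" and X :: "('a, 'm) cpx" and Y :: "('a, 'n) cpx"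
 assumes X: "is_cpx R X" and Y: "is_cpx R Y"
begin

lemma module_tT: "module R (tT R X Y i j)"
 by (rule module_tensor_mod[OF is_cpxD(1)[OF X] is_cpxD(1)[OF Y]])

lemma tX_hom: "mod_hom R (tT R X Y i j) (tT R X Y (i - 1) j) (tX R X Y i j)"
 "x : |obj X i| ==> y : |obj Y j| ==>
   tX R X Y i j (tens R (obj X i) (obj Y j) x y) = tens R (obj X (i - 1)) (obj Y j) (dif X i x) y"
 unfolding tX_def
 using tensor_map_hom[OF is_cpxD(1)[OF X] is_cpxD(1)[OF Y] is_cpxD(1)[OF X] is_cpxD(1)[OF Y] is_cpxD(2)[OF X] mod_hom_id]
 by auto

lemma tY_hom: "mod_hom R (tT R X Y i j) (tT R X Y i (j - 1)) (tY R X Y i j)"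
 "x : |obj X i| ==> y : |obj Y j| ==>
   tY R X Y i j (tens R (obj X i) (obj Y j) x y) = tens R (obj X i) (obj Y (j - 1)) x (dif Y j y)"
 unfolding tY_def
 using tensor_map_hom[OF is_cpxD(1)[OF X] is_cpxD(1)[OF Y] is_cpxD(1)[OF X] is_cpxD(1)[OF Y] mod_hom_id is_cpxD(2)[OF Y]]
 by auto

lemma tX_tX: assumes u: "u : |tT R X Y i j|"
 shows "tX R X Y (i - 1) j (tX R X Y i j u) = 0\<^sub>(tT R X Y (i - 2) j)"
proof -
 have e: "i - 1 - 1 = i - 2" by simp
 note h = tX_hom(1)[of "i - 1" j, unfolded e]
 note h2 = tX_hom(2)[of _ "i - 1" _ j, unfolded e]
 show ?thesis
  by (rule tensor_hom_eq[OF is_cpxD(1)[OF X] is_cpxD(1)[OF Y] module_tT mod_hom_comp[OF tX_hom(1) h]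
     mod_hom_zero_fun[OF module_tT] _ u])
    (simp add: tX_hom(2) h2 mod_homD(1)[OF is_cpxD(2)[OF X]] is_cpxD(3)[OF X]
     tens_zero[OF is_cpxD(1)[OF X] is_cpxD(1)[OF Y]])
qed

lemma tY_tY: assumes u: "u : |tT R X Y i j|"
 shows "tY R X Y i (j - 1) (tY R X Y i j u) = 0\<^sub>(tT R X Y i (j - 2))"
proof -
 have e: "j - 1 - 1 = j - 2" by simp
 note h = tY_hom(1)[of i "j - 1", unfolded e]
 note h2 = tY_hom(2)[of _ i _ "j - 1", unfolded e]
 show ?thesis
  by (rule tensor_hom_eq[OF is_cpxD(1)[OF X] is_cpxD(1)[OF Y] module_tT mod_hom_comp[OF tY_hom(1) h]
     mod_hom_zero_fun[OF module_tT] _ u])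
    (simp add: tY_hom(2) h2 mod_homD(1)[OF is_cpxD(2)[OF Y]] is_cpxD(3)[OF Y]
     tens_zero[OF is_cpxD(1)[OF X] is_cpxD(1)[OF Y]])
qed

lemma tX_tY: assumes u: "u : |tT R X Y i j|"
 shows "tX R X Y i (j - 1) (tY R X Y i j u) = tY R X Y (i - 1) j (tX R X Y i j u)"
 by (rule tensor_hom_eq[OF is_cpxD(1)[OF X] is_cpxD(1)[OF Y] module_tT mod_hom_comp[OF tY_hom(1) tX_hom(1)]
    mod_hom_comp[OF tX_hom(1) tY_hom(1)] _ u])
   (simp add: tX_hom(2) tY_hom(2) mod_homD(1)[OF is_cpxD(2)[OF Y]] mod_homD(1)[OF is_cpxD(2)[OF X]])

lemma tensor_cpx_carrier:
 "w : |obj (tensor_cpx R X Y) n| \<longleftrightarrow>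
   (\<forall>i. w i : |tT R X Y i (n - i)| ) \<and> finite {i. w i \<noteq> 0\<^sub>(tT R X Y i (n - i))}"
 by (auto simp: tensor_cpx_def sum_mod_def PiE_UNIV_domain)

lemma tensor_cpx_ops:
 "0\<^sub>(obj (tensor_cpx R X Y) n) = (%i. 0\<^sub>(tT R X Y i (n - i)))"
 "v +\<^sub>(obj (tensor_cpx R X Y) n) w = (%i. v i +\<^sub>(tT R X Y i (n - i)) w i)"
 "r .\<^sub>(obj (tensor_cpx R X Y) n) w = (%i. r .\<^sub>(tT R X Y i (n - i)) w i)"
 by (simp_all add: tensor_cpx_def sum_mod_def prod_mod_def restrict_def)

lemma tensor_cpx_component_hom:
 assumes "w : |obj (tensor_cpx R X Y) n|"
 shows "w (i + 1) : |tT R X Y (i + 1) (n - 1 - i)|" "w i : |tT R X Y i (n - i)|"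
  "tX R X Y (i + 1) (n - 1 - i) (w (i + 1)) : |tT R X Y i (n - 1 - i)|"
  "tY R X Y i (n - i) (w i) : |tT R X Y i (n - 1 - i)|"
proof -
 have "w (i + 1) : |tT R X Y (i + 1) (n - (i + 1))|" using assms unfolding tensor_cpx_carrier by blast
 moreover have e: "n - (i + 1) = n - 1 - i" "i + 1 - 1 = i" "n - i - 1 = n - 1 - i" by simp_all
 ultimately show w: "w (i + 1) : |tT R X Y (i + 1) (n - 1 - i)|" by simp
 show v: "w i : |tT R X Y i (n - i)|" using assms unfolding tensor_cpx_carrier by blast
 show "tX R X Y (i + 1) (n - 1 - i) (w (i + 1)) : |tT R X Y i (n - 1 - i)|"
  using mod_homD(1)[OF tX_hom(1) w] by (simp add: e)
 show "tY R X Y i (n - i) (w i) : |tT R X Y i (n - 1 - i)|"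
  using mod_homD(1)[OF tY_hom(1) v] by (simp add: e)
qed

lemma tensor_cpx_dif:
 assumes w: "w : |obj (tensor_cpx R X Y) n|"
 shows "dif (tensor_cpx R X Y) n w i =
  tX R X Y (i + 1) (n - 1 - i) (w (i + 1)) +\<^sub>(tT R X Y i (n - 1 - i))
   sg R i .\<^sub>(tT R X Y i (n - 1 - i)) tY R X Y i (n - i) (w i)"
proof -
 have "n - i - 1 = n - 1 - i" by simp
 then have "tY R X Y i (n - i) = tensor_map R (obj X i) (obj Y (n - 1 - i)) id (dif Y (n - i))"
  by (simp only: tY_def)
 then show ?thesis using signed_eq[OF module_tT tensor_cpx_component_hom(4)[OF w], of i i]
  by (simp add: tensor_cpx_def Let_def tX_def)
qed

lemma is_cpx_tensor_cpx: "is_cpx R (tensor_cpx R X Y)"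
proof -
 let ?C = "tensor_cpx R X Y"
 interpret R: cring R by (rule modD(13)[OF module_tT[of 0 0]])
 note sgs = sg_simps[OF R.is_cring]
 have m: "module R (obj ?C n)" for n
  unfolding tensor_cpx_def by (simp add: module_sum_mod[OF R.is_cring module_tT])
 have D: "dif ?C n w : |obj ?C (n - 1)|" if w: "w : |obj ?C n|" for n w
  unfolding tensor_cpx_carrier
 proof (intro conjI allI)
  fix i
  interpret T: module R "tT R X Y i (n - 1 - i)" by (rule module_tT)
  show "dif ?C n w i : |tT R X Y i (n - 1 - i)|"
   unfolding tensor_cpx_dif[OF w] using tensor_cpx_component_hom[OF w] sgs(1) by simp
 next
  have fin: "finite {i. w i \<noteq> 0\<^sub>(tT R X Y i (n - i))}" using w by (simp add: tensor_cpx_carrier)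
  have "{i. dif ?C n w i \<noteq> 0\<^sub>(tT R X Y i (n - 1 - i))} \<subseteq>
   (%i. i - 1) ` {i. w i \<noteq> 0\<^sub>(tT R X Y i (n - i))} \<union> {i. w i \<noteq> 0\<^sub>(tT R X Y i (n - i))}"
  proof (rule subsetI, rule ccontr)
   fix i assume i: "i : {i. dif ?C n w i \<noteq> 0\<^sub>(tT R X Y i (n - 1 - i))}"
    and ni: "i \<notin> (%i. i - 1) ` {i. w i \<noteq> 0\<^sub>(tT R X Y i (n - i))} \<union> {i. w i \<noteq> 0\<^sub>(tT R X Y i (n - i))}"
   interpret T: module R "tT R X Y i (n - 1 - i)" by (rule module_tT)
   have e: "n - (i + 1) = n - 1 - i" "i + 1 - 1 = i" "n - i - 1 = n - 1 - i" by simp_all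
   have w0: "w i = 0\<^sub>(tT R X Y i (n - i))" using ni by simp
   have "i = i + 1 - 1" by simp
   then have "w (i + 1) = 0\<^sub>(tT R X Y (i + 1) (n - (i + 1)))" using ni by blast
   then have w1: "w (i + 1) = 0\<^sub>(tT R X Y (i + 1) (n - 1 - i))" by (simp add: e)
   have "tX R X Y (i + 1) (n - 1 - i) (w (i + 1)) = 0\<^sub>(tT R X Y i (n - 1 - i))"
    unfolding w1 using mod_hom_zero[OF module_tT module_tT tX_hom(1), of "i + 1"] by (simp add: e)
   moreover have "tY R X Y i (n - i) (w i) = 0\<^sub>(tT R X Y i (n - 1 - i))"
    unfolding w0 using mod_hom_zero[OF module_tT module_tT tY_hom(1), of i "n - i"] by (simp add: e)
   ultimately show False using i sgs(1) by (simp add: tensor_cpx_dif[OF w])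
  qed
  then show "finite {i. dif ?C n w i \<noteq> 0\<^sub>(tT R X Y i (n - 1 - i))}"
   by (rule finite_subset) (use fin in simp)
 qed
 have lin: "mod_hom R (obj ?C n) (obj ?C (n - 1)) (dif ?C n)" for n
 proof (rule mod_homI)
  fix v w assume v: "v : |obj ?C n|" and w: "w : |obj ?C n|"
  have vw: "v +\<^sub>(obj ?C n) w : |obj ?C n|" using modD(1)[OF m] v w by auto
  show "dif ?C n (v +\<^sub>(obj ?C n) w) = dif ?C n v +\<^sub>(obj ?C (n - 1)) dif ?C n w"
  proof
   fix i
   have e: "n - (i + 1) = n - 1 - i" "i + 1 - 1 = i" "n - i - 1 = n - 1 - i" by simp_all
   interpret T: module R "tT R X Y i (n - 1 - i)" by (rule module_tT)
   note cv = tensor_cpx_component_hom[OF v, of i] and cw = tensor_cpx_component_hom[OF w, of i]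
   have "tX R X Y (i + 1) (n - 1 - i) (v (i + 1) +\<^sub>(tT R X Y (i + 1) (n - 1 - i)) w (i + 1)) =
    tX R X Y (i + 1) (n - 1 - i) (v (i + 1)) +\<^sub>(tT R X Y i (n - 1 - i)) tX R X Y (i + 1) (n - 1 - i) (w (i + 1))"
    using mod_homD(2)[OF tX_hom(1) cv(1) cw(1)] by (simp add: e)
   moreover have "tY R X Y i (n - i) (v i +\<^sub>(tT R X Y i (n - i)) w i) =
    tY R X Y i (n - i) (v i) +\<^sub>(tT R X Y i (n - 1 - i)) tY R X Y i (n - i) (w i)"
    using mod_homD(2)[OF tY_hom(1) cv(2) cw(2)] by (simp add: e)
   ultimately show "dif ?C n (v +\<^sub>(obj ?C n) w) i = (dif ?C n v +\<^sub>(obj ?C (n - 1)) dif ?C n w) i"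
    using cv cw sgs(1) unfolding tensor_cpx_dif[OF vw]
    by (simp add: tensor_cpx_ops tensor_cpx_dif[OF v] tensor_cpx_dif[OF w] e
      T.smult_r_distr T.M.a_ac)
  qed
 next
  fix r w assume r: "r : |R|" and w: "w : |obj ?C n|"
  have rw: "r .\<^sub>(obj ?C n) w : |obj ?C n|" using modD(8)[OF m] r w by auto
  show "dif ?C n (r .\<^sub>(obj ?C n) w) = r .\<^sub>(obj ?C (n - 1)) dif ?C n w"
  proof
   fix i
   have e: "n - (i + 1) = n - 1 - i" "i + 1 - 1 = i" "n - i - 1 = n - 1 - i" by simp_all
   interpret T: module R "tT R X Y i (n - 1 - i)" by (rule module_tT)
   note cw = tensor_cpx_component_hom[OF w, of i]
   have sw: "sg R i .\<^sub>(tT R X Y i (n - 1 - i)) (r .\<^sub>(tT R X Y i (n - 1 - i)) y) =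
     r .\<^sub>(tT R X Y i (n - 1 - i)) (sg R i .\<^sub>(tT R X Y i (n - 1 - i)) y)"
    if "y : |tT R X Y i (n - 1 - i)|" for y
    using that r sgs(1) by (simp add: T.smult_assoc1[symmetric] R.m_comm)
   have "tX R X Y (i + 1) (n - 1 - i) (r .\<^sub>(tT R X Y (i + 1) (n - 1 - i)) w (i + 1)) =
    r .\<^sub>(tT R X Y i (n - 1 - i)) tX R X Y (i + 1) (n - 1 - i) (w (i + 1))"
    using mod_homD(3)[OF tX_hom(1) r cw(1)] by (simp add: e)
   moreover have "tY R X Y i (n - i) (r .\<^sub>(tT R X Y i (n - i)) w i) =
    r .\<^sub>(tT R X Y i (n - 1 - i)) tY R X Y i (n - i) (w i)"
    using mod_homD(3)[OF tY_hom(1) r cw(2)] by (simp add: e)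
   ultimately show "dif ?C n (r .\<^sub>(obj ?C n) w) i = (r .\<^sub>(obj ?C (n - 1)) dif ?C n w) i"
    using cw sgs(1) r unfolding tensor_cpx_dif[OF rw]
    by (simp add: tensor_cpx_ops tensor_cpx_dif[OF w] e T.smult_r_distr sw)
  qed
 qed (rule D)
 have dd: "dif ?C (n - 1) (dif ?C n w) = 0\<^sub>(obj ?C (n - 2))" if w: "w : |obj ?C n|" for n w
 proof
  fix i
  let ?T = "tT R X Y i (n - 2 - i)"
  interpret T: module R ?T by (rule module_tT)
  have e: "n - (i + 1) = n - 1 - i" "i + 1 - 1 = i" "n - i - 1 = n - 1 - i" "n - 1 - 1 - i = n - 2 - i"
   "n - 1 - (i + 1) = n - 2 - i" "i + 1 + 1 = i + 2" "n - (i + 2) = n - 2 - i" "n - 1 - i - 1 = n - 2 - i"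
   "i + 2 - 1 = i + 1" "i + 2 - 2 = i" "n - i - 2 = n - 2 - i" by simp_all
  note c = tensor_cpx_component_hom[OF w, of i] and c1 = tensor_cpx_component_hom[OF w, of "i + 1", unfolded e]
  note hX = tX_hom(1)[of "i + 1" "n - 2 - i", unfolded e] and hY = tY_hom(1)[of i "n - 1 - i", unfolded e]
  define P where "P = tX R X Y (i + 1) (n - 2 - i) (tY R X Y (i + 1) (n - 1 - i) (w (i + 1)))"
  have Pc: "P : |?T|" unfolding P_def by (rule mod_homD(1)[OF hX c1(4)])
  have D1: "dif ?C n w (i + 1) = tX R X Y (i + 2) (n - 2 - i) (w (i + 2)) +\<^sub>(tT R X Y (i + 1) (n - 2 - i))
    sg R (i + 1) .\<^sub>(tT R X Y (i + 1) (n - 2 - i)) tY R X Y (i + 1) (n - 1 - i) (w (i + 1))"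
   using tensor_cpx_dif[OF w, of "i + 1"] unfolding e .
  have scl: "sg R (i + 1) .\<^sub>(tT R X Y (i + 1) (n - 2 - i)) tY R X Y (i + 1) (n - 1 - i) (w (i + 1)) \<in>
    |tT R X Y (i + 1) (n - 2 - i)|"
   by (rule modD(8)[OF module_tT sgs(1) c1(4)])
  have XX: "tX R X Y (i + 1) (n - 2 - i) (tX R X Y (i + 2) (n - 2 - i) (w (i + 2))) = 0\<^sub>?T"
   using tX_tX[OF c1(1)] unfolding e .
  have 1: "tX R X Y (i + 1) (n - 2 - i) (dif ?C n w (i + 1)) = sg R (i + 1) .\<^sub>?T P"
   unfolding D1 using mod_homD(2)[OF hX c1(3) scl] mod_homD(3)[OF hX sgs(1) c1(4)] XX Pc sgs(1)
   by (simp add: P_def)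
  have scl2: "sg R i .\<^sub>(tT R X Y i (n - 1 - i)) tY R X Y i (n - i) (w i) : |tT R X Y i (n - 1 - i)|"
   by (rule modD(8)[OF module_tT sgs(1) c(4)])
  have YY: "tY R X Y i (n - 1 - i) (tY R X Y i (n - i) (w i)) = 0\<^sub>?T"
   using tY_tY[OF c(2)] unfolding e .
  have "tX R X Y (i + 1) (n - 1 - i - 1) (tY R X Y (i + 1) (n - 1 - i) (w (i + 1))) =
    tY R X Y (i + 1 - 1) (n - 1 - i) (tX R X Y (i + 1) (n - 1 - i) (w (i + 1)))"
   by (rule tX_tY[OF c(1)])
  then have XY: "tY R X Y i (n - 1 - i) (tX R X Y (i + 1) (n - 1 - i) (w (i + 1))) = P"
   unfolding P_def e by simp
  have 2: "tY R X Y i (n - 1 - i) (dif ?C n w i) = P"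
   unfolding tensor_cpx_dif[OF w]
   using mod_homD(2)[OF hY c(3) scl2] mod_homD(3)[OF hY sgs(1) c(4)] YY XY Pc sgs(1) by simp
  have "dif ?C (n - 1) (dif ?C n w) i =
   tX R X Y (i + 1) (n - 2 - i) (dif ?C n w (i + 1)) +\<^sub>?T sg R i .\<^sub>?T tY R X Y i (n - 1 - i) (dif ?C n w i)"
   using tensor_cpx_dif[OF D[OF w], of i] unfolding e .
  also have "\<dots> = 0\<^sub>?T"
   unfolding 1 2 sgs(3) using Pc sgs(1) by (simp add: T.smult_l_minus T.M.l_neg)
  finally show "dif ?C (n - 1) (dif ?C n w) i = 0\<^sub>(obj ?C (n - 2)) i" by (simp add: tensor_cpx_ops)
 qed
 show ?thesis unfolding is_cpx_def using m lin dd by blast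
qed

lemma tensor_trivial:
 assumes "|obj X i| = {0\<^sub>(obj X i)}"
 shows "|tT R X Y i j| = {0\<^sub>(tT R X Y i j)}"
proof -
 interpret T: module R "tT R X Y i j" by (rule module_tT)
 have "submodule {0\<^sub>(tT R X Y i j)} R (tT R X Y i j)" by (rule submodI[OF module_tT]) auto
 from tensor_spanned[OF is_cpxD(1)[OF X] is_cpxD(1)[OF Y] this] show ?thesis
  using assms tens_zero[OF is_cpxD(1)[OF X] is_cpxD(1)[OF Y]] by auto
qed

text \<open>A linear form on \<open>X\<^sub>i\<close> turns \<open>X\<^sub>i \<otimes> Y\<close> into \<open>Y\<close>, compatibly with the differential of \<open>Y\<close>.\<close>

lemma tensor_eval:
 assumes th: "mod_hom R (obj X i) (ring_mod R) tt"
 shows "\<exists>Th. (\<forall>j. mod_hom R (tT R X Y i j) (obj Y j) (Th j)) \<and>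
  (\<forall>j. \<forall>x\<in>|obj X i|. \<forall>y\<in>|obj Y j|. Th j (tens R (obj X i) (obj Y j) x y) = tt x .\<^sub>(obj Y j) y) \<and>
  (\<forall>j. \<forall>u\<in>|tT R X Y i j|. dif Y j (Th j u) = Th (j - 1) (tY R X Y i j u))"
proof -
 note dX = is_cpxD[OF X] and dY = is_cpxD[OF Y]
 interpret R: cring R by (rule modD(13)[OF module_tT[of 0 0]])
 have tc: "tt x : |R|" if "x : |obj X i|" for x using mod_homD(1)[OF th that] by simp
 have "\<exists>Th. mod_hom R (tT R X Y i j) (obj Y j) Th \<and>
  (\<forall>x\<in>|obj X i|. \<forall>y\<in>|obj Y j|. Th (tens R (obj X i) (obj Y j) x y) = tt x .\<^sub>(obj Y j) y)" for j
 proof -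
  interpret Y: module R "obj Y j" by (rule dY)
  show ?thesis
  proof (rule tensor_lift[OF dX(1) dY(1) dY(1)])
   fix r x y assume *: "r : |R|" "x : |obj X i|" "y : |obj Y j|"
   show "tt x .\<^sub>(obj Y j) (r .\<^sub>(obj Y j) y) = r .\<^sub>(obj Y j) (tt x .\<^sub>(obj Y j) y)"
    using * tc[OF *(2)] by (simp add: Y.smult_assoc1[symmetric] R.m_comm)
  qed (use tc mod_homD[OF th] in "simp_all add: Y.smult_r_distr Y.smult_l_distr Y.smult_assoc1")
 qed
 then have "\<exists>Th. \<forall>j. mod_hom R (tT R X Y i j) (obj Y j) (Th j) \<and>
  (\<forall>x\<in>|obj X i|. \<forall>y\<in>|obj Y j|. Th j (tens R (obj X i) (obj Y j) x y) = tt x .\<^sub>(obj Y j) y)"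
  by (intro choice) blast
 then obtain Th where Th: "!!j. mod_hom R (tT R X Y i j) (obj Y j) (Th j)"
  "!!j x y. x : |obj X i| ==> y : |obj Y j| ==> Th j (tens R (obj X i) (obj Y j) x y) = tt x .\<^sub>(obj Y j) y"
  by blast
 have "dif Y j (Th j u) = Th (j - 1) (tY R X Y i j u)" if u: "u : |tT R X Y i j|" for j u
  by (rule tensor_hom_eq[OF dX(1) dY(1) dY(1) mod_hom_comp[OF Th(1) dY(2)] mod_hom_comp[OF tY_hom(1) Th(1)] _ u])
    (simp add: Th(2) tY_hom(2) mod_homD(1)[OF dY(2)] mod_homD(3)[OF dY(2)] tc)
 then show ?thesis using Th by blast
qed

text \<open>Hence the coordinates with respect to a basis of \<open>X\<^sub>i\<close> describe \<open>X\<^sub>i \<otimes> Y\<close> as a direct sum of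
 copies of \<open>Y\<close>.\<close>

lemma tensor_expand:
 assumes bc: "basis_coord R (obj X i) B c"
 shows "\<exists>Th. (\<forall>b\<in>B. \<forall>j. mod_hom R (tT R X Y i j) (obj Y j) (Th b j)) \<and>
  (\<forall>b\<in>B. \<forall>j. \<forall>u\<in>|tT R X Y i j|. dif Y j (Th b j u) = Th b (j - 1) (tY R X Y i j u)) \<and>
  (\<forall>j. \<forall>u\<in>|tT R X Y i j|. \<exists>S. finite S \<and> S \<subseteq> B \<and>
    u = finsum (tT R X Y i j) (%b. tens R (obj X i) (obj Y j) b (Th b j u)) S)"
proof -
 note dX = is_cpxD[OF X] and dY = is_cpxD[OF Y]
 note d = basis_coordD[OF bc]
 have "\<exists>Th. \<forall>b. b : B \<longrightarrow> (\<forall>j. mod_hom R (tT R X Y i j) (obj Y j) (Th b j)) \<and>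
  (\<forall>j. \<forall>x\<in>|obj X i|. \<forall>y\<in>|obj Y j|. Th b j (tens R (obj X i) (obj Y j) x y) = c b x .\<^sub>(obj Y j) y) \<and>
  (\<forall>j. \<forall>u\<in>|tT R X Y i j|. dif Y j (Th b j u) = Th b (j - 1) (tY R X Y i j u))"
  using tensor_eval[OF d(2)] by (intro choice) blast
 then obtain Th where Th: "!!b j. b : B ==> mod_hom R (tT R X Y i j) (obj Y j) (Th b j)"
  "!!b j x y. b : B ==> x : |obj X i| ==> y : |obj Y j| ==>
   Th b j (tens R (obj X i) (obj Y j) x y) = c b x .\<^sub>(obj Y j) y"
  "!!b j u. b : B ==> u : |tT R X Y i j| ==> dif Y j (Th b j u) = Th b (j - 1) (tY R X Y i j u)"
  by blast
 have ex: "\<exists>S. finite S \<and> S \<subseteq> B \<and> u = finsum (tT R X Y i j) (%b. tens R (obj X i) (obj Y j) b (Th b j u)) S"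
  if u: "u : |tT R X Y i j|" for j u
 proof -
  let ?T = "tT R X Y i j" and ?t = "tens R (obj X i) (obj Y j)"
  interpret T: module R ?T by (rule module_tT)
  interpret Xi: module R "obj X i" by (rule dX)
  interpret Yj: module R "obj Y j" by (rule dY)
  note tb = tens_bilinear[OF dX(1)[of i] dY(1)[of j]]
  have tc: "?t b (Th b j u) : |?T|" if "b : B" "u : |?T|" for b u
   using that d(1) mod_homD(1)[OF Th(1)] by (intro tb(1)) auto
  define G where "G u S \<longleftrightarrow> (\<forall>V. finite V \<longrightarrow> S \<subseteq> V \<longrightarrow> V \<subseteq> B \<longrightarrow>
   u = finsum ?T (%b. ?t b (Th b j u)) V)" for u S
  have GD: "u = finsum ?T (%b. ?t b (Th b j u)) V" if "G u S" "finite V" "S \<subseteq> V" "V \<subseteq> B" for u S V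
   using that(1)[unfolded G_def, rule_format, OF that(2-4)] .
  have GI: "G u S" if "!!V. finite V ==> S \<subseteq> V ==> V \<subseteq> B ==> u = finsum ?T (%b. ?t b (Th b j u)) V" for u S
   unfolding G_def by (intro allI impI) (rule that)
  define good where "good u \<longleftrightarrow> (\<exists>S. finite S \<and> S \<subseteq> B \<and> G u S)" for u
  have "submodule {u : |?T|. good u} R ?T"
  proof (rule submodI[OF module_tT])
   have "good 0\<^sub>?T" unfolding good_def
   proof (intro exI[of _ "{}"] conjI GI)
    fix V assume V: "finite V" "V \<subseteq> B"
    have zb: "?t b (Th b j 0\<^sub>?T) = 0\<^sub>?T" if "b : V" for b
    proof -
     have b: "b : B" "b : |obj X i|" using that V(2) d(1) by auto
     show ?thesis
      using mod_hom_zero[OF module_tT dY(1) Th(1)[OF b(1)]] tens_zero(2)[OF dX(1) dY(1) b(2)] by simp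
    qed
    have "finsum ?T (%b. ?t b (Th b j 0\<^sub>?T)) V = finsum ?T (%b. 0\<^sub>?T) V"
     by (rule T.M.finsum_cong'[OF refl]) (use zb in simp_all)
    then show "0\<^sub>?T = finsum ?T (%b. ?t b (Th b j 0\<^sub>?T)) V" by simp
   qed simp_all
   then show "0\<^sub>?T : {u : |?T|. good u}" by simp
  next
   fix u v assume "u : {u : |?T|. good u}" "v : {u : |?T|. good u}"
   then obtain S1 S2 where uv: "u : |?T|" "v : |?T|"
    and S1: "finite S1" "S1 \<subseteq> B" "G u S1"
    and S2: "finite S2" "S2 \<subseteq> B" "G v S2"
    unfolding good_def by blast
   have "u +\<^sub>?T v = finsum ?T (%b. ?t b (Th b j (u +\<^sub>?T v))) V"
    if V: "finite V" "S1 \<union> S2 \<subseteq> V" "V \<subseteq> B" for V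
   proof -
    have "finsum ?T (%b. ?t b (Th b j (u +\<^sub>?T v))) V = finsum ?T (%b. ?t b (Th b j u) +\<^sub>?T ?t b (Th b j v)) V"
    proof (rule T.M.finsum_cong'[OF refl])
     show "(%b. ?t b (Th b j u) +\<^sub>?T ?t b (Th b j v)) : V \<rightarrow> |?T|" using V(3) tc uv by auto
     fix b assume "b : V"
     then have b: "b : B" "b : |obj X i|" using V(3) d(1) by auto
     show "?t b (Th b j (u +\<^sub>?T v)) = ?t b (Th b j u) +\<^sub>?T ?t b (Th b j v)"
      using mod_homD[OF Th(1)[OF b(1)]] uv tb(3)[OF b(2)] by simp
    qed
    also have "\<dots> = finsum ?T (%b. ?t b (Th b j u)) V +\<^sub>?T finsum ?T (%b. ?t b (Th b j v)) V"
     by (rule T.M.finsum_addf) (use V(3) tc uv in auto)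
    also have "\<dots> = u +\<^sub>?T v" using GD[OF S1(3) V(1) _ V(3)] GD[OF S2(3) V(1) _ V(3)] V(2) by simp
    finally show ?thesis by (rule sym)
   qed
   then have "G (u +\<^sub>?T v) (S1 \<union> S2)" by (rule GI)
   then have "good (u +\<^sub>?T v)" unfolding good_def using S1(1,2) S2(1,2) by (intro exI[of _ "S1 \<union> S2"]) simp
   then show "u +\<^sub>?T v : {u : |?T|. good u}" using uv by simp
  next
   fix r u assume r: "r : |R|" and "u : {u : |?T|. good u}"
   then obtain S1 where u: "u : |?T|"
    and S1: "finite S1" "S1 \<subseteq> B" "G u S1"
    unfolding good_def by blast
   have "r .\<^sub>?T u = finsum ?T (%b. ?t b (Th b j (r .\<^sub>?T u))) V"
    if V: "finite V" "S1 \<subseteq> V" "V \<subseteq> B" for V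
   proof -
    have "finsum ?T (%b. ?t b (Th b j (r .\<^sub>?T u))) V = finsum ?T (%b. r .\<^sub>?T ?t b (Th b j u)) V"
    proof (rule T.M.finsum_cong'[OF refl])
     show "(%b. r .\<^sub>?T ?t b (Th b j u)) : V \<rightarrow> |?T|" using V(3) tc u r by auto
     fix b assume "b : V"
     then have b: "b : B" "b : |obj X i|" using V(3) d(1) by auto
     show "?t b (Th b j (r .\<^sub>?T u)) = r .\<^sub>?T ?t b (Th b j u)"
      using mod_homD[OF Th(1)[OF b(1)]] u r tb(5)[OF r b(2)] by simp
    qed
    also have "\<dots> = r .\<^sub>?T finsum ?T (%b. ?t b (Th b j u)) V"
     by (rule T.finsum_smult_ldistr[symmetric]) (use V tc u r in auto)
    also have "\<dots> = r .\<^sub>?T u" using GD[OF S1(3) V] by simp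
    finally show ?thesis by (rule sym)
   qed
   then have "G (r .\<^sub>?T u) S1" by (rule GI)
   then have "good (r .\<^sub>?T u)" unfolding good_def using S1(1,2) by (intro exI[of _ S1]) simp
   then show "r .\<^sub>?T u : {u : |?T|. good u}" using u r by simp
  qed auto
  moreover have "?t x y : {u : |?T|. good u}" if xy: "x : |obj X i|" "y : |obj Y j|" for x y
  proof -
   have "?t x y = finsum ?T (%b. ?t b (Th b j (?t x y))) V"
    if V: "finite V" "{b : B. c b x \<noteq> 0\<^sub>R} \<subseteq> V" "V \<subseteq> B" for V
   proof -
    have x: "x = finsum (obj X i) (%b. c b x .\<^sub>(obj X i) b) V"
     using d(4)[OF xy(1)] Xi.finsum_support[OF V, of "%b. b"] d(1) d(5)[OF _ xy(1)] by (auto simp: Pi_def)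
    have hom: "mod_hom R (obj X i) ?T (%x. ?t x y)" by (rule mod_homI) (use tb xy in auto)
    have Vc: "b : |obj X i|" "c b x : |R|" "b : B" if "b : V" for b
     using that V(3) d(1) d(5)[OF _ xy(1)] by auto
    have "finsum ?T (%b. ?t b (Th b j (?t x y))) V = finsum ?T (%b. ?t (c b x .\<^sub>(obj X i) b) y) V"
     by (rule T.M.finsum_cong'[OF refl]) (use Vc xy tb Th(2) in auto)
    also have "\<dots> = ?t (finsum (obj X i) (%b. c b x .\<^sub>(obj X i) b) V) y"
     by (rule mod_hom_finsum[OF dX(1) module_tT hom V(1), symmetric]) (use Vc in auto)
    finally show ?thesis unfolding x[symmetric] by (rule sym)
   qed
   then have "G (?t x y) {b : B. c b x \<noteq> 0\<^sub>R}" by (rule GI)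
   then have "good (?t x y)" unfolding good_def using d(3)[OF xy(1)]
    by (intro exI[of _ "{b : B. c b x \<noteq> 0\<^sub>R}"] conjI) simp_all
   then show ?thesis using tb(1) xy by simp
  qed
  ultimately have "{u : |?T|. good u} = |?T|"
   by (rule tensor_spanned[OF dX(1) dY(1)])
  then have "good u" using u by blast
  then obtain S where S: "finite S" "S \<subseteq> B" "G u S" unfolding good_def by blast
  show ?thesis by (intro exI[of _ S] conjI S(1,2) GD[OF S(3,1) subset_refl S(2)])
 qed
 show ?thesis
  by (rule exI[of _ Th], intro conjI ballI allI) (rule Th(1) Th(3) ex; assumption)+
qed

end

section \<open>Tensoring a resolution of the residue field with a complex\<close>

lemma tensor_cycle_torsion:
 fixes R :: "'a ring"
 assumes X: "is_cpx R X" and Y: "is_cpx R Y" and free: "free_mod R (obj X i)" and p: "primeideal p R"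
  and t: "torsion_at R p Y j" and u: "u : |tT R X Y i j|"
  and du: "tY R X Y i j u = 0\<^sub>(tT R X Y i (j - 1))"
 shows "\<exists>s\<in>|R| - p. \<exists>v\<in>|tT R X Y i (j + 1)|. tY R X Y i (j + 1) v = s .\<^sub>(tT R X Y i j) u"
proof -
 note dX = is_cpxD[OF X] and dY = is_cpxD[OF Y]
 let ?T = "tT R X Y i j" and ?t = "tens R (obj X i) (obj Y j)"
 interpret T: module R ?T by (rule module_tT[OF X Y])
 interpret T1: module R "tT R X Y i (j + 1)" by (rule module_tT[OF X Y])
 obtain B c where bc: "basis_coord R (obj X i) B c" using free_mod_basis_coord[OF dX(1) free] by blast
 have BX: "B \<subseteq> |obj X i|" using basis_coordD(1)[OF bc] .
 obtain Th where Th1: "\<forall>b\<in>B. \<forall>j. mod_hom R (tT R X Y i j) (obj Y j) (Th b j)"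
  and Th2: "\<forall>b\<in>B. \<forall>j. \<forall>u\<in>|tT R X Y i j|. dif Y j (Th b j u) = Th b (j - 1) (tY R X Y i j u)"
  and Th3: "\<forall>j. \<forall>u\<in>|tT R X Y i j|. \<exists>S. finite S \<and> S \<subseteq> B \<and>
    u = finsum (tT R X Y i j) (%b. tens R (obj X i) (obj Y j) b (Th b j u)) S"
  using tensor_expand[OF X Y bc] by (elim exE conjE)
 note Th = Th1[rule_format] Th2[rule_format] Th3[rule_format]
 obtain S where S: "finite S" "S \<subseteq> B" "u = finsum ?T (%b. ?t b (Th b j u)) S" using Th(3)[OF u] by (elim exE conjE)
 have cyc: "Th b j u : cycles Y j" if "b : B" for b
  using Th(2)[OF that u] mod_homD(1)[OF Th(1)[OF that] u] mod_hom_zero[OF module_tT[OF X Y] dY(1) Th(1)[OF that]]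
  by (simp add: cycles_def du)
 have "\<exists>s\<in>|R| - p. \<forall>x\<in>(%b. Th b j u) ` S. s .\<^sub>(obj Y j) x : boundaries Y j"
 proof (rule common_multiplier[OF dY(1) cycles_boundaries(2)[OF Y] p])
  show "(%b. Th b j u) ` S \<subseteq> |obj Y j|" using cyc S(2) cycles_boundaries(4)[OF Y] by blast
  fix x assume "x : (%b. Th b j u) ` S"
  then have "x : cycles Y j" using cyc S(2) by blast
  then show "\<exists>s\<in>|R| - p. s .\<^sub>(obj Y j) x : boundaries Y j" using t unfolding torsion_at_def by blast
 qed (use S(1) in simp)
 then obtain s where s: "s : |R| - p" "!!b. b : S ==> s .\<^sub>(obj Y j) Th b j u : boundaries Y j" by blast
 then have "\<exists>n. \<forall>b. b : S \<longrightarrow> n b : |obj Y (j + 1)| \<and> dif Y (j + 1) (n b) = s .\<^sub>(obj Y j) Th b j u"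
  by (intro choice) (auto simp: boundaries_def image_iff, metis)
 then obtain n where n: "!!b. b : S ==> n b : |obj Y (j + 1)|"
  "!!b. b : S ==> dif Y (j + 1) (n b) = s .\<^sub>(obj Y j) Th b j u" by blast
 let ?t1 = "tens R (obj X i) (obj Y (j + 1))"
 define v where "v = finsum (tT R X Y i (j + 1)) (%b. ?t1 b (n b)) S"
 have tn: "?t1 b (n b) : |tT R X Y i (j + 1)|" if "b : S" for b
  using n(1)[OF that] that S(2) BX by (intro tens_bilinear(1)[OF dX(1) dY(1)]) auto
 have tu: "?t b (Th b j u) : |?T|" if "b : S" for b
  using cyc[of b] cycles_boundaries(4)[OF Y] that S(2) BX by (intro tens_bilinear(1)[OF dX(1) dY(1)]) auto
 have e: "j + 1 - 1 = j" by simp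
 note hY = tY_hom(1)[OF X Y, of i "j + 1", unfolded e]
 have vc: "v : |tT R X Y i (j + 1)|" unfolding v_def by (rule T1.M.finsum_closed) (use tn in auto)
 have "tY R X Y i (j + 1) v = finsum ?T (%b. tY R X Y i (j + 1) (?t1 b (n b))) S"
  unfolding v_def by (rule mod_hom_finsum[OF module_tT[OF X Y] module_tT[OF X Y] hY S(1)]) (use tn in auto)
 also have "\<dots> = finsum ?T (%b. s .\<^sub>?T ?t b (Th b j u)) S"
 proof (rule T.M.finsum_cong'[OF refl])
  show "(%b. s .\<^sub>?T ?t b (Th b j u)) : S \<rightarrow> |?T|" using tu s(1) by auto
  fix b assume b: "b : S"
  then have bX: "b : |obj X i|" and tb: "Th b j u : |obj Y j|"
   using S(2) BX cyc[of b] cycles_boundaries(4)[OF Y] by auto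
  have "tY R X Y i (j + 1) (?t1 b (n b)) = ?t b (dif Y (j + 1) (n b))"
   using tY_hom(2)[OF X Y bX n(1)[OF b]] by simp
  then show "tY R X Y i (j + 1) (?t1 b (n b)) = s .\<^sub>?T ?t b (Th b j u)"
   using tens_bilinear(5)[OF dX(1) dY(1) _ bX tb, of s] s(1) n(2)[OF b] by simp
 qed
 also have "\<dots> = s .\<^sub>?T finsum ?T (%b. ?t b (Th b j u)) S"
  by (rule T.finsum_smult_ldistr[symmetric]) (use S(1) s(1) tu in auto)
 finally have "tY R X Y i (j + 1) v = s .\<^sub>?T u" using S(3) by simp
 then show ?thesis using s(1) vc by blast
qed

text \<open>
 A chain can be pushed into low \<open>X\<close>-degrees modulo boundaries, at the price of a multiplier outside
 \<open>p\<close>, as long as its boundary vanishes there: its component of top \<open>X\<close>-degree is a cycle of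
 \<open>X\<^sub>i \<otimes> Y\<close>, hence torsion, and a multiple of it is removed by a boundary.
\<close>

lemma tensor_descend:
 fixes R :: "'a ring" and X :: "('a, 'm) cpx" and Y :: "('a, 'n) cpx"
 assumes X: "is_cpx R X" and Y: "is_cpx R Y" and free: "!!i. free_mod R (obj X i)" and p: "primeideal p R"
  and tors: "!!i. i > t0 ==> torsion_at R p Y (n - i)"
  and u: "u : |obj (tensor_cpx R X Y) n|"
  and du: "!!i. i \<ge> t0 ==> dif (tensor_cpx R X Y) n u i = 0\<^sub>(tT R X Y i (n - 1 - i))"
 shows "\<exists>s\<in>|R| - p. \<exists>v\<in>|obj (tensor_cpx R X Y) (n + 1)|. \<forall>i>t0.
  (s .\<^sub>(obj (tensor_cpx R X Y) n) u +\<^sub>(obj (tensor_cpx R X Y) n) dif (tensor_cpx R X Y) (n + 1) v) i =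
   0\<^sub>(tT R X Y i (n - i))"
proof -
 let ?C = "tensor_cpx R X Y"
 note C = is_cpx_tensor_cpx[OF X Y]
 note dC = is_cpxD[OF C]
 interpret R: cring R by (rule modD(13)[OF dC(1)])
 interpret Cn: module R "obj ?C n" by (rule dC)
 interpret Cn1: module R "obj ?C (n + 1)" by (rule dC)
 interpret Cm: module R "obj ?C (n - 1)" by (rule dC)
 note sgs = sg_simps[OF R.is_cring]
 note pc = prime_compl[OF p]
 note car = tensor_cpx_carrier[OF X Y] and ops = tensor_cpx_ops[OF X Y]
 have main: "\<exists>s\<in>|R| - p. \<exists>v\<in>|obj ?C (n + 1)|. \<forall>i>t0.
  (s .\<^sub>(obj ?C n) u +\<^sub>(obj ?C n) dif ?C (n + 1) v) i = 0\<^sub>(tT R X Y i (n - i))"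
  if "u : |obj ?C n|" "!!i. i \<ge> t0 ==> dif ?C n u i = 0\<^sub>(tT R X Y i (n - 1 - i))"
   "!!i. i > t0 + int K ==> u i = 0\<^sub>(tT R X Y i (n - i))" for u K
  using that
 proof (induct K arbitrary: u)
  case 0
  have "1\<^sub>R .\<^sub>(obj ?C n) u +\<^sub>(obj ?C n) dif ?C (n + 1) 0\<^sub>(obj ?C (n + 1)) = u"
   using 0(1) mod_hom_zero[OF dC(1) dC(1) dC(4)] by simp
  then show ?case using 0(3) pc(1) Cn1.M.zero_closed by (intro bexI[of _ "1\<^sub>R"] bexI[of _ "0\<^sub>(obj ?C (n + 1))"]) auto
 next
  case (Suc K)
  define t where "t = t0 + int K + 1"
  have t: "t > t0" "t0 + int (Suc K) = t" "!!i. i > t0 + int K ==> i = t \<or> i > t" by (auto simp: t_def)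
  have e: "n - (t + 1) = n - 1 - t" "t + 1 - 1 = t" "n - t - 1 = n - 1 - t" "n - t + 1 = n + 1 - t"
   "n + 1 - 1 - t = n - t" by simp_all
  interpret T: module R "tT R X Y t (n - t)" by (rule module_tT[OF X Y])
  interpret T1: module R "tT R X Y t (n + 1 - t)" by (rule module_tT[OF X Y])
  interpret Tm: module R "tT R X Y t (n - 1 - t)" by (rule module_tT[OF X Y])
  note uc = tensor_cpx_component_hom[OF X Y Suc(2), of t]
  have "u (t + 1) = 0\<^sub>(tT R X Y (t + 1) (n - (t + 1)))" using Suc(4)[of "t + 1"] t(2) by simp
  then have "tX R X Y (t + 1) (n - 1 - t) (u (t + 1)) = 0\<^sub>(tT R X Y t (n - 1 - t))"
   using mod_hom_zero[OF module_tT[OF X Y] module_tT[OF X Y] tX_hom(1)[OF X Y], of "t + 1" "n - 1 - t"]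
   by (simp add: e)
  then have "sg R t .\<^sub>(tT R X Y t (n - 1 - t)) tY R X Y t (n - t) (u t) = 0\<^sub>(tT R X Y t (n - 1 - t))"
   using Suc(3)[of t] t(1) uc sgs(1) by (simp add: tensor_cpx_dif[OF X Y Suc(2)])
  then have "(sg R t \<otimes>\<^sub>R sg R t) .\<^sub>(tT R X Y t (n - 1 - t)) tY R X Y t (n - t) (u t) = 0\<^sub>(tT R X Y t (n - 1 - t))"
   using uc sgs(1) by (simp add: Tm.smult_assoc1)
  then have "tY R X Y t (n - t) (u t) = 0\<^sub>(tT R X Y t (n - t - 1))" using uc by (simp add: sgs(2) e)
  from tensor_cycle_torsion[OF X Y free p tors[OF t(1)] uc(2) this]
  obtain s0 v0 where s0: "s0 : |R| - p" and v0: "v0 : |tT R X Y t (n + 1 - t)|"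
   "tY R X Y t (n + 1 - t) v0 = s0 .\<^sub>(tT R X Y t (n - t)) u t" by (auto simp: e)
  define v1 where "v1 i = (if i = t then (-\<^sub>R sg R t) .\<^sub>(tT R X Y t (n + 1 - t)) v0
    else 0\<^sub>(tT R X Y i (n + 1 - i)))" for i
  have v1: "v1 : |obj ?C (n + 1)|" unfolding car
  proof
   show "\<forall>i. v1 i : |tT R X Y i (n + 1 - i)|"
    using v0(1) sgs(1) modD(2)[OF module_tT[OF X Y]] by (simp add: v1_def)
   show "finite {i. v1 i \<noteq> 0\<^sub>(tT R X Y i (n + 1 - i))}"
    by (rule finite_subset[of _ "{t}"]) (auto simp: v1_def)
  qed
  define u' where "u' = s0 .\<^sub>(obj ?C n) u +\<^sub>(obj ?C n) dif ?C (n + 1) v1"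
  have dv1: "dif ?C (n + 1) v1 : |obj ?C n|" using mod_homD(1)[OF dC(4) v1] .
  have s0c: "s0 : |R|" using s0 by simp
  have s0u: "s0 .\<^sub>(obj ?C n) u : |obj ?C n|" using Cn.smult_closed[OF s0c Suc(2)] .
  have u': "u' : |obj ?C n|" unfolding u'_def using s0u dv1 by simp
  have top: "u' i = 0\<^sub>(tT R X Y i (n - i))" if i: "i > t0 + int K" for i
  proof -
   have ei: "n + 1 - 1 - i = n - i" "i + 1 - 1 = i" "n + 1 - i - 1 = n - i" by simp_all
   interpret Ti: module R "tT R X Y i (n - i)" by (rule module_tT[OF X Y])
   have x0: "tX R X Y (i + 1) (n - i) (v1 (i + 1)) = 0\<^sub>(tT R X Y i (n - i))"
   proof -
    have "i + 1 \<noteq> t" using t(3)[OF i] by auto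
    moreover have "n + 1 - (i + 1) = n - i" by simp
    ultimately have v0: "v1 (i + 1) = 0\<^sub>(tT R X Y (i + 1) (n - i))" by (simp only: v1_def if_False)
    show ?thesis unfolding v0
     using mod_hom_zero[OF module_tT[OF X Y] module_tT[OF X Y] tX_hom(1)[OF X Y], of "i + 1" "n - i"]
     unfolding ei .
   qed
   have dv: "dif ?C (n + 1) v1 i = sg R i .\<^sub>(tT R X Y i (n - i)) tY R X Y i (n + 1 - i) (v1 i)"
    using tensor_cpx_component_hom(4)[OF X Y v1, of i] sgs(1)
    unfolding tensor_cpx_dif[OF X Y v1] ei x0 by simp
   show ?thesis
   proof (cases "i = t")
    case True
    have ut: "u t : |tT R X Y t (n - t)|" by (rule uc(2))
    have n1: "-\<^sub>R sg R t : |R|" using sgs(1) by simp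
    have sid: "sg R t \<otimes>\<^sub>R (-\<^sub>R sg R t \<otimes>\<^sub>R s0) = -\<^sub>R s0"
     using sgs(1) s0c by (simp add: R.l_minus R.r_minus R.m_assoc[symmetric] sgs(2))
    have hY: "mod_hom R (tT R X Y t (n + 1 - t)) (tT R X Y t (n - t)) (tY R X Y t (n + 1 - t))"
     using tY_hom(1)[OF X Y, of t "n + 1 - t"] by (simp add: algebra_simps)
    have "tY R X Y t (n + 1 - t) (v1 t) = (-\<^sub>R sg R t) .\<^sub>(tT R X Y t (n - t)) (s0 .\<^sub>(tT R X Y t (n - t)) u t)"
     using mod_homD(3)[OF hY n1 v0(1)] v0(2) by (simp add: v1_def)
    then have "dif ?C (n + 1) v1 t = -\<^sub>(tT R X Y t (n - t)) (s0 .\<^sub>(tT R X Y t (n - t)) u t)"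
     using dv True sgs(1) ut s0c sid
     by (simp add: T.smult_assoc1[symmetric] T.smult_l_minus)
    then show ?thesis unfolding True u'_def ops using ut s0c by (simp add: T.M.r_neg)
   next
    case False
    then have "i > t" using t(3)[OF i] by simp
    then have ui: "u i = 0\<^sub>(tT R X Y i (n - i))" using Suc(4)[of i] t(2) by simp
    have "tY R X Y i (n + 1 - i) (v1 i) = 0\<^sub>(tT R X Y i (n - i))"
     using False mod_hom_zero[OF module_tT[OF X Y] module_tT[OF X Y] tY_hom(1)[OF X Y], of i "n + 1 - i"]
     by (simp add: v1_def ei)
    then show ?thesis unfolding u'_def ops dv ui using s0c sgs(1) by simp
   qed
  qed
  have bot: "dif ?C n u' i = 0\<^sub>(tT R X Y i (n - 1 - i))" if "i \<ge> t0" for i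
  proof -
   interpret Ti: module R "tT R X Y i (n - 1 - i)" by (rule module_tT[OF X Y])
   have ddv: "dif ?C n (dif ?C (n + 1) v1) = 0\<^sub>(obj ?C (n - 1))" using dC(5)[OF v1] .
   have du: "dif ?C n u : |obj ?C (n - 1)|" using mod_homD(1)[OF dC(2) Suc(2)] .
   have "dif ?C n u' = s0 .\<^sub>(obj ?C (n - 1)) dif ?C n u"
    unfolding u'_def using mod_homD(2)[OF dC(2) s0u dv1] mod_homD(3)[OF dC(2) s0c Suc(2)] ddv s0c du by simp
   then show ?thesis unfolding ops using Suc(3)[OF that] s0c by (simp add: ops)
  qed
  obtain s1 v2 where s1: "s1 : |R| - p" and v2: "v2 : |obj ?C (n + 1)|"
   and z: "!!i. i > t0 ==> (s1 .\<^sub>(obj ?C n) u' +\<^sub>(obj ?C n) dif ?C (n + 1) v2) i = 0\<^sub>(tT R X Y i (n - i))"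
   using Suc(1)[OF u' bot top] by blast
  have s1c: "s1 : |R|" using s1 by simp
  let ?v = "s1 .\<^sub>(obj ?C (n + 1)) v1 +\<^sub>(obj ?C (n + 1)) v2"
  have v: "?v : |obj ?C (n + 1)|" using v1 v2 s1c by simp
  have dv2: "dif ?C (n + 1) v2 : |obj ?C n|" using mod_homD(1)[OF dC(4) v2] .
  have "dif ?C (n + 1) ?v = s1 .\<^sub>(obj ?C n) dif ?C (n + 1) v1 +\<^sub>(obj ?C n) dif ?C (n + 1) v2"
   using mod_homD(2)[OF dC(4) Cn1.smult_closed[OF s1c v1] v2] mod_homD(3)[OF dC(4) s1c v1] by simp
  then have "(s1 \<otimes>\<^sub>R s0) .\<^sub>(obj ?C n) u +\<^sub>(obj ?C n) dif ?C (n + 1) ?v =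
   s1 .\<^sub>(obj ?C n) u' +\<^sub>(obj ?C n) dif ?C (n + 1) v2"
   unfolding u'_def using s1c s0c Suc(2) dv1 dv2 s0u
   by (simp add: Cn.smult_r_distr Cn.smult_assoc1 Cn.M.a_assoc)
  then show ?case using z pc(2)[OF s1 s0] v by (intro bexI[of _ "s1 \<otimes>\<^sub>R s0"] bexI[of _ ?v]) simp_all
 qed
 have fin: "finite {i. u i \<noteq> 0\<^sub>(tT R X Y i (n - i))}" using u unfolding car by blast
 obtain K where K: "!!i. i : {i. u i \<noteq> 0\<^sub>(tT R X Y i (n - i))} ==> i \<le> K"
  using bdd_above_finite[OF fin] unfolding bdd_above_def by blast
 have "u i = 0\<^sub>(tT R X Y i (n - i))" if "i > t0 + int (nat (K - t0))" for i
 proof (rule ccontr)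
  assume "u i \<noteq> 0\<^sub>(tT R X Y i (n - i))"
  then have "i \<le> K" using K by blast
  then show False using that by (simp split: if_splits)
 qed
 from main[OF u du this] show ?thesis by blast
qed

lemma nakayama_homology:
 fixes R :: "'a ring"
 assumes Y: "is_cpx R Y" and p: "primeideal p R" and fg: "fg_at R Y n"
  and hyp: "!!z. z : cycles Y n ==> \<exists>t\<in>|R| - p. \<exists>y\<in>lincomb (obj Y n) p (cycles Y n).
   \<exists>k\<in>boundaries Y n. t .\<^sub>(obj Y n) z = y +\<^sub>(obj Y n) k"
 shows "torsion_at R p Y n"
proof -
 let ?M = "obj Y n" and ?B = "boundaries Y n"
 interpret M: module R ?M by (rule is_cpxD[OF Y])
 note M = M.module_axioms
 note cB = cycles_boundaries[OF Y, of n]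
 note b = submoduleD[OF M cB(2)]
 note pc = prime_compl[OF p]
 obtain S where S: "finite S" "S \<subseteq> cycles Y n"
  "!!z. z : cycles Y n ==> \<exists>y\<in>lincomb ?M |R| S. \<exists>b\<in>?B. z = y +\<^sub>?M b"
  using fg unfolding fg_at_def by blast
 have Sc: "S \<subseteq> |?M|" using S(2) cB(4) by blast
 have lS: "lincomb ?M p S \<subseteq> |?M|" "lincomb ?M |R| S \<subseteq> |?M|"
  using M.lincomb_closed[OF pc(5) Sc] M.lincomb_closed[OF subset_refl Sc] by auto
 have pS: "\<exists>y\<in>lincomb ?M p S. \<exists>k\<in>?B. x = y +\<^sub>?M k" if "x : lincomb ?M p (cycles Y n)" for x
  using that
 proof induct
  case zero
  then show ?case using b(2) by (intro bexI[of _ "0\<^sub>?M"]) (auto simp: lincomb.zero)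
 next
  case (step a z w)
  obtain y k where yk: "y : lincomb ?M |R| S" "k : ?B" "z = y +\<^sub>?M k" using S(3)[OF step(2)] by blast
  obtain y' k' where yk': "y' : lincomb ?M p S" "k' : ?B" "w = y' +\<^sub>?M k'" using step(4) by blast
  have ac: "a : |R|" using step(1) pc(5) by auto
  have ay: "a .\<^sub>?M y : lincomb ?M p S"
   using M.lincomb_lincomb[OF pc(6) Sc] M.lincomb_single[OF pc(5) lS(2) step(1) yk(1)] by blast
  have c: "y : |?M|" "k : |?M|" "y' : |?M|" "k' : |?M|"
   using yk yk' lS b(1) by auto
  have "a .\<^sub>?M z +\<^sub>?M w = (a .\<^sub>?M y +\<^sub>?M y') +\<^sub>?M (a .\<^sub>?M k +\<^sub>?M k')"
   using c ac yk(3) yk'(3) by (simp add: M.smult_r_distr M.M.a_ac)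
  moreover have "a .\<^sub>?M y +\<^sub>?M y' : lincomb ?M p S" using M.lincomb_add[OF pc(5) Sc ay yk'(1)] .
  moreover have "a .\<^sub>?M k +\<^sub>?M k' : ?B" using b(3)[OF b(4)[OF ac yk(2)] yk'(2)] .
  ultimately show ?case by blast
 qed
 have tors: "\<forall>x\<in>S. \<exists>s\<in>|R| - p. s .\<^sub>?M x : ?B"
 proof (rule nakayama_at_prime[OF M p cB(2) S(1) Sc])
  fix x assume x: "x : S"
  then obtain t y k where t: "t : |R| - p" "y : lincomb ?M p (cycles Y n)" "k : ?B"
   "t .\<^sub>?M x = y +\<^sub>?M k" using hyp[of x] S(2) by blast
  obtain y' k' where y': "y' : lincomb ?M p S" "k' : ?B" "y = y' +\<^sub>?M k'" using pS[OF t(2)] by blast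
  have "y' : |?M|" "k : |?M|" "k' : |?M|" using y' t lS b(1) by auto
  then have "t .\<^sub>?M x = y' +\<^sub>?M (k' +\<^sub>?M k)" using t(4) y'(3) by (simp add: M.M.a_assoc)
  then show "\<exists>t\<in>|R| - p. \<exists>y\<in>lincomb ?M p S. \<exists>k\<in>?B. t .\<^sub>?M x = y +\<^sub>?M k"
   using t(1) y'(1) b(3)[OF y'(2) t(3)] by blast
 qed
 obtain s where s: "s : |R| - p" "!!x. x : S ==> s .\<^sub>?M x : ?B"
  using common_multiplier[OF M cB(2) p S(1) Sc] tors by blast
 have hom: "mod_hom R ?M ?M (%y. s .\<^sub>?M y)"
  by (rule mod_homI) (use s in "auto simp: M.smult_r_distr M.smult_assoc1[symmetric] M.R.m_comm")
 have sub: "lincomb ?M |R| S \<subseteq> {y : |?M|. s .\<^sub>?M y : ?B}"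
 proof (rule lincomb_in_submodule[OF M submodule_preimage[OF M M hom cB(2)]])
  fix a x assume *: "a : |R|" "x : S"
  have "s .\<^sub>?M (a .\<^sub>?M x) = a .\<^sub>?M (s .\<^sub>?M x)"
   using * s(1) Sc by (simp add: M.smult_assoc1[symmetric] M.R.m_comm subset_iff)
  then show "a .\<^sub>?M x : {y : |?M|. s .\<^sub>?M y : ?B}" using b(4)[OF *(1) s(2)[OF *(2)]] * Sc by auto
 qed
 show ?thesis unfolding torsion_at_def
 proof
  fix z assume "z : cycles Y n"
  then obtain y k where yk: "y : lincomb ?M |R| S" "k : ?B" "z = y +\<^sub>?M k" using S(3) by blast
  have "y : |?M|" "k : |?M|" using yk lS b(1) by auto
  then have "s .\<^sub>?M z = s .\<^sub>?M y +\<^sub>?M s .\<^sub>?M k" using yk(3) s(1) by (simp add: M.smult_r_distr)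
  moreover have "s .\<^sub>?M y : ?B" using sub yk(1) by blast
  ultimately have "s .\<^sub>?M z : ?B" using b(3) b(4)[of s k] s(1) yk(2) by auto
  then show "\<exists>s\<in>|R| - p. s .\<^sub>?M z : ?B" using s(1) by blast
 qed
qed

text \<open>What is used of \<open>k(p)\<close> as an \<open>R\<close>-module; \<open>e\<close> is the unit element of the field.\<close>

definition residue_like :: "'a ring => 'a set => ('a, 'n) module => 'n => bool" where
 "residue_like R p k e \<longleftrightarrow> module R k \<and> e : |k| \<and>
   (\<forall>r\<in>|R|. r .\<^sub>k e = 0\<^sub>k \<longleftrightarrow> r : p) \<and>
   (\<forall>a\<in>|k|. \<exists>s\<in>|R| - p. \<exists>r\<in>|R|. s .\<^sub>k a = r .\<^sub>k e) \<and>
   (\<forall>s\<in>|R| - p. bij_betw (%a. s .\<^sub>k a) |k| |k| )"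

lemma residue_linear_form:
 fixes R :: "'a ring"
 assumes F: "module R F" and free: "free_mod R F" and p: "primeideal p R" and k: "residue_like R p k e"
  and ep: "mod_hom R F k ep" and A: "finite A" "A \<subseteq> |F|"
 shows "\<exists>tt. \<exists>s\<in>|R| - p. mod_hom R F (ring_mod R) tt \<and> (\<forall>x\<in>A. tt x .\<^sub>k e = s .\<^sub>k ep x)"
proof -
 have km: "module R k" and e: "e : |k|"
  and frac: "!!a. a : |k| ==> \<exists>s\<in>|R| - p. \<exists>r\<in>|R|. s .\<^sub>k a = r .\<^sub>k e"
  using k by (auto simp: residue_like_def)
 interpret k: module R k by (rule km)
 interpret F: module R F by (rule F)
 have Rm: "module R (ring_mod R)" by (rule module_ring_mod[OF k.R.is_cring])
 interpret Rm: module R "ring_mod R" by (rule Rm)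
 obtain B c where bc: "basis_coord R F B c" using free_mod_basis_coord[OF F free] by blast
 note d = basis_coordD[OF bc]
 define C where "C = (\<Union>x\<in>A. {b : B. c b x \<noteq> 0\<^sub>R})"
 have C: "finite C" "C \<subseteq> B" "!!x. x : A ==> {b : B. c b x \<noteq> 0\<^sub>R} \<subseteq> C"
  using A d(3) by (auto simp: C_def)
 have ev: "mod_hom R (ring_mod R) k (%r. r .\<^sub>k e)"
  by (rule mod_homI) (use e in "auto simp: k.smult_l_distr k.smult_assoc1")
 have K: "submodule ((%r. r .\<^sub>k e) ` |R| ) R k"
  using submodule_image[OF Rm km ev Rm.carrier_is_submodule] by simp
 have "\<exists>s\<in>|R| - p. \<forall>a\<in>ep ` C. s .\<^sub>k a : (%r. r .\<^sub>k e) ` |R|"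
 proof (rule common_multiplier[OF km K p])
  show "ep ` C \<subseteq> |k|" using C(2) d(1) mod_homD(1)[OF ep] by blast
  fix a assume "a : ep ` C"
  then have "a : |k|" using C(2) d(1) mod_homD(1)[OF ep] by blast
  from frac[OF this] show "\<exists>s\<in>|R| - p. s .\<^sub>k a : (%r. r .\<^sub>k e) ` |R|" by blast
 qed (use C(1) in simp)
 then obtain s where s: "s : |R| - p" "!!b. b : C ==> s .\<^sub>k ep b : (%r. r .\<^sub>k e) ` |R|" by blast
 then have "\<exists>r. \<forall>b. b : C \<longrightarrow> r b : |R| \<and> s .\<^sub>k ep b = r b .\<^sub>k e" by (intro choice) blast
 then obtain r where r: "!!b. b : C ==> r b : |R|" "!!b. b : C ==> s .\<^sub>k ep b = r b .\<^sub>k e" by blast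
 define u where "u b = (if b : C then r b else 0\<^sub>R)" for b
 have u: "u : B \<rightarrow> |ring_mod R|" using r by (auto simp: u_def)
 let ?tt = "%x. finsum (ring_mod R) (%b. c b x .\<^sub>(ring_mod R) u b) {b : B. c b x \<noteq> 0\<^sub>R}"
 have "?tt x .\<^sub>k e = s .\<^sub>k ep x" if x: "x : A" for x
 proof -
  have xc: "x : |F|" using x A by auto
  define V where "V = {b : B. c b x \<noteq> 0\<^sub>R}"
  have V: "finite V" "V \<subseteq> C" "x = finsum F (%b. c b x .\<^sub>F b) V"
   using d(3,4)[OF xc] C(3)[OF x] by (auto simp: V_def)
  have Vc: "c b x : |R|" "b : |F|" "r b : |R|" "u b = r b" "ep b : |k|"
   "s .\<^sub>k ep b = r b .\<^sub>k e" if "b : V" for b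
  proof -
   have b: "b : C" "b : B" "b : |F|" using that V(2) C(2) d(1) by auto
   show "c b x : |R|" "b : |F|" "r b : |R|" "u b = r b" "ep b : |k|"
    "s .\<^sub>k ep b = r b .\<^sub>k e"
    using b d(5)[OF b(2) xc] r mod_homD(1)[OF ep b(3)] by (simp_all add: u_def)
  qed
  have sc: "s : |R|" using s by simp
  have "?tt x .\<^sub>k e = finsum (ring_mod R) (%b. c b x .\<^sub>(ring_mod R) u b) V .\<^sub>k e" by (simp add: V_def)
  also have "\<dots> = finsum k (%b. (c b x .\<^sub>(ring_mod R) u b) .\<^sub>k e) V"
   by (rule mod_hom_finsum[OF Rm km ev V(1)]) (use Vc in auto)
  also have "\<dots> = finsum k (%b. s .\<^sub>k ep (c b x .\<^sub>F b)) V"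
  proof (rule k.M.finsum_cong'[OF refl])
   show "(%b. s .\<^sub>k ep (c b x .\<^sub>F b)) : V \<rightarrow> |k|" using Vc sc mod_homD(1)[OF ep] by auto
   fix b assume b: "b : V"
   have "s .\<^sub>k ep (c b x .\<^sub>F b) = c b x .\<^sub>k (s .\<^sub>k ep b)"
    using Vc(1,2,5)[OF b] sc mod_homD(3)[OF ep] by (simp add: k.smult_assoc1[symmetric] k.R.m_comm)
   then show "(c b x .\<^sub>(ring_mod R) u b) .\<^sub>k e = s .\<^sub>k ep (c b x .\<^sub>F b)"
    using Vc[OF b] e by (simp add: k.smult_assoc1)
  qed
  also have "\<dots> = s .\<^sub>k finsum k (%b. ep (c b x .\<^sub>F b)) V"
   by (rule k.finsum_smult_ldistr[symmetric]) (use V(1) sc Vc mod_homD(1)[OF ep] in auto)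
  also have "finsum k (%b. ep (c b x .\<^sub>F b)) V = ep (finsum F (%b. c b x .\<^sub>F b) V)"
   by (rule mod_hom_finsum[OF F km ep V(1), symmetric]) (use Vc in auto)
  also have "\<dots> = ep x" unfolding V(3)[symmetric] ..
  finally show ?thesis .
 qed
 moreover have "mod_hom R F (ring_mod R) ?tt" by (rule basis_extend_hom[OF F Rm bc u])
 ultimately show ?thesis using s(1) by blast
qed

lemma resolution_smult_bijective:
 fixes R :: "'a ring"
 assumes res: "free_resolution R k F" and k: "module R k" and s: "s : |R|"
  and bij: "bij_betw (%a. s .\<^sub>k a) |k| |k|"
 shows "!!n z. z : cycles F n ==> s .\<^sub>(obj F n) z : boundaries F n ==> z : boundaries F n"
  "!!n w. w : cycles F n ==> \<exists>z\<in>cycles F n. w -\<^sub>(obj F n) s .\<^sub>(obj F n) z : boundaries F n"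
proof -
 note rD = free_resolutionD[OF res k]
 have F: "is_cpx R F" using rD(1) by (simp add: bounded_free_def)
 note dF = is_cpxD[OF F]
 obtain ep where ep: "mod_hom R (obj F 0) k ep" "ep ` |obj F 0| = |k|"
  "!!x. x : |obj F 0| ==> ep x = 0\<^sub>k \<longleftrightarrow> x : boundaries F 0" using rD(3) by blast
 interpret k: module R k by (rule k)
 interpret F0: module R "obj F 0" by (rule dF)
 show "z : boundaries F n" if z: "z : cycles F n" "s .\<^sub>(obj F n) z : boundaries F n" for n z
 proof (cases "n = 0")
  case True
  have zc: "z : |obj F 0|" using z(1) True rD(4) by simp
  have "ep (s .\<^sub>(obj F 0) z) = 0\<^sub>k" using ep(3)[of "s .\<^sub>(obj F 0) z"] z(2) True zc s by simp
  then have "s .\<^sub>k ep z = s .\<^sub>k 0\<^sub>k" using mod_homD(3)[OF ep(1) s zc] s by simp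
  then have "ep z = 0\<^sub>k"
   using bij mod_homD(1)[OF ep(1) zc] k.M.zero_closed unfolding bij_betw_def inj_on_def by blast
  then show ?thesis using ep(3)[OF zc] True by simp
 next
  case False
  then show ?thesis using rD(2) z(1) by (auto simp: exact_at_def)
 qed
 show "\<exists>z\<in>cycles F n. w -\<^sub>(obj F n) s .\<^sub>(obj F n) z : boundaries F n" if w: "w : cycles F n" for n w
 proof (cases "n = 0")
  case True
  have wc: "w : |obj F 0|" using w True rD(4) by simp
  have "ep w : (%a. s .\<^sub>k a) ` |k|" using bij mod_homD(1)[OF ep(1) wc] unfolding bij_betw_def by simp
  then obtain a where a: "a : |k|" "ep w = s .\<^sub>k a" by auto
  have "a : ep ` |obj F 0|" using a(1) ep(2) by simp
  then obtain z where z: "z : |obj F 0|" "a = ep z" by auto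
  have "ep (w -\<^sub>(obj F 0) s .\<^sub>(obj F 0) z) = ep w -\<^sub>k s .\<^sub>k ep z"
   using mod_hom_minus[OF dF(1) k ep(1) wc] mod_homD(3)[OF ep(1) s z(1)] s z(1) by simp
  also have "\<dots> = 0\<^sub>k" using a z s by (simp add: a_minus_def k.M.r_neg)
  finally have "w -\<^sub>(obj F 0) s .\<^sub>(obj F 0) z : boundaries F 0" using ep(3) wc z(1) s by simp
  then show ?thesis using True z(1) rD(4) by auto
 next
  case False
  interpret Fn: module R "obj F n" by (rule dF)
  have wb: "w : boundaries F n" using rD(2)[OF False] w by (auto simp: exact_at_def)
  have wc: "w : |obj F n|" using w cycles_boundaries(4)[OF F] by blast
  have "w -\<^sub>(obj F n) s .\<^sub>(obj F n) 0\<^sub>(obj F n) = w"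
   using wc s Fn.M.minus_equality[of "0\<^sub>(obj F n)" "0\<^sub>(obj F n)"] by (simp add: a_minus_def)
  then show ?thesis using wb submoduleD(2)[OF dF(1) cycles_boundaries(1)[OF F]] by metis
 qed
qed

lemma tensor_acyclic_of_torsion:
 fixes R :: "'a ring" and F :: "('a, 'm) cpx" and Y :: "('a, 'n) cpx"
 assumes bf: "bounded_free R F" and Y: "is_cpx R Y" and p: "primeideal p R"
  and inj: "!!s n z. s : |R| - p ==> z : cycles F n ==> s .\<^sub>(obj F n) z : boundaries F n ==> z : boundaries F n"
  and surj: "!!s n w. s : |R| - p ==> w : cycles F n ==>
   \<exists>z\<in>cycles F n. w -\<^sub>(obj F n) s .\<^sub>(obj F n) z : boundaries F n"
  and tors: "!!j. torsion_at R p Y j"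
 shows "acyclic (tensor_cpx R F Y)"
 unfolding acyclic_def exact_at_def
proof safe
 fix n z assume zc: "z : cycles (tensor_cpx R F Y) n"
 have F: "is_cpx R F" and free: "!!n. free_mod R (obj F n)"
  and neg: "!!n. n < 0 ==> |obj F n| = {0\<^sub>(obj F n)}"
  using bf by (auto simp: bounded_free_def)
 let ?C = "tensor_cpx R F Y"
 note dF = is_cpxD[OF F] and dY = is_cpxD[OF Y] and dC = is_cpxD[OF is_cpx_tensor_cpx[OF F Y]]
 note car = tensor_cpx_carrier[OF F Y] and ops = tensor_cpx_ops[OF F Y] and mT = module_tT[OF F Y]
 interpret R: cring R by (rule modD(13)[OF dF(1)])
 note sgs = sg_simps[OF R.is_cring]
 interpret Cn: module R "obj ?C n" by (rule dC)
 interpret Cn1: module R "obj ?C (n + 1)" by (rule dC)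
 have z: "z : |obj ?C n|" and dz: "dif ?C n z = 0\<^sub>(obj ?C (n - 1))" using zc by (auto simp: cycles_def)
 have "\<exists>s\<in>|R| - p. \<exists>v\<in>|obj ?C (n + 1)|. \<forall>i>-1.
  (s .\<^sub>(obj ?C n) z +\<^sub>(obj ?C n) dif ?C (n + 1) v) i = 0\<^sub>(tT R F Y i (n - i))"
  by (rule tensor_descend[OF F Y free p tors z]) (simp add: dz ops)
 then obtain s v where s: "s : |R| - p" and v: "v : |obj ?C (n + 1)|"
  and sv: "!!i. i > -1 ==> (s .\<^sub>(obj ?C n) z +\<^sub>(obj ?C n) dif ?C (n + 1) v) i = 0\<^sub>(tT R F Y i (n - i))" by blast
 have sc: "s : |R|" using s by simp
 have dv: "dif ?C (n + 1) v : |obj ?C n|" using mod_homD(1)[OF dC(4) v] .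
 have szv: "s .\<^sub>(obj ?C n) z +\<^sub>(obj ?C n) dif ?C (n + 1) v : |obj ?C n|" using z dv sc by simp
 have "s .\<^sub>(obj ?C n) z +\<^sub>(obj ?C n) dif ?C (n + 1) v = 0\<^sub>(obj ?C n)"
 proof
  fix i
  show "(s .\<^sub>(obj ?C n) z +\<^sub>(obj ?C n) dif ?C (n + 1) v) i = 0\<^sub>(obj ?C n) i"
  proof (cases "i > -1")
   case True
   then show ?thesis using sv by (simp add: ops(1))
  next
   case False
   have "(s .\<^sub>(obj ?C n) z +\<^sub>(obj ?C n) dif ?C (n + 1) v) i : |tT R F Y i (n - i)|"
    using szv unfolding car by blast
   then show ?thesis using tensor_trivial[OF F Y neg, of i "n - i"] False by (simp add: ops(1))
  qed
 qed
 then have "-\<^sub>(obj ?C n) dif ?C (n + 1) v = s .\<^sub>(obj ?C n) z"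
  by (rule Cn.M.minus_equality) (use z dv sc in simp_all)
 then have sz: "s .\<^sub>(obj ?C n) z = dif ?C (n + 1) (-\<^sub>(obj ?C (n + 1)) v)"
  using mod_hom_neg[OF dC(1) dC(1) dC(4) v] by simp
 obtain g h where g: "!!i. mod_hom R (obj F i) (obj F i) (g i)"
  and h: "!!i. mod_hom R (obj F i) (obj F (i + 1)) (h i)"
  and gd: "!!i x. x : |obj F i| ==> dif F i (g i x) = g (i - 1) (dif F i x)"
  and gh: "!!i x. x : |obj F i| ==> x = s .\<^sub>(obj F i) g i x +\<^sub>(obj F i)
    (dif F (i + 1) (h i x) +\<^sub>(obj F i) h (i - 1) (dif F i x))"
 proof -
  have "\<exists>g h. (\<forall>i. mod_hom R (obj F i) (obj F i) (g i)) \<and> (\<forall>i. mod_hom R (obj F i) (obj F (i + 1)) (h i)) \<and>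
  (\<forall>i. \<forall>x\<in>|obj F i|. dif F i (g i x) = g (i - 1) (dif F i x)) \<and>
  (\<forall>i. \<forall>x\<in>|obj F i|. x = s .\<^sub>(obj F i) g i x +\<^sub>(obj F i)
    (dif F (i + 1) (h i x) +\<^sub>(obj F i) h (i - 1) (dif F i x)))"
   by (rule homotopy_inverse_of_smult[OF bf sc inj[OF s] surj[OF s]])
  then show ?thesis by (elim exE conjE) (rule that; (erule spec | erule allE, erule bspec, assumption))
 qed
 define tg where "tg i j = tensor_map R (obj F i) (obj Y j) (g i) id" for i j
 define th where "th i j = tensor_map R (obj F (i + 1)) (obj Y j) (h i) id" for i j
 note tgh = tensor_map_hom[OF dF(1) dY(1) dF(1) dY(1) g mod_hom_id, folded tg_def]
 note thh = tensor_map_hom[OF dF(1) dY(1) dF(1) dY(1) h mod_hom_id, folded th_def]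
 note X1 = tX_hom[OF F Y] and Y1 = tY_hom[OF F Y]
 note ge = mod_homD(1)[OF g] and he = mod_homD(1)[OF h] and de = mod_homD(1)[OF dF(2)] and ye = mod_homD(1)[OF dY(2)]
 have r1: "tX R F Y i j (tg i j u) = tg (i - 1) j (tX R F Y i j u)" if u: "u : |tT R F Y i j|" for i j u
  by (rule tensor_hom_eq[OF dF(1) dY(1) mT mod_hom_comp[OF tgh(1) X1(1)] mod_hom_comp[OF X1(1) tgh(1)] _ u])
    (simp add: tgh(2) X1(2) ge de gd)
 have r2: "tY R F Y i j (tg i j u) = tg i (j - 1) (tY R F Y i j u)" if u: "u : |tT R F Y i j|" for i j u
  by (rule tensor_hom_eq[OF dF(1) dY(1) mT mod_hom_comp[OF tgh(1) Y1(1)] mod_hom_comp[OF Y1(1) tgh(1)] _ u])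
    (simp add: tgh(2) Y1(2) ge ye)
 have r3: "tY R F Y (i + 1) j (th i j u) = th i (j - 1) (tY R F Y i j u)" if u: "u : |tT R F Y i j|" for i j u
  by (rule tensor_hom_eq[OF dF(1) dY(1) mT mod_hom_comp[OF thh(1) Y1(1)] mod_hom_comp[OF Y1(1) thh(1)] _ u])
    (simp add: thh(2) Y1(2) he ye)
 have r4: "u = s .\<^sub>(tT R F Y i j) tg i j u +\<^sub>(tT R F Y i j)
   (tX R F Y (i + 1) j (th i j u) +\<^sub>(tT R F Y i j) th (i - 1) j (tX R F Y i j u))"
  if u: "u : |tT R F Y i j|" for i j u
 proof -
  have e: "i + 1 - 1 = i" "i - 1 + 1 = i" by simp_all
  note X2 = X1(1)[of "i + 1" j, unfolded e] and h2 = thh(1)[of "i - 1" j, unfolded e]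
  note X2' = X1(2)[of _ "i + 1" _ j, unfolded e] and h2' = thh(2)[of _ "i - 1" _ j, unfolded e]
  have dh: "dif F (i + 1) (h i x) : |obj F i|" if "x : |obj F i|" for x
   using mod_homD(1)[OF dF(4) he[OF that]] .
  have hd: "h (i - 1) (dif F i x) : |obj F i|" if "x : |obj F i|" for x
   using he[OF de[OF that]] by (simp add: e)
  interpret Fi: module R "obj F i" by (rule dF)
  note b = tens_bilinear[OF dF(1)[of i] dY(1)[of j]]
  have "id u = s .\<^sub>(tT R F Y i j) tg i j u +\<^sub>(tT R F Y i j)
   (tX R F Y (i + 1) j (th i j u) +\<^sub>(tT R F Y i j) th (i - 1) j (tX R F Y i j u))"
  proof (rule tensor_hom_eq[OF dF(1) dY(1) mT mod_hom_id _ _ u])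
   show "mod_hom R (tT R F Y i j) (tT R F Y i j) (%u. s .\<^sub>(tT R F Y i j) tg i j u +\<^sub>(tT R F Y i j)
     (tX R F Y (i + 1) j (th i j u) +\<^sub>(tT R F Y i j) th (i - 1) j (tX R F Y i j u)))"
    by (intro mod_hom_add_fun mod_hom_smult_fun mT sc tgh(1) mod_hom_comp[OF thh(1) X2] mod_hom_comp[OF X1(1) h2])
   fix x y assume xy: "x : |obj F i|" "y : |obj Y j|"
   have c: "g i x : |obj F i|" "s .\<^sub>(obj F i) g i x : |obj F i|"
    "dif F (i + 1) (h i x) +\<^sub>(obj F i) h (i - 1) (dif F i x) : |obj F i|"
    using ge[OF xy(1)] sc dh[OF xy(1)] hd[OF xy(1)] by simp_all
   have "tens R (obj F i) (obj Y j) x y = tens R (obj F i) (obj Y j)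
    (s .\<^sub>(obj F i) g i x +\<^sub>(obj F i) (dif F (i + 1) (h i x) +\<^sub>(obj F i) h (i - 1) (dif F i x))) y"
    using gh[OF xy(1)] by simp
   also have "\<dots> = s .\<^sub>(tT R F Y i j) tens R (obj F i) (obj Y j) (g i x) y +\<^sub>(tT R F Y i j)
    (tens R (obj F i) (obj Y j) (dif F (i + 1) (h i x)) y +\<^sub>(tT R F Y i j)
     tens R (obj F i) (obj Y j) (h (i - 1) (dif F i x)) y)"
    using b(2)[OF c(2,3) xy(2)] b(2)[OF dh[OF xy(1)] hd[OF xy(1)] xy(2)] b(4)[OF sc c(1) xy(2)] by simp
   finally have eq: "tens R (obj F i) (obj Y j) x y = s .\<^sub>(tT R F Y i j) tens R (obj F i) (obj Y j) (g i x) y +\<^sub>(tT R F Y i j)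
    (tens R (obj F i) (obj Y j) (dif F (i + 1) (h i x)) y +\<^sub>(tT R F Y i j)
     tens R (obj F i) (obj Y j) (h (i - 1) (dif F i x)) y)" .
   have vals: "tg i j (tens R (obj F i) (obj Y j) x y) = tens R (obj F i) (obj Y j) (g i x) y"
    "tX R F Y (i + 1) j (th i j (tens R (obj F i) (obj Y j) x y)) = tens R (obj F i) (obj Y j) (dif F (i + 1) (h i x)) y"
    "th (i - 1) j (tX R F Y i j (tens R (obj F i) (obj Y j) x y)) = tens R (obj F i) (obj Y j) (h (i - 1) (dif F i x)) y"
    using xy by (simp_all add: tgh(2) thh(2) X1(2) X2' h2' he de)
   from eq show "id (tens R (obj F i) (obj Y j) x y) =
     s .\<^sub>(tT R F Y i j) tg i j (tens R (obj F i) (obj Y j) x y) +\<^sub>(tT R F Y i j)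
     (tX R F Y (i + 1) j (th i j (tens R (obj F i) (obj Y j) x y)) +\<^sub>(tT R F Y i j)
      th (i - 1) j (tX R F Y i j (tens R (obj F i) (obj Y j) x y)))"
    unfolding vals id_apply .
  qed
  then show ?thesis by simp
 qed
 define G where "G m w = (%i. tg i (m - i) (w i))" for m w
 define H where "H w = (%i. th (i - 1) (n + 1 - i) (w (i - 1)))" for w
 have Gc: "G m w : |obj ?C m|" if w: "w : |obj ?C m|" for m w
  unfolding car
 proof
  show "\<forall>i. G m w i : |tT R F Y i (m - i)|"
   using tensor_cpx_component_hom(2)[OF F Y w] mod_homD(1)[OF tgh(1)] by (simp add: G_def)
  have "{i. G m w i \<noteq> 0\<^sub>(tT R F Y i (m - i))} \<subseteq> {i. w i \<noteq> 0\<^sub>(tT R F Y i (m - i))}"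
   using mod_hom_zero[OF mT mT tgh(1)] by (auto simp: G_def)
  then show "finite {i. G m w i \<noteq> 0\<^sub>(tT R F Y i (m - i))}"
   by (rule finite_subset) (use w in "simp add: car")
 qed
 have ths: "mod_hom R (tT R F Y (i - 1) (n + 1 - i)) (tT R F Y i (n + 1 - i)) (th (i - 1) (n + 1 - i))" for i
  using thh(1)[of "i - 1" "n + 1 - i"] by simp
 have Hc: "H w : |obj ?C (n + 1)|" if w: "w : |obj ?C n|" for w
  unfolding car
 proof
  have wi: "w (i - 1) : |tT R F Y (i - 1) (n + 1 - i)|" for i
   using tensor_cpx_component_hom(2)[OF F Y w, of "i - 1"] by (simp add: algebra_simps)
  show "\<forall>i. H w i : |tT R F Y i (n + 1 - i)|"
   using mod_homD(1)[OF ths wi] by (simp add: H_def)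
  have "{i. H w i \<noteq> 0\<^sub>(tT R F Y i (n + 1 - i))} \<subseteq> (%i. i + 1) ` {i. w i \<noteq> 0\<^sub>(tT R F Y i (n - i))}"
  proof
   fix i assume i: "i : {i. H w i \<noteq> 0\<^sub>(tT R F Y i (n + 1 - i))}"
   have e: "n - (i - 1) = n + 1 - i" by simp
   have "w (i - 1) \<noteq> 0\<^sub>(tT R F Y (i - 1) (n - (i - 1)))"
    unfolding e using i mod_hom_zero[OF mT mT ths, of i] by (intro notI) (simp add: H_def)
   then show "i : (%i. i + 1) ` {i. w i \<noteq> 0\<^sub>(tT R F Y i (n - i))}" by (intro image_eqI[of _ _ "i - 1"]) auto
  qed
  then show "finite {i. H w i \<noteq> 0\<^sub>(tT R F Y i (n + 1 - i))}"
   by (rule finite_subset) (use w in "simp add: car")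
 qed
 have Gd: "dif ?C (n + 1) (G (n + 1) w) = G n (dif ?C (n + 1) w)" if w: "w : |obj ?C (n + 1)|" for w
 proof
  fix i
  have e: "n + 1 - 1 - i = n - i" "n + 1 - (i + 1) = n - i" "i + 1 - 1 = i" "n + 1 - i - 1 = n - i" by simp_all
  note c = tensor_cpx_component_hom[OF F Y w, of i, unfolded e]
  note hg = mod_homD[OF tgh(1)[of i "n - i"]]
  have 1: "tX R F Y (i + 1) (n - i) (tg (i + 1) (n - i) (w (i + 1))) = tg i (n - i) (tX R F Y (i + 1) (n - i) (w (i + 1)))"
   using r1[OF c(1)] unfolding e .
  have 2: "tY R F Y i (n + 1 - i) (tg i (n + 1 - i) (w i)) = tg i (n - i) (tY R F Y i (n + 1 - i) (w i))"
   using r2[OF c(2)] unfolding e .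
  show "dif ?C (n + 1) (G (n + 1) w) i = G n (dif ?C (n + 1) w) i"
   unfolding tensor_cpx_dif[OF F Y Gc[OF w]] unfolding G_def tensor_cpx_dif[OF F Y w] e 1 2
   using hg(2)[OF c(3) modD(8)[OF mT sgs(1) c(4)]] hg(3)[OF sgs(1) c(4)] by simp
 qed
 have main: "z = s .\<^sub>(obj ?C n) G n z +\<^sub>(obj ?C n) dif ?C (n + 1) (H z)"
 proof
  fix i
  let ?T = "tT R F Y i (n - i)"
  interpret T: module R ?T by (rule mT)
  have e: "n + 1 - 1 - i = n - i" "n + 1 - (i + 1) = n - i" "i + 1 - 1 = i" "n + 1 - i - 1 = n - i"
   "n - (i - 1) = n + 1 - i" "n - 1 - (i - 1) = n - i" "i - 1 + 1 = i" by simp_all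
  interpret Tm: module R "tT R F Y (i - 1) (n - i)" by (rule mT)
  note c = tensor_cpx_component_hom[OF F Y z, of i] and cm = tensor_cpx_component_hom[OF F Y z, of "i - 1", unfolded e]
  have "dif ?C n z (i - 1) = 0\<^sub>(tT R F Y (i - 1) (n - i))" by (simp add: dz ops e)
  then have "tX R F Y i (n - i) (z i) +\<^sub>(tT R F Y (i - 1) (n - i))
    sg R (i - 1) .\<^sub>(tT R F Y (i - 1) (n - i)) tY R F Y (i - 1) (n + 1 - i) (z (i - 1)) = 0\<^sub>(tT R F Y (i - 1) (n - i))"
   unfolding tensor_cpx_dif[OF F Y z] e .
  then have "tX R F Y i (n - i) (z i) -\<^sub>(tT R F Y (i - 1) (n - i))
    sg R i .\<^sub>(tT R F Y (i - 1) (n - i)) tY R F Y (i - 1) (n + 1 - i) (z (i - 1)) = 0\<^sub>(tT R F Y (i - 1) (n - i))"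
   using cm sgs(1) by (simp add: sgs(4) Tm.smult_l_minus a_minus_def)
  then have X_eq: "tX R F Y i (n - i) (z i) = sg R i .\<^sub>(tT R F Y (i - 1) (n - i)) tY R F Y (i - 1) (n + 1 - i) (z (i - 1))"
   by (rule Tm.M.minus_eq_zeroD) (use cm sgs(1) in auto)
  have "th (i - 1) (n - i) (tX R F Y i (n - i) (z i)) =
    sg R i .\<^sub>?T th (i - 1) (n - i) (tY R F Y (i - 1) (n + 1 - i) (z (i - 1)))"
   unfolding X_eq using mod_homD(3)[OF thh(1) sgs(1) cm(4)] unfolding e .
  also have "th (i - 1) (n - i) (tY R F Y (i - 1) (n + 1 - i) (z (i - 1))) =
    tY R F Y i (n + 1 - i) (th (i - 1) (n + 1 - i) (z (i - 1)))"
   using r3[OF cm(2)] unfolding e by simp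
  finally have hX: "th (i - 1) (n - i) (tX R F Y i (n - i) (z i)) =
    sg R i .\<^sub>?T tY R F Y i (n + 1 - i) (th (i - 1) (n + 1 - i) (z (i - 1)))" .
  have "dif ?C (n + 1) (H z) i = tX R F Y (i + 1) (n - i) (H z (i + 1)) +\<^sub>?T
    sg R i .\<^sub>?T tY R F Y i (n + 1 - i) (H z i)"
   unfolding tensor_cpx_dif[OF F Y Hc[OF z]] e ..
  also have "H z (i + 1) = th i (n - i) (z i)" by (simp add: H_def)
  finally have dH: "dif ?C (n + 1) (H z) i = tX R F Y (i + 1) (n - i) (th i (n - i) (z i)) +\<^sub>?T
    th (i - 1) (n - i) (tX R F Y i (n - i) (z i))"
   unfolding hX by (simp add: H_def)
  show "z i = (s .\<^sub>(obj ?C n) G n z +\<^sub>(obj ?C n) dif ?C (n + 1) (H z)) i"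
   unfolding ops dH using r4[OF c(2)] by (simp add: G_def)
 qed
 have "s .\<^sub>(obj ?C n) G n z = G n (s .\<^sub>(obj ?C n) z)"
  unfolding ops G_def using mod_homD(3)[OF tgh(1) sc tensor_cpx_component_hom(2)[OF F Y z]] by simp
 also have "\<dots> = dif ?C (n + 1) (G (n + 1) (-\<^sub>(obj ?C (n + 1)) v))"
  unfolding sz using Gd[of "-\<^sub>(obj ?C (n + 1)) v"] v by simp
 finally have "z = dif ?C (n + 1) (G (n + 1) (-\<^sub>(obj ?C (n + 1)) v)) +\<^sub>(obj ?C n) dif ?C (n + 1) (H z)"
  using main by simp
 also have "\<dots> = dif ?C (n + 1) (G (n + 1) (-\<^sub>(obj ?C (n + 1)) v) +\<^sub>(obj ?C (n + 1)) H z)"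
  using mod_homD(2)[OF dC(4) Gc Hc[OF z], of "-\<^sub>(obj ?C (n + 1)) v"] v by simp
 finally show "z : boundaries ?C n"
  unfolding boundaries_def using Gc[of "-\<^sub>(obj ?C (n + 1)) v" "n + 1"] Hc[OF z] v
  by (metis Cn1.M.a_closed Cn1.M.a_inv_closed imageI)
qed

text \<open>
 The lowest homology that is not torsion survives in the tensor product. Indeed, if the cycle
 \<open>e \<otimes> z\<close>, where \<open>e\<close> represents \<open>1\<close> in "k(p)", is a boundary, then after multiplication by some \<open>s\<close>
 outside \<open>p\<close> it bounds a chain with components in \<open>F\<^sub>0 \<otimes> Y\<close> and \<open>F\<^sub>1 \<otimes> Y\<close> only; a linear form on
 \<open>F\<^sub>0\<close> that represents \<open>F\<^sub>0 \<rightarrow> k(p)\<close> turns this into an equation that puts a multiple of \<open>z\<close> into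
 \<open>p Z + B\<close>, and Nakayama's lemma applies.
\<close>

lemma torsion_of_tensor_acyclic:
 fixes R :: "'a ring" and F :: "('a, 'm) cpx" and Y :: "('a, 'n) cpx"
 assumes res: "free_resolution R k F" and Y: "is_cpx R Y" and p: "primeideal p R"
  and k: "residue_like R p k e"
  and ac: "acyclic (tensor_cpx R F Y)" and fg: "fg_at R Y b"
  and below: "!!j. j < b ==> torsion_at R p Y j"
 shows "torsion_at R p Y b"
proof (rule nakayama_homology[OF Y p fg])
 fix z assume zc: "z : cycles Y b"
 have km: "module R k" and ek: "e : |k|" and ann: "!!r. r : |R| ==> r .\<^sub>k e = 0\<^sub>k \<longleftrightarrow> r : p"
  using k by (auto simp: residue_like_def)
 note rD = free_resolutionD[OF res km]
 have F: "is_cpx R F" and free: "!!n. free_mod R (obj F n)"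
  and neg: "!!n. n < 0 ==> |obj F n| = {0\<^sub>(obj F n)}"
  using rD(1) by (auto simp: bounded_free_def)
 let ?C = "tensor_cpx R F Y"
 note dF = is_cpxD[OF F] and dY = is_cpxD[OF Y] and dC = is_cpxD[OF is_cpx_tensor_cpx[OF F Y]]
 note car = tensor_cpx_carrier[OF F Y] and ops = tensor_cpx_ops[OF F Y] and mT = module_tT[OF F Y]
 note X1 = tX_hom[OF F Y] and Y1 = tY_hom[OF F Y]
 interpret R: cring R by (rule modD(13)[OF dF(1)])
 interpret k: module R k by (rule km)
 interpret Cb: module R "obj ?C b" by (rule dC)
 interpret Cb1: module R "obj ?C (b + 1)" by (rule dC)
 interpret Yb: module R "obj Y b" by (rule dY)
 note sgs = sg_simps[OF R.is_cring] and pc = prime_compl[OF p]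
 obtain ep where ep: "mod_hom R (obj F 0) k ep" "ep ` |obj F 0| = |k|"
  "!!x. x : |obj F 0| ==> ep x = 0\<^sub>k \<longleftrightarrow> x : boundaries F 0" using rD(3) by blast
 have "e : ep ` |obj F 0|" using ek ep(2) by simp
 then obtain x0 where x0: "x0 : |obj F 0|" "ep x0 = e" by auto
 have zb: "z : |obj Y b|" and dz: "dif Y b z = 0\<^sub>(obj Y (b - 1))" using zc by (auto simp: cycles_def)
 let ?x = "tens R (obj F 0) (obj Y b) x0 z"
 have xc: "?x : |tT R F Y 0 b|" by (rule tens_bilinear(1)[OF dF(1) dY(1) x0(1) zb])
 define w where "w i = (if i = 0 then ?x else 0\<^sub>(tT R F Y i (b - i)))" for i
 have w: "w : |obj ?C b|" unfolding car
 proof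
  show "\<forall>i. w i : |tT R F Y i (b - i)|" using xc modD(2)[OF mT] by (simp add: w_def)
  show "finite {i. w i \<noteq> 0\<^sub>(tT R F Y i (b - i))}" by (rule finite_subset[of _ "{0}"]) (auto simp: w_def)
 qed
 have "dif ?C b w = 0\<^sub>(obj ?C (b - 1))"
 proof
  fix i
  let ?T = "tT R F Y i (b - 1 - i)"
  interpret T: module R ?T by (rule mT)
  have e: "b - (i + 1) = b - 1 - i" "i + 1 - 1 = i" "b - i - 1 = b - 1 - i" by simp_all
  have cc: "dif ?C b w i : |?T|"
   using mod_homD(1)[OF dC(2) w] unfolding car by blast
  show "dif ?C b w i = 0\<^sub>(obj ?C (b - 1)) i"
  proof (cases "i < 0")
   case True
   then show ?thesis using cc tensor_trivial[OF F Y neg[OF True], of "b - 1 - i"] by (simp add: ops)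
  next
   case False
   then have "w (i + 1) = 0\<^sub>(tT R F Y (i + 1) (b - 1 - i))" by (simp add: w_def e)
   then have "tX R F Y (i + 1) (b - 1 - i) (w (i + 1)) = 0\<^sub>?T"
    using mod_hom_zero[OF mT mT X1(1), of "i + 1" "b - 1 - i"] by (simp add: e)
   moreover have "tY R F Y i (b - i) (w i) = 0\<^sub>?T"
   proof (cases "i = 0")
    case True
    then show ?thesis using Y1(2)[OF x0(1) zb] tens_zero(2)[OF dF(1) dY(1) x0(1)] by (simp add: w_def dz)
   next
    case False
    then show ?thesis using mod_hom_zero[OF mT mT Y1(1), of i "b - i"] by (simp add: w_def e)
   qed
   ultimately show ?thesis using sgs(1) by (simp add: tensor_cpx_dif[OF F Y w] ops)
  qed
 qed
 then have "w : cycles ?C b" using w by (simp add: cycles_def)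
 then have "w : boundaries ?C b" using ac by (auto simp: acyclic_def exact_at_def)
 then obtain u where u: "u : |obj ?C (b + 1)|" "w = dif ?C (b + 1) u" by (auto simp: boundaries_def)
 have "\<exists>s\<in>|R| - p. \<exists>v\<in>|obj ?C (b + 1 + 1)|. \<forall>i>1.
  (s .\<^sub>(obj ?C (b + 1)) u +\<^sub>(obj ?C (b + 1)) dif ?C (b + 1 + 1) v) i = 0\<^sub>(tT R F Y i (b + 1 - i))"
 proof (rule tensor_descend[OF F Y free p _ u(1)])
  fix i :: int assume "i > 1"
  then show "torsion_at R p Y (b + 1 - i)" by (intro below) simp
 next
  fix i :: int assume "i \<ge> 1"
  then show "dif ?C (b + 1) u i = 0\<^sub>(tT R F Y i (b + 1 - 1 - i))" using u(2)[symmetric] by (simp add: w_def)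
 qed
 then obtain s v where s: "s : |R| - p" and v: "v : |obj ?C (b + 1 + 1)|"
  and top: "!!i. i > 1 ==> (s .\<^sub>(obj ?C (b + 1)) u +\<^sub>(obj ?C (b + 1)) dif ?C (b + 1 + 1) v) i = 0\<^sub>(tT R F Y i (b + 1 - i))"
  by blast
 have sc: "s : |R|" using s by simp
 define y where "y = s .\<^sub>(obj ?C (b + 1)) u +\<^sub>(obj ?C (b + 1)) dif ?C (b + 1 + 1) v"
 have dv: "dif ?C (b + 1 + 1) v : |obj ?C (b + 1)|" using mod_homD(1)[OF dC(4) v] .
 have su: "s .\<^sub>(obj ?C (b + 1)) u : |obj ?C (b + 1)|" using u(1) sc by simp
 have y: "y : |obj ?C (b + 1)|" using su dv by (simp add: y_def)
 have ddv: "dif ?C (b + 1) (dif ?C (b + 1 + 1) v) = 0\<^sub>(obj ?C b)" using dC(5)[OF v] by simp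
 have dy: "dif ?C (b + 1) y = s .\<^sub>(obj ?C b) w"
  unfolding y_def using mod_homD(2)[OF dC(4) su dv] mod_homD(3)[OF dC(4) sc u(1)] ddv u(2) w sc by simp
 have y2: "y 2 = 0\<^sub>(tT R F Y 2 (b - 1))" using top[of 2] by (simp add: y_def algebra_simps)
 note c0 = tensor_cpx_component_hom[OF F Y y, of 0, simplified] and c1 = tensor_cpx_component_hom[OF F Y y, of 1, simplified]
 note hY0 = Y1(1)[of 0 "b + 1", simplified] and hX1 = X1(1)[of 1 b, simplified]
 have e0: "tX R F Y 1 b (y 1) +\<^sub>(tT R F Y 0 b) tY R F Y 0 (b + 1) (y 0) = s .\<^sub>(tT R F Y 0 b) ?x"
 proof -
  interpret T: module R "tT R F Y 0 b" by (rule mT)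
  have "dif ?C (b + 1) y 0 = s .\<^sub>(tT R F Y 0 b) ?x" unfolding dy by (simp add: ops w_def)
  then show ?thesis using tensor_cpx_dif[OF F Y y, of 0] c0 by (simp add: sgs(5))
 qed
 have e1: "tY R F Y 1 b (y 1) = 0\<^sub>(tT R F Y 1 (b - 1))"
 proof -
  interpret T: module R "tT R F Y 1 (b - 1)" by (rule mT)
  have "tX R F Y 2 (b - 1) (y 2) = 0\<^sub>(tT R F Y 1 (b - 1))"
   unfolding y2 using mod_hom_zero[OF mT mT X1(1), of 2 "b - 1"] by simp
  then have "sg R 1 .\<^sub>(tT R F Y 1 (b - 1)) tY R F Y 1 b (y 1) = 0\<^sub>(tT R F Y 1 (b - 1))"
   using tensor_cpx_dif[OF F Y y, of 1] dy c1 sgs(1) sc by (simp add: ops w_def)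
  then have "(sg R 1 \<otimes>\<^sub>R sg R 1) .\<^sub>(tT R F Y 1 (b - 1)) tY R F Y 1 b (y 1) = 0\<^sub>(tT R F Y 1 (b - 1))"
   using c1 sgs(1) by (simp add: T.smult_assoc1)
  then show ?thesis using c1 by (simp add: sgs(2))
 qed
 obtain B c where bc: "basis_coord R (obj F 1) B c" using free_mod_basis_coord[OF dF(1) free] by blast
 obtain Th where Th1: "\<forall>b\<in>B. \<forall>j. mod_hom R (tT R F Y 1 j) (obj Y j) (Th b j)"
  and Th2: "\<forall>b\<in>B. \<forall>j. \<forall>u\<in>|tT R F Y 1 j|. dif Y j (Th b j u) = Th b (j - 1) (tY R F Y 1 j u)"
  and Th3: "\<forall>j. \<forall>u\<in>|tT R F Y 1 j|. \<exists>S. finite S \<and> S \<subseteq> B \<and>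
    u = finsum (tT R F Y 1 j) (%b. tens R (obj F 1) (obj Y j) b (Th b j u)) S"
  using tensor_expand[OF F Y bc] by (elim exE conjE)
 note Th = Th1[rule_format] Th2[rule_format] Th3[rule_format]
 have y1: "y 1 : |tT R F Y 1 b|" using c1(2) .
 obtain S where S: "finite S" "S \<subseteq> B"
  "y 1 = finsum (tT R F Y 1 b) (%x. tens R (obj F 1) (obj Y b) x (Th x b (y 1))) S"
  using Th(3)[OF y1] by (elim exE conjE)
 have SF: "S \<subseteq> |obj F 1|" using S(2) basis_coordD(1)[OF bc] by blast
 define m where "m x = Th x b (y 1)" for x
 have mc: "m x : cycles Y b" if "x : S" for x
  using Th(2)[OF _ y1, of x] mod_homD(1)[OF Th(1) y1, of x] mod_hom_zero[OF mT dY(1) Th(1), of x "b - 1"] that S(2)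
  by (auto simp: cycles_def e1 m_def)
 have mcc: "m x : |obj Y b|" if "x : S" for x using mc[OF that] by (simp add: cycles_def)
 have dS: "dif F 1 x : |obj F 0|" if "x : S" for x using mod_homD(1)[OF dF(2), of x 1] that SF by auto
 obtain tt s' where s': "s' : |R| - p" and tt: "mod_hom R (obj F 0) (ring_mod R) tt"
  and tte: "!!x. x : insert x0 (dif F 1 ` S) ==> tt x .\<^sub>k e = s' .\<^sub>k ep x"
  using residue_linear_form[OF dF(1) free p k ep(1), of "insert x0 (dif F 1 ` S)"] S(1) x0(1) dS by blast
 have ttc: "tt x : |R|" if "x : |obj F 0|" for x using mod_homD(1)[OF tt that] by simp
 have ttp: "tt (dif F 1 x) : p" if x: "x : S" for x
 proof -
  have "dif F 1 x : boundaries F 0" using x SF by (auto simp: boundaries_def)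
  then have "ep (dif F 1 x) = 0\<^sub>k" using ep(3)[OF dS[OF x]] by simp
  then show ?thesis using tte[of "dif F 1 x"] x ann[OF ttc[OF dS[OF x]]] s' by auto
 qed
 have ttx0: "tt x0 : |R| - p"
  using tte[of x0] x0(2) ann[OF ttc[OF x0(1)]] ann[of s'] s' ttc[OF x0(1)] by auto
 obtain E where E: "\<forall>j. mod_hom R (tT R F Y 0 j) (obj Y j) (E j)"
  "\<forall>j. \<forall>x\<in>|obj F 0|. \<forall>y\<in>|obj Y j|. E j (tens R (obj F 0) (obj Y j) x y) = tt x .\<^sub>(obj Y j) y"
  "\<forall>j. \<forall>u\<in>|tT R F Y 0 j|. dif Y j (E j u) = E (j - 1) (tY R F Y 0 j u)"
  using tensor_eval[OF F Y tt] by (elim exE conjE)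
 note E = E[rule_format]
 have 1: "E b (s .\<^sub>(tT R F Y 0 b) ?x) = (s \<otimes>\<^sub>R tt x0) .\<^sub>(obj Y b) z"
  using mod_homD(3)[OF E(1) sc xc] E(2)[OF x0(1) zb] sc ttx0 zb by (simp add: Yb.smult_assoc1)
 have 2: "E b (tY R F Y 0 (b + 1) (y 0)) : boundaries Y b"
  using E(3)[of "y 0" "b + 1"] c0(2) mod_homD(1)[OF E(1)] by (auto simp: boundaries_def image_iff) (metis)
 have 3: "E b (tX R F Y 1 b (y 1)) : lincomb (obj Y b) p (cycles Y b)"
 proof -
  have t1: "tens R (obj F 1) (obj Y b) x (m x) : |tT R F Y 1 b|" if "x : S" for x
   using that SF mcc[OF that] by (intro tens_bilinear(1)[OF dF(1) dY(1)]) auto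
  have hom: "mod_hom R (tT R F Y 1 b) (obj Y b) (%u. E b (tX R F Y 1 b u))" by (rule mod_hom_comp[OF hX1 E(1)])
  have val: "E b (tX R F Y 1 b (tens R (obj F 1) (obj Y b) x (m x))) = tt (dif F 1 x) .\<^sub>(obj Y b) m x" if x: "x : S" for x
   using X1(2)[OF subsetD[OF SF x] mcc[OF x]] E(2)[OF dS[OF x] mcc[OF x]] by simp
  have "E b (tX R F Y 1 b (y 1)) = finsum (obj Y b) (%x. E b (tX R F Y 1 b (tens R (obj F 1) (obj Y b) x (m x)))) S"
   by (subst S(3), fold m_def) (rule mod_hom_finsum[OF mT dY(1) hom S(1)], use t1 in auto)
  also have "\<dots> = finsum (obj Y b) (%x. tt (dif F 1 x) .\<^sub>(obj Y b) m x) S"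
   by (rule Yb.M.finsum_cong'[OF refl]) (use val ttc[OF dS] mcc in auto)
  finally have eq: "E b (tX R F Y 1 b (y 1)) = finsum (obj Y b) (%x. tt (dif F 1 x) .\<^sub>(obj Y b) m x) S" .
  show ?thesis unfolding eq
  proof (rule submodule_finsum[OF dY(1) Yb.lincomb_submodule[OF pc(6) cycles_boundaries(4)[OF Y]] S(1)])
   fix x assume x: "x : S"
   show "tt (dif F 1 x) .\<^sub>(obj Y b) m x : lincomb (obj Y b) p (cycles Y b)"
    by (rule Yb.lincomb_single[OF pc(5) cycles_boundaries(4)[OF Y] ttp[OF x] mc[OF x]])
  qed
 qed
 have "(s \<otimes>\<^sub>R tt x0) .\<^sub>(obj Y b) z = E b (tX R F Y 1 b (y 1)) +\<^sub>(obj Y b) E b (tY R F Y 0 (b + 1) (y 0))"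
  unfolding 1[symmetric] e0[symmetric]
  by (rule mod_homD(2)[OF E(1)]) (use mod_homD(1)[OF hX1 y1] mod_homD(1)[OF hY0 c0(2)] in auto)
 then show "\<exists>t\<in>|R| - p. \<exists>y\<in>lincomb (obj Y b) p (cycles Y b). \<exists>k\<in>boundaries Y b.
   t .\<^sub>(obj Y b) z = y +\<^sub>(obj Y b) k"
  using 2 3 pc(2)[OF s ttx0] by blast
qed

lemma torsion_induct_from_below:
 fixes R :: "'a ring"
 assumes Y: "is_cpx R Y" and p: "primeideal p R" and low: "!!j. j < b0 ==> exact_at Y j"
  and step: "!!b. (!!j. j < b ==> torsion_at R p Y j) ==> torsion_at R p Y b"
 shows "torsion_at R p Y j"
proof (cases "j < b0")
 case True
 then show ?thesis using exact_at_imp(1)[OF Y low p] by blast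
next
 case False
 have "\<forall>i \<le> b0 + int m. torsion_at R p Y i" for m
 proof (induct m)
  case 0
  have "torsion_at R p Y i" if "i < b0" for i using exact_at_imp(1)[OF Y low[OF that] p] .
  then have "torsion_at R p Y b0" by (rule step)
  then show ?case using \<open>\<And>i. i < b0 \<Longrightarrow> torsion_at R p Y i\<close> by (auto simp: le_less)
 next
  case (Suc m)
  have "torsion_at R p Y (b0 + int (Suc m))" by (rule step) (use Suc in auto)
  then have "torsion_at R p Y i" if "i \<le> b0 + int (Suc m)" for i
   using that Suc by (cases "i = b0 + int (Suc m)") auto
  then show ?case by blast
 qed
 from this[of "nat (j - b0)"] show ?thesis using False by auto
qed

theorem tensor_acyclic_iff:
 fixes R :: "'a ring" and F :: "('a, 'm) cpx" and Y :: "('a, 'n) cpx"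
 assumes res: "free_resolution R k F" and Y: "is_cpx R Y" and p: "primeideal p R"
  and k: "residue_like R p k e" and fg: "!!j. fg_at R Y j" and low: "!!j. j < b0 ==> exact_at Y j"
 shows "acyclic (tensor_cpx R F Y) \<longleftrightarrow> (\<forall>j. torsion_at R p Y j)"
proof
 assume ac: "acyclic (tensor_cpx R F Y)"
 show "\<forall>j. torsion_at R p Y j"
 proof
  fix j
  show "torsion_at R p Y j"
   by (rule torsion_induct_from_below[OF Y p low torsion_of_tensor_acyclic[OF res Y p k ac fg]])
 qed
next
 assume tors: "\<forall>j. torsion_at R p Y j"
 have km: "module R k" and bij: "!!s. s : |R| - p ==> bij_betw (%a. s .\<^sub>k a) |k| |k|"
  using k by (auto simp: residue_like_def)
 note sb = resolution_smult_bijective[OF res km _ bij]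
 show "acyclic (tensor_cpx R F Y)"
  by (rule tensor_acyclic_of_torsion[OF free_resolutionD(1)[OF res km] Y p])
    (use sb tors in auto)
qed

section \<open>Localization at a prime ideal\<close>

lemma restrict_scalars_simps [simp]:
 "|restrict_scalars ph N| = |N|" "0\<^sub>(restrict_scalars ph N) = 0\<^sub>N"
 "add (restrict_scalars ph N) = add N" "r .\<^sub>(restrict_scalars ph N) x = ph r .\<^sub>N x"
 by (simp_all add: restrict_scalars_def)

lemma loc_cpx_obj [simp]: "obj (loc_cpx R p X) n = loc_mod R p (obj X n)"
 by (simp add: loc_cpx_def)

lemma restrict_cpx_simps [simp]:
 "obj (restrict_cpx ph X) n = restrict_scalars ph (obj X n)" "dif (restrict_cpx ph X) = dif X"
 "cycles (restrict_cpx ph X) n = cycles X n" "boundaries (restrict_cpx ph X) n = boundaries X n"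
 by (simp_all add: restrict_cpx_def cycles_def boundaries_def)

context
 fixes R :: "'a ring" and p
 assumes R: "cring R" and p: "primeideal p R"
begin

interpretation R: cring R by (rule R)

lemmas pc = prime_compl[OF p]

private abbreviation (input) S where "S \<equiv> |R| - p"

lemma Sc: "s : S ==> s : |R|" by simp

lemma S_mult: "s : S ==> t : S ==> s \<otimes>\<^sub>R t : S" by (rule pc(2))

lemma scale_eq:
 assumes M: "module R M" and e: "a .\<^sub>M x = b .\<^sub>M y"
  and c: "a : |R|" "b : |R|" "c : |R|" "x : |M|" "y : |M|"
 shows "(c \<otimes>\<^sub>R a) .\<^sub>M x = (c \<otimes>\<^sub>R b) .\<^sub>M y"
 using e c modD(11)[OF M] by simp

lemma mem_frac:
 fixes M :: "('a, 'm) module"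
 assumes M: "module R M" and x: "x : |M|" "s : S"
 shows "(y, t) : frac R p M x s \<longleftrightarrow> y : |M| \<and> t : S \<and>
  (\<exists>u\<in>S. (u \<otimes>\<^sub>R t) .\<^sub>M x = (u \<otimes>\<^sub>R s) .\<^sub>M y)"
 using x modD(11)[OF M] by (auto simp: frac_def)

lemma frac_self:
 fixes M :: "('a, 'm) module"
 assumes M: "module R M" and x: "x : |M|" "s : S"
 shows "(x, s) : frac R p M x s"
 using x pc(1) by (auto simp: mem_frac[OF M x])

lemma frac_trans:
 fixes M :: "('a, 'm) module"
 assumes M: "module R M" and x: "x : |M|" "s : S" and y: "y : |M|" "t : S"
  and z: "z : |M|" "r : S"
  and u: "u : S" "(u \<otimes>\<^sub>R t) .\<^sub>M x = (u \<otimes>\<^sub>R s) .\<^sub>M y"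
  and v: "v : S" "(v \<otimes>\<^sub>R r) .\<^sub>M y = (v \<otimes>\<^sub>R t) .\<^sub>M z"
 shows "\<exists>w\<in>S. (w \<otimes>\<^sub>R r) .\<^sub>M x = (w \<otimes>\<^sub>R s) .\<^sub>M z"
proof
 note c = Sc[OF x(2)] Sc[OF y(2)] Sc[OF z(2)] Sc[OF u(1)] Sc[OF v(1)]
 let ?w = "u \<otimes>\<^sub>R v \<otimes>\<^sub>R t"
 show "?w : S" by (intro S_mult u v y)
 have "(?w \<otimes>\<^sub>R r) .\<^sub>M x = ((v \<otimes>\<^sub>R r) \<otimes>\<^sub>R (u \<otimes>\<^sub>R t)) .\<^sub>M x" using c by (simp add: R.m_ac)
 also have "\<dots> = ((v \<otimes>\<^sub>R r) \<otimes>\<^sub>R (u \<otimes>\<^sub>R s)) .\<^sub>M y" by (rule scale_eq[OF M u(2)]) (use c x y in auto)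
 also have "\<dots> = ((u \<otimes>\<^sub>R s) \<otimes>\<^sub>R (v \<otimes>\<^sub>R r)) .\<^sub>M y" using c by (simp add: R.m_ac)
 also have "\<dots> = ((u \<otimes>\<^sub>R s) \<otimes>\<^sub>R (v \<otimes>\<^sub>R t)) .\<^sub>M z" by (rule scale_eq[OF M v(2)]) (use c y z in auto)
 also have "\<dots> = (?w \<otimes>\<^sub>R s) .\<^sub>M z" using c by (simp add: R.m_ac)
 finally show "(?w \<otimes>\<^sub>R r) .\<^sub>M x = (?w \<otimes>\<^sub>R s) .\<^sub>M z" .
qed

lemma frac_eq_iff:
 fixes M :: "('a, 'm) module"
 assumes M: "module R M" and x: "x : |M|" "s : S" and y: "y : |M|" "t : S"
 shows "frac R p M x s = frac R p M y t \<longleftrightarrow> (\<exists>u\<in>S. (u \<otimes>\<^sub>R t) .\<^sub>M x = (u \<otimes>\<^sub>R s) .\<^sub>M y)"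
proof
 assume "frac R p M x s = frac R p M y t"
 then have "(y, t) : frac R p M x s" using frac_self[OF M y] by simp
 then show "\<exists>u\<in>S. (u \<otimes>\<^sub>R t) .\<^sub>M x = (u \<otimes>\<^sub>R s) .\<^sub>M y" by (simp add: mem_frac[OF M x])
next
 assume "\<exists>u\<in>S. (u \<otimes>\<^sub>R t) .\<^sub>M x = (u \<otimes>\<^sub>R s) .\<^sub>M y"
 then obtain u where u: "u : S" "(u \<otimes>\<^sub>R t) .\<^sub>M x = (u \<otimes>\<^sub>R s) .\<^sub>M y" by blast
 have "(z, r) : frac R p M x s \<longleftrightarrow> (z, r) : frac R p M y t" for z r
 proof
  assume "(z, r) : frac R p M x s"
  then obtain v where z: "z : |M|" "r : S" and v: "v : S" "(v \<otimes>\<^sub>R r) .\<^sub>M x = (v \<otimes>\<^sub>R s) .\<^sub>M z"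
   unfolding mem_frac[OF M x] by blast
  show "(z, r) : frac R p M y t"
   unfolding mem_frac[OF M y] using z frac_trans[OF M y x z u(1) u(2)[symmetric] v] by blast
 next
  assume "(z, r) : frac R p M y t"
  then obtain v where z: "z : |M|" "r : S" and v: "v : S" "(v \<otimes>\<^sub>R r) .\<^sub>M y = (v \<otimes>\<^sub>R t) .\<^sub>M z"
   unfolding mem_frac[OF M y] by blast
  show "(z, r) : frac R p M x s"
   unfolding mem_frac[OF M x] using z frac_trans[OF M x y z u v] by blast
 qed
 then show "frac R p M x s = frac R p M y t" by auto
qed

lemma frac_eqI:
 fixes M :: "('a, 'm) module"
 assumes M: "module R M" and x: "x : |M|" "s : S" and y: "y : |M|" "t : S"
  and e: "t .\<^sub>M x = s .\<^sub>M y"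
 shows "frac R p M x s = frac R p M y t"
 unfolding frac_eq_iff[OF M x y]
 by (rule bexI[of _ "1\<^sub>R"]) (use e x y pc(1) in auto)

lemma loc_carrier: "|loc_mod R p M| = {frac R p M x s |x s. x : |M| \<and> s : S}"
 by (simp add: loc_mod_def)

lemma loc_zero: "0\<^sub>(loc_mod R p M) = frac R p M 0\<^sub>M 1\<^sub>R"
 by (simp add: loc_mod_def)

lemma loc_memI: "x : |M| ==> s : S ==> frac R p M x s : |loc_mod R p M|"
 by (auto simp: loc_carrier)

lemma loc_cases:
 assumes "X : |loc_mod R p M|"
 obtains x s where "x : |M|" "s : S" "X = frac R p M x s"
 using assms by (auto simp: loc_carrier)

lemma loc_add:
 fixes M :: "('a, 'm) module"
 assumes M: "module R M" and x: "x : |M|" "s : S" and y: "y : |M|" "t : S"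
 shows "frac R p M x s +\<^sub>(loc_mod R p M) frac R p M y t = frac R p M (t .\<^sub>M x +\<^sub>M s .\<^sub>M y) (s \<otimes>\<^sub>R t)"
proof -
 interpret M: module R M by (rule M)
 have key: "frac R p M (t' .\<^sub>M x' +\<^sub>M s' .\<^sub>M y') (s' \<otimes>\<^sub>R t') = frac R p M (t .\<^sub>M x +\<^sub>M s .\<^sub>M y) (s \<otimes>\<^sub>R t)"
  if "(x', s') : frac R p M x s" "(y', t') : frac R p M y t" for x' s' y' t'
 proof -
  from that obtain u v where x': "x' : |M|" "s' : S" and y': "y' : |M|" "t' : S"
   and u: "u : S" "(u \<otimes>\<^sub>R s') .\<^sub>M x = (u \<otimes>\<^sub>R s) .\<^sub>M x'"
   and v: "v : S" "(v \<otimes>\<^sub>R t') .\<^sub>M y = (v \<otimes>\<^sub>R t) .\<^sub>M y'"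
   unfolding mem_frac[OF M x] mem_frac[OF M y] by blast
  note c = Sc[OF x(2)] Sc[OF y(2)] Sc[OF x'(2)] Sc[OF y'(2)] Sc[OF u(1)] Sc[OF v(1)]
  have 1: "((v \<otimes>\<^sub>R t \<otimes>\<^sub>R t') \<otimes>\<^sub>R (u \<otimes>\<^sub>R s')) .\<^sub>M x = ((v \<otimes>\<^sub>R t \<otimes>\<^sub>R t') \<otimes>\<^sub>R (u \<otimes>\<^sub>R s)) .\<^sub>M x'"
   by (rule scale_eq[OF M u(2)]) (use c x x' in auto)
  have 2: "((u \<otimes>\<^sub>R s \<otimes>\<^sub>R s') \<otimes>\<^sub>R (v \<otimes>\<^sub>R t')) .\<^sub>M y = ((u \<otimes>\<^sub>R s \<otimes>\<^sub>R s') \<otimes>\<^sub>R (v \<otimes>\<^sub>R t)) .\<^sub>M y'"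
   by (rule scale_eq[OF M v(2)]) (use c y y' in auto)
  have "(u \<otimes>\<^sub>R v \<otimes>\<^sub>R (s \<otimes>\<^sub>R t)) .\<^sub>M (t' .\<^sub>M x' +\<^sub>M s' .\<^sub>M y') =
    ((v \<otimes>\<^sub>R t \<otimes>\<^sub>R t') \<otimes>\<^sub>R (u \<otimes>\<^sub>R s)) .\<^sub>M x' +\<^sub>M ((u \<otimes>\<^sub>R s \<otimes>\<^sub>R s') \<otimes>\<^sub>R (v \<otimes>\<^sub>R t)) .\<^sub>M y'"
   using c x' y' by (simp add: M.smult_r_distr M.smult_assoc1[symmetric] R.m_ac)
  also have "\<dots> = (u \<otimes>\<^sub>R v \<otimes>\<^sub>R (s' \<otimes>\<^sub>R t')) .\<^sub>M (t .\<^sub>M x +\<^sub>M s .\<^sub>M y)"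
   unfolding 1[symmetric] 2[symmetric] using c x y
   by (simp add: M.smult_r_distr M.smult_assoc1[symmetric] R.m_ac)
  finally have e: "(u \<otimes>\<^sub>R v \<otimes>\<^sub>R (s \<otimes>\<^sub>R t)) .\<^sub>M (t' .\<^sub>M x' +\<^sub>M s' .\<^sub>M y') =
   (u \<otimes>\<^sub>R v \<otimes>\<^sub>R (s' \<otimes>\<^sub>R t')) .\<^sub>M (t .\<^sub>M x +\<^sub>M s .\<^sub>M y)" .
  have m: "t' .\<^sub>M x' +\<^sub>M s' .\<^sub>M y' : |M|" "t .\<^sub>M x +\<^sub>M s .\<^sub>M y : |M|" using c x y x' y' by auto
  show ?thesis
   unfolding frac_eq_iff[OF M m(1) S_mult[OF x'(2) y'(2)] m(2) S_mult[OF x(2) y(2)]]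
   using e S_mult[OF u(1) v(1)] by blast
 qed
 have "frac R p M x s +\<^sub>(loc_mod R p M) frac R p M y t =
  (\<Union>(x', s')\<in>frac R p M x s. \<Union>(y', t')\<in>frac R p M y t. frac R p M (t' .\<^sub>M x' +\<^sub>M s' .\<^sub>M y') (s' \<otimes>\<^sub>R t'))"
  by (simp add: loc_mod_def)
 also have "\<dots> = frac R p M (t .\<^sub>M x +\<^sub>M s .\<^sub>M y) (s \<otimes>\<^sub>R t)"
 proof (rule SUP_eq_const)
  show "frac R p M x s \<noteq> {}" using frac_self[OF M x] by blast
  fix q assume q: "q : frac R p M x s"
  have "(\<Union>q'\<in>frac R p M y t. case q' of (y', t') => frac R p M (t' .\<^sub>M fst q +\<^sub>M snd q .\<^sub>M y') (snd q \<otimes>\<^sub>R t')) =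
   frac R p M (t .\<^sub>M x +\<^sub>M s .\<^sub>M y) (s \<otimes>\<^sub>R t)"
  proof (rule SUP_eq_const)
   show "frac R p M y t \<noteq> {}" using frac_self[OF M y] by blast
   fix q' assume q': "q' : frac R p M y t"
   show "(case q' of (y', t') => frac R p M (t' .\<^sub>M fst q +\<^sub>M snd q .\<^sub>M y') (snd q \<otimes>\<^sub>R t')) =
    frac R p M (t .\<^sub>M x +\<^sub>M s .\<^sub>M y) (s \<otimes>\<^sub>R t)"
    using key[of "fst q" "snd q" "fst q'" "snd q'"] q q' by (simp add: case_prod_unfold)
  qed
  then show "(case q of (x', s') => \<Union>(y', t')\<in>frac R p M y t. frac R p M (t' .\<^sub>M x' +\<^sub>M s' .\<^sub>M y') (s' \<otimes>\<^sub>R t')) =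
   frac R p M (t .\<^sub>M x +\<^sub>M s .\<^sub>M y) (s \<otimes>\<^sub>R t)" by (simp add: case_prod_unfold)
 qed
 finally show ?thesis .
qed

lemma ring_mod_module: "module R (ring_mod R)" by (rule module_ring_mod[OF R])

lemma loc_smult:
 fixes M :: "('a, 'm) module"
 assumes M: "module R M" and a: "a : |R|" "s : S" and x: "x : |M|" "t : S"
 shows "frac R p (ring_mod R) a s .\<^sub>(loc_mod R p M) frac R p M x t = frac R p M (a .\<^sub>M x) (s \<otimes>\<^sub>R t)"
proof -
 interpret M: module R M by (rule M)
 have a': "a : |ring_mod R|" using a by simp
 have key: "frac R p M (a' .\<^sub>M x') (s' \<otimes>\<^sub>R t') = frac R p M (a .\<^sub>M x) (s \<otimes>\<^sub>R t)"
  if "(a', s') : frac R p (ring_mod R) a s" "(x', t') : frac R p M x t" for a' s' x' t'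
 proof -
  from that obtain u v where a': "a' : |R|" "s' : S" and x': "x' : |M|" "t' : S"
   and u: "u : S" "(u \<otimes>\<^sub>R s') \<otimes>\<^sub>R a = (u \<otimes>\<^sub>R s) \<otimes>\<^sub>R a'"
   and v: "v : S" "(v \<otimes>\<^sub>R t') .\<^sub>M x = (v \<otimes>\<^sub>R t) .\<^sub>M x'"
   unfolding mem_frac[OF ring_mod_module a' a(2)] mem_frac[OF M x] by auto
  note c = Sc[OF a(2)] Sc[OF x(2)] Sc[OF a'(2)] Sc[OF x'(2)] Sc[OF u(1)] Sc[OF v(1)] a(1) a'(1)
  have "(u \<otimes>\<^sub>R v \<otimes>\<^sub>R (s \<otimes>\<^sub>R t)) .\<^sub>M (a' .\<^sub>M x') = (((u \<otimes>\<^sub>R s) \<otimes>\<^sub>R a') \<otimes>\<^sub>R (v \<otimes>\<^sub>R t)) .\<^sub>M x'"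
   using c x' by (simp add: M.smult_assoc1[symmetric] R.m_ac)
  also have "\<dots> = (((u \<otimes>\<^sub>R s) \<otimes>\<^sub>R a') \<otimes>\<^sub>R (v \<otimes>\<^sub>R t')) .\<^sub>M x"
   by (rule scale_eq[OF M v(2)[symmetric]]) (use c x x' in auto)
  also have "\<dots> = (u \<otimes>\<^sub>R v \<otimes>\<^sub>R (s' \<otimes>\<^sub>R t')) .\<^sub>M (a .\<^sub>M x)"
   unfolding u(2)[symmetric] using c x by (simp add: M.smult_assoc1[symmetric] R.m_ac)
  finally have e: "(u \<otimes>\<^sub>R v \<otimes>\<^sub>R (s \<otimes>\<^sub>R t)) .\<^sub>M (a' .\<^sub>M x') = (u \<otimes>\<^sub>R v \<otimes>\<^sub>R (s' \<otimes>\<^sub>R t')) .\<^sub>M (a .\<^sub>M x)" .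
  have m: "a' .\<^sub>M x' : |M|" "a .\<^sub>M x : |M|" using c x x' by auto
  show ?thesis
   unfolding frac_eq_iff[OF M m(1) S_mult[OF a'(2) x'(2)] m(2) S_mult[OF a(2) x(2)]]
   using e S_mult[OF u(1) v(1)] by blast
 qed
 have "frac R p (ring_mod R) a s .\<^sub>(loc_mod R p M) frac R p M x t =
  (\<Union>(a', s')\<in>frac R p (ring_mod R) a s. \<Union>(x', t')\<in>frac R p M x t. frac R p M (a' .\<^sub>M x') (s' \<otimes>\<^sub>R t'))"
  by (simp add: loc_mod_def)
 also have "\<dots> = frac R p M (a .\<^sub>M x) (s \<otimes>\<^sub>R t)"
 proof (rule SUP_eq_const)
  show "frac R p (ring_mod R) a s \<noteq> {}" using frac_self[OF ring_mod_module a' a(2)] by blast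
  fix q assume q: "q : frac R p (ring_mod R) a s"
  have "(\<Union>q'\<in>frac R p M x t. case q' of (x', t') => frac R p M (fst q .\<^sub>M x') (snd q \<otimes>\<^sub>R t')) =
   frac R p M (a .\<^sub>M x) (s \<otimes>\<^sub>R t)"
  proof (rule SUP_eq_const)
   show "frac R p M x t \<noteq> {}" using frac_self[OF M x] by blast
   fix q' assume q': "q' : frac R p M x t"
   show "(case q' of (x', t') => frac R p M (fst q .\<^sub>M x') (snd q \<otimes>\<^sub>R t')) = frac R p M (a .\<^sub>M x) (s \<otimes>\<^sub>R t)"
    using key[of "fst q" "snd q" "fst q'" "snd q'"] q q' by (simp add: case_prod_unfold)
  qed
  then show "(case q of (a', s') => \<Union>(x', t')\<in>frac R p M x t. frac R p M (a' .\<^sub>M x') (s' \<otimes>\<^sub>R t')) =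
   frac R p M (a .\<^sub>M x) (s \<otimes>\<^sub>R t)" by (simp add: case_prod_unfold)
 qed
 finally show ?thesis .
qed

lemma loc_mod_laws:
 fixes M :: "('a, 'm) module"
 assumes M: "module R M"
 defines "L \<equiv> loc_mod R p M" and "A \<equiv> loc_mod R p (ring_mod R)"
 shows "X : |L| ==> Y : |L| ==> X +\<^sub>L Y : |L|"
  "0\<^sub>L : |L|"
  "X : |L| ==> Y : |L| ==> Z : |L| ==> (X +\<^sub>L Y) +\<^sub>L Z = X +\<^sub>L (Y +\<^sub>L Z)"
  "X : |L| ==> Y : |L| ==> X +\<^sub>L Y = Y +\<^sub>L X"
  "X : |L| ==> 0\<^sub>L +\<^sub>L X = X"
  "X : |L| ==> \<exists>Y\<in>|L|. Y +\<^sub>L X = 0\<^sub>L"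
  "C : |A| ==> X : |L| ==> C .\<^sub>L X : |L|"
  "C : |A| ==> D : |A| ==> X : |L| ==> (C +\<^sub>A D) .\<^sub>L X = C .\<^sub>L X +\<^sub>L D .\<^sub>L X"
  "C : |A| ==> X : |L| ==> Y : |L| ==> C .\<^sub>L (X +\<^sub>L Y) = C .\<^sub>L X +\<^sub>L C .\<^sub>L Y"
  "C : |A| ==> D : |A| ==> X : |L| ==> (C .\<^sub>A D) .\<^sub>L X = C .\<^sub>L (D .\<^sub>L X)"
  "X : |L| ==> frac R p (ring_mod R) 1\<^sub>R 1\<^sub>R .\<^sub>L X = X"
proof -
 interpret M: module R M by (rule M)
 note add = loc_add[OF M, folded L_def] and sm = loc_smult[OF M, folded L_def]
  and mem = loc_memI[where M = M, folded L_def] and cs = loc_cases[where M = M, folded L_def]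
 note addR = loc_add[OF ring_mod_module, folded A_def] and smR = loc_smult[OF ring_mod_module, folded A_def]
  and csR = loc_cases[where M = "ring_mod R", folded A_def]
 note Rc = ring_mod_simps
 note S1 = pc(1) and z = loc_zero[where M = M, folded L_def]
 note fe = frac_eqI[OF M]
 note simps = M.smult_r_distr M.smult_l_distr M.smult_assoc1[symmetric] R.m_ac M.M.a_ac
 show "X : |L| ==> Y : |L| ==> X +\<^sub>L Y : |L|"
  by (elim cs) (simp add: add mem S_mult Sc del: Diff_iff)
 show "0\<^sub>L : |L|" unfolding z by (intro mem S1) simp
 show "(X +\<^sub>L Y) +\<^sub>L Z = X +\<^sub>L (Y +\<^sub>L Z)" if "X : |L|" "Y : |L|" "Z : |L|"
 proof -
  from that obtain x s y t w r where *: "x : |M|" "s : S" "y : |M|" "t : S" "w : |M|" "r : S"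
   and [simp]: "X = frac R p M x s" "Y = frac R p M y t" "Z = frac R p M w r" by (elim cs)
  note c = *(1,3,5) Sc[OF *(2)] Sc[OF *(4)] Sc[OF *(6)]
  show ?thesis
   by (simp add: add S_mult * c del: Diff_iff) (rule fe, use c S_mult * in "simp_all add: simps del: Diff_iff")
 qed
 show "X +\<^sub>L Y = Y +\<^sub>L X" if "X : |L|" "Y : |L|"
 proof -
  from that obtain x s y t where *: "x : |M|" "s : S" "y : |M|" "t : S"
   and [simp]: "X = frac R p M x s" "Y = frac R p M y t" by (elim cs)
  note c = *(1,3) Sc[OF *(2)] Sc[OF *(4)]
  show ?thesis by (simp add: add * c R.m_comm M.M.a_comm del: Diff_iff)
 qed
 show "0\<^sub>L +\<^sub>L X = X" if "X : |L|"
 proof -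
  from that obtain x s where *: "x : |M|" "s : S" and [simp]: "X = frac R p M x s" by (elim cs)
  show ?thesis unfolding z using * S1 by (simp add: add del: Diff_iff) (simp add: Sc)
 qed
 show "\<exists>Y\<in>|L|. Y +\<^sub>L X = 0\<^sub>L" if "X : |L|"
 proof -
  from that obtain x s where *: "x : |M|" "s : S" and [simp]: "X = frac R p M x s" by (elim cs)
  note c = *(1) Sc[OF *(2)]
  have "s .\<^sub>M -\<^sub>M x +\<^sub>M s .\<^sub>M x = 0\<^sub>M" using c by (simp add: M.smult_r_minus M.M.l_neg)
  then have "frac R p M (-\<^sub>M x) s +\<^sub>L X = 0\<^sub>L" unfolding z
   using c * by (simp add: add del: Diff_iff) (rule fe, use c S_mult * S1 in "simp_all del: Diff_iff")
  then show ?thesis using mem[of "-\<^sub>M x" s] c * by blast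
 qed
 show "C : |A| ==> X : |L| ==> C .\<^sub>L X : |L|"
  by (elim cs csR) (simp add: sm mem S_mult del: Diff_iff)
 show "(C +\<^sub>A D) .\<^sub>L X = C .\<^sub>L X +\<^sub>L D .\<^sub>L X" if "C : |A|" "D : |A|" "X : |L|"
 proof -
  from that obtain a s b t x r where *: "a : |ring_mod R|" "s : S" "b : |ring_mod R|" "t : S" "x : |M|" "r : S"
   and [simp]: "C = frac R p (ring_mod R) a s" "D = frac R p (ring_mod R) b t" "X = frac R p M x r" by (elim cs csR)
  note c = *(1,3)[unfolded Rc] *(5) Sc[OF *(2)] Sc[OF *(4)] Sc[OF *(6)]
  show ?thesis
   by (simp add: add addR sm S_mult *(2,4,6) c del: Diff_iff) (rule fe, use c S_mult *(2,4,6) in "simp_all add: simps del: Diff_iff")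
 qed
 show "C .\<^sub>L (X +\<^sub>L Y) = C .\<^sub>L X +\<^sub>L C .\<^sub>L Y" if "C : |A|" "X : |L|" "Y : |L|"
 proof -
  from that obtain a s y t x r where *: "a : |ring_mod R|" "s : S" "y : |M|" "t : S" "x : |M|" "r : S"
   and [simp]: "C = frac R p (ring_mod R) a s" "Y = frac R p M y t" "X = frac R p M x r" by (elim cs csR)
  note c = *(1)[unfolded Rc] *(3,5) Sc[OF *(2)] Sc[OF *(4)] Sc[OF *(6)]
  show ?thesis
   by (simp add: add sm S_mult *(2,4,6) c del: Diff_iff) (rule fe, use c S_mult *(2,4,6) in "simp_all add: simps del: Diff_iff")
 qed
 show "(C .\<^sub>A D) .\<^sub>L X = C .\<^sub>L (D .\<^sub>L X)" if "C : |A|" "D : |A|" "X : |L|"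
 proof -
  from that obtain a s b t x r where *: "a : |ring_mod R|" "s : S" "b : |ring_mod R|" "t : S" "x : |M|" "r : S"
   and [simp]: "C = frac R p (ring_mod R) a s" "D = frac R p (ring_mod R) b t" "X = frac R p M x r" by (elim cs csR)
  note c = *(1,3)[unfolded Rc] *(5) Sc[OF *(2)] Sc[OF *(4)] Sc[OF *(6)]
  show ?thesis
   by (simp add: smR sm S_mult *(2,4,6) c R.m_assoc M.smult_assoc1 del: Diff_iff)
 qed
 show "frac R p (ring_mod R) 1\<^sub>R 1\<^sub>R .\<^sub>L X = X" if "X : |L|"
 proof -
  from that obtain x s where *: "x : |M|" "s : S" and [simp]: "X = frac R p M x s" by (elim cs)
  show ?thesis using * S1 by (simp add: sm del: Diff_iff) (simp add: Sc)
 qed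
qed

lemma loc_ring_simps:
 "|loc_ring R p| = |loc_mod R p (ring_mod R)|"
 "monoid.mult (loc_ring R p) = smult (loc_mod R p (ring_mod R))"
 "1\<^sub>(loc_ring R p) = frac R p (ring_mod R) 1\<^sub>R 1\<^sub>R"
 "0\<^sub>(loc_ring R p) = 0\<^sub>(loc_mod R p (ring_mod R))"
 "add (loc_ring R p) = add (loc_mod R p (ring_mod R))"
 by (simp_all add: loc_ring_def Let_def)

lemma cring_loc_ring: "cring (loc_ring R p)"
proof -
 note l = loc_mod_laws[OF ring_mod_module]
 have comm: "x \<otimes>\<^sub>(loc_ring R p) y = y \<otimes>\<^sub>(loc_ring R p) x"
  if "x : |loc_ring R p|" "y : |loc_ring R p|" for x y
 proof -
  from that obtain a s b t where *: "a : |R|" "s : S" "b : |R|" "t : S"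
   and [simp]: "x = frac R p (ring_mod R) a s" "y = frac R p (ring_mod R) b t"
   unfolding loc_ring_simps by (elim loc_cases) simp
  show ?thesis unfolding loc_ring_simps
   using * by (simp add: loc_smult[OF ring_mod_module] R.m_comm Sc del: Diff_iff)
 qed
 have one: "1\<^sub>(loc_ring R p) : |loc_ring R p|"
  unfolding loc_ring_simps by (intro loc_memI pc(1)) simp
 show ?thesis
 proof (rule cringI)
  show "abelian_group (loc_ring R p)"
   by (rule abelian_groupI; unfold loc_ring_simps; rule l; assumption)
  show "comm_monoid (loc_ring R p)"
   by (rule comm_monoidI) (use comm one l in "auto simp: loc_ring_simps")
 qed (use l in "auto simp: loc_ring_simps")
qed

lemma module_loc_mod:
 fixes M :: "('a, 'm) module"
 assumes M: "module R M" shows "module (loc_ring R p) (loc_mod R p M)"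
 by (rule modI[where R = "loc_ring R p" and M = "loc_mod R p M"], rule cring_loc_ring, unfold loc_ring_simps)
  (rule loc_mod_laws[OF M]; assumption)+

lemma loc_map_hom:
 "r : |R| ==> loc_map R p r : |loc_ring R p|"
 "r : |R| ==> s : |R| ==> loc_map R p (r +\<^sub>R s) = loc_map R p r +\<^sub>(loc_ring R p) loc_map R p s"
 "r : |R| ==> s : |R| ==> loc_map R p (r \<otimes>\<^sub>R s) = loc_map R p r \<otimes>\<^sub>(loc_ring R p) loc_map R p s"
 "loc_map R p 1\<^sub>R = 1\<^sub>(loc_ring R p)"
 unfolding loc_ring_simps loc_map_def using pc(1)
 by (auto simp: loc_add[OF ring_mod_module] loc_smult[OF ring_mod_module] intro!: loc_memI)

lemma loc_unit:
 assumes s: "s : S"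
 shows "frac R p (ring_mod R) 1\<^sub>R s : |loc_ring R p|"
  "frac R p (ring_mod R) 1\<^sub>R s \<otimes>\<^sub>(loc_ring R p) loc_map R p s = 1\<^sub>(loc_ring R p)"
proof -
 show "frac R p (ring_mod R) 1\<^sub>R s : |loc_ring R p|"
  unfolding loc_ring_simps by (intro loc_memI s) simp
 show "frac R p (ring_mod R) 1\<^sub>R s \<otimes>\<^sub>(loc_ring R p) loc_map R p s = 1\<^sub>(loc_ring R p)"
  unfolding loc_ring_simps loc_map_def
  using loc_smult[OF ring_mod_module R.one_closed s, of s "1\<^sub>R"] s pc(1) Sc[OF s]
  by (simp del: Diff_iff) (rule frac_eqI[OF ring_mod_module], use s pc(1) Sc[OF s] in "simp_all del: Diff_iff")
qed

lemma module_restrict_scalars: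
 fixes N :: "(('a \<times> 'a) set, 'm) module"
 assumes N: "module (loc_ring R p) N" shows "module R (restrict_scalars (loc_map R p) N)"
proof -
 interpret N: module "loc_ring R p" N by (rule N)
 show ?thesis unfolding restrict_scalars_def
 proof (rule modI, goal_cases)
  case 1 show ?case by (rule R)
 next
  case (7 x) then show ?case by (intro bexI[of _ "-\<^sub>N x"]) (auto simp: N.M.l_neg)
 qed (auto simp: loc_map_hom N.M.a_ac N.smult_l_distr N.smult_r_distr N.smult_assoc1)
qed

lemma loc_smult_bij:
 assumes N: "module (loc_ring R p) N" and s: "s : S"
 shows "bij_betw (%x. loc_map R p s .\<^sub>N x) |N| |N|"
proof -
 interpret N: module "loc_ring R p" N by (rule N)
 note u = loc_unit[OF s] and l = loc_map_hom(1)[OF Sc[OF s]]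
 let ?u = "frac R p (ring_mod R) 1\<^sub>R s"
 have u': "loc_map R p s \<otimes>\<^sub>(loc_ring R p) ?u = 1\<^sub>(loc_ring R p)" using u l by (simp add: N.R.m_comm)
 show ?thesis
  by (rule bij_betw_byWitness[of _ "%x. ?u .\<^sub>N x"])
    (use u l u' in "auto simp: N.smult_assoc1[symmetric]")
qed

subsection \<open>The residue field\<close>

private abbreviation (input) "P \<equiv> genideal (loc_ring R p) (loc_map R p ` p)"

lemma residue_ideal: "P = {frac R p (ring_mod R) a s |a s. a : p \<and> s : S}" (is "_ = ?Q")
proof
 interpret L: cring "loc_ring R p" by (rule cring_loc_ring)
 interpret p: ideal p R by (rule pc(6))
 have pR: "a : |R|" if "a : p" for a using that pc(5) by auto
 have sub: "loc_map R p ` p \<subseteq> |loc_ring R p|" using loc_map_hom(1) pR by auto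
 have Qi: "ideal ?Q (loc_ring R p)"
 proof (rule idealI[OF L.ring_axioms])
  have add: "x +\<^sub>(loc_ring R p) y : ?Q" if "x : ?Q" "y : ?Q" for x y
  proof -
   from that obtain a s b t where *: "a : p" "s : S" "b : p" "t : S"
    and [simp]: "x = frac R p (ring_mod R) a s" "y = frac R p (ring_mod R) b t" by blast
   have "x +\<^sub>(loc_ring R p) y = frac R p (ring_mod R) (t \<otimes>\<^sub>R a +\<^sub>R s \<otimes>\<^sub>R b) (s \<otimes>\<^sub>R t)"
    unfolding loc_ring_simps using loc_add[OF ring_mod_module, of a s b t] * pR by simp
   moreover have "t \<otimes>\<^sub>R a +\<^sub>R s \<otimes>\<^sub>R b : p" using * p.I_l_closed Sc by (intro p.a_closed) auto
   ultimately show ?thesis using S_mult[OF *(2,4)] by blast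
  qed
  have l: "x \<otimes>\<^sub>(loc_ring R p) y : ?Q" if "y : ?Q" "x : |loc_ring R p|" for x y
  proof -
   from that(2) obtain b t where b: "b : |R|" "t : S" "x = frac R p (ring_mod R) b t"
    unfolding loc_ring_simps by (elim loc_cases) simp
   from that(1) obtain a s where a: "a : p" "s : S" "y = frac R p (ring_mod R) a s" by blast
   have "x \<otimes>\<^sub>(loc_ring R p) y = frac R p (ring_mod R) (b \<otimes>\<^sub>R a) (t \<otimes>\<^sub>R s)"
    unfolding loc_ring_simps a b(3) using loc_smult[OF ring_mod_module b(1,2), of a s] a pR by simp
   then show ?thesis using p.I_l_closed[OF a(1) b(1)] S_mult[OF b(2) a(2)] by blast
  qed
  have Qc: "?Q \<subseteq> |loc_ring R p|" unfolding loc_ring_simps using pR by (auto intro!: loc_memI)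
  show "subgroup ?Q (add_monoid (loc_ring R p))"
  proof (rule L.add.subgroupI)
   show "?Q \<subseteq> |loc_ring R p|" by (rule Qc)
   have "frac R p (ring_mod R) 0\<^sub>R 1\<^sub>R : ?Q" using pc(1) p.zero_closed by blast
   then show "?Q \<noteq> {}" by blast
   fix x assume x: "x : ?Q"
   have xc: "x : |loc_ring R p|" using x Qc by blast
   have m1: "-\<^sub>(loc_ring R p) 1\<^sub>(loc_ring R p) : |loc_ring R p|" by simp
   have "(-\<^sub>(loc_ring R p) 1\<^sub>(loc_ring R p)) \<otimes>\<^sub>(loc_ring R p) x : ?Q" using l[OF x m1] .
   then show "-\<^sub>(loc_ring R p) x : ?Q" using xc by (simp add: L.l_minus)
  qed (use add in auto)
  fix x y assume xy: "x : ?Q" "y : |loc_ring R p|"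
  show yx: "y \<otimes>\<^sub>(loc_ring R p) x : ?Q" by (rule l[OF xy])
  show "x \<otimes>\<^sub>(loc_ring R p) y : ?Q" unfolding L.m_comm[OF subsetD[OF Qc xy(1)] xy(2)] by (rule yx)
 qed
 have "loc_map R p ` p \<subseteq> ?Q" using pc(1) by (auto simp: loc_map_def)
 then show "P \<subseteq> ?Q" by (rule L.genideal_minimal[OF Qi])
 interpret P: ideal P "loc_ring R p" by (rule L.genideal_ideal[OF sub])
 show "?Q \<subseteq> P"
 proof
  fix x assume "x : ?Q"
  then obtain a s where a: "a : p" "s : S" "x = frac R p (ring_mod R) a s" by blast
  have "loc_map R p a : P" using L.genideal_self[OF sub] a(1) by blast
  then have "frac R p (ring_mod R) 1\<^sub>R s \<otimes>\<^sub>(loc_ring R p) loc_map R p a : P"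
   using P.I_l_closed loc_unit(1)[OF a(2)] by blast
  also have "frac R p (ring_mod R) 1\<^sub>R s \<otimes>\<^sub>(loc_ring R p) loc_map R p a = x"
   unfolding loc_ring_simps loc_map_def a(3)
   using loc_smult[OF ring_mod_module R.one_closed a(2), of a "1\<^sub>R"] pR[OF a(1)] pc(1) Sc[OF a(2)] by simp
  finally show "x : P" .
 qed
qed

lemma residue_submodule: "submodule P (loc_ring R p) (ring_mod (loc_ring R p))"
proof -
 interpret L: cring "loc_ring R p" by (rule cring_loc_ring)
 have "loc_map R p ` p \<subseteq> |loc_ring R p|" using loc_map_hom(1) pc(5) by auto
 then interpret P: ideal P "loc_ring R p" by (rule L.genideal_ideal)
 show ?thesis
  by (rule submodI[OF module_ring_mod[OF cring_loc_ring]]) (use P.I_l_closed P.Icarr in auto)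
qed

lemma frac_in_residue_ideal: "a : |R| ==> s : S ==> frac R p (ring_mod R) a s : P \<longleftrightarrow> a : p"
proof
 assume a: "a : |R|" and s: "s : S"
 show "a : p ==> frac R p (ring_mod R) a s : P" unfolding residue_ideal using s by blast
 assume "frac R p (ring_mod R) a s : P"
 then obtain b t where b: "b : p" "t : S" "frac R p (ring_mod R) a s = frac R p (ring_mod R) b t"
  unfolding residue_ideal by blast
 have bR: "b : |R|" using b(1) pc(5) by auto
 obtain u where u: "u : S" "(u \<otimes>\<^sub>R t) \<otimes>\<^sub>R a = (u \<otimes>\<^sub>R s) \<otimes>\<^sub>R b"
  using b(3) frac_eq_iff[OF ring_mod_module, of a s b t] a s b(2) bR by auto
 have "(u \<otimes>\<^sub>R t) \<otimes>\<^sub>R a : p"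
  unfolding u(2) using ideal.I_l_closed[OF pc(6) b(1)] u(1) s by auto
 then show "a : p" using S_mult[OF u(1) b(2)] a primeideal.I_prime[OF p, of "u \<otimes>\<^sub>R t" a] by auto
qed

lemma module_residue_loc: "module (loc_ring R p) (residue_loc R p)"
 unfolding residue_loc_def
 by (rule module_mod.Q_module[OF module_modI[OF module_ring_mod[OF cring_loc_ring] residue_submodule]])

lemma residue_loc_facts:
 "|residue_loc R p| = (%x. P +>\<^sub>(ring_mod (loc_ring R p)) x) ` |loc_ring R p|"
 "A : |loc_ring R p| ==> x : |loc_ring R p| ==>
   A .\<^sub>(residue_loc R p) (P +>\<^sub>(ring_mod (loc_ring R p)) x) = P +>\<^sub>(ring_mod (loc_ring R p)) (A \<otimes>\<^sub>(loc_ring R p) x)"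
 "x : |loc_ring R p| ==> P +>\<^sub>(ring_mod (loc_ring R p)) x = 0\<^sub>(residue_loc R p) \<longleftrightarrow> x : P"
proof -
 interpret k: module_mod "loc_ring R p" "ring_mod (loc_ring R p)" P
  by (rule module_modI[OF module_ring_mod[OF cring_loc_ring] residue_submodule])
 show "|residue_loc R p| = (%x. P +>\<^sub>(ring_mod (loc_ring R p)) x) ` |loc_ring R p|"
  using k.Q_carrier by (simp add: residue_loc_def)
 show "A : |loc_ring R p| ==> x : |loc_ring R p| ==>
   A .\<^sub>(residue_loc R p) (P +>\<^sub>(ring_mod (loc_ring R p)) x) = P +>\<^sub>(ring_mod (loc_ring R p)) (A \<otimes>\<^sub>(loc_ring R p) x)"
  using k.Q_smult by (simp add: residue_loc_def)
 show "x : |loc_ring R p| ==> P +>\<^sub>(ring_mod (loc_ring R p)) x = 0\<^sub>(residue_loc R p) \<longleftrightarrow> x : P"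
  using k.cls_zero_iff by (simp add: residue_loc_def)
qed

lemma residue_like_residue_mod:
 "residue_like R p (residue_mod R p) (P +>\<^sub>(ring_mod (loc_ring R p)) 1\<^sub>(loc_ring R p))"
 unfolding residue_like_def residue_mod_def
proof (intro conjI ballI)
 interpret L: cring "loc_ring R p" by (rule cring_loc_ring)
 note f = residue_loc_facts
 let ?e = "P +>\<^sub>(ring_mod (loc_ring R p)) 1\<^sub>(loc_ring R p)"
 show "module R (restrict_scalars (loc_map R p) (residue_loc R p))"
  by (rule module_restrict_scalars[OF module_residue_loc])
 show "?e : |restrict_scalars (loc_map R p) (residue_loc R p)|" by (simp add: f(1))
 have re: "r .\<^sub>(restrict_scalars (loc_map R p) (residue_loc R p)) ?e = P +>\<^sub>(ring_mod (loc_ring R p)) loc_map R p r"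
  if "r : |R|" for r
  using f(2)[OF loc_map_hom(1)[OF that] L.one_closed] loc_map_hom(1)[OF that] by simp
 show "r .\<^sub>(restrict_scalars (loc_map R p) (residue_loc R p)) ?e =
   0\<^sub>(restrict_scalars (loc_map R p) (residue_loc R p)) \<longleftrightarrow> r : p" if "r : |R|" for r
  using f(3)[OF loc_map_hom(1)[OF that]] frac_in_residue_ideal[OF that pc(1)] re[OF that]
  by (simp add: loc_map_def)
 fix a assume "a : |restrict_scalars (loc_map R p) (residue_loc R p)|"
 then obtain x where x: "x : |loc_ring R p|" "a = P +>\<^sub>(ring_mod (loc_ring R p)) x" by (auto simp: f(1))
 from x(1) obtain b s where b: "b : |R|" "s : S" "x = frac R p (ring_mod R) b s"
  unfolding loc_ring_simps by (elim loc_cases) simp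
 have "loc_map R p s \<otimes>\<^sub>(loc_ring R p) x = loc_map R p b"
  unfolding loc_ring_simps loc_map_def b(3)
  using loc_smult[OF ring_mod_module Sc[OF b(2)] pc(1), of b s] b Sc[OF b(2)]
  by simp (rule frac_eqI[OF ring_mod_module], use b pc(1) in "simp_all")
 then have "s .\<^sub>(restrict_scalars (loc_map R p) (residue_loc R p)) a =
   b .\<^sub>(restrict_scalars (loc_map R p) (residue_loc R p)) ?e"
  using f(2)[OF loc_map_hom(1)[OF Sc[OF b(2)]] x(1)] x(2) re[OF b(1)] by simp
 then show "\<exists>s\<in>|R| - p. \<exists>r\<in>|R|. s .\<^sub>(restrict_scalars (loc_map R p) (residue_loc R p)) a =
   r .\<^sub>(restrict_scalars (loc_map R p) (residue_loc R p)) ?e" using b by blast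
next
 fix s assume "s : |R| - p"
 from loc_smult_bij[OF module_residue_loc this]
 show "bij_betw (%a. s .\<^sub>(restrict_scalars (loc_map R p) (residue_loc R p)) a)
   |restrict_scalars (loc_map R p) (residue_loc R p)|
   |restrict_scalars (loc_map R p) (residue_loc R p)|" by simp
qed

subsection \<open>Localization of complexes\<close>

lemma loc_dif:
 fixes X :: "('a, 'm) cpx"
 assumes X: "is_cpx R X" and x: "x : |obj X n|" "s : S"
 shows "dif (loc_cpx R p X) n (frac R p (obj X n) x s) = frac R p (obj X (n - 1)) (dif X n x) s"
proof -
 note dX = is_cpxD[OF X]
 have "(\<Union>q\<in>frac R p (obj X n) x s. case q of (y, t) => frac R p (obj X (n - 1)) (dif X n y) t) =
  frac R p (obj X (n - 1)) (dif X n x) s"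
 proof (rule SUP_eq_const)
  show "frac R p (obj X n) x s \<noteq> {}" using frac_self[OF dX(1) x] by blast
  fix q assume "q : frac R p (obj X n) x s"
  then obtain y t u where q: "q = (y, t)" and y: "y : |obj X n|" "t : S"
   and u: "u : S" "(u \<otimes>\<^sub>R t) .\<^sub>(obj X n) x = (u \<otimes>\<^sub>R s) .\<^sub>(obj X n) y"
   using mem_frac[OF dX(1) x] by (cases q) auto
  have "dif X n ((u \<otimes>\<^sub>R t) .\<^sub>(obj X n) x) = dif X n ((u \<otimes>\<^sub>R s) .\<^sub>(obj X n) y)" using u(2) by simp
  then have "(u \<otimes>\<^sub>R s) .\<^sub>(obj X (n - 1)) dif X n y = (u \<otimes>\<^sub>R t) .\<^sub>(obj X (n - 1)) dif X n x"
   using mod_homD(3)[OF dX(2) _ x(1), of "u \<otimes>\<^sub>R t"] mod_homD(3)[OF dX(2) _ y(1), of "u \<otimes>\<^sub>R s"] u(1) x(2) y(2) by auto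
  then show "(case q of (y, t) => frac R p (obj X (n - 1)) (dif X n y) t) = frac R p (obj X (n - 1)) (dif X n x) s"
   using frac_eq_iff[OF dX(1) mod_homD(1)[OF dX(2) y(1)] y(2) mod_homD(1)[OF dX(2) x(1)] x(2)] u(1) q by auto
 qed
 then show ?thesis by (simp add: loc_cpx_def)
qed

lemma frac_zero:
 fixes M :: "('a, 'm) module"
 assumes M: "module R M" and x: "x : |M|" "s : S"
 shows "frac R p M x s = 0\<^sub>(loc_mod R p M) \<longleftrightarrow> (\<exists>u\<in>S. u .\<^sub>M x = 0\<^sub>M)"
 unfolding loc_zero frac_eq_iff[OF M x modD(2)[OF M] pc(1)]
 using x(2) modD(16)[OF M] by (auto simp: modD(16)[OF M])

lemma is_cpx_loc_cpx:
 fixes X :: "('a, 'm) cpx"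
 assumes X: "is_cpx R X" shows "is_cpx (loc_ring R p) (loc_cpx R p X)"
proof -
 note dX = is_cpxD[OF X]
 have hom: "mod_hom (loc_ring R p) (loc_mod R p (obj X n)) (loc_mod R p (obj X (n - 1))) (dif (loc_cpx R p X) n)" for n
 proof (rule mod_homI)
  note h = mod_homD[OF dX(2)]
  fix A assume "A : |loc_mod R p (obj X n)|"
  then obtain x s where x: "x : |obj X n|" "s : S" "A = frac R p (obj X n) x s" by (rule loc_cases)
  show "dif (loc_cpx R p X) n A : |loc_mod R p (obj X (n - 1))|"
   unfolding x(3) loc_dif[OF X x(1,2)] by (intro loc_memI h x)
  show "dif (loc_cpx R p X) n (C .\<^sub>(loc_mod R p (obj X n)) A) = C .\<^sub>(loc_mod R p (obj X (n - 1))) dif (loc_cpx R p X) n A"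
   if "C : |loc_ring R p|" for C
  proof -
   from that obtain a t where a: "a : |R|" "t : S" "C = frac R p (ring_mod R) a t"
    unfolding loc_ring_simps by (elim loc_cases) simp
   show ?thesis
    unfolding a(3) x(3) loc_smult[OF dX(1) a(1,2) x(1,2)] loc_dif[OF X x(1,2)]
     loc_dif[OF X modD(8)[OF dX(1) a(1) x(1)] S_mult[OF a(2) x(2)]]
     loc_smult[OF dX(1) a(1,2) h(1)[OF x(1)] x(2)] h(3)[OF a(1) x(1)] ..
  qed
  fix B assume "B : |loc_mod R p (obj X n)|"
  then obtain y t where y: "y : |obj X n|" "t : S" "B = frac R p (obj X n) y t" by (rule loc_cases)
  note c = modD(8)[OF dX(1) Sc[OF y(2)] x(1)] modD(8)[OF dX(1) Sc[OF x(2)] y(1)]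
  show "dif (loc_cpx R p X) n (A +\<^sub>(loc_mod R p (obj X n)) B) =
    dif (loc_cpx R p X) n A +\<^sub>(loc_mod R p (obj X (n - 1))) dif (loc_cpx R p X) n B"
   unfolding x(3) y(3) loc_add[OF dX(1) x(1,2) y(1,2)] loc_dif[OF X x(1,2)] loc_dif[OF X y(1,2)]
    loc_dif[OF X modD(1)[OF dX(1) c] S_mult[OF x(2) y(2)]]
    loc_add[OF dX(1) h(1)[OF x(1)] x(2) h(1)[OF y(1)] y(2)] h(2)[OF c] h(3)[OF Sc[OF y(2)] x(1)]
    h(3)[OF Sc[OF x(2)] y(1)] ..
 qed
 have "dif (loc_cpx R p X) (n - 1) (dif (loc_cpx R p X) n A) = 0\<^sub>(loc_mod R p (obj X (n - 2)))"
  if "A : |loc_mod R p (obj X n)|" for n A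
 proof -
  from that obtain x s where x: "x : |obj X n|" "s : S" "A = frac R p (obj X n) x s" by (rule loc_cases)
  have "n - 1 - 1 = n - 2" by simp
  then have "dif (loc_cpx R p X) (n - 1) (dif (loc_cpx R p X) n A) = frac R p (obj X (n - 2)) 0\<^sub>(obj X (n - 2)) s"
   unfolding x(3) loc_dif[OF X x(1,2)] loc_dif[OF X mod_homD(1)[OF dX(2) x(1)] x(2)] dX(3)[OF x(1)] by simp
  also have "\<dots> = 0\<^sub>(loc_mod R p (obj X (n - 2)))"
   unfolding frac_zero[OF dX(1) modD(2)[OF dX(1)] x(2)]
   using pc(1) modD(16)[OF dX(1) R.one_closed] by blast
  finally show ?thesis .
 qed
 then show ?thesis unfolding is_cpx_def using hom module_loc_mod[OF dX(1)] by simp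
qed

lemma loc_cycles_boundaries:
 fixes X :: "('a, 'm) cpx"
 assumes X: "is_cpx R X" and x: "x : |obj X n|" "s : S"
 shows "frac R p (obj X n) x s : cycles (loc_cpx R p X) n \<longleftrightarrow> (\<exists>u\<in>S. u .\<^sub>(obj X n) x : cycles X n)"
  "x : boundaries X n ==> frac R p (obj X n) x s : boundaries (loc_cpx R p X) n"
proof -
 note dX = is_cpxD[OF X]
 have "frac R p (obj X n) x s : cycles (loc_cpx R p X) n \<longleftrightarrow>
   (\<exists>u\<in>S. u .\<^sub>(obj X (n - 1)) dif X n x = 0\<^sub>(obj X (n - 1)))"
  using loc_memI[OF x] loc_dif[OF X x] frac_zero[OF dX(1) mod_homD(1)[OF dX(2) x(1)] x(2)]
  by (simp add: cycles_def)
 also have "\<dots> \<longleftrightarrow> (\<exists>u\<in>S. u .\<^sub>(obj X n) x : cycles X n)"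
  using mod_homD(3)[OF dX(2) _ x(1)] modD(8)[OF dX(1) _ x(1)] by (auto simp: cycles_def)
 finally show "frac R p (obj X n) x s : cycles (loc_cpx R p X) n \<longleftrightarrow> (\<exists>u\<in>S. u .\<^sub>(obj X n) x : cycles X n)" .
 assume "x : boundaries X n"
 then obtain y where y: "y : |obj X (n + 1)|" "x = dif X (n + 1) y" by (auto simp: boundaries_def)
 have "frac R p (obj X n) x s = dif (loc_cpx R p X) (n + 1) (frac R p (obj X (n + 1)) y s)"
  using loc_dif[OF X y(1) x(2)] y(2) by simp
 then show "frac R p (obj X n) x s : boundaries (loc_cpx R p X) n"
  unfolding boundaries_def using loc_memI[OF y(1) x(2)] by simp
qed

end

section \<open>Complexes of homomorphisms into an injective module\<close>

lemma submodule_add: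
 assumes M: "module R M" and U: "submodule U R M" and V: "submodule V R M"
 shows "submodule {x +\<^sub>M y |x y. x : U \<and> y : V} R M" (is "submodule ?W R M")
proof -
 interpret M: module R M by fact
 note u = submoduleD[OF M U] and v = submoduleD[OF M V]
 have I: "x : U ==> y : V ==> z = x +\<^sub>M y ==> z : ?W" for x y z by blast
 show ?thesis
 proof (rule submodI[OF M])
  show "?W \<subseteq> |M|" using u(1) v(1) by auto
  show "0\<^sub>M : ?W" by (rule I[OF u(2) v(2)]) simp
  fix w assume "w : ?W"
  then obtain x y where w: "x : U" "y : V" "w = x +\<^sub>M y" by blast
  have c: "x : |M|" "y : |M|" using w u(1) v(1) by auto
  show "r .\<^sub>M w : ?W" if "r : |R|" for r
   by (rule I[OF u(4)[OF that w(1)] v(4)[OF that w(2)]]) (use that c w(3) in "simp add: M.smult_r_distr")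
  fix w' assume "w' : ?W"
  then obtain x' y' where w': "x' : U" "y' : V" "w' = x' +\<^sub>M y'" by blast
  have c': "x' : |M|" "y' : |M|" using w' u(1) v(1) by auto
  show "w +\<^sub>M w' : ?W"
   by (rule I[OF u(3)[OF w(1) w'(1)] v(3)[OF w(2) w'(2)]]) (use c c' w(3) w'(3) in "simp add: M.M.a_ac")
 qed
qed

lemma injective_extend_submodule:
 fixes R :: "'a ring" and B :: "('a, 'm) module"
 assumes E: "injective_mod R E" and B: "module R B" and G: "partial_hom R B E G"
 obtains g where "mod_hom R B E g" "!!x y. (x, y) : G ==> g x = y"
proof -
 have mE: "module R E" using E by (simp add: injective_mod_def)
 note D = partial_homD[OF G]
 have U: "submodule (Domain G) R B"
  by (rule submodI[OF B]) (auto simp: Domain_iff intro: D)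
 let ?A = "sub_mod B (Domain G)"
 have "G \<subseteq> Domain G \<times> |E|" using D(2) by auto
 then have "partial_hom R ?A E G" using G by (simp add: partial_hom_def)
 from partial_hom_total_imp_mod_hom[OF module_sub_mod[OF B U] mE this]
 obtain f where f: "mod_hom R ?A E f" "!!x y. (x, y) : G ==> f x = y" by auto
 have "mod_hom R ?A B id" by (rule mod_homI) (use D(1) in auto)
 from injective_mod_extend[OF E module_sub_mod[OF B U] B this _ f(1)]
 obtain g where "mod_hom R B E g" "!!x. x : Domain G ==> g x = f x" by auto
 then show ?thesis using f(2) by (intro that[of g]) (auto simp: Domain_iff)
qed

lemma injective_factor:
 fixes R :: "'a ring" and B :: "('a, 'm) module" and C :: "('a, 'n) module" and E :: "('a, 'e) module"
 assumes E: "injective_mod R E" and B: "module R B" and C: "module R C"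
  and d: "mod_hom R B C d" and f: "mod_hom R B E f"
  and ker: "!!x. x : |B| ==> d x = 0\<^sub>C ==> f x = 0\<^sub>E"
 obtains g where "mod_hom R C E g" "!!x. x : |B| ==> g (d x) = f x"
proof -
 have mE: "module R E" using E by (simp add: injective_mod_def)
 define G where "G = (%x. (d x, f x)) ` |B|"
 have GI: "(d x, f x) : G" if "x : |B|" for x using that by (simp add: G_def)
 have Gc: thesis if "z : G" "!!x. x : |B| ==> z = (d x, f x) ==> thesis" for z thesis
  using that unfolding G_def by blast
 note dD = mod_homD[OF d] and fD = mod_homD[OF f]
 have G: "partial_hom R C E G" unfolding partial_hom_def
 proof (intro conjI allI impI)
  show "G \<subseteq> |C| \<times> |E|" using dD(1) fD(1) by (auto simp: G_def)
  show "(0\<^sub>C, 0\<^sub>E) : G"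
   using GI[OF modD(2)[OF B]] mod_hom_zero[OF B C d] mod_hom_zero[OF B mE f] by simp
  show "(x +\<^sub>C x', y +\<^sub>E y') : G" if xy: "(x, y) : G" "(x', y') : G" for x y x' y'
  proof -
   obtain u v where "u : |B|" "(x, y) = (d u, f u)" "v : |B|" "(x', y') = (d v, f v)"
    using Gc[OF xy(1)] Gc[OF xy(2)] by metis
   then show ?thesis using GI[of "u +\<^sub>B v"] by (simp add: dD fD modD[OF B])
  qed
  show "(r .\<^sub>C x, r .\<^sub>E y) : G" if r: "r : |R|" and xy: "(x, y) : G" for r x y
  proof -
   obtain u where "u : |B|" "(x, y) = (d u, f u)" using Gc[OF xy] by metis
   then show ?thesis using GI[of "r .\<^sub>B u"] r by (simp add: dD fD modD[OF B])
  qed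
  show "y = 0\<^sub>E" if "(0\<^sub>C, y) : G" for y using Gc[OF that] ker by (metis prod.inject)
 qed
 obtain g where "mod_hom R C E g" "!!x y. (x, y) : G ==> g x = y"
  by (rule injective_extend_submodule[OF E C G]) blast
 then show ?thesis using GI by (intro that[of g]) auto
qed

context
 fixes R :: "'a ring" and A :: "('a, 'm) cpx" and E :: "('a, 'e) module"
 assumes A: "is_cpx R A" and E: "injective_mod R E"
begin

private abbreviation (input) "W \<equiv> hom_cpx R A (mod_cpx E)"

lemma injective_module: "module R E" using E by (simp add: injective_mod_def)

lemma is_cpx_hom_injective: "is_cpx R W"
 by (rule is_cpx_hom_cpx[OF A is_cpx_mod_cpx[OF injective_module]])

lemma hom_into_mod:
 "h : |obj W n| \<longleftrightarrow> h (- n) : extensional |obj A (- n)| \<and>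
   mod_hom R (obj A (- n)) E (h (- n)) \<and> (\<forall>i. i \<noteq> - n \<longrightarrow> h i = (%_. undefined))"
proof -
 have *: "g : extensional |obj A i| \<and> mod_hom R (obj A i) (obj (mod_cpx E) (i + n)) g \<longleftrightarrow>
   g = (%_. undefined)" if "i \<noteq> - n" for g i
 proof -
  have "i + n \<noteq> 0" using that by simp
  then show ?thesis using modD[OF is_cpxD(1)[OF A, of i]]
   by (auto simp: extensional_def mod_hom_def fun_eq_iff)
 qed
 have "h : |obj W n| \<longleftrightarrow> (\<forall>i. if i = - n
   then h i : extensional |obj A i| \<and> mod_hom R (obj A i) E (h i) else h i = (%_. undefined))"
  unfolding hom_cpx_carrier
 proof (intro all_cong1)
  fix i
  show "(h i : extensional |obj A i| \<and> mod_hom R (obj A i) (obj (mod_cpx E) (i + n)) (h i)) =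
   (if i = - n then h i : extensional |obj A i| \<and> mod_hom R (obj A i) E (h i)
    else h i = (%_. undefined))"
   using *[of i "h i"] by (cases "i = - n") simp_all
 qed
 also have "\<dots> \<longleftrightarrow> h (- n) : extensional |obj A (- n)| \<and>
   mod_hom R (obj A (- n)) E (h (- n)) \<and> (\<forall>i. i \<noteq> - n \<longrightarrow> h i = (%_. undefined))" by metis
 finally show ?thesis .
qed

lemma hom_into_mod_one:
 assumes f: "mod_hom R (obj A (- n)) E f"
 obtains h where "h : |obj W n|" "!!x. x : |obj A (- n)| ==> h (- n) x = f x"
 using that[of "(%_ _. undefined)(- n := restrict f |obj A (- n)| )"] f is_cpxD(1)[OF A]
 by (simp add: hom_into_mod)

lemma hom_into_mod_val: "h : |obj W n| ==> mod_hom R (obj A (- n)) E (h (- n))"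
 by (simp add: hom_into_mod)

lemma hom_injective_cycles:
 assumes h: "h : |obj W n|"
 shows "h : cycles W n \<longleftrightarrow> (\<forall>x\<in>boundaries A (- n). h (- n) x = 0\<^sub>E)"
proof -
 note e = modD[OF injective_module] and dA = is_cpxD[OF A]
 note sg = sg_simps[OF e(13)]
 have "dif (mod_cpx E) (i + n) (h i x) = sg R n .\<^sub>(obj (mod_cpx E) (i + n - 1)) h (i - 1) (dif A i x) \<longleftrightarrow>
  (i = 1 - n \<longrightarrow> h (- n) (dif A (1 - n) x) = 0\<^sub>E)" if x: "x : |obj A i|" for i x
 proof (cases "i = 1 - n")
  case True
  have d: "dif A i x : |obj A (i - 1)|" using mod_homD(1)[OF dA(2) x] .
  have "h (- n) (dif A i x) : |E|" using mod_homD(1)[OF hom_into_mod_val[OF h]] d True by simp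
  then have "(0\<^sub>E = sg R n .\<^sub>E h (- n) (dif A i x)) \<longleftrightarrow> h (- n) (dif A i x) = 0\<^sub>E"
   using e(16)[OF sg(1), of n] e(11)[OF sg(1) sg(1), of "h (- n) (dif A i x)" n n] e(12) sg(2)[of n] by fastforce
  then show ?thesis using True by simp
 next
  case False
  then have "i + n - 1 \<noteq> 0" "i + n \<noteq> 1" by auto
  then show ?thesis using False by simp
 qed
 then have "h : cycles W n \<longleftrightarrow> (\<forall>x\<in>|obj A (1 - n)|. h (- n) (dif A (1 - n) x) = 0\<^sub>E)"
  unfolding hom_cpx_cycle_iff[OF A is_cpx_mod_cpx[OF injective_module] h] by auto
 then show ?thesis by (simp add: boundaries_def)
qed

text \<open>Here injectivity enters: a homomorphism that vanishes on the cycles factors through the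
 differential, and the factor extends to all of the next module.\<close>

lemma hom_injective_boundaries:
 assumes h: "h : |obj W n|"
 shows "h : boundaries W n \<longleftrightarrow> (\<forall>x\<in>cycles A (- n). h (- n) x = 0\<^sub>E)"
proof -
 note e = modD[OF injective_module] and dA = is_cpxD[OF A]
 interpret R: cring R by (rule e)
 note sg = sg_simps[OF R.is_cring]
 let ?d = "dif A (- n)" and ?D = "dif W (n + 1)"
 have i: "- n - 1 = - (n + 1)" "- n + (n + 1) = 1" "-\<^sub>R sg R (n + 1) = sg R n" using sg by auto
 have dv: "?D g (- n) x = sg R n .\<^sub>E g (- (n + 1)) (?d x)"
  "g (- (n + 1)) (?d x) : |E|"
  if g: "g : |obj W (n + 1)|" and x: "x : |obj A (- n)|" for g x
 proof -
  have dx: "?d x : |obj A (- (n + 1))|" using mod_homD(1)[OF dA(2) x] by simp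
  show c: "g (- (n + 1)) (?d x) : |E|" using mod_homD(1)[OF hom_into_mod_val[OF g] dx] .
  show "?D g (- n) x = sg R n .\<^sub>E g (- (n + 1)) (?d x)"
   using hom_cpx_dif[OF A is_cpx_mod_cpx[OF injective_module] g x] c e(5,8) sg(1) unfolding i by simp
 qed
 have Dc: "?D g : |obj W n|" if "g : |obj W (n + 1)|" for g
  using mod_homD(1)[OF is_cpxD(4)[OF is_cpx_hom_injective] that] .
 show ?thesis
 proof
  assume "h : boundaries W n"
  then obtain g where g: "g : |obj W (n + 1)|" "h = ?D g" by (auto simp: boundaries_def)
  have "mod_hom R (obj A (- (n + 1))) E (g (- (n + 1)))" by (rule hom_into_mod_val[OF g(1)])
  then have "g (- (n + 1)) 0\<^sub>(obj A (- n - 1)) = 0\<^sub>E"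
   using mod_hom_zero[OF dA(1) injective_module, of "- (n + 1)"] by simp
  then show "\<forall>x\<in>cycles A (- n). h (- n) x = 0\<^sub>E"
   using dv[OF g(1)] g(2) e(16) sg(1) by (auto simp: cycles_def)
 next
  assume v: "\<forall>x\<in>cycles A (- n). h (- n) x = 0\<^sub>E"
  have d: "mod_hom R (obj A (- n)) (obj A (- (n + 1))) ?d" using dA(2)[of "- n"] by simp
  obtain f where f: "mod_hom R (obj A (- (n + 1))) E f" "!!x. x : |obj A (- n)| ==> f (?d x) = h (- n) x"
   by (rule injective_factor[OF E dA(1,1) d hom_into_mod_val[OF h]]) (use v in "auto simp: cycles_def")
  obtain g where g: "g : |obj W (n + 1)|"
   "!!x. x : |obj A (- (n + 1))| ==> g (- (n + 1)) x = sg R n .\<^sub>E f x"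
   by (rule hom_into_mod_one[OF mod_hom_smult_fun[OF injective_module f(1) sg(1)]]) blast
  have "h = ?D g"
  proof (rule hom_cpx_eqI[OF h Dc[OF g(1)]])
   fix i x assume x: "x : |obj A i|"
   show "h i x = ?D g i x"
   proof (cases "i = - n")
    case True
    then have "h i x : |E|" using mod_homD(1)[OF hom_into_mod_val[OF h]] x by simp
    then show ?thesis
     using True x dv(1)[OF g(1)] g(2)[OF mod_homD(1)[OF d]] f(2)
       e(11)[OF sg(1) sg(1), symmetric, of "h i x"] e(12)[of "h i x"] sg(2) by simp
   next
    case False
    then show ?thesis using h Dc[OF g(1)] by (auto simp: hom_into_mod)
   qed
  qed
  then show "h : boundaries W n" using g(1) by (auto simp: boundaries_def)
 qed
qed

lemma exact_at_hom_injective: "exact_at A n ==> exact_at W (- n)"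
 unfolding exact_at_def
proof
 fix h assume e: "cycles A n \<subseteq> boundaries A n" and h: "h : cycles W (- n)"
 then have c: "h : |obj W (- n)|" by (simp add: cycles_def)
 show "h : boundaries W (- n)"
  using e h unfolding hom_injective_cycles[OF c] hom_injective_boundaries[OF c] by auto
qed

end


lemma torsion_at_imp_exact_loc:
 fixes R :: "'a ring" and X :: "('a, 'm) cpx"
 assumes R: "cring R" and p: "primeideal p R" and X: "is_cpx R X" and t: "torsion_at R p X n"
 shows "exact_at (loc_cpx R p X) n"
 unfolding exact_at_def
proof
 note loc = loc_cases[OF R p] loc_cycles_boundaries[OF R p X] is_cpxD[OF X]
 interpret R: cring R by (rule R)
 note S_mult = S_mult[OF R p]
 fix z assume z: "z : cycles (loc_cpx R p X) n"
 then have "z : |loc_mod R p (obj X n)|" by (simp add: cycles_def loc_cpx_obj)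
 then obtain x s where x: "x : |obj X n|" "s : |R| - p" "z = frac R p (obj X n) x s"
  by (rule loc_cases[OF R p])
 then obtain u where u: "u : |R| - p" "u .\<^sub>(obj X n) x : cycles X n"
  using z loc_cycles_boundaries(1)[OF R p X x(1,2)] by auto
 with t obtain v where v: "v : |R| - p" "v .\<^sub>(obj X n) (u .\<^sub>(obj X n) x) : boundaries X n"
  unfolding torsion_at_def by blast
 have vu: "v \<otimes>\<^sub>R u : |R| - p" by (rule S_mult[OF v(1) u(1)])
 note m = modD[OF is_cpxD(1)[OF X]]
 have b: "(v \<otimes>\<^sub>R u) .\<^sub>(obj X n) x : boundaries X n" using v u x m(11) by auto
 have c: "(v \<otimes>\<^sub>R u) .\<^sub>(obj X n) x : |obj X n|" using vu x(1) m(8) by auto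
 have "z = frac R p (obj X n) ((v \<otimes>\<^sub>R u) .\<^sub>(obj X n) x) ((v \<otimes>\<^sub>R u) \<otimes>\<^sub>R s)"
  unfolding x(3)
 proof (rule frac_eqI[OF R p is_cpxD(1)[OF X] x(1,2) c S_mult[OF vu x(2)]])
  show "((v \<otimes>\<^sub>R u) \<otimes>\<^sub>R s) .\<^sub>(obj X n) x = s .\<^sub>(obj X n) ((v \<otimes>\<^sub>R u) .\<^sub>(obj X n) x)"
   using m(11)[of s "v \<otimes>\<^sub>R u" x] x vu R.m_comm[of s "v \<otimes>\<^sub>R u"] by auto
 qed
 then show "z : boundaries (loc_cpx R p X) n"
  using loc_cycles_boundaries(2)[OF R p X c S_mult[OF vu x(2)] b] by simp
qed

text \<open>
 If the homology in degree \<open>j\<close> does not vanish at \<open>p\<close>, Nakayama's lemma provides a cycle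
 \<open>z\<^sub>0\<close> no multiple of which by an element outside \<open>p\<close> lies in "U = pZ + B". On the
 submodule of the localization generated by \<open>U\<close> and \<open>z\<^sub>0\<close>, sending \<open>U\<close> to \<open>0\<close> and
 \<open>z\<^sub>0\<close> to a generator \<open>v\<close> of the residue field is well defined.
\<close>

lemma detecting_hom:
 fixes R :: "'a ring" and X :: "('a, 'm) cpx" and E :: "(('a \<times> 'a) set, 'e) module"
 assumes R: "cring R" and p: "primeideal p R" and X: "is_cpx R X" and fg: "fg_at R X j"
  and nt: "\<not> torsion_at R p X j" and E: "injective_mod (loc_ring R p) E"
  and v: "v : |E|" "v \<noteq> 0\<^sub>E" "!!b s. b : p ==> s : |R| - p ==> frac R p (ring_mod R) b s .\<^sub>E v = 0\<^sub>E"
 obtains f z where "mod_hom (loc_ring R p) (loc_mod R p (obj X j)) E f"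
  "z : cycles (loc_cpx R p X) j" "f z \<noteq> 0\<^sub>E"
  "\<forall>y\<in>boundaries (loc_cpx R p X) j. f y = 0\<^sub>E"
  "\<forall>b\<in>p. \<forall>z\<in>cycles (loc_cpx R p X) j. loc_map R p b .\<^sub>E f z = 0\<^sub>E"
proof -
 let ?M = "obj X j" and ?Z = "cycles X j" and ?B = "boundaries X j" and ?S = "|R| - p" and ?L = "loc_ring R p"
 let ?F = "frac R p ?M" and ?r = "frac R p (ring_mod R)" and ?A = "loc_mod R p ?M"
 note M = is_cpxD(1)[OF X, of j] and cb = cycles_boundaries[OF X, of j]
 interpret R: cring R by (rule R)
 interpret M: module R ?M by (rule M)
 have mE: "module ?L E" using E by (simp add: injective_mod_def)
 interpret E: module ?L E by (rule mE)
 note pc = prime_compl[OF p] and rM = module_ring_mod[OF R]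
 note S_mult = S_mult[OF R p] and S1 = pc(1)
 note memI = loc_memI[OF R p] and add = loc_add[OF R p M] and sm = loc_smult[OF R p M]
 obtain z0 where z0: "z0 : ?Z" "!!t y k. t : ?S ==> y : lincomb ?M p ?Z ==> k : ?B ==>
   t .\<^sub>?M z0 \<noteq> y +\<^sub>?M k"
  using nakayama_homology[OF X p fg] nt by blast
 have z0M: "z0 : |?M|" using z0(1) cb(4) by auto
 define U where "U = {y +\<^sub>?M k |y k. y : lincomb ?M p ?Z \<and> k : ?B}"
 have lc: "submodule (lincomb ?M p ?Z) R ?M" by (rule M.lincomb_submodule[OF pc(6) cb(4)])
 have U: "submodule U R ?M" unfolding U_def by (rule submodule_add[OF M lc cb(2)])
 note u = submoduleD[OF M U] and l = submoduleD[OF M lc] and bb = submoduleD[OF M cb(2)]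
 have lU: "y : lincomb ?M p ?Z ==> y : U" and bU: "k : ?B ==> k : U" for y k
  using bb(1,2) l(1,2) by (force simp: U_def)+
 have z0U: "t .\<^sub>?M z0 \<notin> U" if "t : ?S" for t using z0(2)[OF that] by (auto simp: U_def)
 define G where "G = {(?F (y +\<^sub>?M r .\<^sub>?M z0) s, ?r r s .\<^sub>E v) |y r s. y : U \<and> r : |R| \<and> s : ?S}"
 have GI: "(?F (y +\<^sub>?M r .\<^sub>?M z0) s, ?r r s .\<^sub>E v) : G" if "y : U" "r : |R|" "s : ?S" for y r s
  using that unfolding G_def by blast
 have Gc: thesis if "(a, b) : G" "!!y r s. y : U ==> r : |R| ==> s : ?S ==>
   a = ?F (y +\<^sub>?M r .\<^sub>?M z0) s ==> b = ?r r s .\<^sub>E v ==> thesis" for a b thesis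
  using that unfolding G_def by blast
 have rc: "?r r s : |?L|" if "r : |R|" "s : ?S" for r s
  unfolding loc_ring_simps[OF R p] using that by (intro memI) simp_all
 have yrz: "y +\<^sub>?M r .\<^sub>?M z0 : |?M|" if "y : U" "r : |R|" for y r
  using that u(1) z0M by auto
 have G: "partial_hom ?L ?A E G" unfolding partial_hom_def
 proof (intro conjI allI impI)
  show "G \<subseteq> |?A| \<times> |E|"
   by (clarify, erule Gc) (auto intro!: memI E.smult_closed intro: yrz rc v(1))
  have "?r 0\<^sub>R 1\<^sub>R = 0\<^sub>?L" unfolding loc_ring_simps[OF R p] by (simp add: loc_zero[OF R p])
  then show "(0\<^sub>?A, 0\<^sub>E) : G"
   using GI[OF u(2) R.zero_closed S1] z0M v(1) by (simp add: loc_zero[OF R p])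
  show "(a +\<^sub>?A a', b +\<^sub>E b') : G" if ab: "(a, b) : G" "(a', b') : G" for a b a' b'
  proof -
   from ab(1) obtain y r s where 1: "y : U" "r : |R|" "s : ?S"
    "a = ?F (y +\<^sub>?M r .\<^sub>?M z0) s" "b = ?r r s .\<^sub>E v" by (rule Gc)
   from ab(2) obtain y' r' s' where 2: "y' : U" "r' : |R|" "s' : ?S"
    "a' = ?F (y' +\<^sub>?M r' .\<^sub>?M z0) s'" "b' = ?r r' s' .\<^sub>E v" by (rule Gc)
   have sR: "s : |R|" "s' : |R|" using 1(3) 2(3) by auto
   have yM: "y : |?M|" "y' : |?M|" using 1(1) 2(1) u(1) by auto
   have "a +\<^sub>?A a' = ?F ((s' .\<^sub>?M y +\<^sub>?M s .\<^sub>?M y') +\<^sub>?M (s' \<otimes>\<^sub>R r +\<^sub>R s \<otimes>\<^sub>R r') .\<^sub>?M z0) (s \<otimes>\<^sub>R s')"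
    unfolding 1(4) 2(4) add[OF yrz[OF 1(1,2)] 1(3) yrz[OF 2(1,2)] 2(3)]
    using sR yM z0M 1(2) 2(2)
    by (simp add: M.smult_r_distr M.smult_l_distr M.smult_assoc1 M.M.a_ac)
   moreover have "b +\<^sub>E b' = ?r (s' \<otimes>\<^sub>R r +\<^sub>R s \<otimes>\<^sub>R r') (s \<otimes>\<^sub>R s') .\<^sub>E v"
    using E.smult_l_distr[OF rc[OF 1(2,3)] rc[OF 2(2,3)] v(1)] loc_add[OF R p rM, of r s r' s'] 1 2
    by (simp add: loc_ring_simps[OF R p])
   ultimately show ?thesis
    using GI[OF u(3)[OF u(4)[OF sR(2) 1(1)] u(4)[OF sR(1) 2(1)]] _ S_mult[OF 1(3) 2(3)]] sR 1(2) 2(2) by simp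
  qed
  show "(C .\<^sub>?A a, C .\<^sub>E b) : G" if C: "C : |?L|" and ab: "(a, b) : G" for C a b
  proof -
   from ab obtain y r s where 1: "y : U" "r : |R|" "s : ?S"
    "a = ?F (y +\<^sub>?M r .\<^sub>?M z0) s" "b = ?r r s .\<^sub>E v" by (rule Gc)
   from C obtain c t where c: "c : |R|" "t : ?S" "C = ?r c t"
    unfolding loc_ring_simps[OF R p] by (elim loc_cases[OF R p]) simp
   have yM: "y : |?M|" using 1(1) u(1) by auto
   have "C .\<^sub>?A a = ?F (c .\<^sub>?M y +\<^sub>?M (c \<otimes>\<^sub>R r) .\<^sub>?M z0) (t \<otimes>\<^sub>R s)"
    unfolding 1(4) c(3) sm[OF c(1,2) yrz[OF 1(1,2)] 1(3)]
    using c(1) 1(2) yM z0M by (simp add: M.smult_r_distr M.smult_assoc1)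
   moreover have "C .\<^sub>E b = ?r (c \<otimes>\<^sub>R r) (t \<otimes>\<^sub>R s) .\<^sub>E v"
    unfolding 1(5) using E.smult_assoc1[OF C rc[OF 1(2,3)] v(1)] loc_smult[OF R p rM c(1,2), of r s] 1 c(3)
    by (simp add: loc_ring_simps[OF R p])
   ultimately show ?thesis
    using GI[OF u(4)[OF c(1) 1(1)] R.m_closed[OF c(1) 1(2)] S_mult[OF c(2) 1(3)]] by simp
  qed
  show "b = 0\<^sub>E" if "(0\<^sub>?A, b) : G" for b
  proof -
   from that obtain y r s where 1: "y : U" "r : |R|" "s : ?S"
    "0\<^sub>?A = ?F (y +\<^sub>?M r .\<^sub>?M z0) s" "b = ?r r s .\<^sub>E v" by (rule Gc)
   then obtain w where w: "w : ?S" "w .\<^sub>?M (y +\<^sub>?M r .\<^sub>?M z0) = 0\<^sub>?M"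
    using frac_zero[OF R p M yrz[OF 1(1,2)] 1(3)] by auto
   have yM: "y : |?M|" using 1(1) u(1) by auto
   have wR: "w : |R|" using w(1) by simp
   have "(w \<otimes>\<^sub>R r) .\<^sub>?M z0 +\<^sub>?M w .\<^sub>?M y = 0\<^sub>?M"
    using w(2) wR 1(2) yM z0M by (simp add: M.smult_r_distr M.smult_assoc1 M.M.a_ac)
   then have "-\<^sub>?M (w .\<^sub>?M y) = (w \<otimes>\<^sub>R r) .\<^sub>?M z0"
    using wR 1(2) yM z0M by (intro M.M.minus_equality) simp_all
   then have "(w \<otimes>\<^sub>R r) .\<^sub>?M z0 : U" using u(5)[OF u(4)[OF wR 1(1)]] by simp
   then have "w \<otimes>\<^sub>R r : p" using z0U[of "w \<otimes>\<^sub>R r"] wR 1(2) by auto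
   then have "r : p" using primeideal.I_prime[OF p, of w r] w(1) 1(2) by auto
   then show ?thesis using 1(5) v(3)[OF _ 1(3)] by simp
  qed
 qed
 have mA: "module ?L ?A" by (rule module_loc_mod[OF R p M])
 obtain f where f: "mod_hom ?L ?A E f" "!!a b. (a, b) : G ==> f a = b"
  by (rule injective_extend_submodule[OF E mA G]) blast
 have r0: "?r 0\<^sub>R s .\<^sub>E v = 0\<^sub>E" if "s : ?S" for s
  using v(3)[OF _ that] additive_subgroup.zero_closed[OF ideal.axioms(1)[OF pc(6)]] by simp
 have fU: "f (?F y s) = 0\<^sub>E" if "y : U" "s : ?S" for y s
 proof -
  have "y +\<^sub>?M 0\<^sub>R .\<^sub>?M z0 = y" using u(1) that(1) z0M by auto
  then show ?thesis using f(2)[OF GI[OF that(1) R.zero_closed that(2)]] r0[OF that(2)] by simp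
 qed
 show ?thesis
 proof (rule that[OF f(1)]; (intro ballI)?)
  have "u .\<^sub>?M z0 : ?Z" if "u : |R|" for u using submoduleD(4)[OF M cb(1) that z0(1)] .
  then show "?F z0 1\<^sub>R : cycles (loc_cpx R p X) j"
   unfolding loc_cycles_boundaries(1)[OF R p X z0M S1] using S1 by blast
  have "f (?F z0 1\<^sub>R) = ?r 1\<^sub>R 1\<^sub>R .\<^sub>E v"
   using f(2)[OF GI[OF u(2) R.one_closed S1]] z0M by simp
  then have "f (?F z0 1\<^sub>R) = v" using E.smult_one[OF v(1)] by (simp add: loc_ring_simps[OF R p])
  then show "f (?F z0 1\<^sub>R) \<noteq> 0\<^sub>E" using v(2) by simp
 next
  fix y assume "y : boundaries (loc_cpx R p X) j"
  then obtain a where a: "a : |loc_mod R p (obj X (j + 1))|" "y = dif (loc_cpx R p X) (j + 1) a"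
   by (auto simp: boundaries_def loc_cpx_obj)
  from a(1) obtain x s where x: "x : |obj X (j + 1)|" "s : ?S" "a = frac R p (obj X (j + 1)) x s"
   by (rule loc_cases[OF R p])
  have "dif X (j + 1) x : ?B" using x(1) by (simp add: boundaries_def)
  then show "f y = 0\<^sub>E"
   using fU[OF bU x(2)] loc_dif[OF R p X x(1,2)] a(2) x(3) by simp
 next
  fix b z assume b: "b : p" and z: "z : cycles (loc_cpx R p X) j"
  then have "z : |?A|" by (simp add: cycles_def loc_cpx_obj)
  then obtain x s where x: "x : |?M|" "s : ?S" "z = ?F x s" by (rule loc_cases[OF R p])
  then obtain w where w: "w : ?S" "w .\<^sub>?M x : ?Z" using z loc_cycles_boundaries(1)[OF R p X x(1,2)] by auto
  have wR: "w : |R|" and bR: "b : |R|" and sR: "s : |R|" using w(1) b pc(5) x(2) by auto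
  have bw: "b .\<^sub>?M (w .\<^sub>?M x) : U" by (rule lU[OF M.lincomb_single[OF pc(5) cb(4) b w(2)]])
  have "z = ?F (w .\<^sub>?M x) (w \<otimes>\<^sub>R s)" unfolding x(3)
   by (rule frac_eqI[OF R p M x(1,2) _ S_mult[OF w(1) x(2)]])
     (use wR sR x(1) in "simp_all add: M.smult_assoc1[symmetric] R.m_comm")
  then have "loc_map R p b .\<^sub>?A z = ?F (b .\<^sub>?M (w .\<^sub>?M x)) (w \<otimes>\<^sub>R s)"
   using sm[OF bR S1, of "w .\<^sub>?M x" "w \<otimes>\<^sub>R s"] wR sR x(1) S_mult[OF w(1) x(2)] by (simp add: loc_map_def)
  then show "loc_map R p b .\<^sub>E f z = 0\<^sub>E"
   using fU[OF bw S_mult[OF w(1) x(2)]] mod_homD(3)[OF f(1) loc_map_hom(1)[OF R p bR], of z] \<open>z \<in> carrier ?A\<close>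
   by simp
 qed
qed

lemma residue_ring_module:
 fixes R :: "'a ring"
 assumes R: "cring R" and p: "ideal p R"
 shows "module_mod R (ring_mod R) p"
proof -
 interpret ideal p R by (rule p)
 have "submodule p R (ring_mod R)"
  by (rule submodI[OF module_ring_mod[OF R]]) (use I_l_closed Icarr in auto)
 then show ?thesis by (rule module_modI[OF module_ring_mod[OF R]])
qed

lemma is_cpx_restrict_cpx:
 fixes R :: "'a ring" and W :: "(('a \<times> 'a) set, 'm) cpx"
 assumes R: "cring R" and p: "primeideal p R" and W: "is_cpx (loc_ring R p) W"
 shows "is_cpx R (restrict_cpx (loc_map R p) W)"
 using is_cpxD(2,3)[OF W] module_restrict_scalars[OF R p is_cpxD(1)[OF W]] loc_map_hom(1)[OF R p]
 by (auto simp: is_cpx_def mod_hom_def)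

text \<open>
 In the lowest degree where the homology of \<open>X\<close> does not vanish at \<open>p\<close>, the map of
 \<open>detecting_hom\<close> is a cycle annihilated by \<open>p\<close> up to boundaries; together with the augmentation of
 the resolution it defines a nontrivial class.
\<close>

lemma hom_resolution_acyclic_iff:
 fixes R :: "'a ring" and X :: "('a, 'm) cpx" and E :: "(('a \<times> 'a) set, 'e) module" and F :: "('a, 'k) cpx"
 assumes R: "cring R" and p: "primeideal p R" and X: "is_cpx R X" and fg: "!!j. fg_at R X j"
  and low: "!!j. j < b0 ==> exact_at X j" and E: "injective_envelope (loc_ring R p) (residue_loc R p) E"
  and F: "free_resolution R (quot_mod (ring_mod R) p) F"
 defines "Y \<equiv> restrict_cpx (loc_map R p) (hom_cpx (loc_ring R p) (loc_cpx R p X) (mod_cpx E))"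
 shows "acyclic (hom_cpx R F Y) \<longleftrightarrow> (\<forall>j. torsion_at R p X j)"
proof -
 let ?L = "loc_ring R p" and ?A = "loc_cpx R p X"
 let ?W = "hom_cpx ?L ?A (mod_cpx E)"
 have inj: "injective_mod ?L E" using E by (simp add: injective_envelope_def)
 then have mE: "module ?L E" by (simp add: injective_mod_def)
 note A = is_cpx_loc_cpx[OF R p X]
 note W = is_cpx_hom_injective[OF A inj]
 have Y: "is_cpx R Y" unfolding Y_def by (rule is_cpx_restrict_cpx[OF R p W])
 have Ys: "cycles Y n = cycles ?W n" "boundaries Y n = boundaries ?W n" "obj Y n = restrict_scalars (loc_map R p) (obj ?W n)" for n
  by (simp_all add: Y_def)
 have exact: "exact_at Y (- j)" if "torsion_at R p X j" for j
  using exact_at_hom_injective[OF A inj torsion_at_imp_exact_loc[OF R p X that]] by (simp add: exact_at_def Ys)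
 interpret k: module_mod R "ring_mod R" p by (rule residue_ring_module[OF R prime_compl(6)[OF p]])
 note F' = free_resolutionD[OF F k.Q_module]
 show ?thesis
 proof
  assume t: "\<forall>j. torsion_at R p X j"
  have "exact_at Y n" for n using exact[of "- n"] t by simp
  then show "acyclic (hom_cpx R F Y)" by (intro hom_cpx_acyclic[OF F'(1) Y]) (simp add: acyclic_def)
 next
  assume ac: "acyclic (hom_cpx R F Y)"
  have "torsion_at R p X b" if below: "!!j. j < b ==> torsion_at R p X j" for b
  proof (rule ccontr)
   assume nt: "\<not> torsion_at R p X b"
   obtain io where io: "mod_hom ?L (residue_loc R p) E io" "inj_on io |residue_loc R p|"
    using E by (auto simp: injective_envelope_def)
   interpret L: cring ?L by (rule cring_loc_ring[OF R p])
   note kL = module_residue_loc[OF R p] and rf = residue_loc_facts[OF R p]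
   define P where "P = genideal ?L (loc_map R p ` p)"
   let ?e = "P +>\<^sub>(ring_mod ?L) 1\<^sub>?L"
   have e: "?e : |residue_loc R p|" unfolding P_def rf(1) by (rule imageI) simp
   have fr: "frac R p (ring_mod R) a s : |?L|" if "a : |R|" "s : |R| - p" for a s
    unfolding loc_ring_simps[OF R p] using that by (intro loc_memI[OF R p]) simp_all
   have f0: "?e \<noteq> 0\<^sub>(residue_loc R p)"
    using rf(3)[OF L.one_closed] frac_in_residue_ideal[OF R p, of "1\<^sub>R" "1\<^sub>R"] prime_compl(1)[OF p]
    by (simp add: P_def loc_ring_simps(3)[OF R p])
   have ann: "frac R p (ring_mod R) a s .\<^sub>E io ?e = 0\<^sub>E" if "a : p" "s : |R| - p" for a s
   proof -
    have aR: "a : |R|" using that(1) prime_compl(5)[OF p] by auto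
    have "frac R p (ring_mod R) a s .\<^sub>(residue_loc R p) ?e = 0\<^sub>(residue_loc R p)"
     using rf(2)[OF fr[OF aR that(2)] L.one_closed] rf(3)[OF fr[OF aR that(2)]]
      frac_in_residue_ideal[OF R p aR that(2)] that(1) fr[OF aR that(2)] by (simp add: P_def)
    then show ?thesis
     using mod_homD(3)[OF io(1) fr[OF aR that(2)] e] mod_hom_zero[OF kL mE io(1)] by simp
   qed
   have v0: "io ?e \<noteq> 0\<^sub>E"
    using f0 inj_onD[OF io(2), of ?e "0\<^sub>(residue_loc R p)"] e modD(2)[OF kL] mod_hom_zero[OF kL mE io(1)] by auto
   obtain f z where f: "mod_hom ?L (loc_mod R p (obj X b)) E f" "z : cycles ?A b" "f z \<noteq> 0\<^sub>E"
    "\<forall>y\<in>boundaries ?A b. f y = 0\<^sub>E"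
    "\<forall>a\<in>p. \<forall>z\<in>cycles ?A b. loc_map R p a .\<^sub>E f z = 0\<^sub>E"
    by (rule detecting_hom[OF R p X fg nt inj mod_homD(1)[OF io(1) e] v0 ann], assumption, assumption) (rule that; assumption)
   have f': "mod_hom ?L (obj ?A (- (- b))) E f" using f(1) by simp
   obtain ph where ph: "ph : |obj ?W (- b)|" "!!x. x : |obj ?A (- (- b))| ==> ph (- (- b)) x = f x"
    by (rule hom_into_mod_one[OF A inj f']) blast
   have phv: "ph b x = f x" if "x : cycles ?A b" for x
    using ph(2)[of x] that by (simp add: cycles_def)
   have bc: "boundaries ?A b \<subseteq> cycles ?A b" by (rule cycles_boundaries(3)[OF A])
   have phc: "ph : cycles Y (- b)" "ph \<notin> boundaries Y (- b)"
    unfolding Ys hom_injective_cycles[OF A inj ph(1)] hom_injective_boundaries[OF A inj ph(1)]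
    using phv f(2-4) bc by auto
   have ex: "exact_at Y (- b + int i + 1)" for i
    using exact[OF below[of "b - int i - 1"]] by (simp add: algebra_simps)
   have pph: "a .\<^sub>(obj Y (- b)) ph : boundaries Y (- b)" if a: "a : p" for a
   proof -
    have aL: "loc_map R p a : |?L|" using loc_map_hom(1)[OF R p] a prime_compl(5)[OF p] by auto
    have c: "loc_map R p a .\<^sub>(obj ?W (- b)) ph : |obj ?W (- b)|"
     by (rule modD(8)[OF is_cpxD(1)[OF W] aL ph(1)])
    have "(loc_map R p a .\<^sub>(obj ?W (- b)) ph) (- (- b)) x = 0\<^sub>E" if "x : cycles ?A (- (- b))" for x
     using that f(5)[rule_format, OF a, of x] phv[of x] by (simp add: hom_cpx_ops cycles_def)
    then show ?thesis unfolding Ys restrict_scalars_simps hom_injective_boundaries[OF A inj c] by (intro ballI)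
   qed
   obtain ep where ep0: "mod_hom R (obj F 0) k.Q ep \<and> ep ` |obj F 0| = |k.Q| \<and>
     (\<forall>x\<in>|obj F 0|. ep x = 0\<^sub>(k.Q) \<longleftrightarrow> x : boundaries F 0)" using F'(3) by (rule exE)
   note ep = ep0[THEN conjunct1] ep0[THEN conjunct2, THEN conjunct1] ep0[THEN conjunct2, THEN conjunct2, rule_format]
   have dF: "is_cpx R F" "free_mod R (obj F 0)" using F'(1) by (auto simp: bounded_free_def)
   have pr: "mod_hom R (ring_mod R) k.Q k.cls"
    by (rule mod_homI) (simp_all only: k.Q_add k.Q_smult k.Q_carrier imageI)
   have sub: "ep ` |obj F 0| \<subseteq> k.cls ` |ring_mod R|" unfolding ep(2) k.Q_carrier ..
   obtain tt where tt: "mod_hom R (obj F 0) (ring_mod R) tt" "!!x. x : |obj F 0| ==> k.cls (tt x) = ep x"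
    using free_mod_lift[OF is_cpxD(1)[OF dF(1)] dF(2) module_ring_mod[OF R] k.Q_module ep(1) pr sub] by blast
   note ttc = mod_homD(1)[OF tt(1)]
   have ttp: "tt (dif F 1 x) : p" if x: "x : |obj F 1|" for x
   proof -
    have d: "dif F 1 x : |obj F 0|" using mod_homD(1)[OF is_cpxD(4)[OF dF(1), of 0]] x by simp
    moreover have "dif F 1 x : boundaries F 0" unfolding boundaries_def using x by simp
    ultimately have "k.cls (tt (dif F 1 x)) = 0\<^sub>(k.Q)" using tt(2) ep(3) by simp
    then show ?thesis unfolding k.cls_zero_iff[OF ttc[OF d]] .
   qed
   interpret R: cring R by (rule R)
   note n = modD[OF module_ring_mod[OF R]]
   have "k.cls 1\<^sub>R : |k.Q|" unfolding k.Q_carrier by (rule imageI) simp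
   then have "k.cls 1\<^sub>R : ep ` |obj F 0|" unfolding ep(2) .
   then obtain e where e: "e : |obj F 0|" "k.cls 1\<^sub>R = ep e" by (rule imageE)
   have tte: "tt e : |R|" using ttc[OF e(1)] by simp
   have "k.cls (tt e) = k.cls 1\<^sub>R" using tt(2)[OF e(1)] e(2) by simp
   then have m: "tt e -\<^sub>(ring_mod R) 1\<^sub>R : p" using k.cls_eq_iff[of "tt e" "1\<^sub>R"] tte by simp
   have "1\<^sub>R +\<^sub>(ring_mod R) (tt e -\<^sub>(ring_mod R) 1\<^sub>R) = tt e"
    using n(3)[of "tt e" "-\<^sub>(ring_mod R) 1\<^sub>R" "1\<^sub>R"] n(4)[of "1\<^sub>R" "tt e +\<^sub>(ring_mod R) -\<^sub>(ring_mod R) 1\<^sub>R"]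
     n(7)[of "1\<^sub>R"] n(14)[of "tt e"] n(1)[of "tt e"] n(6)[of "1\<^sub>R"] tte by (simp add: a_minus_def)
   then have "tt e = 1\<^sub>R +\<^sub>R (tt e -\<^sub>(ring_mod R) 1\<^sub>R)" by simp
   with hom_cpx_not_acyclic[OF F'(1) Y prime_compl(6)[OF p] tt(1) ttp e(1) m _ phc pph ex] ac
   show False by blast
  qed
  then show "\<forall>j. torsion_at R p X j" using torsion_induct_from_below[OF X p low] by blast
 qed
qed

section \<open>The injective cogenerator\<close>

lemma maximal_inverse:
 assumes R: "cring R" and m: "maximalideal m R" and r: "r : |R|" "r \<notin> m"
 obtains s c where "s : |R|" "c : m" "s \<otimes>\<^sub>R r = 1\<^sub>R +\<^sub>R c"
proof -
 interpret R: cring R by (rule R)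
 interpret m: maximalideal m R by (rule m)
 have I1: "ideal (PIdl\<^bsub>R\<^esub> r <+>\<^sub>R m) R"
  by (rule R.add_ideals[OF R.cgenideal_ideal[OF r(1)] m.ideal_axioms])
 have mem: "s \<otimes>\<^sub>R r +\<^sub>R a : PIdl\<^bsub>R\<^esub> r <+>\<^sub>R m" if "s : |R|" "a : m" for s a
  using that unfolding set_add_def' cgenideal_def by blast
 have I2: "m \<subseteq> PIdl\<^bsub>R\<^esub> r <+>\<^sub>R m"
 proof
  fix a assume "a : m"
  then show "a : PIdl\<^bsub>R\<^esub> r <+>\<^sub>R m" using mem[OF R.zero_closed, of a] r(1) m.Icarr by simp
 qed
 have I3: "r : PIdl\<^bsub>R\<^esub> r <+>\<^sub>R m" using mem[OF R.one_closed m.zero_closed] r(1) by simp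
 have "PIdl\<^bsub>R\<^esub> r <+>\<^sub>R m \<subseteq> |R|" using ideal.Icarr[OF I1] by (rule subsetI)
 from m.I_maximal[OF I1 I2 this] have "PIdl\<^bsub>R\<^esub> r <+>\<^sub>R m = |R|"
 proof
  assume "PIdl\<^bsub>R\<^esub> r <+>\<^sub>R m = m"
  then show ?thesis using I3 r(2) by simp
 qed
 then have one: "1\<^sub>R : PIdl\<^bsub>R\<^esub> r <+>\<^sub>R m" by simp
 obtain s a where s: "s : |R|" "a : m" "1\<^sub>R = s \<otimes>\<^sub>R r +\<^sub>R a"
  using one unfolding set_add_def' cgenideal_def by blast
 have a: "a : |R|" using s(2) by (rule m.Icarr)
 have "s \<otimes>\<^sub>R r = 1\<^sub>R +\<^sub>R -\<^sub>R a"
  unfolding s(3) using s(1) r(1) a by (simp add: R.a_assoc R.r_neg)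
 then show ?thesis using s(1,2) by (intro that[of s "-\<^sub>R a"]) simp_all
qed

lemma maximal_unit_scale:
 assumes M: "module R M" and m: "maximalideal m R" and r: "r : |R|" "r \<notin> m"
  and u: "u : |M|" "!!a. a : m ==> a .\<^sub>M u = 0\<^sub>M"
 obtains s where "s : |R|" "s .\<^sub>M (r .\<^sub>M u) = u"
proof -
 interpret M: module R M by fact
 obtain s c where s: "s : |R|" "c : m" "s \<otimes>\<^sub>R r = 1\<^sub>R +\<^sub>R c"
  by (rule maximal_inverse[OF M.R.is_cring m r])
 have c: "c : |R|" using s(2) ideal.Icarr[OF maximalideal.axioms(1)[OF m]] by blast
 have "s .\<^sub>M (r .\<^sub>M u) = (1\<^sub>R +\<^sub>R c) .\<^sub>M u"
  using M.smult_assoc1[OF s(1) r(1) u(1)] s(3) by simp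
 also have "\<dots> = u" using c u(2)[OF s(2)] u(1) by (simp add: M.smult_l_distr)
 finally show ?thesis using that s(1) by blast
qed

text \<open>
 An element \<open>u\<close> killed by a maximal ideal lies in the image of \<open>R/m\<close> as soon as a nonzero multiple of
 it does, and essentiality of the envelope provides such a multiple.
\<close>

lemma envelope_killed:
 fixes R :: "'a ring" and E :: "('a, 'e) module"
 assumes R: "cring R" and m: "maximalideal m R" and E: "injective_envelope R (quot_mod (ring_mod R) m) E"
 obtains w where "w : |E|" "!!a. a : m ==> a .\<^sub>E w = 0\<^sub>E"
  "!!n u. maximalideal n R ==> u : |E| ==> u \<noteq> 0\<^sub>E ==> (!!a. a : n ==> a .\<^sub>E u = 0\<^sub>E) ==>
    n = m \<and> (\<exists>r\<in>|R|. u = r .\<^sub>E w)"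
proof -
 interpret R: cring R by (rule R)
 interpret m: maximalideal m R by (rule m)
 interpret k: module_mod R "ring_mod R" m by (rule residue_ring_module[OF R m.ideal_axioms])
 have mE: "module R E" using E by (simp add: injective_envelope_def injective_mod_def)
 interpret E: module R E by (rule mE)
 from E obtain io where io: "mod_hom R k.Q E io" "inj_on io |k.Q|"
  and ess: "!!U. submodule U R E ==> U \<noteq> {0\<^sub>E} ==> U \<inter> io ` |k.Q| \<noteq> {0\<^sub>E}"
  unfolding injective_envelope_def by (elim conjE exE) simp
 note kQ = k.Q_module
 define w where "w = io (k.cls 1\<^sub>R)"
 have cQ: "k.cls x : |k.Q|" if "x : |R|" for x unfolding k.Q_carrier using that by simp
 have w: "w : |E|" unfolding w_def by (rule mod_homD(1)[OF io(1) cQ[OF R.one_closed]])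
 have iw: "io (k.cls x) = x .\<^sub>E w" if "x : |R|" for x
  using mod_homD(3)[OF io(1) that cQ[OF R.one_closed]] k.Q_smult[OF that, of "1\<^sub>R"] that by (simp add: w_def)
 have mw: "a .\<^sub>E w = 0\<^sub>E" if "a : m" for a
  using iw[of a] k.cls_zero_iff[of a] that m.Icarr[OF that] mod_hom_zero[OF kQ mE io(1)] by simp
 show ?thesis
 proof (rule that[OF w mw], assumption)
  fix n u assume n: "maximalideal n R" and u: "u : |E|" "u \<noteq> 0\<^sub>E" "!!a. a : n ==> a .\<^sub>E u = 0\<^sub>E"
  interpret n: maximalideal n R by (rule n)
  define U where "U = (%r. r .\<^sub>E u) ` |R|"
  have "mod_hom R (ring_mod R) E (%r. r .\<^sub>E u)"
   by (rule mod_homI) (use u(1) in "simp_all add: E.smult_l_distr E.smult_assoc1")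
  from submodule_image[OF module_ring_mod[OF R] mE this module.carrier_is_submodule[OF module_ring_mod[OF R]]]
  have U: "submodule U R E" by (simp add: U_def)
  have uU: "u : U" unfolding U_def by (rule image_eqI[of _ _ "1\<^sub>R"]) (use u(1) in simp_all)
  have "0\<^sub>E : U \<inter> io ` |k.Q|"
   using submoduleD(2)[OF mE U] mod_hom_zero[OF kQ mE io(1)] modD(2)[OF kQ] by (metis IntI imageI)
  moreover have "U \<inter> io ` |k.Q| \<noteq> {0\<^sub>E}" using ess[OF U] uU u(2) by blast
  ultimately obtain y where y: "y : U" "y : io ` |k.Q|" "y \<noteq> 0\<^sub>E" by blast
  from y(1) obtain r where r: "r : |R|" "y = r .\<^sub>E u" by (auto simp: U_def)
  from y(2) obtain q where q: "q : |k.Q|" "y = io q" by (rule imageE)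
  from q(1) obtain x where x: "x : |ring_mod R|" "q = k.cls x" by (rule k.Q_cases)
  have xR: "x : |R|" and yx: "y = x .\<^sub>E w" using x q(2) iw by simp_all
  have ny: "a .\<^sub>E y = 0\<^sub>E" if a: "a : n" for a
   unfolding r(2) using u(1,3) r(1) a n.Icarr[OF a]
   by (metis E.smult_assoc1 E.smult_r_null R.m_comm)
  have my: "a .\<^sub>E y = 0\<^sub>E" if a: "a : m" for a
   unfolding yx using w xR mw[OF a] m.Icarr[OF a]
   by (metis E.smult_assoc1 E.smult_r_null R.m_comm)
  have yE: "y : |E|" using r u(1) by simp
  have "n = m"
  proof (rule ccontr)
   assume "n \<noteq> m"
   then have "\<not> n \<subseteq> m" using n.I_maximal[OF m.ideal_axioms] m.a_subset m.I_notcarr by blast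
   then obtain a where a: "a : n" "a \<notin> m" by blast
   obtain s where "s : |R|" "s .\<^sub>E (a .\<^sub>E y) = y"
    by (rule maximal_unit_scale[OF mE m n.Icarr[OF a(1)] a(2) yE my])
   then show False using ny[OF a(1)] y(3) by simp
  qed
  have "r \<notin> n" using u(3) r(2) y(3) by blast
  then obtain s where s: "s : |R|" "s .\<^sub>E (r .\<^sub>E u) = u"
   using maximal_unit_scale[OF mE n r(1) _ u(1,3)] by blast
  then have "u = (s \<otimes>\<^sub>R x) .\<^sub>E w" using r(2) yx w xR by (simp add: E.smult_assoc1)
  then show "n = m \<and> (\<exists>r\<in>|R|. u = r .\<^sub>E w)" using \<open>n = m\<close> s(1) xR by blast
 qed
qed

text \<open>The socle condition on \<open>D\<close> below is all that the duality uses about the envelopes.\<close>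

definition simple_socles :: "'a ring => ('a, 'e) module => bool" where
 "simple_socles R D \<longleftrightarrow> (\<forall>m u v. maximalideal m R \<longrightarrow> u : |D| \<longrightarrow> v : |D| \<longrightarrow> v \<noteq> 0\<^sub>D \<longrightarrow>
   (\<forall>a\<in>m. a .\<^sub>D u = 0\<^sub>D) \<longrightarrow> (\<forall>a\<in>m. a .\<^sub>D v = 0\<^sub>D) \<longrightarrow> (\<exists>r\<in>|R|. u = r .\<^sub>D v))"

lemma sum_envelopes:
 fixes R :: "'a ring" and E :: "'a set => ('a, 'e) module"
 assumes R: "cring R" and fin: "finite (Max_Spec R)"
  and E: "!!m. m : Max_Spec R ==> injective_envelope R (quot_mod (ring_mod R) m) (E m)"
 shows "injective_mod R (sum_mod (Max_Spec R) E)" "simple_socles R (sum_mod (Max_Spec R) E)"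
proof -
 let ?I = "Max_Spec R" and ?D = "sum_mod (Max_Spec R) E"
 have inj: "injective_mod R (E m)" if "m : ?I" for m using E[OF that] by (simp add: injective_envelope_def)
 then have mE: "module R (E m)" if "m : ?I" for m using that by (simp add: injective_mod_def)
 have mD: "module R ?D" by (rule module_sum_mod[OF R mE])
 have "finite {i : ?I. f i \<noteq> 0\<^sub>(E i)}" for f using fin by simp
 then have Dc: "|?D| = (\<Pi>\<^sub>E i\<in>?I. |E i| )" by (simp add: sum_mod_def)
 have Dz: "0\<^sub>?D = (\<lambda>i\<in>?I. 0\<^sub>(E i))"
  and Da: "f +\<^sub>?D g = (\<lambda>i\<in>?I. f i +\<^sub>(E i) g i)"
  and Ds: "r .\<^sub>?D f = (\<lambda>i\<in>?I. r .\<^sub>(E i) f i)" for r f g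
  by (simp_all add: sum_mod_def prod_mod_def)
 show "injective_mod R ?D" unfolding injective_mod_def
 proof (intro conjI mD allI impI, elim conjE)
  fix A :: "('a, 'a) module" and B :: "('a, 'a) module" and j f
  assume *: "module R A" "module R B" "mod_hom R A B j" "inj_on j |A|" "mod_hom R A ?D f"
  have "\<exists>g. mod_hom R B (E m) g \<and> (\<forall>x\<in>|A|. g (j x) = f x m)" if m: "m : ?I" for m
  proof (rule injective_mod_extend[OF inj[OF m] *(1-4)])
   show "mod_hom R A (E m) (%x. f x m)"
    by (rule mod_homI) (use mod_homD[OF *(5)] m in "auto simp: Dc Da Ds")
  qed
  then obtain g where g: "!!m. m : ?I ==> mod_hom R B (E m) (g m)"
   "!!m x. m : ?I ==> x : |A| ==> g m (j x) = f x m" by metis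
  have "mod_hom R B ?D (%x. \<lambda>m\<in>?I. g m x)"
   by (rule mod_homI) (use mod_homD[OF g(1)] in "auto simp: Dc Da Ds cong: restrict_cong")
  moreover have "(\<lambda>m\<in>?I. g m (j x)) = f x" if "x : |A|" for x
   by (rule extensionalityI[of _ ?I]) (use mod_homD(1)[OF *(5) that] g(2)[OF _ that] in "auto simp: Dc PiE_def")
  ultimately show "\<exists>g. mod_hom R B ?D g \<and> (\<forall>x\<in>|A|. g (j x) = f x)" by blast
 qed
 show "simple_socles R ?D" unfolding simple_socles_def
 proof (intro allI impI)
  fix m u v assume m: "maximalideal m R" and u: "u : |?D|" "\<forall>a\<in>m. a .\<^sub>?D u = 0\<^sub>?D"
   and v: "v : |?D|" "\<forall>a\<in>m. a .\<^sub>?D v = 0\<^sub>?D" "v \<noteq> 0\<^sub>?D"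
  have mI: "m : ?I" using m by (simp add: Max_Spec_def)
  have comp: "x i : |E i|" "a : m ==> a .\<^sub>(E i) x i = 0\<^sub>(E i)"
   if "x : |?D|" "\<forall>a\<in>m. a .\<^sub>?D x = 0\<^sub>?D" "i : ?I" for x i a
  proof -
   show "x i : |E i|" using that(1,3) by (auto simp: Dc)
   assume "a : m"
   with that(2) have "(a .\<^sub>?D x) i = 0\<^sub>?D i" by simp
   then show "a .\<^sub>(E i) x i = 0\<^sub>(E i)" using that(3) by (simp add: Ds Dz)
  qed
  have off: "x i = 0\<^sub>(E i)" if x: "x : |?D|" "\<forall>a\<in>m. a .\<^sub>?D x = 0\<^sub>?D" and i: "i : ?I" "i \<noteq> m" for x i
  proof (rule ccontr)
   assume nz: "x i \<noteq> 0\<^sub>(E i)"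
   have iM: "maximalideal i R" using i(1) by (simp add: Max_Spec_def)
   show False
    by (rule envelope_killed[OF R iM E[OF i(1)]]) (use comp[OF x i(1)] nz i(2) m in blast)
  qed
  obtain w where w: "w : |E m|" "!!a. a : m ==> a .\<^sub>(E m) w = 0\<^sub>(E m)"
   "!!n u. maximalideal n R ==> u : |E m| ==> u \<noteq> 0\<^sub>(E m) ==> (!!a. a : n ==> a .\<^sub>(E m) u = 0\<^sub>(E m)) ==>
     n = m \<and> (\<exists>r\<in>|R|. u = r .\<^sub>(E m) w)" by (rule envelope_killed[OF R m E[OF mI]]) blast
  note um = comp[OF u mI] and vm = comp[OF v(1,2) mI]
  interpret Em: module R "E m" by (rule mE[OF mI])
  have vm0: "v m \<noteq> 0\<^sub>(E m)"
  proof
   assume "v m = 0\<^sub>(E m)"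
   then have "v i = 0\<^sub>(E i)" if "i : ?I" for i using off[OF v(1,2) that] by (cases "i = m") auto
   then have "v = 0\<^sub>?D" unfolding Dz using v(1)
    by (intro extensionalityI[of _ ?I]) (auto simp: Dc PiE_def)
   then show False using v(3) by simp
  qed
  obtain b where b: "b : |R|" "v m = b .\<^sub>(E m) w" using w(3)[OF m vm(1) vm0 vm(2)] by blast
  have "b \<notin> m" using w(2) b(2) vm0 by metis
  then obtain s where s: "s : |R|" "s .\<^sub>(E m) (b .\<^sub>(E m) w) = w"
   using maximal_unit_scale[OF mE[OF mI] m b(1) _ w(1,2)] by blast
  obtain a where a: "a : |R|" "u m = a .\<^sub>(E m) w"
  proof (cases "u m = 0\<^sub>(E m)")
   case True
   then show ?thesis using that[of "0\<^sub>R"] w(1) by simp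
  next
   case False
   then show ?thesis using w(3)[OF m um(1) _ um(2)] that by blast
  qed
  have "u = (a \<otimes>\<^sub>R s) .\<^sub>?D v"
  proof (rule extensionalityI[of _ ?I])
   fix i assume i: "i : ?I"
   show "u i = ((a \<otimes>\<^sub>R s) .\<^sub>?D v) i"
   proof (cases "i = m")
    case True
    then show ?thesis using a s b w(1) mI by (simp add: Ds Em.smult_assoc1)
   next
    case False
    then show ?thesis
     using off[OF u i] off[OF v(1,2) i] modD(16)[OF mE[OF i], of "a \<otimes>\<^sub>R s"] a(1) s(1) i by (simp add: Ds)
   qed
  qed (use u(1) in "auto simp: Dc Ds PiE_def")
  then show "\<exists>r\<in>|R|. u = r .\<^sub>?D v" using a(1) s(1) by blast
 qed
qed

section \<open>Duals of artinian modules over complete rings\<close>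

lemma ideal_transporter:
 assumes M: "module R M" and U: "submodule U R M" and x: "x : |M|"
 shows "ideal {a : |R|. a .\<^sub>M x : U} R" (is "ideal ?I R")
proof -
 interpret M: module R M by fact
 note u = submoduleD[OF M U]
 have smul: "s \<otimes>\<^sub>R a : ?I" if "a : ?I" "s : |R|" for a s
  using that x u(4) by (simp add: M.smult_assoc1)
 show ?thesis
 proof (rule idealI[OF M.R.ring_axioms])
  show "subgroup ?I (add_monoid R)"
  proof (rule M.R.add.subgroupI)
   show "?I \<subseteq> |R|" by blast
   show "?I \<noteq> {}" using x u(2) by (auto intro!: exI[of _ "0\<^sub>R"])
   show "-\<^sub>R a : ?I" if "a : ?I" for a
    using smul[OF that, of "-\<^sub>R 1\<^sub>R"] that by (simp add: M.R.l_minus)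
   show "a +\<^sub>R b : ?I" if "a : ?I" "b : ?I" for a b
    using that x u(3) by (simp add: M.smult_l_distr)
  qed
  fix a s assume a: "a : ?I" "s : |R|"
  show "s \<otimes>\<^sub>R a : ?I" by (rule smul[OF a])
  then show "a \<otimes>\<^sub>R s : ?I" using M.R.m_comm[of a s] a by simp
 qed
qed

lemma lincomb_times:
 assumes M: "module R M" and S: "S \<subseteq> |M|" and a: "a : |R|" and J: "J \<subseteq> |R|"
  and K: "!!b. b : J ==> a \<otimes>\<^sub>R b : K" and y: "y : lincomb M J S"
 shows "a .\<^sub>M y : lincomb M K S"
proof -
 interpret M: module R M by fact
 show ?thesis using y
 proof induct
  case zero then show ?case using a by (simp add: lincomb.zero)
 next
  case (step b x y)
  have c: "b : |R|" "x : |M|" "y : |M|"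
   using step(1-3) J S M.lincomb_closed[OF J S] by auto
  then have "a .\<^sub>M (b .\<^sub>M x +\<^sub>M y) = (a \<otimes>\<^sub>R b) .\<^sub>M x +\<^sub>M a .\<^sub>M y"
   using a by (simp add: M.smult_r_distr M.smult_assoc1)
  then show ?case using lincomb.step[OF K[OF step(1)] step(2,4)] by simp
 qed
qed

lemma proper_ideal_in_maximal:
 assumes R: "cring R" and N: "noetherian_ring R" and I: "ideal I R"
  and max: "!!m. maximalideal m R ==> \<not> I \<subseteq> m"
 shows "I = |R|"
proof (rule ccontr)
 assume ne: "I \<noteq> |R|"
 interpret R: cring R by (rule R)
 let ?P = "{J. ideal J R \<and> I \<subseteq> J \<and> 1\<^sub>R \<notin> J}"
 have IP: "I : ?P" using I ideal.one_imp_carrier[OF I] ne by auto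
 have "\<exists>m\<in>?P. \<forall>J\<in>?P. m \<subseteq> J \<longrightarrow> J = m"
 proof (rule subset_Zorn_nonempty)
  show "?P \<noteq> {}" using IP by blast
  fix C assume C: "C \<noteq> {}" "subset.chain ?P C"
  then have "subset.chain {J. ideal J R} C" unfolding subset_chain_def by blast
  then have "\<Union>C \<in> C" by (rule noetherian_ring.ideal_chain_is_trivial[OF N C(1)])
  then show "\<Union>C \<in> ?P" using C(2) unfolding subset_chain_def by blast
 qed
 then obtain m where m: "m : ?P" "!!J. J : ?P ==> m \<subseteq> J ==> J = m" by (elim bexE) simp
 have "maximalideal m R"
 proof (rule maximalidealI)
  show "ideal m R" "|R| \<noteq> m" using m(1) by auto
  fix J assume J: "ideal J R" "m \<subseteq> J" "J \<subseteq> |R|"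
  show "J = m \<or> J = |R|"
  proof (cases "1\<^sub>R : J")
   case True
   then show ?thesis using ideal.one_imp_carrier[OF J(1)] by blast
  next
   case False
   then have "J : ?P" using J(1,2) m(1) by auto
   then show ?thesis using m(2) J(2) by blast
  qed
 qed
 then show False using max m(1) by blast
qed

context
 fixes R :: "'a ring" and A :: "('a, 'm) module" and D :: "('a, 'e) module"
 assumes R: "cring R" and N: "noetherian_ring R" and A: "artinian_mod R A"
  and inj: "injective_mod R D" and soc: "simple_socles R D"
begin

interpretation R: cring R by (rule R)

lemma artinian_dual_modules: "module R A" "module R D" "module R (hom_mod R A D)"
 using A inj module_hom_mod by (auto simp: artinian_mod_def injective_mod_def)

lemma artinian_dcc: "(!!n. submodule (C n) R A \<and> C (Suc n) \<subseteq> C n) ==> \<exists>N. \<forall>n\<ge>N. C n = C N" for C :: "nat => 'm set"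
 using A[unfolded artinian_mod_def, THEN conjunct2, THEN spec[of _ C]] by simp

interpretation A: module R A by (rule artinian_dual_modules)
interpretation D: module R D by (rule artinian_dual_modules)

private abbreviation (input) "H \<equiv> hom_mod R A D"

interpretation H: module R H by (rule artinian_dual_modules)

lemma hom_modD:
 "f : |H| \<longleftrightarrow> f : extensional |A| \<and> mod_hom R A D f"
 "x : |A| ==> (f +\<^sub>H g) x = f x +\<^sub>D g x" "x : |A| ==> (r .\<^sub>H f) x = r .\<^sub>D f x"
 "x : |A| ==> 0\<^sub>H x = 0\<^sub>D"
 by (simp_all add: hom_mod_def)

lemma hom_mod_val: "f : |H| ==> x : |A| ==> f x : |D|"
 using mod_homD(1) by (auto simp: hom_modD)

lemma hom_mod_neg: "f : |H| ==> x : |A| ==> (-\<^sub>H f) x = -\<^sub>D f x"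
 using hom_modD(2)[of x "-\<^sub>H f" f] hom_modD(4)[of x] H.M.l_neg[of f] hom_mod_val
 by (intro D.M.minus_equality[symmetric]) auto

lemma hom_mod_eqI:
 "f : |H| ==> g : |H| ==> (!!x. x : |A| ==> f x = g x) ==> f = g"
 by (rule extensionalityI[of _ "|A|"]) (auto simp: hom_modD)

lemma hom_mod_diff: "f : |H| ==> g : |H| ==> g +\<^sub>H (f +\<^sub>H -\<^sub>H g) = f"
 using H.M.a_lcomm[of g f "-\<^sub>H g"] by (simp add: H.M.r_neg)

private definition killed where "killed T = {x : |A|. \<forall>t\<in>T. t .\<^sub>A x = 0\<^sub>A}"

lemma killed_submodule:
 assumes T: "T \<subseteq> |R|" shows "submodule (killed T) R A"
proof (rule submodI[OF artinian_dual_modules(1)])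
 show "killed T \<subseteq> |A|" by (auto simp: killed_def)
 show "0\<^sub>A : killed T" using T by (auto simp: killed_def)
 show "x +\<^sub>A y : killed T" if "x : killed T" "y : killed T" for x y
  using that T by (auto simp: killed_def A.smult_r_distr)
 show "r .\<^sub>A x : killed T" if r: "r : |R|" and x: "x : killed T" for r x
 proof -
  have "t .\<^sub>A (r .\<^sub>A x) = r .\<^sub>A (t .\<^sub>A x)" if "t : T" for t
   using that T x r by (metis (no_types, lifting) A.smult_assoc1 R.m_comm killed_def mem_Collect_eq subsetD)
  then show ?thesis using x r by (simp add: killed_def)
 qed
qed

text \<open>If \<open>f\<close> vanishes where \<open>a\<close> and \<open>T\<close> act as zero, then on the part killed by \<open>T\<close> it
 factors through multiplication by \<open>a\<close>, so it is a multiple of \<open>a\<close> there.\<close>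

lemma vanish_on_killed_finite:
 assumes T: "finite T" "T \<subseteq> |R|" and f: "f : |H|" "!!x. x : killed T ==> f x = 0\<^sub>D"
 shows "f : lincomb H T |H|"
 using T f
proof (induct T arbitrary: f)
 case empty
 have "f = 0\<^sub>H" by (rule hom_mod_eqI) (use empty in "auto simp: killed_def hom_modD(4)")
 then show ?case by (simp add: lincomb.zero)
next
 case (insert a T)
 have a: "a : |R|" and T: "T \<subseteq> |R|" using insert(4) by auto
 note K = killed_submodule[OF T] and mA = artinian_dual_modules(1)
 note k = submoduleD[OF mA K]
 let ?K = "sub_mod A (killed T)"
 have d: "mod_hom R ?K A (%x. a .\<^sub>A x)"
 proof (rule mod_homI)
  fix r x assume "r : |R|" "x : |?K|"
  then show "a .\<^sub>A (r .\<^sub>?K x) = r .\<^sub>A (a .\<^sub>A x)"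
   using k(1) a A.smult_assoc1[of a r x] A.smult_assoc1[of r a x] R.m_comm[of a r] by auto
 qed (use subsetD[OF k(1)] a in "auto simp: A.smult_r_distr")
 have fm: "mod_hom R A D f" using insert(5) by (simp add: hom_modD)
 have fK: "mod_hom R ?K D f" by (rule mod_homI) (use mod_homD[OF fm] subsetD[OF k(1)] in simp_all)
 have ker: "f x = 0\<^sub>D" if "x : |?K|" "a .\<^sub>A x = 0\<^sub>A" for x
  using insert(6)[of x] that by (simp add: killed_def)
 obtain g where g: "mod_hom R A D g" "!!x. x : |?K| ==> g (a .\<^sub>A x) = f x"
  by (rule injective_factor[OF inj module_sub_mod[OF mA K] mA d fK ker]) simp_all
 let ?g = "restrict g |A|"
 have gH: "?g : |H|" using g(1) mA by (simp add: hom_modD)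
 have ag: "a .\<^sub>H ?g : |H|" using gH a by simp
 have "f +\<^sub>H -\<^sub>H (a .\<^sub>H ?g) : lincomb H T |H|"
 proof (rule insert(3)[OF T])
  show "f +\<^sub>H -\<^sub>H (a .\<^sub>H ?g) : |H|" using insert(5) ag by simp
  fix x assume x: "x : killed T"
  then have xA: "x : |A|" using k(1) by auto
  have "a .\<^sub>D g x = f x" using mod_homD(3)[OF g(1) a xA] g(2)[of x] x by simp
  then show "(f +\<^sub>H -\<^sub>H (a .\<^sub>H ?g)) x = 0\<^sub>D"
   using xA hom_mod_neg[OF ag xA] hom_mod_val[OF insert(5) xA] by (simp add: hom_modD(2,3) D.M.r_neg)
 qed
 then have "f +\<^sub>H -\<^sub>H (a .\<^sub>H ?g) : lincomb H (insert a T) |H|"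
  using lincomb_mono[of T "insert a T" "|H|" "|H|"] by blast
 from lincomb.step[OF _ gH this, of a] show ?case using hom_mod_diff[OF insert(5) ag] by simp
qed

lemma vanish_on_killed:
 assumes m: "ideal m R" and f: "f : |H|" "!!x. x : killed m ==> f x = 0\<^sub>D"
 shows "f : lincomb H m |H|"
proof -
 obtain T where T: "T \<subseteq> |R|" "finite T" "m = genideal R T"
  using noetherian_ring.finetely_gen[OF N m] by blast
 have "x : killed m" if x: "x : killed T" for x
 proof -
  have xA: "x : |A|" using x by (simp add: killed_def)
  have "submodule {0\<^sub>A} R A" by (rule submodI[OF artinian_dual_modules(1)]) auto
  from ideal_transporter[OF artinian_dual_modules(1) this xA]
  have "genideal R T \<subseteq> {a : |R|. a .\<^sub>A x : {0\<^sub>A}}"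
   by (rule R.genideal_minimal) (use x T(1) in "auto simp: killed_def")
  then show ?thesis using xA T(3) by (auto simp: killed_def)
 qed
 then have "f : lincomb H T |H|" using vanish_on_killed_finite[OF T(2,1) f(1)] f(2) by blast
 moreover have "T \<subseteq> m" unfolding T(3) by (rule R.genideal_self[OF T(1)])
 ultimately show ?thesis using lincomb_mono[of T m "|H|" "|H|"] by blast
qed

text \<open>
 On the part of \<open>A\<close> killed by a maximal ideal \<open>m\<close> all homomorphisms take values in a one-dimensional
 space over \<open>R/m\<close>, so functionals with a common kernel inside that of \<open>h\<close> generate \<open>h\<close>.
\<close>

lemma functional_in_span:
 assumes m: "maximalideal m R" and S: "finite S" "S \<subseteq> |H|" and h: "h : |H|"
  and ker: "!!x. x : killed m ==> (!!f. f : S ==> f x = 0\<^sub>D) ==> h x = 0\<^sub>D"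
 shows "\<exists>s\<in>lincomb H |R| S. \<forall>x\<in>killed m. h x = s x"
 using S h ker
proof (induct S arbitrary: h)
 case empty
 have "h x = 0\<^sub>H x" if "x : killed m" for x
  using empty(3)[OF that] that by (simp add: killed_def hom_modD(4))
 then show ?case using lincomb.zero by blast
next
 case (insert g S)
 have mR: "m \<subseteq> |R|" using ideal.Icarr[OF maximalideal.axioms(1)[OF m]] by blast
 note k = submoduleD[OF artinian_dual_modules(1) killed_submodule[OF mR]]
 have g: "g : |H|" and S: "S \<subseteq> |H|" using insert(4) by auto
 let ?V = "{x : killed m. \<forall>f\<in>S. f x = 0\<^sub>D}"
 have VA: "x : |A|" if "x : ?V" for x using that k(1) by auto
 have hom: "f (x +\<^sub>A r .\<^sub>A y) = f x +\<^sub>D r .\<^sub>D f y"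
  if "f : |H|" "x : |A|" "y : |A|" "r : |R|" for f x y r
  using that mod_homD[of R A D f] by (simp add: hom_modD(1))
 have kill: "a .\<^sub>D f x = 0\<^sub>D" if "f : |H|" "x : killed m" "a : m" for f x a
 proof -
  have "f (a .\<^sub>A x) = a .\<^sub>D f x" using that mR k(1) mod_homD(3)[of R A D f a x] by (auto simp: hom_modD(1))
  then show ?thesis
   using that mod_hom_zero[OF artinian_dual_modules(1,2), of f] by (simp add: hom_modD(1) killed_def)
 qed
 have "\<exists>r\<in>|R|. \<forall>x\<in>?V. h x = r .\<^sub>D g x"
 proof (cases "\<forall>x\<in>?V. g x = 0\<^sub>D")
  case True
  then have "h x = 0\<^sub>R .\<^sub>D g x" if "x : ?V" for x
   using insert(6)[of x] that by auto
  then show ?thesis by blast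
 next
  case False
  then obtain y where y: "y : ?V" "g y \<noteq> 0\<^sub>D" by blast
  have one: "\<exists>r\<in>|R|. f x = r .\<^sub>D g y" if "f : |H|" "x : ?V" for f x
  proof -
   have "f x : |D|" "g y : |D|" using hom_mod_val that g VA y(1) by auto
   then show ?thesis
    using soc m kill[OF that(1)] kill[OF g] that(2) y unfolding simple_socles_def by blast
  qed
  obtain r where r: "r : |R|" "h y = r .\<^sub>D g y" using one[OF insert(5) y(1)] by blast
  have "h x = r .\<^sub>D g x" if x: "x : ?V" for x
  proof -
   obtain t where t: "t : |R|" "g x = t .\<^sub>D g y" using one[OF g x] by blast
   let ?z = "x +\<^sub>A (-\<^sub>R t) .\<^sub>A y"
   have c: "x : |A|" "y : |A|" using VA x y(1) by auto
   have n: "(-\<^sub>R t) .\<^sub>D v = -\<^sub>D (t .\<^sub>D v)" if "v : |D|" for v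
    using that t(1) by (simp add: D.smult_l_minus)
   have "?z : killed m" using k(3,4) x y(1) t(1) by auto
   moreover have "f ?z = 0\<^sub>D" if "f : S" for f
   proof -
    have "f x = 0\<^sub>D" "f y = 0\<^sub>D" using that x y(1) by blast+
    then show ?thesis using hom[OF subsetD[OF S that] c, of "-\<^sub>R t"] t(1) by simp
   qed
   moreover have "g ?z = 0\<^sub>D"
    using hom[OF g c, of "-\<^sub>R t"] t hom_mod_val[OF g c(2)] n by (simp add: D.M.r_neg)
   ultimately have "h ?z = 0\<^sub>D" using insert(6)[of ?z] by blast
   then have "h x +\<^sub>D -\<^sub>D (t .\<^sub>D h y) = 0\<^sub>D"
    using hom[OF insert(5) c, of "-\<^sub>R t"] t(1) hom_mod_val[OF insert(5) c(2)] n by simp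
   then have "h x = t .\<^sub>D h y"
    using hom_mod_val[OF insert(5)] c t(1) D.M.r_neg[of "t .\<^sub>D h y"]
    by (metis D.M.add.inv_closed D.M.add.r_cancel D.smult_closed)
   then show ?thesis
    unfolding t(2) r(2) using t(1) r(1) hom_mod_val[OF g c(2)] by (metis D.smult_assoc1 R.m_comm)
  qed
  then show ?thesis using r(1) by blast
 qed
 then obtain r where r: "r : |R|" "!!x. x : ?V ==> h x = r .\<^sub>D g x" by blast
 have rg: "r .\<^sub>H g : |H|" using r(1) g by simp
 let ?h = "h +\<^sub>H -\<^sub>H (r .\<^sub>H g)"
 have "\<exists>s\<in>lincomb H |R| S. \<forall>x\<in>killed m. ?h x = s x"
 proof (rule insert(3)[OF S])
  show "?h : |H|" using insert(5) rg by simp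
  fix x assume x: "x : killed m" "!!f. f : S ==> f x = 0\<^sub>D"
  then have xA: "x : |A|" using k(1) by auto
  show "?h x = 0\<^sub>D"
   using r(2)[of x] x xA hom_mod_neg[OF rg xA] hom_mod_val[OF insert(5) xA] by (simp add: hom_modD(2,3) D.M.r_neg)
 qed
 then obtain s where s: "s : lincomb H |R| S" "!!x. x : killed m ==> ?h x = s x" by blast
 have sH: "s : |H|" using s(1) H.lincomb_closed[OF subset_refl S] by blast
 have "h x = (r .\<^sub>H g +\<^sub>H s) x" if x: "x : killed m" for x
 proof -
  have xA: "x : |A|" using x k(1) by auto
  have "(r .\<^sub>H g +\<^sub>H ?h) x = (r .\<^sub>H g +\<^sub>H s) x" using s(2)[OF x] xA by (simp only: hom_modD(2))
  then show ?thesis using hom_mod_diff[OF insert(5) rg] by simp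
 qed
 moreover have "r .\<^sub>H g +\<^sub>H s : lincomb H |R| (insert g S)"
  using lincomb_mono[of "|R|" "|R|" S "insert g S" H] s(1) r(1) by (intro lincomb.step) auto
 ultimately show ?case by blast
qed

lemma dual_fg_mod_maximal:
 assumes m: "maximalideal m R"
 shows "\<exists>S. finite S \<and> S \<subseteq> |H| \<and> (\<forall>h\<in>|H|. \<exists>s\<in>lincomb H |R| S.
  \<exists>y\<in>lincomb H m |H|. h = s +\<^sub>H y)"
proof -
 interpret m: maximalideal m R by (rule m)
 have mR: "m \<subseteq> |R|" using m.Icarr by blast
 note k = submoduleD[OF artinian_dual_modules(1) killed_submodule[OF mR]]
 define V where "V S = {x : killed m. \<forall>f\<in>S. f x = 0\<^sub>D}" for S
 have V: "submodule (V S) R A" if "S \<subseteq> |H|" for S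
 proof (rule submodI[OF artinian_dual_modules(1)])
  have f: "mod_hom R A D f" if "f : S" for f using that \<open>S \<subseteq> carrier H\<close> by (auto simp: hom_modD(1))
  show "V S \<subseteq> |A|" using k(1) by (auto simp: V_def)
  show "0\<^sub>A : V S" using k(2) mod_hom_zero[OF artinian_dual_modules(1,2) f] by (simp add: V_def)
  show "x +\<^sub>A y : V S" if "x : V S" "y : V S" for x y
  proof -
   have v: "x : killed m" "y : killed m" "!!f. f : S ==> f x = 0\<^sub>D" "!!f. f : S ==> f y = 0\<^sub>D"
    using that by (auto simp: V_def)
   have "f (x +\<^sub>A y) = 0\<^sub>D" if "f : S" for f
    using mod_homD(2)[OF f[OF that] subsetD[OF k(1) v(1)] subsetD[OF k(1) v(2)]] v(3,4)[OF that] by simp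
   then show ?thesis using k(3)[OF v(1,2)] by (simp add: V_def)
  qed
  show "r .\<^sub>A x : V S" if "r : |R|" "x : V S" for r x
  proof -
   have v: "x : killed m" "!!f. f : S ==> f x = 0\<^sub>D" using that(2) by (auto simp: V_def)
   have "f (r .\<^sub>A x) = 0\<^sub>D" if "f : S" for f
    using mod_homD(3)[OF f[OF that] \<open>r \<in> carrier R\<close> subsetD[OF k(1) v(1)]] v(2)[OF that] \<open>r \<in> carrier R\<close> by simp
   then show ?thesis using k(4)[OF that(1) v(1)] by (simp add: V_def)
  qed
 qed
 define good where "good S \<longleftrightarrow> (\<forall>h\<in>|H|. \<forall>x\<in>V S. h x = 0\<^sub>D)" for S
 have "\<exists>S. finite S \<and> S \<subseteq> |H| \<and> good S"
 proof (rule ccontr)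
  assume neg: "\<not> ?thesis"
  have "\<exists>h. h : |H| \<and> (\<exists>x\<in>V S. h x \<noteq> 0\<^sub>D)" if "finite S" "S \<subseteq> |H|" for S
  proof -
   have "\<not> good S" using neg that by blast
   then show ?thesis unfolding good_def by blast
  qed
  note ex = someI_ex[OF this]
  define g where "g S = (SOME h. h : |H| \<and> (\<exists>x\<in>V S. h x \<noteq> 0\<^sub>D))" for S
  note g = ex[folded g_def, THEN conjunct1] ex[folded g_def, THEN conjunct2]
  define T where "T n = ((%S. insert (g S) S) ^^ n) {}" for n
  have TS: "T (Suc n) = insert (g (T n)) (T n)" for n by (simp add: T_def)
  have T: "finite (T n) \<and> T n \<subseteq> |H|" for n
   by (induct n) (use g(1) in "auto simp: TS T_def")
  have "\<exists>N. \<forall>n\<ge>N. V (T n) = V (T N)"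
   by (rule artinian_dcc) (use V T in "auto simp: TS V_def")
  then obtain N where N: "\<forall>n\<ge>N. V (T n) = V (T N)" by (elim exE)
  have e: "V (T (Suc N)) = V (T N)" by (rule N[rule_format]) simp
  obtain x where x: "x : V (T N)" "g (T N) x \<noteq> 0\<^sub>D" using g(2) T by blast
  have "x : V (T (Suc N))" using x(1) unfolding e .
  then show False using x(2) by (simp add: V_def TS)
 qed
 then obtain S where S: "finite S" "S \<subseteq> |H|" "good S" by (elim exE conjE)
 have "\<exists>s\<in>lincomb H |R| S. \<exists>y\<in>lincomb H m |H|. h = s +\<^sub>H y" if h: "h : |H|" for h
 proof -
  have "\<exists>s\<in>lincomb H |R| S. \<forall>x\<in>killed m. h x = s x"
   by (rule functional_in_span[OF m S(1,2) h]) (use S(3)[unfolded good_def, THEN bspec, OF h] in "simp add: V_def")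
  then obtain s where s: "s : lincomb H |R| S" "\<forall>x\<in>killed m. h x = s x" by (elim bexE)
  have sH: "s : |H|" using s(1) H.lincomb_closed[OF subset_refl S(2)] by blast
  have "h +\<^sub>H -\<^sub>H s : lincomb H m |H|"
  proof (rule vanish_on_killed[OF m.ideal_axioms])
   show "h +\<^sub>H -\<^sub>H s : |H|" using h sH by simp
   fix x assume x: "x : killed m"
   then have xA: "x : |A|" using k(1) by auto
   show "(h +\<^sub>H -\<^sub>H s) x = 0\<^sub>D"
    using s(2) x xA hom_mod_neg[OF sH xA] hom_mod_val[OF sH xA] by (simp add: hom_modD(2) D.M.r_neg)
  qed
  then show ?thesis using s(1) hom_mod_diff[OF h sH] by (intro bexI[of _ s] bexI[of _ "h +\<^sub>H -\<^sub>H s"]) simp_all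
 qed
 then show ?thesis using S(1,2) by blast
qed

lemma inter_maximal_ideal:
 assumes "F \<subseteq> Max_Spec R" shows "ideal ( |R| \<inter> \<Inter>F) R"
proof -
 have "ideal (\<Inter>(insert |R| F)) R"
  by (rule R.i_Intersect) (use assms R.oneideal maximalideal.axioms(1) in "auto simp: Max_Spec_def")
 then show ?thesis by simp
qed

text \<open>Passing from \<open>I\<close> to \<open>I \<inter> m\<close>: substitute \<open>H = \<langle>S'\<rangle> + mH\<close> into \<open>IH\<close>, and note that
 \<open>I m \<subseteq> I \<inter> m\<close>.\<close>

lemma dual_fg_mod_inter:
 assumes fin: "finite M" and M: "M \<subseteq> Max_Spec R"
 shows "\<exists>S. finite S \<and> S \<subseteq> |H| \<and> (\<forall>h\<in>|H|. \<exists>s\<in>lincomb H |R| S.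
  \<exists>y\<in>lincomb H ( |R| \<inter> \<Inter>M) |H|. h = s +\<^sub>H y)"
 using fin M
proof (induct M)
 case empty
 have "\<exists>s\<in>lincomb H |R| {}. \<exists>y\<in>lincomb H |R| |H|. h = s +\<^sub>H y" if "h : |H|" for h
  by (rule bexI[OF _ lincomb.zero], rule bexI[of _ h]) (use that H.lincomb_incl in auto)
 then show ?case by (intro exI[of _ "{}"]) simp
next
 case (insert m M)
 have m: "maximalideal m R" using insert(4) by (auto simp: Max_Spec_def)
 note mi = maximalideal.axioms(1)[OF m]
 let ?I = "|R| \<inter> \<Inter>M" and ?K = "|R| \<inter> \<Inter>(insert m M)"
 have I: "ideal ?I R" and K: "ideal ?K R" using inter_maximal_ideal[of M] inter_maximal_ideal[of "insert m M"] insert(4) by simp_all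
 obtain S where S: "finite S" "S \<subseteq> |H|" "!!h. h : |H| ==>
   \<exists>s\<in>lincomb H |R| S. \<exists>y\<in>lincomb H ?I |H|. h = s +\<^sub>H y"
  using insert(3)[OF subset_trans[OF subset_insertI insert(4)]] by (elim exE conjE) auto
 obtain S' where S': "finite S'" "S' \<subseteq> |H|" "!!h. h : |H| ==>
   \<exists>s\<in>lincomb H |R| S'. \<exists>y\<in>lincomb H m |H|. h = s +\<^sub>H y"
  using dual_fg_mod_maximal[OF m] by (elim exE conjE) auto
 note mH = artinian_dual_modules(3)
 let ?T = "S \<union> S'"
 have T: "?T \<subseteq> |H|" using S(2) S'(2) by blast
 define U where "U = {s +\<^sub>H y |s y. s : lincomb H |R| ?T \<and> y : lincomb H ?K |H|}"
 note l = H.lincomb_submodule[OF R.oneideal T] and l' = H.lincomb_submodule[OF K subset_refl]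
 have U: "submodule U R H" unfolding U_def by (rule submodule_add[OF mH l l'])
 note u = submoduleD[OF mH U]
 have UI: "s +\<^sub>H y : U" if "s : lincomb H |R| ?T" "y : lincomb H ?K |H|" for s y
  using that unfolding U_def by blast
 have IU: "lincomb H ?I |H| \<subseteq> U"
 proof (rule lincomb_in_submodule[OF mH U])
  fix a h assume a: "a : ?I" and h: "h : |H|"
  obtain s y where sy: "s : lincomb H |R| S'" "y : lincomb H m |H|" "h = s +\<^sub>H y"
   using S'(3)[OF h] by blast
  have aR: "a : |R|" using a by simp
  have mR: "m \<subseteq> |R|" using ideal.Icarr[OF mi] by blast
  have c: "s : |H|" "y : |H|"
   using sy(1,2) H.lincomb_closed[OF subset_refl S'(2)] H.lincomb_closed[OF mR subset_refl] by auto
  have "a \<otimes>\<^sub>R b : ?K" if "b : m" for b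
   using ideal.I_l_closed[OF mi that aR] ideal.I_r_closed[OF I a, of b] mR that by auto
  from lincomb_times[OF mH subset_refl aR mR this sy(2)]
  have 1: "a .\<^sub>H y : lincomb H ?K |H|" by simp
  have "s : lincomb H |R| ?T" using sy(1) lincomb_mono[of "|R|" "|R|" S' ?T H] by blast
  then have "a .\<^sub>H s : lincomb H |R| ?T" by (rule submoduleD(4)[OF mH l aR])
  from UI[OF this 1] show "a .\<^sub>H h : U" unfolding sy(3) using aR c by (simp add: H.smult_r_distr)
 qed
 have "h : U" if h: "h : |H|" for h
 proof -
  obtain s y where sy: "s : lincomb H |R| S" "y : lincomb H ?I |H|" "h = s +\<^sub>H y"
   using S(3)[OF h] by blast
  have s: "s : lincomb H |R| ?T" using sy(1) lincomb_mono[of "|R|" "|R|" S ?T H] by blast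
  then have "s : U" using UI[OF s lincomb.zero] submoduleD(1)[OF mH l] by auto
  then show ?thesis unfolding sy(3) using u(3) IU sy(2) by blast
 qed
 then show ?case unfolding U_def using S(1) S'(1) T by (intro exI[of _ ?T]) blast
qed

private abbreviation (input) "J \<equiv> |R| \<inter> \<Inter>(Max_Spec R)"

lemma ideal_power_ideal: "ideal I R ==> ideal (ideal_power R I n) R"
 by (induct n) (auto intro: R.oneideal R.ideal_prod_is_ideal)

lemma ideal_power_Suc_subset:
 assumes I: "ideal I R" shows "ideal_power R I (Suc n) \<subseteq> ideal_power R I n"
proof
 note P = ideal_power_ideal[OF I, of n]
 fix x assume "x : ideal_power R I (Suc n)"
 then have "x : ideal_prod R (ideal_power R I n) I" by simp
 then show "x : ideal_power R I n"
 proof induct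
  case (prod i j) then show ?case using ideal.I_r_closed[OF P] ideal.Icarr[OF I] by blast
 next
  case (sum s t) then show ?case using additive_subgroup.a_closed[OF ideal.axioms(1)[OF P]] by blast
 qed
qed

lemma ideal_power_antimono:
 assumes I: "ideal I R" and le: "n \<le> k" shows "ideal_power R I k \<subseteq> ideal_power R I n"
 using le by (induct rule: dec_induct) (use ideal_power_Suc_subset[OF I] in blast)+

text \<open>
 The descending chain \<open>J\<^sup>n x\<close> is stationary, and its last term is finitely generated and equal to its
 product with \<open>J\<close>, hence zero by Nakayama's lemma at every maximal ideal.
\<close>

lemma artinian_killed_by_power:
 assumes x: "x : |A|"
 shows "\<exists>n. \<forall>a\<in>ideal_power R J n. a .\<^sub>A x = 0\<^sub>A"
proof -
 note J = inter_maximal_ideal[OF subset_refl] and mA = artinian_dual_modules(1)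
 let ?P = "ideal_power R J"
 define Q where "Q n = (%a. a .\<^sub>A x) ` ?P n" for n
 have PR: "?P n \<subseteq> |R|" for n using ideal.Icarr[OF ideal_power_ideal[OF J]] by blast
 have hx: "mod_hom R (ring_mod R) A (%a. a .\<^sub>A x)"
  by (rule mod_homI) (use x in "simp_all add: A.smult_l_distr A.smult_assoc1")
 have Q: "submodule (Q n) R A" for n
 proof -
  interpret ideal "?P n" R by (rule ideal_power_ideal[OF J])
  have "submodule (?P n) R (ring_mod R)"
   by (rule submodI[OF module_ring_mod[OF R]]) (use I_l_closed Icarr in auto)
  from submodule_image[OF module_ring_mod[OF R] mA hx this] show ?thesis by (simp add: Q_def)
 qed
 have "\<exists>N. \<forall>n\<ge>N. Q n = Q N"
  by (rule artinian_dcc) (use Q ideal_power_Suc_subset[OF J] in "auto simp: Q_def simp del: ideal_power.simps")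
 then obtain n where "\<forall>k\<ge>n. Q k = Q n" by (elim exE)
 then have stat: "Q (Suc n) = Q n" by (elim allE[of _ "Suc n"]) simp
 obtain T where T: "T \<subseteq> |R|" "finite T" "?P n = genideal R T"
  using noetherian_ring.finetely_gen[OF N ideal_power_ideal[OF J]] by blast
 have TP: "T \<subseteq> ?P n" unfolding T(3) by (rule R.genideal_self[OF T(1)])
 define S where "S = (%a. a .\<^sub>A x) ` T"
 have S: "finite S" "S \<subseteq> |A|" using T(1,2) x by (auto simp: S_def)
 note l = A.lincomb_submodule[OF R.oneideal S(2)]
 have "genideal R T \<subseteq> {a : |R|. a .\<^sub>A x : lincomb A |R| S}"
  by (rule R.genideal_minimal[OF ideal_transporter[OF mA l x]])
    (use T(1) A.lincomb_incl[OF S(2)] in "auto simp: S_def")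
 then have QS: "Q n \<subseteq> lincomb A |R| S" unfolding Q_def T(3) by blast
 have z: "submodule {0\<^sub>A} R A" by (rule submodI[OF mA]) auto
 have mm: "\<forall>s\<in>S. \<exists>t\<in>|R| - m. t .\<^sub>A s : {0\<^sub>A}" if m: "maximalideal m R" for m
 proof (rule nakayama_at_prime[OF mA R.maximalideal_prime[OF m] z S])
  note mi = maximalideal.axioms(1)[OF m]
  have mR: "m \<subseteq> |R|" using ideal.Icarr[OF mi] by blast
  note lm = A.lincomb_submodule[OF mi S(2)]
  have Jm: "J \<subseteq> m" using m by (auto simp: Max_Spec_def)
  have prod: "b .\<^sub>A x : lincomb A m S" if "b : ideal_prod R (?P n) J" for b
   using that
  proof induct
   case (prod i j)
   have ij: "i : |R|" "j : |R|" "j : m" using prod PR Jm by auto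
   have "i .\<^sub>A x : lincomb A |R| S" using QS prod(1) by (auto simp: Q_def)
   then have "j .\<^sub>A (i .\<^sub>A x) : lincomb A m S"
    by (intro subsetD[OF A.lincomb_lincomb[OF mi S(2)]] A.lincomb_single[OF mR] submoduleD(1)[OF mA l] ij)
   then show ?case using ij x by (simp add: A.smult_assoc1[symmetric] R.m_comm)
  next
   case (sum s t)
   have "s : |R|" "t : |R|"
    using sum(1,3) ideal.Icarr[OF R.ideal_prod_is_ideal[OF ideal_power_ideal[OF J] J]] by auto
   then show ?case using submoduleD(3)[OF mA lm sum(2,4)] x by (simp add: A.smult_l_distr)
  qed
  fix s assume s: "s : S"
  then have "s : Q (Suc n)" unfolding stat using TP by (auto simp: S_def Q_def)
  then have "s : lincomb A m S" using prod by (auto simp: Q_def)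
  moreover have "1\<^sub>R .\<^sub>A s = s +\<^sub>A 0\<^sub>A" using s S(2) by auto
  moreover have "1\<^sub>R : |R| - m" using prime_compl(1)[OF R.maximalideal_prime[OF m]] .
  ultimately show "\<exists>t\<in>|R| - m. \<exists>y\<in>lincomb A m S. \<exists>k\<in>{0\<^sub>A}. t .\<^sub>A s = y +\<^sub>A k" by blast
 qed
 have "s = 0\<^sub>A" if s: "s : S" for s
 proof -
  have sA: "s : |A|" using s S(2) by blast
  have "{a : |R|. a .\<^sub>A s : {0\<^sub>A}} = |R|"
   by (rule proper_ideal_in_maximal[OF R N ideal_transporter[OF mA z sA]]) (use mm s in blast)
  then have "1\<^sub>R .\<^sub>A s : {0\<^sub>A}" using R.one_closed by blast
  then show ?thesis using sA by simp
 qed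
 then have "lincomb A |R| S \<subseteq> {0\<^sub>A}"
  using modD(16)[OF mA] by (intro lincomb_in_submodule[OF mA z]) fastforce
 then show ?thesis using QS by (intro exI[of _ n]) (auto simp: Q_def)
qed

lemma lincomb_eval_zero:
 assumes y: "y : lincomb H I |H|" and I: "I \<subseteq> |R|" and x: "x : |A|"
  and k: "!!a. a : I ==> a .\<^sub>A x = 0\<^sub>A"
 shows "y x = 0\<^sub>D"
 using y
proof induct
 case zero show ?case by (rule hom_modD(4)[OF x])
next
 case (step a f y)
 have f: "mod_hom R A D f" using step(2) by (simp add: hom_modD(1))
 have "a .\<^sub>D f x = 0\<^sub>D"
  using mod_homD(3)[OF f subsetD[OF I step(1)] x] k[OF step(1)] mod_hom_zero[OF artinian_dual_modules(1,2) f] by simp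
 then show ?case using step(4) x by (simp add: hom_modD(2,3))
qed

lemma lincomb_finsum:
 assumes I: "ideal I R" and S: "finite S" "S \<subseteq> |H|" and x: "x : lincomb H I S"
 shows "\<exists>c. c : S \<rightarrow> I \<and> x = finsum H (%s. c s .\<^sub>H s) S"
 using S x
proof (induct S arbitrary: x)
 case empty
 from empty(2) show ?case by cases auto
next
 case (insert s S)
 have S: "S \<subseteq> |H|" and s: "s : |H|" using insert(4) by auto
 obtain a y where a: "a : I" "y : lincomb H I S" "x = a .\<^sub>H s +\<^sub>H y"
  by (rule H.lincomb_insert[OF I s S insert(5)])
 obtain c where c: "c : S \<rightarrow> I" "y = finsum H (%s. c s .\<^sub>H s) S" using insert(3)[OF S a(2)] by (elim exE conjE)
 let ?c = "c(s := a)"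
 have IR: "I \<subseteq> |R|" using ideal.Icarr[OF I] by blast
 have e: "finsum H (%t. ?c t .\<^sub>H t) S = y" unfolding c(2)
  by (rule H.M.finsum_cong') (use insert(2) c(1) IR S in "auto simp: Pi_iff subset_iff")
 have "finsum H (%t. ?c t .\<^sub>H t) (insert s S) = ?c s .\<^sub>H s +\<^sub>H finsum H (%t. ?c t .\<^sub>H t) S"
  by (rule H.M.finsum_insert) (use insert(1,2) c(1) a(1) IR S s in "auto simp: Pi_iff subset_iff")
 then have "x = finsum H (%t. ?c t .\<^sub>H t) (insert s S)" using e a(3) by simp
 then show ?case using a(1) c(1) by (intro exI[of _ ?c]) auto
qed

lemma finsum_coeff_add:
 assumes S: "finite S" "S \<subseteq> |H|" and c: "c : S \<rightarrow> |R|" "d : S \<rightarrow> |R|"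
  and e: "!!s. s : S ==> e s = c s +\<^sub>R d s"
 shows "finsum H (%s. e s .\<^sub>H s) S = finsum H (%s. c s .\<^sub>H s) S +\<^sub>H finsum H (%s. d s .\<^sub>H s) S"
proof -
 have m: "(%s. c s .\<^sub>H s) : S \<rightarrow> |H|" "(%s. d s .\<^sub>H s) : S \<rightarrow> |H|"
  using c S(2) by (auto simp: Pi_iff subset_iff)
 have "finsum H (%s. e s .\<^sub>H s) S = finsum H (%s. c s .\<^sub>H s +\<^sub>H d s .\<^sub>H s) S"
  by (rule H.M.finsum_cong') (use c S(2) e in "auto simp: Pi_iff subset_iff H.smult_l_distr")
 then show ?thesis using H.M.finsum_addf[OF m] by simp
qed

text \<open>
 Modulo \<open>JH\<close> the dual is generated by a finite set \<open>S\<close>. Successive approximation gives coefficients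
 on \<open>S\<close> that form Cauchy sequences, and the limits represent \<open>h\<close>: this is checked at each \<open>x\<close>, where
 the error terms vanish eventually because \<open>x\<close> is killed by a power of \<open>J\<close>.
\<close>

lemma artinian_dual_finitely_generated:
 assumes sc: "semilocal_complete R"
 shows "\<exists>S. finite S \<and> S \<subseteq> |H| \<and> |H| = lincomb H |R| S"
proof -
 note J = inter_maximal_ideal[OF subset_refl] and mH = artinian_dual_modules(3)
 have fin: "finite (Max_Spec R)" and complete: "adically_complete R J"
  using sc by (auto simp: semilocal_complete_def)
 let ?P = "ideal_power R J"
 let ?L = "%n. lincomb H (?P n) |H|"
 let ?F = "%c S. finsum H (%s. c s .\<^sub>H s) S"
 note P = ideal_power_ideal[OF J]
 have PR: "?P n \<subseteq> |R|" for n using ideal.Icarr[OF P] by blast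
 have LH: "?L n \<subseteq> |H|" for n by (rule H.lincomb_closed[OF PR subset_refl])
 obtain S where S: "finite S" "S \<subseteq> |H|" and gen: "!!h. h : |H| ==>
   \<exists>s\<in>lincomb H |R| S. \<exists>y\<in>lincomb H J |H|. h = s +\<^sub>H y"
  using dual_fg_mod_inter[OF fin subset_refl] by (elim exE conjE) auto
 have Fc: "?F c S : |H|" if "c : S \<rightarrow> |R|" for c
  by (rule H.M.finsum_closed) (use that S(2) in "auto simp: Pi_iff subset_iff")
 have FL: "?F c S : lincomb H I S" if "c : S \<rightarrow> I" "ideal I R" for c I
 proof (rule submodule_finsum[OF mH H.lincomb_submodule[OF that(2) S(2)] S(1)])
  have "I \<subseteq> |R|" using ideal.Icarr[OF that(2)] by blast
  then show "c s .\<^sub>H s : lincomb H I S" if "s : S" for s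
   using \<open>c \<in> S \<rightarrow> I\<close> that by (intro H.lincomb_single S(2)) auto
 qed
 have refine: "\<exists>d y'. d : S \<rightarrow> ?P n \<and> y' : ?L (Suc n) \<and> y = ?F d S +\<^sub>H y'" if y: "y : ?L n" for n y
 proof -
  let ?A = "lincomb H (?P n) S" and ?B = "?L (Suc n)"
  note lA = H.lincomb_submodule[OF P[of n] S(2)] and lB = H.lincomb_submodule[OF P[of "Suc n"] subset_refl]
  define U where "U = {s +\<^sub>H y |s y. s : ?A \<and> y : ?B}"
  have U: "submodule U R H" unfolding U_def by (rule submodule_add[OF mH lA lB])
  have "?L n \<subseteq> U"
  proof (rule lincomb_in_submodule[OF mH U])
   fix a h assume a: "a : ?P n" and h: "h : |H|"
   obtain s z where sz: "s : lincomb H |R| S" "z : lincomb H J |H|" "h = s +\<^sub>H z"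
    using gen[OF h] by blast
   have aR: "a : |R|" using a PR by blast
   have JR: "J \<subseteq> |R|" by blast
   have c: "s : |H|" "z : |H|"
    using sz(1,2) H.lincomb_closed[OF subset_refl S(2)] H.lincomb_closed[OF JR subset_refl] by auto
   have as: "a .\<^sub>H s : ?A"
    by (rule lincomb_times[OF mH S(2) aR subset_refl ideal.I_r_closed[OF P a] sz(1)])
   have az: "a .\<^sub>H z : ?B"
    by (rule lincomb_times[OF mH subset_refl aR JR _ sz(2)]) (simp only: ideal_power.simps ideal_prod.prod[OF a])
   have "a .\<^sub>H h = a .\<^sub>H s +\<^sub>H a .\<^sub>H z" unfolding sz(3) using aR c by (simp add: H.smult_r_distr)
   then show "a .\<^sub>H h : U" using as az unfolding U_def by blast
  qed
  then obtain s y' where sy: "s : ?A" "y' : ?B" "y = s +\<^sub>H y'" using y unfolding U_def by blast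
  obtain d where d: "d : S \<rightarrow> ?P n" "s = ?F d S" using lincomb_finsum[OF P S sy(1)] by (elim exE conjE)
  show ?thesis by (intro exI[of _ d] exI[of _ y'] conjI d(1) sy(2)) (simp only: sy(3) d(2))
 qed
 have "\<exists>f. \<forall>n y. y : ?L n \<longrightarrow> fst (f n y) : S \<rightarrow> ?P n \<and> snd (f n y) : ?L (Suc n) \<and> y = ?F (fst (f n y)) S +\<^sub>H snd (f n y)"
 proof (intro choice allI)
  fix n y
  show "\<exists>q. y : ?L n \<longrightarrow> fst q : S \<rightarrow> ?P n \<and> snd q : ?L (Suc n) \<and> y = ?F (fst q) S +\<^sub>H snd q"
  proof (cases "y : ?L n")
   case True
   from refine[OF this] obtain d y' where q: "d : S \<rightarrow> ?P n \<and> y' : ?L (Suc n) \<and> y = ?F d S +\<^sub>H y'" by (elim exE)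
   show ?thesis by (intro exI[of _ "(d, y')"] impI, unfold fst_conv snd_conv) (rule q)
  next
   case False then show ?thesis by blast
  qed
 qed
 then obtain f where f0: "\<forall>n y. y : ?L n \<longrightarrow> fst (f n y) : S \<rightarrow> ?P n \<and> snd (f n y) : ?L (Suc n) \<and>
   y = ?F (fst (f n y)) S +\<^sub>H snd (f n y)" by (rule exE)
 note f1 = f0[THEN spec, THEN spec, THEN mp]
 note f = f1[THEN conjunct1] f1[THEN conjunct2, THEN conjunct1] f1[THEN conjunct2, THEN conjunct2]
 have "h : lincomb H |R| S" if h: "h : |H|" for h
 proof -
  define y where "y = rec_nat h (%n y. snd (f n y))"
  define d where "d n = fst (f n (y n))" for n
  define c where "c = rec_nat (%s. 0\<^sub>R) (%n e s. e s +\<^sub>R d n s)"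
  have c0: "c 0 s = 0\<^sub>R" and cS: "c (Suc n) s = c n s +\<^sub>R d n s" for n s by (simp_all add: c_def)
  have yL: "y n : ?L n" for n
  proof (induct n)
   case 0 show ?case using H.lincomb_incl[OF subset_refl h] by (simp add: y_def)
  next
   case (Suc n) then show ?case using f(2)[of "y n" n] by (simp add: y_def del: ideal_power.simps)
  qed
  have ySuc: "y (Suc n) = snd (f n (y n))" for n by (simp add: y_def)
  have yS: "y n = ?F (d n) S +\<^sub>H y (Suc n)" for n unfolding d_def ySuc by (rule f(3)[OF yL])
  have dP: "d n : S \<rightarrow> ?P n" for n using f(1)[OF yL[of n]] by (simp add: d_def)
  have dR: "d n : S \<rightarrow> |R|" for n using dP[of n] PR[of n] by (auto simp: Pi_iff subset_iff)
  have cR: "c n : S \<rightarrow> |R|" for n by (induct n) (use dR in "auto simp: c0 cS Pi_iff")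
  have yH: "y n : |H|" for n using yL LH by blast
  have hc: "h = ?F (c n) S +\<^sub>H y n" for n
  proof (induct n)
   case 0
   have "?F (c 0) S = finsum H (%s. 0\<^sub>H) S" by (rule H.M.finsum_cong') (use S(2) in "auto simp: c0 subset_iff")
   then show ?case using h by (simp add: y_def)
  next
   case (Suc n)
   have "?F (c (Suc n)) S = ?F (c n) S +\<^sub>H ?F (d n) S" by (rule finsum_coeff_add[OF S cR dR cS])
   then show ?case using Suc yS[of n] H.M.a_assoc[OF Fc[OF cR[of n]] Fc[OF dR[of n]] yH[of "Suc n"]] by simp
  qed
  have tail: "c i s -\<^sub>R c n s : ?P n" if s: "s : S" and i: "n \<le> i" for i n s
   using i
  proof (induct rule: dec_induct)
   case base
   have "c n s : |R|" using cR s by blast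
   then have "c n s -\<^sub>R c n s = 0\<^sub>R" by (simp add: a_minus_def R.r_neg)
   then show ?case using additive_subgroup.zero_closed[OF ideal.axioms(1)[OF P]] by simp
  next
   case (step i)
   have r: "c n s : |R|" "c i s : |R|" "d i s : |R|" using cR dR s by blast+
   have "d i s : ?P n" using dP[of i] s ideal_power_antimono[OF J step(1)] by blast
   moreover have "c (Suc i) s -\<^sub>R c n s = (c i s -\<^sub>R c n s) +\<^sub>R d i s"
    unfolding cS a_minus_def using r by (simp add: R.a_ac)
   ultimately show ?case using additive_subgroup.a_closed[OF ideal.axioms(1)[OF P] step(3)] by simp
  qed
  have minus: "u -\<^sub>R v : ?P n" if "u : ?P n" "v : ?P n" for u v n
   using that additive_subgroup.a_closed[OF ideal.axioms(1)[OF P]] additive_subgroup.a_inv_closed[OF ideal.axioms(1)[OF P]]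
   by (simp add: a_minus_def)
  have swap: "(a -\<^sub>R b) -\<^sub>R (a -\<^sub>R e) = e -\<^sub>R b" "(b -\<^sub>R a) -\<^sub>R (e -\<^sub>R a) = b -\<^sub>R e"
   if r: "a : |R|" "b : |R|" "e : |R|" for a b e
   using r by algebra+
  have "\<exists>l. l : |R| \<and> (\<forall>n. l -\<^sub>R c n s : ?P n)" if s: "s : S" for s
  proof -
   have cs: "c n s : |R|" for n using cR s by blast
   have "\<exists>M. \<forall>i\<ge>M. \<forall>j\<ge>M. c i s -\<^sub>R c j s : ?P n" for n
    using minus[OF tail[OF s] tail[OF s], of n _ _] swap(2)[OF cs cs cs] by (intro exI[of _ n]) metis
   then have "\<exists>!l. l : |R| \<and> (\<forall>n. \<exists>M. \<forall>i\<ge>M. c i s -\<^sub>R l : ?P n)"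
    using complete[unfolded adically_complete_def, THEN spec[of _ "%n. c n s"]] cs by blast
   then obtain l where l0: "l : |R| \<and> (\<forall>n. \<exists>M. \<forall>i\<ge>M. c i s -\<^sub>R l : ?P n)" by (elim ex1E) (rule that)
   note l = l0[THEN conjunct1] l0[THEN conjunct2, THEN spec]
   have "l -\<^sub>R c n s : ?P n" for n
   proof -
    obtain M where M: "\<forall>i\<ge>M. c i s -\<^sub>R l : ?P n" using l(2) by blast
    let ?i = "max M n"
    have "c ?i s -\<^sub>R l : ?P n" using M by simp
    from minus[OF tail[OF s, of n ?i] this] show ?thesis using swap(1)[OF cs[of ?i] cs[of n] l(1)] by simp
   qed
   then show ?thesis using l(1) by blast
  qed
  then have "\<forall>s\<in>S. \<exists>l. l : |R| \<and> (\<forall>n. l -\<^sub>R c n s : ?P n)" by (intro ballI)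
  from bchoice[OF this] obtain l where l: "\<forall>s\<in>S. l s : |R| \<and> (\<forall>n. l s -\<^sub>R c n s : ?P n)" by (elim exE)
  have lR: "l : S \<rightarrow> |R|" using l by auto
  have "h = ?F l S"
  proof (rule hom_mod_eqI[OF h Fc[OF lR]])
   fix x assume x: "x : |A|"
   obtain n where n: "!!a. a : ?P n ==> a .\<^sub>A x = 0\<^sub>A" using artinian_killed_by_power[OF x] by (elim exE) blast
   let ?e = "%s. l s -\<^sub>R c n s"
   have eP: "?e : S \<rightarrow> ?P n" using l by auto
   have eR: "?e : S \<rightarrow> |R|" using eP PR[of n] by (auto simp: Pi_iff subset_iff)
   have "l s = c n s +\<^sub>R ?e s" if "s : S" for s
   proof -
    have "c n s : |R|" "l s : |R|" using cR lR that by blast+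
    then show ?thesis by algebra
   qed
   from finsum_coeff_add[OF S cR eR this]
   have Fl: "?F l S = ?F (c n) S +\<^sub>H ?F ?e S" by simp
   have "?F ?e S : ?L n" using FL[OF eP P] subsetD[OF lincomb_mono[of "?P n" "?P n" S "|H|" H, OF subset_refl S(2)]] by blast
   then have z: "?F ?e S x = 0\<^sub>D" by (rule lincomb_eval_zero[OF _ PR x n])
   have z': "y n x = 0\<^sub>D" by (rule lincomb_eval_zero[OF yL PR x n])
   have "h x = (?F (c n) S +\<^sub>H y n) x" by (rule arg_cong[OF hc, of "%h. h x"])
   then show "h x = ?F l S x" unfolding Fl hom_modD(2)[OF x] z z' .
  qed
  then show ?thesis using FL[OF lR R.oneideal] by simp
 qed
 then show ?thesis using S H.lincomb_closed[OF subset_refl S(2)] by (intro exI[of _ S]) blast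
qed

end

section \<open>Small support and cosupport\<close>

definition induced_hom ::
  "'a ring => ('a, 'm) cpx => int => ('a, 'n) module => ('m => 'n) => ('a, 'e) module => (int => 'm => 'e) => 'n => 'e" where
 "induced_hom R M j A pj D h =
   (SOME g. g : |hom_mod R A D| \<and> (\<forall>z\<in>cycles M j. g (pj z) = h j z))"

text \<open>
 A cycle of the dual complex vanishes on boundaries and so induces a map on homology. Every map on
 homology arises in this way, since maps on the cycles extend to the whole module.
\<close>

lemma homology_via_dual:
 fixes R :: "'a ring" and M :: "('a, 'm) cpx" and D :: "('a, 'e) module" and A :: "('a, 'n) module"
 assumes M: "is_cpx R M" and D: "injective_mod R D" and h: "homology_via R M j A pj"
 shows "homology_via R (hom_cpx R M (mod_cpx D)) (- j) (hom_mod R A D) (induced_hom R M j A pj D)"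
proof -
 let ?X = "hom_cpx R M (mod_cpx D)" and ?Z = "sub_mod (obj M j) (cycles M j)"
 let ?Th = "induced_hom R M j A pj D"
 note mD = injective_module[OF M D] and A = homology_viaD(1)[OF h] and pj = homology_viaD(2)[OF h]
  and via = homology_viaD(3-5)[OF h]
 note mM = is_cpxD(1)[OF M, of j] and cb = cycles_boundaries[OF M, of j]
 note c = submoduleD[OF mM cb(1)]
 note cyc = hom_injective_cycles[OF M D, of _ "- j", unfolded minus_minus]
 note bnd = hom_injective_boundaries[OF M D, of _ "- j", unfolded minus_minus]
 have cX: "h : |obj ?X (- j)|" if "h : cycles ?X (- j)" for h using that by (simp add: cycles_def)
 have ex: "\<exists>g. g : |hom_mod R A D| \<and> (\<forall>z\<in>cycles M j. g (pj z) = h j z)" if h: "h : cycles ?X (- j)" for h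
 proof -
  have v: "mod_hom R (obj M j) D (h j)" using hom_into_mod_val[OF M D cX[OF h]] by simp
  have hZ: "mod_hom R ?Z D (h j)" by (rule mod_homI) (use mod_homD[OF v] subsetD[OF c(1)] in simp_all)
  have ker: "h j z = 0\<^sub>D" if "z : |?Z|" "pj z = 0\<^sub>A" for z
   using h[unfolded cyc[OF cX[OF h]]] via(3)[of z] that by simp
  obtain g where g: "mod_hom R A D g" "!!z. z : |?Z| ==> g (pj z) = h j z"
   by (rule injective_factor[OF D module_cycles[OF M] A pj hZ ker]) simp_all
  show ?thesis
   by (rule exI[of _ "restrict g |A|"]) (use g via(1) A in "simp add: hom_mod_def")
 qed
 have Thc: "?Th h : |hom_mod R A D|" and Th: "!!z. z : cycles M j ==> ?Th h (pj z) = h j z"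
  if "h : cycles ?X (- j)" for h
  using someI_ex[OF ex[OF that], folded induced_hom_def] by simp_all
 have eqI: "f = g" if "f : |hom_mod R A D|" "g : |hom_mod R A D|"
  "!!z. z : cycles M j ==> f (pj z) = g (pj z)" for f g
 proof (rule extensionalityI[of _ "|A|"])
  show "f : extensional |A|" "g : extensional |A|" using that(1,2) by (auto simp: hom_mod_def)
  fix a assume "a : |A|"
  then show "f a = g a" using via(2) that(3) by blast
 qed
 note X = is_cpxD(1)[OF is_cpx_hom_injective[OF M D], of "- j"]
 note cXD = submoduleD[OF X cycles_boundaries(1)[OF is_cpx_hom_injective[OF M D]]]
 note mH = module_hom_mod[OF A mD] and bH = modD[OF module_hom_mod[OF A mD]]
 show ?thesis unfolding homology_via_def
 proof (intro conjI ballI mH mod_homI)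
  fix h assume "h : |sub_mod (obj ?X (- j)) (cycles ?X (- j))|"
  then have h: "h : cycles ?X (- j)" by simp
  show "?Th h : |hom_mod R A D|" by (rule Thc[OF h])
  show "?Th (r .\<^sub>(sub_mod (obj ?X (- j)) (cycles ?X (- j))) h) = r .\<^sub>(hom_mod R A D) ?Th h" if r: "r : |R|" for r
   unfolding sub_mod_simps
  proof (rule eqI[OF Thc[OF cXD(4)[OF r h]] bH(8)[OF r Thc[OF h]]])
   fix z assume z: "z : cycles M j"
   then show "?Th (r .\<^sub>(obj ?X (- j)) h) (pj z) = (r .\<^sub>(hom_mod R A D) ?Th h) (pj z)"
    unfolding Th[OF cXD(4)[OF r h] z] using Th[OF h z] via(1)[OF z] c(1) by (auto simp: hom_mod_def hom_cpx_ops)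
  qed
  fix g assume "g : |sub_mod (obj ?X (- j)) (cycles ?X (- j))|"
  then have g: "g : cycles ?X (- j)" by simp
  show "?Th (h +\<^sub>(sub_mod (obj ?X (- j)) (cycles ?X (- j))) g) = ?Th h +\<^sub>(hom_mod R A D) ?Th g"
   unfolding sub_mod_simps
  proof (rule eqI[OF Thc[OF cXD(3)[OF h g]] bH(1)[OF Thc[OF h] Thc[OF g]]])
   fix z assume z: "z : cycles M j"
   then show "?Th (h +\<^sub>(obj ?X (- j)) g) (pj z) = (?Th h +\<^sub>(hom_mod R A D) ?Th g) (pj z)"
    unfolding Th[OF cXD(3)[OF h g] z] using Th[OF h z] Th[OF g z] via(1)[OF z] c(1) by (auto simp: hom_mod_def hom_cpx_ops)
  qed
 next
  show "?Th ` cycles ?X (- j) = |hom_mod R A D|"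
  proof
   show "?Th ` cycles ?X (- j) \<subseteq> |hom_mod R A D|" using Thc by blast
   show "|hom_mod R A D| \<subseteq> ?Th ` cycles ?X (- j)"
   proof
    fix f assume f: "f : |hom_mod R A D|"
    then have fm: "mod_hom R A D f" by (simp add: hom_mod_def)
    have id: "mod_hom R ?Z (obj M j) id" by (rule mod_homI) (use c(1) in auto)
    have "mod_hom R ?Z D (%z. f (pj z))"
     by (rule mod_homI) (use mod_homD[OF pj] mod_homD[OF fm] in simp_all)
    from injective_mod_extend[OF D module_cycles[OF M] mM id _ this]
    obtain k where k: "mod_hom R (obj M j) D k" "!!z. z : cycles M j ==> k z = f (pj z)" by auto
    have k': "mod_hom R (obj M (- (- j))) D k" using k(1) by simp
    obtain h where h: "h : |obj ?X (- j)|" "!!x. x : |obj M j| ==> h j x = k x"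
     using hom_into_mod_one[OF M D k'] by (metis minus_minus)
    have hz: "h j z = f (pj z)" if "z : cycles M j" for z using h(2) k(2) that c(1) by auto
    have hX: "h : cycles ?X (- j)" unfolding cyc[OF h(1)]
    proof
     fix b assume b: "b : boundaries M j"
     then have bc: "b : cycles M j" using cb(3) by blast
     show "h j b = 0\<^sub>D" using hz[OF bc] via(3)[OF bc] b mod_hom_zero[OF A mD fm] by simp
    qed
    have "f = ?Th h" by (rule eqI[OF f Thc[OF hX]]) (simp only: Th[OF hX] hz)
    then show "f : ?Th ` cycles ?X (- j)" using hX by blast
   qed
  qed
 next
  fix h assume h: "h : cycles ?X (- j)"
  have z: "0\<^sub>(hom_mod R A D) (pj z) = 0\<^sub>D" if "z : cycles M j" for z
   using via(1)[OF that] by (simp add: hom_mod_def)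
  show "?Th h = 0\<^sub>(hom_mod R A D) \<longleftrightarrow> h : boundaries ?X (- j)"
   unfolding bnd[OF cX[OF h]]
  proof
   assume "?Th h = 0\<^sub>(hom_mod R A D)"
   then show "\<forall>x\<in>cycles M j. h j x = 0\<^sub>D" using Th[OF h] z by (intro ballI) metis
  next
   assume v: "\<forall>x\<in>cycles M j. h j x = 0\<^sub>D"
   show "?Th h = 0\<^sub>(hom_mod R A D)"
    by (rule eqI[OF Thc[OF h] bH(2)]) (simp only: Th[OF h] z v[rule_format])
  qed
 qed
qed

lemma cring_prime_nontrivial: "primeideal p R ==> 1\<^sub>R \<noteq> 0\<^sub>R"
 using prime_compl(1)[of p R] additive_subgroup.zero_closed[OF ideal.axioms(1)[OF prime_compl(6)]] by force

lemma mem_supp_iff: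
 fixes R :: "'a ring" and M :: "('a, 'm) cpx"
 assumes R: "cring R" and M: "is_cpx R M" and fg: "!!j. fg_at R M j" and low: "!!j. j < b ==> exact_at M j"
  and p: "primeideal p R"
 shows "p : supp R M \<longleftrightarrow> (\<exists>j. \<not> torsion_at R p M j)"
proof -
 note k = residue_like_residue_mod[OF R p]
 have mk: "module R (residue_mod R p)" using k by (simp add: residue_like_def)
 note F = resolution[OF R cring_prime_nontrivial[OF p] mk]
 have "is_cpx R (tensor_cpx R (resolution R (residue_mod R p)) M)"
  using F by (intro is_cpx_tensor_cpx M) (simp add: free_resolution_def)
 from derived_iso_zero_iff[OF R this] tensor_acyclic_iff[OF F M p k fg low]
 show ?thesis using p by (simp add: supp_def Spec_def Ltensor_def)
qed

lemma mem_cosupp_iff: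
 fixes R :: "'a ring" and M :: "('a, 'm) cpx" and E :: "'a set => ('a, 'e) module"
  and EL :: "'a set => (('a \<times> 'a) set, 'f) module"
 defines "X \<equiv> dual_cpx R E M"
 assumes R: "cring R" and EL: "envelope_choice R E EL" and X: "is_cpx R X" and fg: "!!j. fg_at R X j"
  and low: "!!j. j < b ==> exact_at X j" and p: "primeideal p R"
 shows "p : cosupp R E EL M \<longleftrightarrow> (\<exists>j. \<not> torsion_at R p X j)"
proof -
 interpret k: module_mod R "ring_mod R" p by (rule residue_ring_module[OF R prime_compl(6)[OF p]])
 note F = resolution[OF R cring_prime_nontrivial[OF p] k.Q_module]
 have env: "injective_envelope (loc_ring R p) (residue_loc R p) (EL p)"
  using EL p by (simp add: envelope_choice_def Spec_def)
 then have inj: "injective_mod (loc_ring R p) (EL p)" by (simp add: injective_envelope_def)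
 note Y = is_cpx_restrict_cpx[OF R p is_cpx_hom_injective[OF is_cpx_loc_cpx[OF R p X] inj]]
 have "is_cpx R (hom_cpx R (resolution R k.Q) (restrict_cpx (loc_map R p)
   (hom_cpx (loc_ring R p) (loc_cpx R p X) (mod_cpx (EL p)))))"
  using F by (intro is_cpx_hom_cpx Y) (simp add: free_resolution_def)
 from derived_iso_zero_iff[OF R this] hom_resolution_acyclic_iff[OF R p X fg low env F]
 show ?thesis using p by (simp add: cosupp_def Spec_def RHom_def coloc_cpx_def X_def)
qed

theorem proposition5p3:
  fixes R :: "'a ring"
    and E :: "'a set \<Rightarrow> ('a, 'e) module"
    and EL :: "'a set \<Rightarrow> (('a \<times> 'a) set, 'f) module"
  assumes "cring R" and "noetherian_ring R"
  shows "(\<forall>M :: ('a, 'm) cpx. M \<in> Dn_plus R \<longrightarrow>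
            supp R M = (\<Union>i::int. supp R (mod_cpx (homology i M)))) \<and>
         (semilocal_complete R \<and> envelope_choice R E EL \<longrightarrow>
            (\<forall>M :: ('a, 'n) cpx. M \<in> Da_minus R \<longrightarrow>
               cosupp R E EL M = (\<Union>i::int. cosupp R E EL (mod_cpx (homology i M)))))"
proof (intro conjI allI impI)
 note R = assms(1)
 fix M :: "('a, 'm) cpx" assume "M : Dn_plus R"
 then obtain b where M: "is_cpx R M" and noeth: "!!i. noetherian_mod R (homology i M)"
  and b: "!!n. n < b ==> |homology n M| = {0\<^sub>(homology n M)}" unfolding Dn_plus_def by auto
 have fg: "fg_at R N j" if "is_cpx R N" "homology_via R N j (homology i M) pj"
  for N :: "('a, 'y) cpx" and j i pj
  using noetherian_mod_fg[OF noeth[of i]] fg_at_homology[OF that] by (elim exE conjE)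
 note hv = homology_via_homology[OF M]
 have low: "exact_at M j" if "j < b" for j using b[OF that] exact_at_iff_homology[OF M] by simp
 show "supp R M = (\<Union>i. supp R (mod_cpx (homology i M)))" (is "_ = ?U")
 proof (rule Set.set_eqI)
  fix p
  show "p : supp R M \<longleftrightarrow> p : ?U"
  proof (cases "primeideal p R")
   case True
   have "p : supp R (mod_cpx (homology i M)) \<longleftrightarrow> \<not> torsion_at R p M i" for i
   proof -
    let ?C = "mod_cpx (homology i M)"
    note H = homology_viaD(1)[OF hv[of i]]
    note C = is_cpx_mod_cpx[OF H] and hC = homology_via_mod_cpx[OF H]
    have e: "exact_at ?C j" if "j \<noteq> 0" for j by (rule mod_cpx_cycles(3)[OF H that])
    have f: "fg_at R ?C j" for j
     using fg[OF C hC] exact_at_imp(2)[OF C e True] by (cases "j = 0") auto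
    have "p : supp R ?C \<longleftrightarrow> (\<exists>j. \<not> torsion_at R p ?C j)"
     by (rule mem_supp_iff[OF R C f _ True, of 0]) (simp add: e)
    also have "\<dots> \<longleftrightarrow> \<not> torsion_at R p ?C 0" using exact_at_imp(1)[OF C e True] by metis
    finally show ?thesis unfolding torsion_at_homology[OF C hC] torsion_at_homology[OF M hv] .
   qed
   then show ?thesis using mem_supp_iff[OF R M fg[OF M hv] low True] by simp
  qed (auto simp: supp_def Spec_def)
 qed
next
 note R = assms(1)
 fix M :: "('a, 'n) cpx" assume sc: "semilocal_complete R \<and> envelope_choice R E EL" and "M : Da_minus R"
 then obtain b where M: "is_cpx R M" and art: "!!i. artinian_mod R (homology i M)"
  and b: "!!n. b < n ==> |homology n M| = {0\<^sub>(homology n M)}" unfolding Da_minus_def by auto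
 have fin: "finite (Max_Spec R)" using sc by (simp add: semilocal_complete_def)
 let ?D = "sum_mod (Max_Spec R) E"
 have D: "injective_mod R ?D" "simple_socles R ?D"
  using sum_envelopes[OF R fin, of E] sc by (auto simp: envelope_choice_def)
 note hv = homology_via_homology[OF M]
 let ?H = "%i. hom_mod R (homology i M) ?D"
 have fg: "fg_at R N j" if "is_cpx R N" "homology_via R N j (?H i) pj"
  for N :: "('a, 'y) cpx" and j i pj
  using artinian_dual_finitely_generated[OF R assms(2) art D conjunct1[OF sc], of i] fg_at_homology[OF that]
  by (elim exE conjE)
 note X = is_cpx_hom_injective[OF M D(1)] and hX = homology_via_dual[OF M D(1) hv]
 have low: "exact_at (dual_cpx R E M) j" if "j < - b" for j
  using exact_at_hom_injective[OF M D(1), of "- j"] b[of "- j"] exact_at_iff_homology[OF M, of "- j"] that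
  by (simp add: dual_cpx_def)
 have fX: "fg_at R (dual_cpx R E M) j" for j
  using fg[OF X hX, of "- j"] by (simp add: dual_cpx_def)
 show "cosupp R E EL M = (\<Union>i. cosupp R E EL (mod_cpx (homology i M)))" (is "_ = ?U")
 proof (rule Set.set_eqI)
  fix p
  show "p : cosupp R E EL M \<longleftrightarrow> p : ?U"
  proof (cases "primeideal p R")
   case True
   have m: "p : cosupp R E EL (mod_cpx (homology i M)) \<longleftrightarrow> \<not> torsion_at R p (dual_cpx R E M) (- i)" for i
   proof -
    let ?C = "mod_cpx (homology i M)"
    note H = homology_viaD(1)[OF hv[of i]]
    note C = is_cpx_mod_cpx[OF H]
    note Y = is_cpx_hom_injective[OF C D(1), folded dual_cpx_def]
     and hY = homology_via_dual[OF C D(1) homology_via_mod_cpx[OF H], folded dual_cpx_def, unfolded minus_zero]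
    have e: "exact_at (dual_cpx R E ?C) j" if "j \<noteq> 0" for j
     using exact_at_hom_injective[OF C D(1) mod_cpx_cycles(3)[OF H], of "- j"] that by (simp add: dual_cpx_def)
    have f: "fg_at R (dual_cpx R E ?C) j" for j
     using fg[OF Y hY] exact_at_imp(2)[OF Y e True] by (cases "j = 0") auto
    have "p : cosupp R E EL ?C \<longleftrightarrow> (\<exists>j. \<not> torsion_at R p (dual_cpx R E ?C) j)"
     by (rule mem_cosupp_iff[OF R conjunct2[OF sc] Y f _ True, of 0]) (simp add: e)
    also have "\<dots> \<longleftrightarrow> \<not> torsion_at R p (dual_cpx R E ?C) 0" using exact_at_imp(1)[OF Y e True] by metis
    finally show ?thesis
     unfolding torsion_at_homology[OF Y hY] torsion_at_homology[OF X hX, folded dual_cpx_def] .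
   qed
   have "p : cosupp R E EL M \<longleftrightarrow> (\<exists>j. \<not> torsion_at R p (dual_cpx R E M) j)"
    by (rule mem_cosupp_iff[OF R conjunct2[OF sc] X[folded dual_cpx_def] fX low True])
   also have "\<dots> \<longleftrightarrow> (\<exists>i. \<not> torsion_at R p (dual_cpx R E M) (- i))" by (metis minus_minus)
   finally show ?thesis using m by simp
  qed (auto simp: cosupp_def Spec_def)
 qed
qed

end
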